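(* Let $n\ge 2$ and $G_n=\mathbb{Z}^n\rtimes SL_n(\mathbb{Z})$. If $n$ is even, then $L(\mathbb{Z}^n\rtimes\{\pm I_n\})$ is the unique maximal Haagerup $G_n$-invariant von Neumann subalgebra of $L(G_n)$; if $n$ is odd, then $L(\mathbb{Z}^n)$ is the unique maximal Haagerup $G_n$-invariant von Neumann subalgebra of $L(G_n)$. Here $I_n$ denotes the identity matrix in $SL_n(\mathbb{Z})$.
   Context: $SL_n(\mathbb{Z})$ acts on $\mathbb{Z}^n$ (column vectors) by left matrix multiplication, and $G_n=\mathbb{Z}^n\rtimes SL_n(\mathbb{Z})$ is the corresponding semidirect product. For a countable discrete group $G$, $L(G)\subseteq B(\ell^2(G))$ is the group von Neumann algebra, with canonical unitaries $u_g$ and canonical trace $\tau(x)=\langle x\delta_e,\delta_e\rangle$; for a subgroup $H\le G$, $L(H)$ is viewed as the von Neumann subalgebra of $L(G)$ generated by $\{u_h:h\in H\}$. A von Neumann subalgebra $P\subseteq L(G)$ is $G$-invariant if $u_gPu_g^{*}=P$ for all $g\in G$. A "Haagerup" von Neumann subalgebra is one with the Haagerup property (as a finite von Neumann algebra with the trace $\tau$); $L(H)$ has the Haagerup property if and only if the group $H$ does. "Maximal" is with respect to inclusion among $G_n$-invariant von Neumann subalgebras of $L(G_n)$ with the Haagerup property. *)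

theory Defs
  imports "HOL-Analysis.Analysis" "HOL-Algebra.Group" "HOL-Library.Function_Algebras"
begin

section \<open>The group \<open>\<int>\<^sup>n \<rtimes> SL\<^sub>n(\<int>)\<close>\<close>

definition semidirect_product ::
  "('a, 'c) monoid_scheme \<Rightarrow> ('b, 'd) monoid_scheme \<Rightarrow> ('b \<Rightarrow> 'a \<Rightarrow> 'a) \<Rightarrow> ('a \<times> 'b) monoid" where
  "semidirect_product N H \<alpha> =
     \<lparr>carrier = carrier N \<times> carrier H,
      mult = (\<lambda>(a, h) (b, k). (a \<otimes>\<^bsub>N\<^esub> \<alpha> h b, h \<otimes>\<^bsub>H\<^esub> k)),
      one = (\<one>\<^bsub>N\<^esub>, \<one>\<^bsub>H\<^esub>)\<rparr>"

definition Zn :: "(int ^ 'n) monoid" where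
  "Zn = \<lparr>carrier = UNIV, mult = (+), one = 0\<rparr>"

definition SLn :: "(int ^ 'n ^ 'n) monoid" where
  "SLn = \<lparr>carrier = {A. det A = 1}, mult = (**), one = mat 1\<rparr>"

definition Gn :: "((int ^ 'n) \<times> (int ^ 'n ^ 'n)) monoid" where
  "Gn = semidirect_product Zn SLn (*v)"


section \<open>Bounded operators on \<open>\<ell>\<^sup>2(S)\<close>\<close>

text \<open>
  A vector of \<open>\<ell>\<^sup>2(S)\<close> is a function on the whole type that vanishes off \<open>S\<close>; likewise an operator
  is a function on all of \<open>'a \<Rightarrow> complex\<close> that vanishes off \<open>\<ell>\<^sup>2(S)\<close>. So equality of vectors and of
  operators is equality in HOL. The inner product is linear in its first argument.
\<close>

type_synonym 'a vec2 = "'a \<Rightarrow> complex"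
type_synonym 'a op2 = "'a vec2 \<Rightarrow> 'a vec2"

definition ell2 :: "'a set \<Rightarrow> 'a vec2 set" where
  "ell2 S = {f. (\<forall>x. x \<notin> S \<longrightarrow> f x = 0) \<and> (\<lambda>x. (cmod (f x))\<^sup>2) summable_on S}"

definition ell2_inner :: "'a vec2 \<Rightarrow> 'a vec2 \<Rightarrow> complex" where
  "ell2_inner f g = (\<Sum>\<^sub>\<infinity>x. f x * cnj (g x))"

definition ell2_norm :: "'a vec2 \<Rightarrow> real" where
  "ell2_norm f = sqrt (\<Sum>\<^sub>\<infinity>x. (cmod (f x))\<^sup>2)"

definition ell2_topology :: "'a set \<Rightarrow> 'a vec2 topology" where
  "ell2_topology S = Metric_space.mtopology (ell2 S) (\<lambda>f g. ell2_norm (f - g))"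

definition delta :: "'a \<Rightarrow> 'a vec2" where
  "delta a = (\<lambda>x. if x = a then 1 else 0)"

definition vec_scale :: "complex \<Rightarrow> 'a vec2 \<Rightarrow> 'a vec2" where
  "vec_scale c f = (\<lambda>x. c * f x)"

definition op_scale :: "complex \<Rightarrow> 'a op2 \<Rightarrow> 'a op2" where
  "op_scale c A = (\<lambda>f. vec_scale c (A f))"

definition op_id :: "'a set \<Rightarrow> 'a op2" where
  "op_id S = (\<lambda>f. if f \<in> ell2 S then f else 0)"

definition linear_map_on :: "'a vec2 set \<Rightarrow> 'a op2 \<Rightarrow> bool" where
  "linear_map_on K A \<longleftrightarrow>
     (\<forall>f\<in>K. A f \<in> K) \<and>
     (\<forall>f\<in>K. \<forall>g\<in>K. A (f + g) = A f + A g) \<and>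
     (\<forall>c. \<forall>f\<in>K. A (vec_scale c f) = vec_scale c (A f))"

definition bounded_ops :: "'a set \<Rightarrow> 'a op2 set" where
  "bounded_ops S =
     {A. linear_map_on (ell2 S) A \<and>
         (\<exists>C. \<forall>f\<in>ell2 S. ell2_norm (A f) \<le> C * ell2_norm f) \<and>
         (\<forall>f. f \<notin> ell2 S \<longrightarrow> A f = 0)}"

definition adj :: "'a set \<Rightarrow> 'a op2 \<Rightarrow> 'a op2" where
  "adj S A = (THE B. B \<in> bounded_ops S \<and>
     (\<forall>f\<in>ell2 S. \<forall>g\<in>ell2 S. ell2_inner (A f) g = ell2_inner f (B g)))"

definition op_pos :: "'a set \<Rightarrow> 'a op2 \<Rightarrow> bool" where
  "op_pos S A \<longleftrightarrow> (\<forall>f\<in>ell2 S. ell2_inner (A f) f \<in> \<real>\<^sub>\<ge>\<^sub>0)"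

definition op_le :: "'a set \<Rightarrow> 'a op2 \<Rightarrow> 'a op2 \<Rightarrow> bool" where
  "op_le S A B \<longleftrightarrow> op_pos S (B - A)"


section \<open>Von Neumann algebras\<close>

definition weak_operator_topology :: "'a set \<Rightarrow> 'a op2 topology" where
  "weak_operator_topology S = topology_generated_by
     {{A \<in> bounded_ops S. ell2_inner (A f) g \<in> U} | f g U.
        f \<in> ell2 S \<and> g \<in> ell2 S \<and> open U}"

definition von_neumann_algebra :: "'a set \<Rightarrow> 'a op2 set \<Rightarrow> bool" where
  "von_neumann_algebra S P \<longleftrightarrow>
     P \<subseteq> bounded_ops S \<and> op_id S \<in> P \<and>
     (\<forall>A\<in>P. \<forall>B\<in>P. A + B \<in> P \<and> A \<circ> B \<in> P) \<and>
     (\<forall>c. \<forall>A\<in>P. op_scale c A \<in> P) \<and>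
     (\<forall>A\<in>P. adj S A \<in> P) \<and>
     closedin (weak_operator_topology S) P"

definition vn_generated :: "'a set \<Rightarrow> 'a op2 set \<Rightarrow> 'a op2 set" where
  "vn_generated S X = \<Inter> {P. von_neumann_algebra S P \<and> X \<subseteq> P}"


section \<open>Group von Neumann algebras\<close>

definition left_regular :: "('a, 'b) monoid_scheme \<Rightarrow> 'a \<Rightarrow> 'a op2" where
  "left_regular G g = (\<lambda>f. if f \<in> ell2 (carrier G)
     then (\<lambda>x. if x \<in> carrier G then f (inv\<^bsub>G\<^esub> g \<otimes>\<^bsub>G\<^esub> x) else 0) else 0)"

definition subgroup_vna :: "('a, 'b) monoid_scheme \<Rightarrow> 'a set \<Rightarrow> 'a op2 set" where
  "subgroup_vna G H = vn_generated (carrier G) (left_regular G ` H)"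

abbreviation group_vna :: "('a, 'b) monoid_scheme \<Rightarrow> 'a op2 set" where
  "group_vna G \<equiv> subgroup_vna G (carrier G)"

definition canonical_trace :: "('a, 'b) monoid_scheme \<Rightarrow> 'a op2 \<Rightarrow> complex" where
  "canonical_trace G x = ell2_inner (x (delta \<one>\<^bsub>G\<^esub>)) (delta \<one>\<^bsub>G\<^esub>)"

definition trace_norm2 :: "('a, 'b) monoid_scheme \<Rightarrow> 'a op2 \<Rightarrow> real" where
  "trace_norm2 G x = sqrt (Re (canonical_trace G (adj (carrier G) x \<circ> x)))"

definition invariant_subalgebra :: "('a, 'b) monoid_scheme \<Rightarrow> 'a op2 set \<Rightarrow> bool" where
  "invariant_subalgebra G P \<longleftrightarrow>
     von_neumann_algebra (carrier G) P \<and> P \<subseteq> group_vna G \<and>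
     (\<forall>g\<in>carrier G.
        (\<lambda>x. left_regular G g \<circ> x \<circ> adj (carrier G) (left_regular G g)) ` P = P)"


section \<open>The Haagerup property\<close>

definition matrix_pos :: "'a set \<Rightarrow> nat \<Rightarrow> (nat \<Rightarrow> nat \<Rightarrow> 'a op2) \<Rightarrow> bool" where
  "matrix_pos S k X \<longleftrightarrow> (\<forall>\<xi>. (\<forall>i<k. \<xi> i \<in> ell2 S) \<longrightarrow>
     (\<Sum>i<k. \<Sum>j<k. ell2_inner (X i j (\<xi> j)) (\<xi> i)) \<in> \<real>\<^sub>\<ge>\<^sub>0)"

definition completely_positive :: "'a set \<Rightarrow> 'a op2 set \<Rightarrow> ('a op2 \<Rightarrow> 'a op2) \<Rightarrow> bool" where
  "completely_positive S P \<phi> \<longleftrightarrow>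
     (\<forall>x\<in>P. \<phi> x \<in> P) \<and>
     (\<forall>x\<in>P. \<forall>y\<in>P. \<phi> (x + y) = \<phi> x + \<phi> y) \<and>
     (\<forall>c. \<forall>x\<in>P. \<phi> (op_scale c x) = op_scale c (\<phi> x)) \<and>
     (\<forall>k X. (\<forall>i<k. \<forall>j<k. X i j \<in> P) \<and> matrix_pos S k X \<longrightarrow>
        matrix_pos S k (\<lambda>i j. \<phi> (X i j)))"

definition is_op_sup :: "'a set \<Rightarrow> 'a op2 set \<Rightarrow> 'a op2 set \<Rightarrow> 'a op2 \<Rightarrow> bool" where
  "is_op_sup S P D x \<longleftrightarrow> x \<in> P \<and> (\<forall>d\<in>D. op_le S d x) \<and>
     (\<forall>y\<in>P. (\<forall>d\<in>D. op_le S d y) \<longrightarrow> op_le S x y)"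

text \<open>A positive map is normal if it preserves suprema of upward directed sets of positive elements.\<close>

definition normal_map :: "'a set \<Rightarrow> 'a op2 set \<Rightarrow> ('a op2 \<Rightarrow> 'a op2) \<Rightarrow> bool" where
  "normal_map S P \<phi> \<longleftrightarrow>
     (\<forall>D x. D \<subseteq> P \<and> D \<noteq> {} \<and> (\<forall>d\<in>D. op_pos S d) \<and>
        (\<forall>a\<in>D. \<forall>b\<in>D. \<exists>c\<in>D. op_le S a c \<and> op_le S b c) \<and> is_op_sup S P D x \<longrightarrow>
        is_op_sup S P (\<phi> ` D) (\<phi> x))"

text \<open>
  \<open>L\<^sup>2(P, \<tau>)\<close>, realized as the closure of \<open>P \<delta>\<^sub>e\<close> in \<open>\<ell>\<^sup>2(G)\<close>: the map \<open>x \<mapsto> x \<delta>\<^sub>e\<close> is isometric for the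
  norm \<open>trace_norm2\<close>.
\<close>

definition L2_space :: "('a, 'b) monoid_scheme \<Rightarrow> 'a op2 set \<Rightarrow> 'a vec2 set" where
  "L2_space G P =
     ell2_topology (carrier G) closure_of ((\<lambda>x. x (delta \<one>\<^bsub>G\<^esub>)) ` P)"

definition compact_operator_on :: "'a set \<Rightarrow> 'a vec2 set \<Rightarrow> 'a op2 \<Rightarrow> bool" where
  "compact_operator_on S K T \<longleftrightarrow> linear_map_on K T \<and>
     compactin (ell2_topology S)
       (ell2_topology S closure_of (T ` {f \<in> K. ell2_norm f \<le> 1}))"

definition L2_compact :: "('a, 'b) monoid_scheme \<Rightarrow> 'a op2 set \<Rightarrow> ('a op2 \<Rightarrow> 'a op2) \<Rightarrow> bool" where
  "L2_compact G P \<phi> \<longleftrightarrow>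
     (\<exists>T. compact_operator_on (carrier G) (L2_space G P) T \<and>
        (\<forall>x\<in>P. T (x (delta \<one>\<^bsub>G\<^esub>)) = \<phi> x (delta \<one>\<^bsub>G\<^esub>)))"

definition subtracial :: "('a, 'b) monoid_scheme \<Rightarrow> 'a op2 set \<Rightarrow> ('a op2 \<Rightarrow> 'a op2) \<Rightarrow> bool" where
  "subtracial G P \<phi> \<longleftrightarrow>
     (\<forall>x\<in>P. op_pos (carrier G) x \<longrightarrow>
        Re (canonical_trace G (\<phi> x)) \<le> Re (canonical_trace G x))"

text \<open>
  The Haagerup property of \<open>(P, \<tau>)\<close>: there is a net of normal completely positive subtracial
  \<open>L\<^sup>2\<close>-compact maps on \<open>P\<close> converging to the identity pointwise in the 2-norm. The net is expressed
  by a proper filter on the type of maps.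
\<close>

definition haagerup :: "('a, 'b) monoid_scheme \<Rightarrow> 'a op2 set \<Rightarrow> bool" where
  "haagerup G P \<longleftrightarrow>
     (\<exists>F. F \<noteq> bot \<and>
        (\<forall>\<^sub>F \<phi> in F. completely_positive (carrier G) P \<phi> \<and> normal_map (carrier G) P \<phi> \<and>
           subtracial G P \<phi> \<and> L2_compact G P \<phi>) \<and>
        (\<forall>x\<in>P. ((\<lambda>\<phi>. trace_norm2 G (\<phi> x - x)) \<longlongrightarrow> 0) F))"

definition maximal_haagerup_invariant :: "('a, 'b) monoid_scheme \<Rightarrow> 'a op2 set \<Rightarrow> bool" where
  "maximal_haagerup_invariant G P \<longleftrightarrow>
     invariant_subalgebra G P \<and> haagerup G P \<and>
     (\<forall>Q. invariant_subalgebra G Q \<and> haagerup G Q \<and> P \<subseteq> Q \<longrightarrow> Q = P)"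

definition unique_maximal_haagerup_invariant ::
  "('a, 'b) monoid_scheme \<Rightarrow> 'a op2 set \<Rightarrow> bool" where
  "unique_maximal_haagerup_invariant G P \<longleftrightarrow>
     maximal_haagerup_invariant G P \<and> (\<forall>Q. maximal_haagerup_invariant G Q \<longrightarrow> Q = P)"

end

theory Submission
  imports Defs "HOL-Real_Asymp.Real_Asymp" "HOL-Computational_Algebra.Polynomial"
begin

text \<open>
  Let \<open>Q\<close> be an invariant subalgebra with the Haagerup property and let \<open>c(g)\<close> be the squared norm of the
  projection of \<open>\<delta>\<^sub>g\<close> onto \<open>L\<^sup>2(Q)\<close>; it is invariant under conjugation. A map in the Haagerup net of \<open>Q\<close> acts
  on \<open>L\<^sup>2(Q)\<close> by a compact operator \<open>T\<close>, and \<open>g \<mapsto> \<langle>T e\<^sub>Q \<delta>\<^sub>g, \<delta>\<^sub>g\<rangle>\<close> is a positive definite function that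
  vanishes at infinity; along the net these functions converge to \<open>c\<close>. Their restrictions to \<open>\<int>\<^sup>n\<close>
  have spectral measures on the dual torus with little mass near the torsion points. For
  \<open>h \<noteq> \<plusminus>1\<close>, conjugating \<open>(w, h)\<close> by translations and transvections moves all other mass off itself, so
  \<open>c(w, h) = 0\<close>. Hence every element of \<open>Q\<close> is supported on the amenable normal subgroup
  \<open>\<int>\<^sup>n \<rtimes> (SL\<^sub>n(\<int>) \<inter> {\<plusminus>1})\<close>. Averaging over Folner sets shows that such elements lie in the algebra of that
  subgroup, and that this algebra itself has the Haagerup property.
\<close>

text \<open>A single conjugate of \<open>h\<close> yields no contradiction, since the spectral
  measure may sit in directions that its cutoff misses. Hence \<open>n0\<close> conjugates are used
  at once, with functionals in general position: at every point of the torus all but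
  \<open>R\<close> of them behave well, and \<open>R\<close> does not depend on \<open>n0\<close>.
  Summed over the family, the uncontrolled mass is at most \<open>R + 6\<close>, so some member has
  at most \<open>(R + 6) / n0\<close>. Torsion points resist displacement because integer matrices
  map them to torsion points; their mass is removed by Wiener's argument, which uses that the
  functions vanish at infinity. The order of choices matters: averaging polynomials and the finite
  set on which \<open>c\<close> is approximated are fixed before the positive definite function, the
  neighbourhood of the torsion points only after it. Measures, conditional expectations and
  functional calculus appear only through substitutes: the positive functional
  \<open>trig_fun\<close>, the reproducing kernel \<open>kvec\<close>, and Bernstein polynomials of
  operator matrices.\<close>

abbreviation (input) "ivec z \<equiv> (\<chi> i. of_int (z $ i))"

subsection \<open>Positive definite functions on \<open>\<int>\<^sup>n\<close>\<close>

lemma nonneg_Reals_sum [intro]: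
  fixes f :: "'a \<Rightarrow> complex"
  assumes "\<And>i. i \<in> A ==> f i \<in> \<real>\<^sub>\<ge>\<^sub>0" shows "sum f A \<in> \<real>\<^sub>\<ge>\<^sub>0"
  using assms by (induction A rule: infinite_finite_induct) (auto intro!: nonneg_Reals_add_I)

lemma nonneg_Reals_tendsto:
  fixes f :: "nat \<Rightarrow> complex"
  assumes "\<And>n. f n \<in> \<real>\<^sub>\<ge>\<^sub>0" "f \<longlonglongrightarrow> l" shows "l \<in> \<real>\<^sub>\<ge>\<^sub>0"
  using closed_nonneg_Reals_complex assms by (meson closed_sequentially)

definition dotp :: "int ^ 'n \<Rightarrow> real ^ 'n \<Rightarrow> real" where
  "dotp v \<theta> = (\<Sum>i\<in>UNIV. real_of_int (v $ i) * \<theta> $ i)"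

text \<open>Normalised to period one, so that the dual torus is the quotient of
  \<open>real ^ 'n\<close> by the integer vectors and its torsion points are the rational
  ones.\<close>

definition echar :: "real \<Rightarrow> complex" where
  "echar t = cis (2 * pi * t)"

lemma echar_add: "echar (s + t) = echar s * echar t"
  by (simp add: echar_def cis_mult algebra_simps)

lemma echar_uminus: "echar (- t) = cnj (echar t)"
  by (simp add: echar_def cis_cnj)

lemma echar_diff: "echar (s - t) = echar s * cnj (echar t)"
  using echar_add[of s "-t"] by (simp add: echar_uminus)

lemma echar_0 [simp]: "echar 0 = 1"
  by (simp add: echar_def)

lemma norm_echar [simp]: "cmod (echar t) = 1"
  by (simp add: echar_def)

lemma echar_sum: "finite A ==> echar (sum f A) = (\<Prod>i\<in>A. echar (f i))"
  by (induction A rule: finite_induct) (auto simp: echar_add)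

lemma echar_of_int [simp]: "echar (of_int n) = 1"
  unfolding echar_def by (rule cis_multiple_2pi) auto

lemma echar_mult_nat: "echar (real n * t) = echar t ^ n"
  unfolding echar_def Complex.DeMoivre by (simp add: mult_ac)

lemma dotp_add: "dotp (v + u) \<theta> = dotp v \<theta> + dotp u \<theta>"
  by (simp add: dotp_def algebra_simps sum.distrib)

lemma dotp_diff: "dotp (v - u) \<theta> = dotp v \<theta> - dotp u \<theta>"
  by (simp add: dotp_def algebra_simps sum_subtractf)

lemma dotp_uminus: "dotp (- u) \<theta> = - dotp u \<theta>"
  by (simp add: dotp_def sum_negf)

lemma dotp_zero [simp]: "dotp 0 \<theta> = 0"
  by (simp add: dotp_def)

definition box :: "int \<Rightarrow> (int ^ 'n) set" where
  "box N = {v. \<forall>i. v $ i \<in> {0..<N}}"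

lemma sum_prod_box:
  fixes f :: "'n::finite \<Rightarrow> int \<Rightarrow> 'b::comm_semiring_1"
  shows "(\<Sum>t\<in>box N. \<Prod>i\<in>UNIV. f i (t $ i)) = (\<Prod>i\<in>UNIV. \<Sum>s\<in>{0..<N}. f i s)"
proof -
  have "(\<Prod>i\<in>UNIV. \<Sum>s\<in>{0..<N}. f i s)
      = (\<Sum>g\<in>PiE UNIV (\<lambda>_. {0..<N}). \<Prod>i\<in>UNIV. f i (g i))"
    by (rule prod_sum_PiE) auto
  also have "\<dots> = (\<Sum>t\<in>box N. \<Prod>i\<in>UNIV. f i (t $ i))"
    by (rule sum.reindex_bij_witness[where i = "\<lambda>t. vec_nth t" and j = vec_lambda])
       (auto simp: box_def PiE_def Pi_def extensional_def)
  finally show ?thesis by simp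
qed

lemma finite_box [simp]: "finite (box N :: (int ^ 'n::finite) set)"
proof -
  have "(box N :: (int ^ 'n) set) \<subseteq> vec_lambda ` (PiE UNIV (\<lambda>_. {0..<N}))"
  proof
    fix t :: "int ^ 'n" assume "t \<in> box N"
    then have "vec_nth t \<in> PiE UNIV (\<lambda>_. {0..<N})" by (auto simp: box_def)
    then show "t \<in> vec_lambda ` (PiE UNIV (\<lambda>_. {0..<N}))"
      by (metis image_eqI vec_nth_inverse)
  qed
  then show ?thesis by (rule finite_subset) (auto intro!: finite_PiE)
qed

lemma card_box: "card (box N :: (int ^ 'n::finite) set) = nat N ^ CARD('n)"
proof -
  have "card (box N :: (int ^ 'n) set) = (\<Sum>t\<in>(box N :: (int ^ 'n) set). \<Prod>i\<in>(UNIV::'n set). 1)"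
    by simp
  also have "\<dots> = nat N ^ CARD('n)"
    by (subst sum_prod_box) simp
  finally show ?thesis .
qed

lemma sum_echar_roots:
  fixes c M :: int assumes "M > 0"
  shows "(\<Sum>s\<in>{0..<M}. echar (of_int c * (of_int s / of_int M))) = (if M dvd c then of_int M else 0)"
proof -
  define z where "z = echar (of_int c / of_int M)"
  have "(\<Sum>s\<in>{0..<M}. echar (of_int c * (of_int s / of_int M))) = (\<Sum>k<nat M. z ^ k)"
    by (rule sum.reindex_bij_witness[where i = int and j = nat])
       (use assms in \<open>auto simp: z_def echar_mult_nat[symmetric] field_simps\<close>)
  also have "\<dots> = (if M dvd c then of_int M else 0)"
  proof (cases "M dvd c")
    case True
    then obtain q where "c = M * q" by auto
    then have "z = 1" using assms by (simp add: z_def)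
    then show ?thesis using True assms by simp
  next
    case False
    have "z \<noteq> 1"
    proof
      assume "z = 1"
      then obtain n :: int where "2 * pi * of_int c / of_int M = 2 * real_of_int n * pi"
        unfolding z_def echar_def cis_conv_exp exp_eq_1 by auto
      then have "real_of_int c / of_int M = real_of_int n"
        using pi_gt_zero by (simp add: divide_simps split: if_splits)
      then have "real_of_int c = of_int n * of_int M" using assms by (simp add: field_simps)
      then have "c = n * M" by (metis of_int_eq_iff of_int_mult)
      then show False using False by simp
    qed
    moreover have "z ^ nat M = 1"
      unfolding z_def using assms by (simp add: echar_mult_nat[symmetric])
    ultimately show ?thesis using False by (simp add: geometric_sum)
  qed
  finally show ?thesis .
qed

text \<open>Orthogonality of characters on the grid of \<open>M\<close>-torsion points. Such grid
  sums take the place of integrals over the torus.\<close>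

lemma sum_echar_box:
  fixes v :: "int ^ 'n::finite" and M :: int assumes "M > 0"
  shows "(\<Sum>t\<in>box M. echar (dotp v (\<chi> i. of_int (t $ i) / of_int M)))
     = (if \<forall>i. M dvd v $ i then of_int M ^ CARD('n) else 0)"
proof -
  have "(\<Sum>t\<in>box M. echar (dotp v (\<chi> i. of_int (t $ i) / of_int M)))
     = (\<Sum>t\<in>box M. \<Prod>i\<in>UNIV. echar (of_int (v $ i) * (of_int (t $ i) / of_int M)))"
    by (simp add: dotp_def echar_sum)
  also have "\<dots> = (\<Prod>i\<in>UNIV. \<Sum>s\<in>{0..<M}. echar (of_int (v $ i) * (of_int s / of_int M)))"
    by (rule sum_prod_box)
  also have "\<dots> = (\<Prod>i\<in>UNIV. if M dvd v $ i then of_int M else 0)"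
    using sum_echar_roots[OF assms] by simp
  also have "\<dots> = (if \<forall>i. M dvd v $ i then of_int M ^ CARD('n) else 0)"
    using assms by auto
  finally show ?thesis .
qed

text \<open>Trigonometric polynomials are lists of pairs of a coefficient and a frequency.\<close>

definition trig_eval :: "(complex \<times> (int ^ 'n)) list \<Rightarrow> real ^ 'n \<Rightarrow> complex" where
  "trig_eval p \<theta> = (\<Sum>(c, v)\<leftarrow>p. c * echar (dotp v \<theta>))"

definition trig_fun :: "(int ^ 'n \<Rightarrow> complex) \<Rightarrow> (complex \<times> (int ^ 'n)) list \<Rightarrow> complex" where
  "trig_fun \<rho> p = (\<Sum>(c, v)\<leftarrow>p. c * \<rho> v)"

definition trig_mult ::
  "(complex \<times> (int ^ 'n)) list \<Rightarrow> (complex \<times> (int ^ 'n)) list \<Rightarrow> (complex \<times> (int ^ 'n)) list" where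
  "trig_mult p q = concat (map (\<lambda>(c, v). map (\<lambda>(d, u). (c * d, v + u)) q) p)"

definition trig_cnj :: "(complex \<times> (int ^ 'n)) list \<Rightarrow> (complex \<times> (int ^ 'n)) list" where
  "trig_cnj p = map (\<lambda>(c, v). (cnj c, - v)) p"

definition trig_scale :: "complex \<Rightarrow> (complex \<times> (int ^ 'n)) list \<Rightarrow> (complex \<times> (int ^ 'n)) list" where
  "trig_scale a p = map (\<lambda>(c, v). (a * c, v)) p"

lemma trig_eval_Nil [simp]: "trig_eval [] \<theta> = 0"
  by (simp add: trig_eval_def)

lemma trig_eval_Cons: "trig_eval (x # p) \<theta> = fst x * echar (dotp (snd x) \<theta>) + trig_eval p \<theta>"
  by (simp add: trig_eval_def split: prod.splits)

lemma trig_eval_append: "trig_eval (p @ q) \<theta> = trig_eval p \<theta> + trig_eval q \<theta>"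
  by (simp add: trig_eval_def)

lemma trig_fun_Nil [simp]: "trig_fun \<rho> [] = 0"
  by (simp add: trig_fun_def)

lemma trig_fun_Cons: "trig_fun \<rho> (x # p) = fst x * \<rho> (snd x) + trig_fun \<rho> p"
  by (simp add: trig_fun_def split: prod.splits)

lemma trig_fun_append: "trig_fun \<rho> (p @ q) = trig_fun \<rho> p + trig_fun \<rho> q"
  by (simp add: trig_fun_def)

lemma trig_eval_scale: "trig_eval (trig_scale a p) \<theta> = a * trig_eval p \<theta>"
  by (induction p) (auto simp: trig_eval_Cons trig_scale_def algebra_simps)

lemma trig_fun_scale: "trig_fun \<rho> (trig_scale a p) = a * trig_fun \<rho> p"
  by (induction p) (auto simp: trig_fun_Cons trig_scale_def algebra_simps)

lemma trig_eval_cnj: "trig_eval (trig_cnj p) \<theta> = cnj (trig_eval p \<theta>)"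
  by (induction p) (auto simp: trig_eval_Cons trig_cnj_def dotp_uminus echar_uminus)

lemma trig_eval_mult: "trig_eval (trig_mult p q) \<theta> = trig_eval p \<theta> * trig_eval q \<theta>"
proof (induction p)
  case (Cons x p)
  have "trig_eval (map (\<lambda>(d, u). (fst x * d, snd x + u)) q) \<theta>
      = fst x * echar (dotp (snd x) \<theta>) * trig_eval q \<theta>"
    by (induction q) (auto simp: trig_eval_Cons dotp_add echar_add algebra_simps)
  then show ?case using Cons
    by (cases x) (simp add: trig_mult_def trig_eval_append trig_eval_Cons algebra_simps)
qed (simp add: trig_mult_def)

definition pos_def_Zn :: "(int ^ 'n \<Rightarrow> complex) \<Rightarrow> bool" where
  "pos_def_Zn \<rho> \<longleftrightarrow> (\<forall>F a. finite F \<longrightarrow> (\<Sum>u\<in>F. \<Sum>v\<in>F. cnj (a u) * a v * \<rho> (v - u)) \<in> \<real>\<^sub>\<ge>\<^sub>0)"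

text \<open>For \<open>N > 0\<close> these are the coefficients of the Fejer kernel, the products of
  the factors \<open>max 0 (1 - \<bar>v $ i\<bar> / N)\<close>. Counting pairs makes them fit the
  double sum in \<open>pos_def_Zn\<close>.\<close>

definition fejer :: "nat \<Rightarrow> int ^ 'n \<Rightarrow> real" where
  "fejer N v = card {(a, b) \<in> box (int N) \<times> box (int N). a - b = v} / real N ^ CARD('n)"

lemma fejer_tendsto: "(\<lambda>N. fejer N (v :: int ^ 'n::finite)) \<longlonglongrightarrow> 1"
proof -
  define L where "L = Max (range (\<lambda>i. nat \<bar>v $ i\<bar>))"
  have L: "\<bar>v $ i\<bar> \<le> int L" for i
  proof -
    have "nat \<bar>v $ i\<bar> \<le> L" unfolding L_def by (rule Max_ge) auto
    then show ?thesis by simp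
  qed
  let ?D = "\<lambda>N. {(a, b) \<in> box (int N) \<times> box (int N). a - b = v}"
  have upper: "fejer N v \<le> 1" for N
  proof -
    have "card (?D N) \<le> card (box (int N) :: (int ^ 'n) set)"
      by (rule card_inj_on_le[where f = fst]) (auto simp: inj_on_def)
    then have "card (?D N) \<le> N ^ CARD('n)"
      by (simp add: card_box)
    then have "real (card (?D N)) \<le> real N ^ CARD('n)"
      unfolding of_nat_power[symmetric] of_nat_le_iff .
    then show ?thesis by (auto simp: fejer_def divide_le_eq_1)
  qed
  have lower: "((real N - 2 * real L) / real N) ^ CARD('n) \<le> fejer N v" if "N > 2 * L" for N
  proof -
    \<comment> \<open>All entries of \<open>v\<close> are at most \<open>L\<close> in absolute
      value, so a box shortened by \<open>2 * L\<close> can be shifted by \<open>L\<close> and then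
      by \<open>- v\<close> without leaving the large box.\<close>
    let ?sh = "\<lambda>t::int ^ 'n. (\<chi> i. t $ i + int L, (\<chi> i. t $ i + int L) - v) :: (int ^ 'n) \<times> (int ^ 'n)"
    have fin: "finite (?D N)"
      by (rule finite_subset[of _ "box (int N) \<times> box (int N)"]) auto
    have "card (box (int N - 2 * int L) :: (int ^ 'n) set) \<le> card (?D N)"
    proof (rule card_inj_on_le[where f = ?sh])
      show "inj_on ?sh (box (int N - 2 * int L))"
        by (auto simp: inj_on_def vec_eq_iff)
      show "?sh ` box (int N - 2 * int L) \<subseteq> ?D N"
      proof safe
        fix t :: "int ^ 'n" assume t: "t \<in> box (int N - 2 * int L)"
        have "0 \<le> t $ i \<and> t $ i < int N - 2 * int L" for i using t by (simp add: box_def)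
        then show "(\<chi> i. t $ i + int L) \<in> box (int N)" "(\<chi> i. t $ i + int L) - v \<in> box (int N)"
          using L by (auto simp: box_def) (smt (verit) L)+
      qed auto
    qed (rule fin)
    then have "(N - 2 * L) ^ CARD('n) \<le> card (?D N)"
      using that by (simp add: card_box nat_diff_distrib nat_mult_distrib)
    then have "real ((N - 2 * L) ^ CARD('n)) \<le> real (card (?D N))" by simp
    then have "(real N - 2 * real L) ^ CARD('n) \<le> real (card (?D N))"
      using that by (simp add: of_nat_diff)
    then show ?thesis unfolding fejer_def power_divide
      by (rule divide_right_mono) auto
  qed
  have "(\<lambda>N. (real N - 2 * real L) / real N) \<longlonglongrightarrow> 1"
    by real_asymp
  then have lim: "(\<lambda>N. ((real N - 2 * real L) / real N) ^ CARD('n)) \<longlonglongrightarrow> 1 ^ CARD('n)"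
    by (rule tendsto_power)
  show ?thesis
  proof (rule tendsto_sandwich[OF _ _ lim[simplified] tendsto_const])
    show "\<forall>\<^sub>F N in sequentially. ((real N - 2 * real L) / real N) ^ CARD('n) \<le> fejer N v"
      using eventually_gt_at_top[of "2 * L"] by eventually_elim (rule lower)
  qed (use upper in auto)
qed

text \<open>The substitute for Bochner's theorem. For the Fejer truncation of \<open>\<rho>\<close>
  with \<open>N > 0\<close> the functional is, up to a positive factor, a sum over a finite grid of
  \<open>trig_eval p\<close> times a nonnegative density; letting \<open>N\<close> grow recovers
  \<open>\<rho>\<close>.\<close>

lemma trig_fun_nonneg:
  fixes \<rho> :: "int ^ 'n::finite \<Rightarrow> complex"
  assumes pd: "pos_def_Zn \<rho>" and pos: "\<And>\<theta>. trig_eval p \<theta> \<in> \<real>\<^sub>\<ge>\<^sub>0"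
  shows "trig_fun \<rho> p \<in> \<real>\<^sub>\<ge>\<^sub>0"
proof (rule nonneg_Reals_tendsto)
  let ?f = "\<lambda>N v. complex_of_real (fejer N v) * \<rho> v"
  show "(\<lambda>N. trig_fun (?f N) p) \<longlonglongrightarrow> trig_fun \<rho> p"
  proof (induction p)
    case (Cons x p)
    have "(\<lambda>N. fst x * (complex_of_real (fejer N (snd x)) * \<rho> (snd x))) \<longlonglongrightarrow> fst x * (of_real 1 * \<rho> (snd x))"
      by (intro tendsto_intros fejer_tendsto)
    with Cons show ?case unfolding trig_fun_Cons by (intro tendsto_add) auto
  qed simp
next
  let ?f = "\<lambda>N v. complex_of_real (fejer N v) * \<rho> v"
  fix N :: nat
  define L where "L = Max (insert 0 ((\<lambda>(v, i). nat \<bar>v $ i\<bar>) ` (snd ` set p \<times> UNIV)))"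
  have L: "\<bar>v $ i\<bar> \<le> int L" if "(c, v) \<in> set p" for c v i
  proof -
    have "nat \<bar>v $ i\<bar> \<le> L" unfolding L_def
      by (rule Max_ge) (use that in \<open>force+\<close>)
    then show ?thesis by simp
  qed
  \<comment> \<open>Fine enough to avoid aliasing: the entries of \<open>v - (a - b)\<close> have
    absolute value below \<open>M\<close>, so they are divisible by \<open>M\<close> only if they
    are zero.\<close>
  define M where "M = int (N + L + 1)"
  have M: "M > 0" by (simp add: M_def)
  define th :: "int ^ 'n \<Rightarrow> real ^ 'n" where "th t = (\<chi> i. of_int (t $ i) / of_int M)" for t
  \<comment> \<open>The density of the truncated functional. It is nonnegative because it is the
    form of \<open>pos_def_Zn\<close> at the phases
    \<open>cnj (echar (dotp a \<theta>))\<close>.\<close>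
  define A where "A \<theta> = (\<Sum>b\<in>box (int N). \<Sum>a\<in>box (int N). \<rho> (a - b) * cnj (echar (dotp (a - b) \<theta>)))"
    for \<theta> :: "real ^ 'n"
  have A: "A \<theta> \<in> \<real>\<^sub>\<ge>\<^sub>0" for \<theta>
  proof -
    have "A \<theta> = (\<Sum>b\<in>box (int N). \<Sum>a\<in>box (int N).
        cnj (cnj (echar (dotp b \<theta>))) * cnj (echar (dotp a \<theta>)) * \<rho> (a - b))"
      unfolding A_def by (intro sum.cong refl) (simp add: dotp_diff echar_diff)
    moreover have "\<dots> \<in> \<real>\<^sub>\<ge>\<^sub>0"
      by (rule pd[unfolded pos_def_Zn_def, rule_format, OF finite_box])
    ultimately show ?thesis by simp
  qed
  have key: "(\<Sum>t\<in>box M. echar (dotp v (th t)) * A (th t))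
      = of_int M ^ CARD('n) * (of_real (real N ^ CARD('n) * fejer N v) * \<rho> v)"
    if v: "(c, v) \<in> set p" for c v
  proof -
    let ?B = "box (int N) :: (int ^ 'n) set"
    have eq: "(\<forall>i. M dvd (v - (a - b)) $ i) \<longleftrightarrow> a - b = v" if "a \<in> ?B" "b \<in> ?B" for a b
    proof
      assume d: "\<forall>i. M dvd (v - (a - b)) $ i"
      have "(v - (a - b)) $ i = 0" for i
      proof (rule ccontr)
        assume "(v - (a - b)) $ i \<noteq> 0"
        then have "M \<le> \<bar>(v - (a - b)) $ i\<bar>" using d by (metis dvd_imp_le_int M abs_of_pos)
        moreover have "0 \<le> a $ i" "a $ i < int N" "0 \<le> b $ i" "b $ i < int N"
          using that by (auto simp: box_def)
        moreover have "\<bar>v $ i\<bar> \<le> int L" using L v by blast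
        ultimately show False unfolding M_def by simp
      qed
      then show "a - b = v" by (simp add: vec_eq_iff)
    qed auto
    have "(\<Sum>t\<in>box M. echar (dotp v (th t)) * A (th t))
       = (\<Sum>t\<in>box M. \<Sum>b\<in>?B. \<Sum>a\<in>?B. \<rho> (a - b) * echar (dotp (v - (a - b)) (th t)))"
      unfolding A_def sum_distrib_left
      by (intro sum.cong refl) (simp add: dotp_diff echar_diff)
    also have "\<dots> = (\<Sum>b\<in>?B. \<Sum>a\<in>?B. \<Sum>t\<in>box M. \<rho> (a - b) * echar (dotp (v - (a - b)) (th t)))"
    proof -
      have "(\<Sum>a\<in>?B. \<Sum>t\<in>box M. \<rho> (a - b) * echar (dotp (v - (a - b)) (th t)))
         = (\<Sum>t\<in>box M. \<Sum>a\<in>?B. \<rho> (a - b) * echar (dotp (v - (a - b)) (th t)))" for b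
        by (rule sum.swap)
      then show ?thesis by (simp only: sum.swap[of _ ?B "box M"])
    qed
    also have "\<dots> = (\<Sum>b\<in>?B. \<Sum>a\<in>?B. if a - b = v then \<rho> v * of_int M ^ CARD('n) else 0)"
    proof (intro sum.cong refl)
      fix b a assume "b \<in> ?B" "a \<in> ?B"
      then show "(\<Sum>t\<in>box M. \<rho> (a - b) * echar (dotp (v - (a - b)) (th t)))
          = (if a - b = v then \<rho> v * of_int M ^ CARD('n) else 0)"
        unfolding th_def sum_distrib_left[symmetric] sum_echar_box[OF M] eq[OF \<open>a \<in> ?B\<close> \<open>b \<in> ?B\<close>]
        by simp
    qed
    also have "\<dots> = (\<Sum>x\<in>?B \<times> ?B. if snd x - fst x = v then \<rho> v * of_int M ^ CARD('n) else 0)"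
      by (simp add: sum.cartesian_product case_prod_unfold)
    also have "\<dots> = of_nat (card {x \<in> ?B \<times> ?B. snd x - fst x = v}) * (\<rho> v * of_int M ^ CARD('n))"
      by (subst sum.inter_filter[symmetric]) auto
    finally have 1: "(\<Sum>t\<in>box M. echar (dotp v (th t)) * A (th t))
       = of_nat (card {x \<in> ?B \<times> ?B. snd x - fst x = v}) * (\<rho> v * of_int M ^ CARD('n))" .
    have 2: "card {x \<in> ?B \<times> ?B. snd x - fst x = v} = card {(a, b) \<in> ?B \<times> ?B. a - b = v}"
      by (rule bij_betw_same_card[of prod.swap]) (auto simp: bij_betw_def inj_on_def image_def)
    have 3: "complex_of_nat (card {(a, b) \<in> ?B \<times> ?B. a - b = v}) = of_real (real N ^ CARD('n) * fejer N v)"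
      unfolding fejer_def by (cases "N = 0") (auto simp: box_def)
    show ?thesis unfolding 1 2 3 by (simp only: mult_ac)
  qed
  have nn: "(\<Sum>t\<in>box M. trig_eval p (th t) * A (th t)) \<in> \<real>\<^sub>\<ge>\<^sub>0"
    by (rule nonneg_Reals_sum, rule nonneg_Reals_mult_I, rule pos, rule A)
  have eq: "(\<Sum>t\<in>box M. trig_eval p (th t) * A (th t))
      = of_real (of_int M ^ CARD('n) * real N ^ CARD('n)) * trig_fun (?f N) p"
    using key
  proof (induction p)
    case (Cons x p)
    have IH: "(\<Sum>t\<in>box M. trig_eval p (th t) * A (th t))
      = of_real (of_int M ^ CARD('n) * real N ^ CARD('n)) * trig_fun (?f N) p"
      by (rule Cons.IH) (rule Cons.prems, rule list.set_intros(2))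
    have k: "(\<Sum>t\<in>box M. echar (dotp (snd x) (th t)) * A (th t))
      = of_int M ^ CARD('n) * (of_real (real N ^ CARD('n) * fejer N (snd x)) * \<rho> (snd x))"
      by (rule Cons.prems[of "fst x" "snd x"]) simp
    have "(\<Sum>t\<in>box M. trig_eval (x # p) (th t) * A (th t))
       = fst x * (\<Sum>t\<in>box M. echar (dotp (snd x) (th t)) * A (th t))
         + (\<Sum>t\<in>box M. trig_eval p (th t) * A (th t))"
      by (simp only: trig_eval_Cons distrib_right sum.distrib mult.assoc sum_distrib_left)
    then show ?case unfolding IH k by (simp only: trig_fun_Cons of_real_mult of_real_power of_real_of_int_eq distrib_left mult_ac)
  qed simp
  have fin: "of_real (of_int M ^ CARD('n) * real N ^ CARD('n)) * trig_fun (?f N) p \<in> \<real>\<^sub>\<ge>\<^sub>0"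
    using nn unfolding eq .
  show "trig_fun (?f N) p \<in> \<real>\<^sub>\<ge>\<^sub>0"
  proof (cases "N = 0")
    case True
    then have z: "fejer N v = 0" for v :: "int ^ 'n" by (simp add: fejer_def)
    have "trig_fun (?f N) q = 0" for q
      by (induction q) (simp_all add: trig_fun_Cons z)
    then show ?thesis by simp
  next
    case False
    define r where "r = real_of_int M ^ CARD('n) * real N ^ CARD('n)"
    have "r > 0" using False M by (simp add: r_def)
    then have "trig_fun (?f N) p
        = of_real (1 / r) * (of_real r * trig_fun (?f N) p)"
      by simp
    also have "\<dots> \<in> \<real>\<^sub>\<ge>\<^sub>0"
      by (rule nonneg_Reals_mult_I[OF _ fin[folded r_def]]) (use \<open>r > 0\<close> in simp)
    finally show ?thesis .
  qed
qed

section \<open>Integer matrices of determinant one and the group law\<close>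

lemma det_map_matrix_of_int:
  "det (map_matrix real_of_int A) = real_of_int (det (A :: int ^ 'n ^ 'n))"
  by (simp add: det_def)

lemma map_matrix_of_int_mult:
  "map_matrix real_of_int (A ** B) = map_matrix real_of_int A ** map_matrix real_of_int B"
  by (simp add: vec_eq_iff matrix_matrix_mult_def)

lemma map_matrix_of_int_mat: "map_matrix real_of_int (mat 1) = mat 1"
  by (simp add: vec_eq_iff mat_def)

lemma map_matrix_of_int_inject:
  "map_matrix real_of_int A = map_matrix real_of_int B \<longleftrightarrow> A = B"
  by (simp add: vec_eq_iff)

text \<open>Cramer's rule: the inverse is the adjugate divided by the determinant, and the adjugate
  \<open>B\<close> has integer entries.\<close>

lemma int_matrix_inverse:
  fixes A :: "int ^ 'n ^ 'n" assumes "det A = 1"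
  obtains B where "A ** B = mat 1" "B ** A = mat 1" "det B = 1"
proof -
  let ?R = "map_matrix real_of_int A"
  have d: "det ?R = 1" using assms by (simp add: det_map_matrix_of_int)
  define B :: "int ^ 'n ^ 'n" where
    "B = (\<chi> k l. det (\<chi> i j. if j = k then (if i = l then 1 else 0) else A $ i $ j))"
  have col: "?R *v (\<chi> k. real_of_int (B $ k $ l)) = axis l 1" for l
  proof -
    have "real_of_int (B $ k $ l)
        = det (\<chi> i j. if j = k then (axis l 1 :: real ^ 'n) $ i else ?R $ i $ j) / det ?R" for k
    proof -
      have "(\<chi> i j. if j = k then (axis l 1 :: real ^ 'n) $ i else ?R $ i $ j)
         = map_matrix real_of_int (\<chi> i j. if j = k then (if i = l then 1 else 0) else A $ i $ j)"
        by (auto simp: vec_eq_iff axis_def)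
      then show ?thesis using d by (simp only: det_map_matrix_of_int) (simp add: B_def)
    qed
    then show ?thesis using d by (subst cramer) (simp_all add: vec_eq_iff)
  qed
  have "?R ** map_matrix real_of_int B = mat 1"
  proof -
    have "(?R ** map_matrix real_of_int B) $ i $ l = (?R *v (\<chi> k. real_of_int (B $ k $ l))) $ i" for i l
      by (simp add: matrix_matrix_mult_def matrix_vector_mult_def)
    then show ?thesis unfolding col by (auto simp: vec_eq_iff mat_def axis_def)
  qed
  moreover from this have "map_matrix real_of_int B ** ?R = mat 1"
    by (simp add: matrix_left_right_inverse)
  ultimately have *: "A ** B = mat 1" "B ** A = mat 1"
    by (metis map_matrix_of_int_inject map_matrix_of_int_mat map_matrix_of_int_mult)+
  then have "det A * det B = 1" by (metis det_I det_mul)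
  then show ?thesis using that[of B] * assms by simp
qed

lemma carrier_Gn: "carrier Gn = {(v, A). det A = 1}"
  by (auto simp: Gn_def semidirect_product_def Zn_def SLn_def)

lemma mem_carrier_Gn [simp]: "(v, A) \<in> carrier Gn \<longleftrightarrow> det A = 1"
  by (simp add: carrier_Gn)

lemma mult_Gn [simp]: "(v, A) \<otimes>\<^bsub>Gn\<^esub> (u, B) = (v + A *v u, A ** B)"
  by (simp add: Gn_def semidirect_product_def Zn_def SLn_def)

lemma one_Gn [simp]: "\<one>\<^bsub>Gn\<^esub> = (0, mat 1)"
  by (simp add: Gn_def semidirect_product_def Zn_def SLn_def)

lemma group_Gn: "group (Gn :: ((int ^ 'n) \<times> (int ^ 'n ^ 'n)) monoid)"
proof (rule groupI)
  fix x :: "(int ^ 'n) \<times> (int ^ 'n ^ 'n)" assume "x \<in> carrier Gn"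
  then obtain v A where x: "x = (v, A)" "det A = 1" by (cases x) auto
  obtain B where "B ** A = mat 1" "det B = 1" using int_matrix_inverse[OF x(2)] by metis
  then show "\<exists>y\<in>carrier Gn. y \<otimes>\<^bsub>Gn\<^esub> x = \<one>\<^bsub>Gn\<^esub>"
    using x by (intro bexI[of _ "(- (B *v v), B)"]) auto
qed (auto simp: carrier_Gn det_mul matrix_vector_mul_assoc matrix_mul_assoc matrix_vector_right_distrib add.assoc)

lemma inv_Gn:
  fixes A :: "int ^ 'n ^ 'n"
  assumes "det A = 1" "B ** A = mat 1" "det B = 1"
  shows "inv\<^bsub>Gn\<^esub> (v, A) = (- (B *v v), B)"
proof -
  interpret group "Gn :: ((int ^ 'n) \<times> (int ^ 'n ^ 'n)) monoid" by (rule group_Gn)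
  show ?thesis by (rule inv_equality) (use assms in auto)
qed

lemma inv_Gn_translation [simp]: "inv\<^bsub>Gn\<^esub> (v, mat 1) = (- v, mat 1)"
  by (subst inv_Gn[where B = "mat 1"]) auto

text \<open>Stated for the four numbers of a possibly degenerate form on two vectors, so that it
  serves the GNS form, \<open>ell2_inner\<close> and 2 by 2 operator matrices alike.\<close>

lemma cauchy_schwarz_form:
  fixes A D Z Z' :: complex
  assumes nn: "\<And>\<alpha> \<beta>. \<alpha> * cnj \<alpha> * A + \<beta> * cnj \<beta> * D + \<alpha> * cnj \<beta> * Z + \<beta> * cnj \<alpha> * Z' \<in> \<real>\<^sub>\<ge>\<^sub>0"
  shows "(cmod Z)\<^sup>2 \<le> Re A * Re D" and "Z' = cnj Z"
proof -
  have A: "Re A \<ge> 0" "Im A = 0" using nn[of 1 0] by (auto simp: complex_nonneg_Reals_iff)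
  have D: "Re D \<ge> 0" "Im D = 0" using nn[of 0 1] by (auto simp: complex_nonneg_Reals_iff)
  have "Im (Z + Z') = 0" using nn[of 1 1] A D by (auto simp: complex_nonneg_Reals_iff)
  moreover have "Im (\<i> * Z - \<i> * Z') = 0" using nn[of \<i> 1] A D by (auto simp: complex_nonneg_Reals_iff)
  ultimately show Z': "Z' = cnj Z" by (auto simp: complex_eq_iff)
  \<comment> \<open>The test vector is \<open>t\<close> times the first vector plus \<open>Z\<close>
    times the second; the phase of \<open>Z\<close> makes both cross terms real.\<close>
  have *: "t\<^sup>2 * Re A + (cmod Z)\<^sup>2 * Re D + 2 * t * (cmod Z)\<^sup>2 \<ge> 0" for t :: real
  proof -
    have "of_real t * of_real t * A + Z * cnj Z * D + of_real t * cnj Z * Z + Z * of_real t * cnj Z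
        \<in> \<real>\<^sub>\<ge>\<^sub>0"
      using nn[of "of_real t" Z] Z' by simp
    then have "Re (of_real t * of_real t * A + Z * cnj Z * D + of_real t * cnj Z * Z + Z * of_real t * cnj Z) \<ge> 0"
      by (simp add: complex_nonneg_Reals_iff)
    also have "of_real t * of_real t * A + Z * cnj Z * D + of_real t * cnj Z * Z + Z * of_real t * cnj Z
       = of_real (t * t) * A + of_real ((cmod Z)\<^sup>2) * D + of_real (2 * t * (cmod Z)\<^sup>2)"
      using complex_norm_square[of Z] by (simp add: algebra_simps)
    finally show ?thesis by (simp add: power2_eq_square)
  qed
  show "(cmod Z)\<^sup>2 \<le> Re A * Re D"
  proof (cases "Z = 0")
    case True then show ?thesis using A D by simp
  next
    case False
    then have m: "(cmod Z)\<^sup>2 > 0" by simp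
    show ?thesis
    proof (cases "Re A = 0")
      case True
      have "Re D + 2 * t \<ge> 0" for t
      proof -
        have "(cmod Z)\<^sup>2 * (Re D + 2 * t) \<ge> 0" using *[of t] True by (simp add: algebra_simps)
        then show ?thesis using m by (simp add: zero_le_mult_iff)
      qed
      from this[of "- Re D - 1"] D show ?thesis by simp
    next
      case A0: False
      then have "Re A > 0" using A by simp
      have "0 \<le> ((cmod Z)\<^sup>2 / Re A)\<^sup>2 * Re A + (cmod Z)\<^sup>2 * Re D - 2 * ((cmod Z)\<^sup>2 / Re A) * (cmod Z)\<^sup>2"
        using *[of "- ((cmod Z)\<^sup>2 / Re A)"] by simp
      also have "\<dots> = (cmod Z)\<^sup>2 * (Re D - (cmod Z)\<^sup>2 / Re A)"
        using A0 by (simp add: field_simps power2_eq_square)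
      finally have "Re D - (cmod Z)\<^sup>2 / Re A \<ge> 0" using m by (simp add: zero_le_mult_iff)
      then show ?thesis using \<open>Re A > 0\<close> by (simp add: field_simps)
    qed
  qed
qed

section \<open>Positive definite functions on the group and their GNS form\<close>

definition posdef :: "('g, 'b) monoid_scheme \<Rightarrow> ('g \<Rightarrow> complex) \<Rightarrow> bool" where
  "posdef G \<psi> \<longleftrightarrow> (\<forall>k g a. (\<forall>i<k. g i \<in> carrier G) \<longrightarrow>
     (\<Sum>i<(k::nat). \<Sum>j<k. cnj (a i) * a j * \<psi> (inv\<^bsub>G\<^esub> (g i) \<otimes>\<^bsub>G\<^esub> g j)) \<in> \<real>\<^sub>\<ge>\<^sub>0)"

text \<open>The GNS form of \<open>\<psi>\<close>, with vectors given as formal linear combinations of group elements.\<close>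

definition gns_form :: "('g, 'b) monoid_scheme \<Rightarrow> ('g \<Rightarrow> complex) \<Rightarrow> (complex \<times> 'g) list \<Rightarrow> (complex \<times> 'g) list \<Rightarrow> complex" where
  "gns_form G \<psi> X Y = (\<Sum>(a, s)\<leftarrow>X. \<Sum>(b, t)\<leftarrow>Y. a * cnj b * \<psi> (inv\<^bsub>G\<^esub> t \<otimes>\<^bsub>G\<^esub> s))"

lemma gns_form_Nil [simp]: "gns_form G \<psi> [] Y = 0" "gns_form G \<psi> X [] = 0"
  by (auto simp: gns_form_def case_prod_unfold)

lemma gns_form_Cons_left:
  "gns_form G \<psi> (x # X) Y = (\<Sum>(b, t)\<leftarrow>Y. fst x * cnj b * \<psi> (inv\<^bsub>G\<^esub> t \<otimes>\<^bsub>G\<^esub> snd x)) + gns_form G \<psi> X Y"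
  by (simp add: gns_form_def case_prod_unfold)

lemma gns_form_append_left: "gns_form G \<psi> (X @ X') Y = gns_form G \<psi> X Y + gns_form G \<psi> X' Y"
  by (simp add: gns_form_def)

lemma gns_form_append_right: "gns_form G \<psi> X (Y @ Y') = gns_form G \<psi> X Y + gns_form G \<psi> X Y'"
  by (induction X) (simp_all add: gns_form_Cons_left)

lemma gns_form_scale_left:
  "gns_form G \<psi> (map (\<lambda>(a, s). (c * a, s)) X) Y = c * gns_form G \<psi> X Y"
  by (induction X)
     (simp_all add: gns_form_Cons_left case_prod_unfold algebra_simps sum_list_const_mult)

lemma gns_form_scale_right:
  "gns_form G \<psi> X (map (\<lambda>(a, s). (c * a, s)) Y) = cnj c * gns_form G \<psi> X Y"
  by (induction X)
     (simp_all add: gns_form_Cons_left case_prod_unfold algebra_simps sum_list_const_mult[symmetric] o_def)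

lemma gns_form_nonneg:
  assumes "posdef G \<psi>" "\<And>a s. (a, s) \<in> set X ==> s \<in> carrier G"
  shows "gns_form G \<psi> X X \<in> \<real>\<^sub>\<ge>\<^sub>0"
proof -
  have "gns_form G \<psi> X X = (\<Sum>j<length X. \<Sum>i<length X.
      cnj (fst (X ! i)) * fst (X ! j) * \<psi> (inv\<^bsub>G\<^esub> snd (X ! i) \<otimes>\<^bsub>G\<^esub> snd (X ! j)))"
    by (simp add: gns_form_def case_prod_unfold sum_list_sum_nth atLeast0LessThan mult_ac)
  also have "\<dots> = (\<Sum>i<length X. \<Sum>j<length X.
      cnj (fst (X ! i)) * fst (X ! j) * \<psi> (inv\<^bsub>G\<^esub> snd (X ! i) \<otimes>\<^bsub>G\<^esub> snd (X ! j)))"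
    by (rule sum.swap)
  also have "\<dots> \<in> \<real>\<^sub>\<ge>\<^sub>0"
  proof -
    have "\<forall>i<length X. snd (X ! i) \<in> carrier G"
      using assms(2) by (metis nth_mem prod.collapse)
    then show ?thesis
      using assms(1)[unfolded posdef_def, rule_format, of "length X" "\<lambda>i. snd (X ! i)" "\<lambda>i. fst (X ! i)"]
      by blast
  qed
  finally show ?thesis .
qed

lemma gns_form_cauchy_schwarz:
  assumes "posdef G \<psi>" "\<And>a s. (a, s) \<in> set X ==> s \<in> carrier G" "\<And>a s. (a, s) \<in> set Y ==> s \<in> carrier G"
  shows "(cmod (gns_form G \<psi> X Y))\<^sup>2 \<le> Re (gns_form G \<psi> X X) * Re (gns_form G \<psi> Y Y)"
    and "gns_form G \<psi> Y X = cnj (gns_form G \<psi> X Y)"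
proof -
  have *: "\<alpha> * cnj \<alpha> * gns_form G \<psi> X X + \<beta> * cnj \<beta> * gns_form G \<psi> Y Y
      + \<alpha> * cnj \<beta> * gns_form G \<psi> X Y + \<beta> * cnj \<alpha> * gns_form G \<psi> Y X \<in> \<real>\<^sub>\<ge>\<^sub>0" for \<alpha> \<beta>
  proof -
    let ?Z = "map (\<lambda>(a, s). (\<alpha> * a, s)) X @ map (\<lambda>(a, s). (\<beta> * a, s)) Y"
    have "gns_form G \<psi> ?Z ?Z \<in> \<real>\<^sub>\<ge>\<^sub>0"
      by (rule gns_form_nonneg[OF assms(1)]) (use assms(2,3) in auto)
    then show ?thesis
      unfolding gns_form_append_left gns_form_append_right gns_form_scale_left gns_form_scale_right
      by (simp add: algebra_simps)
  qed
  show "(cmod (gns_form G \<psi> X Y))\<^sup>2 \<le> Re (gns_form G \<psi> X X) * Re (gns_form G \<psi> Y Y)"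
    by (rule cauchy_schwarz_form(1)[OF *])
  show "gns_form G \<psi> Y X = cnj (gns_form G \<psi> X Y)"
    by (rule cauchy_schwarz_form(2)[OF *])
qed

definition shift_vec :: "(complex \<times> (int ^ 'n)) list \<Rightarrow> (complex \<times> ((int ^ 'n) \<times> (int ^ 'n ^ 'n))) list" where
  "shift_vec p = map (\<lambda>(c, v). (c, (v, mat 1))) p"

definition left_translate ::
  "(int ^ 'n) \<times> (int ^ 'n ^ 'n) \<Rightarrow> (complex \<times> (int ^ 'n)) list \<Rightarrow> (complex \<times> ((int ^ 'n) \<times> (int ^ 'n ^ 'n))) list" where
  "left_translate g p = map (\<lambda>(c, v). (c, g \<otimes>\<^bsub>Gn\<^esub> (v, mat 1))) p"

text \<open>Let \<open>\<pi>\<close> and \<open>\<xi>\<close> be the GNS representation and cyclic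
  vector of \<open>\<psi>\<close>. A trigonometric polynomial \<open>p\<close> stands for the vector
  \<open>p(\<pi>)\<xi>\<close> built from translations, and the value is the inner product of
  \<open>\<pi>(g) p(\<pi>)\<xi>\<close> with \<open>q(\<pi>)\<xi>\<close>.\<close>

definition trig_form ::
  "((int ^ 'n) \<times> (int ^ 'n ^ 'n) \<Rightarrow> complex) \<Rightarrow> (int ^ 'n) \<times> (int ^ 'n ^ 'n) \<Rightarrow>
   (complex \<times> (int ^ 'n)) list \<Rightarrow> (complex \<times> (int ^ 'n)) list \<Rightarrow> complex" where
  "trig_form \<psi> g p q = gns_form Gn \<psi> (left_translate g p) (shift_vec q)"

definition trig_comp :: "int ^ 'n ^ 'n \<Rightarrow> (complex \<times> (int ^ 'n)) list \<Rightarrow> (complex \<times> (int ^ 'n)) list" where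
  "trig_comp A p = map (\<lambda>(c, v). (c, A *v v)) p"

text \<open>The transposed matrix, acting on lifts of points of the dual torus;
  \<open>dotp_matvec\<close> is the duality.\<close>

definition tmatvec :: "int ^ 'n ^ 'n \<Rightarrow> real ^ 'n \<Rightarrow> real ^ 'n" where
  "tmatvec A \<theta> = (\<chi> j. \<Sum>i\<in>UNIV. of_int (A $ i $ j) * \<theta> $ i)"

lemma dotp_matvec: "dotp (A *v v) \<theta> = dotp v (tmatvec A \<theta>)"
proof -
  have "dotp (A *v v) \<theta> = (\<Sum>i\<in>UNIV. \<Sum>j\<in>UNIV. of_int (A $ i $ j) * of_int (v $ j) * \<theta> $ i)"
    by (simp add: dotp_def matrix_vector_mult_def sum_distrib_right)
  also have "\<dots> = (\<Sum>j\<in>UNIV. \<Sum>i\<in>UNIV. of_int (A $ i $ j) * of_int (v $ j) * \<theta> $ i)"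
    by (rule sum.swap)
  also have "\<dots> = dotp v (tmatvec A \<theta>)"
    by (simp add: dotp_def tmatvec_def sum_distrib_left mult_ac)
  finally show ?thesis .
qed

lemma trig_eval_comp: "trig_eval (trig_comp A p) \<theta> = trig_eval p (tmatvec A \<theta>)"
  by (induction p) (auto simp: trig_comp_def trig_eval_Cons dotp_matvec)

lemma gns_shift_vec:
  "gns_form Gn \<psi> (shift_vec p) (shift_vec q)
     = trig_fun (\<lambda>v. \<psi> (v, mat 1)) (trig_mult p (trig_cnj q))"
proof (induction p)
  case (Cons x p)
  have "(\<Sum>(b, t)\<leftarrow>shift_vec q. fst x * cnj b * \<psi> (inv\<^bsub>Gn\<^esub> t \<otimes>\<^bsub>Gn\<^esub> (snd x, mat 1)))
     = trig_fun (\<lambda>v. \<psi> (v, mat 1)) (map (\<lambda>(d, u). (fst x * d, snd x + u)) (trig_cnj q))"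
    by (induction q) (auto simp: shift_vec_def trig_cnj_def trig_fun_Cons algebra_simps)
  with Cons show ?case
    by (cases x) (simp add: shift_vec_def gns_form_Cons_left trig_mult_def trig_fun_append)
qed (simp add: shift_vec_def trig_mult_def)

lemma gns_left_translate:
  assumes "g \<in> carrier (Gn :: ((int ^ 'n) \<times> (int ^ 'n ^ 'n)) monoid)"
  shows "gns_form Gn \<psi> (left_translate g p) (left_translate g q) = gns_form Gn \<psi> (shift_vec p) (shift_vec q)"
proof -
  interpret group "Gn :: ((int ^ 'n) \<times> (int ^ 'n ^ 'n)) monoid" by (rule group_Gn)
  have *: "inv\<^bsub>Gn\<^esub> (g \<otimes>\<^bsub>Gn\<^esub> (u, mat 1)) \<otimes>\<^bsub>Gn\<^esub> (g \<otimes>\<^bsub>Gn\<^esub> (v, mat 1)) = inv\<^bsub>Gn\<^esub> (u, mat 1) \<otimes>\<^bsub>Gn\<^esub> (v, mat 1)"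
    for u v
    using assms by (simp del: inv_Gn_translation mult_Gn add: inv_mult_group m_assoc[symmetric])
      (simp del: inv_Gn_translation mult_Gn add: m_assoc)
  show ?thesis
    unfolding gns_form_def left_translate_def shift_vec_def by (simp add: case_prod_unfold o_def *)
qed

lemma carrier_shift_vec: "(a, s) \<in> set (shift_vec p) ==> s \<in> carrier Gn"
  by (auto simp: shift_vec_def)

lemma carrier_left_translate:
  "g \<in> carrier Gn ==> (a, s) \<in> set (left_translate g p) ==> s \<in> carrier Gn"
  by (cases g) (auto simp: left_translate_def det_mul)

text \<open>Left translation is unitary for the GNS form, so \<open>g\<close> disappears from the
  norms and both factors become values of the spectral functional on the translations.\<close>

lemma trig_form_cauchy_schwarz:
  assumes "posdef Gn \<psi>" "g \<in> carrier Gn"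
  shows "(cmod (trig_form \<psi> g p q))\<^sup>2 \<le>
     Re (trig_fun (\<lambda>v. \<psi> (v, mat 1)) (trig_mult p (trig_cnj p))) *
     Re (trig_fun (\<lambda>v. \<psi> (v, mat 1)) (trig_mult q (trig_cnj q)))"
  using gns_form_cauchy_schwarz(1)[OF assms(1), of "left_translate g p" "shift_vec q"]
    carrier_left_translate[OF assms(2)] carrier_shift_vec
  by (simp add: trig_form_def gns_left_translate[OF assms(2)] gns_shift_vec) blast

lemma trig_form_append_left: "trig_form \<psi> g (p @ p') q = trig_form \<psi> g p q + trig_form \<psi> g p' q"
  by (simp add: trig_form_def left_translate_def gns_form_append_left)

lemma trig_form_append_right: "trig_form \<psi> g p (q @ q') = trig_form \<psi> g p q + trig_form \<psi> g p q'"
  by (simp add: trig_form_def shift_vec_def gns_form_append_right)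

lemma trig_form_scale_left: "trig_form \<psi> g (trig_scale c p) q = c * trig_form \<psi> g p q"
  using gns_form_scale_left[of Gn \<psi> c "left_translate g p" "shift_vec q"]
  by (simp add: trig_form_def left_translate_def trig_scale_def case_prod_unfold o_def)

lemma trig_form_scale_right: "trig_form \<psi> g p (trig_scale c q) = cnj c * trig_form \<psi> g p q"
  using gns_form_scale_right[of Gn \<psi> "left_translate g p" c "shift_vec q"]
  by (simp add: trig_form_def shift_vec_def trig_scale_def case_prod_unfold o_def)

lemma trig_form_eq:
  "trig_form \<psi> (w, A) p q = (\<Sum>(c, v)\<leftarrow>p. \<Sum>(d, u)\<leftarrow>q. c * cnj d * \<psi> (w + A *v v - u, A))"
  by (simp add: trig_form_def gns_form_def left_translate_def shift_vec_def case_prod_unfold o_def algebra_simps)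

text \<open>Conjugation by \<open>(w, A)\<close> sends the translation by \<open>v\<close> to the
  translation by \<open>A *v v\<close>. Therefore \<open>p\<close> passes to the left of
  \<open>(w, A)\<close> as \<open>trig_comp A p\<close>, and from there as an adjoint into the other
  argument.\<close>

lemma trig_form_move:
  "trig_form \<psi> (w, A) p q = trig_form \<psi> (w, A) [(1, 0)] (trig_mult q (trig_cnj (trig_comp A p)))"
proof -
  have one: "trig_form \<psi> (w, A) [(1, 0)] r = (\<Sum>(d, u)\<leftarrow>r. cnj d * \<psi> (w - u, A))" for r
    by (simp add: trig_form_eq)
  have "(\<Sum>(d, u)\<leftarrow>trig_mult q (trig_cnj (trig_comp A p)). cnj d * \<psi> (w - u, A))
      = (\<Sum>(d, u)\<leftarrow>q. \<Sum>(c, v)\<leftarrow>p. c * cnj d * \<psi> (w + A *v v - u, A))"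
    by (induction q) (auto simp: trig_mult_def trig_cnj_def trig_comp_def case_prod_unfold o_def algebra_simps)
  also have "\<dots> = (\<Sum>(c, v)\<leftarrow>p. \<Sum>(d, u)\<leftarrow>q. c * cnj d * \<psi> (w + A *v v - u, A))"
    by (simp add: case_prod_unfold sum_list_sum_nth sum.swap[of _ "{0..<length p}" "{0..<length q}"])
  finally show ?thesis unfolding one trig_form_eq[of \<psi> w A p q] by simp
qed

lemma posdef_finite:
  assumes "posdef G \<psi>" "finite F" "\<And>u. u \<in> F ==> h u \<in> carrier G"
  shows "(\<Sum>u\<in>F. \<Sum>v\<in>F. cnj (a u) * a v * \<psi> (inv\<^bsub>G\<^esub> h u \<otimes>\<^bsub>G\<^esub> h v)) \<in> \<real>\<^sub>\<ge>\<^sub>0"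
proof -
  obtain e where e: "bij_betw e {0..<card F} F" using ex_bij_betw_nat_finite[OF assms(2)] by blast
  then have e': "bij_betw e {..<card F} F" by (simp add: atLeast0LessThan)
  have "(\<Sum>i<card F. \<Sum>j<card F. cnj (a (e i)) * a (e j) * \<psi> (inv\<^bsub>G\<^esub> h (e i) \<otimes>\<^bsub>G\<^esub> h (e j))) \<in> \<real>\<^sub>\<ge>\<^sub>0"
    using assms(1)[unfolded posdef_def, rule_format, of "card F" "\<lambda>i. h (e i)" "\<lambda>i. a (e i)"]
      assms(3) bij_betwE[OF e'] by auto
  also have "(\<Sum>i<card F. \<Sum>j<card F. cnj (a (e i)) * a (e j) * \<psi> (inv\<^bsub>G\<^esub> h (e i) \<otimes>\<^bsub>G\<^esub> h (e j)))
     = (\<Sum>i<card F. \<Sum>v\<in>F. cnj (a (e i)) * a v * \<psi> (inv\<^bsub>G\<^esub> h (e i) \<otimes>\<^bsub>G\<^esub> h v))"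
    by (intro sum.cong refl sum.reindex_bij_betw[OF e'])
  also have "\<dots> = (\<Sum>u\<in>F. \<Sum>v\<in>F. cnj (a u) * a v * \<psi> (inv\<^bsub>G\<^esub> h u \<otimes>\<^bsub>G\<^esub> h v))"
    by (rule sum.reindex_bij_betw[OF e'])
  finally show ?thesis .
qed

lemma pos_def_Zn_restrict:
  assumes "posdef Gn \<psi>" shows "pos_def_Zn (\<lambda>v. \<psi> (v, mat 1))"
  unfolding pos_def_Zn_def
proof (intro allI impI)
  fix F :: "(int ^ 'a) set" and a assume "finite F"
  from posdef_finite[OF assms this, of "\<lambda>v. (v, mat 1)" a]
  show "(\<Sum>u\<in>F. \<Sum>v\<in>F. cnj (a u) * a v * \<psi> (v - u, mat 1)) \<in> \<real>\<^sub>\<ge>\<^sub>0"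
    by simp
qed

lemma trig_fun_mono:
  assumes "pos_def_Zn \<rho>" "\<And>\<theta>. trig_eval q \<theta> - trig_eval p \<theta> \<in> \<real>\<^sub>\<ge>\<^sub>0"
  shows "Re (trig_fun \<rho> p) \<le> Re (trig_fun \<rho> q)"
proof -
  have "trig_fun \<rho> (q @ trig_scale (-1) p) \<in> \<real>\<^sub>\<ge>\<^sub>0"
    by (rule trig_fun_nonneg[OF assms(1)])
       (use assms(2) in \<open>simp add: trig_eval_append trig_eval_scale\<close>)
  then show ?thesis
    by (simp add: trig_fun_append trig_fun_scale complex_nonneg_Reals_iff)
qed

definition trig_sq :: "(complex \<times> (int ^ 'n)) list \<Rightarrow> (complex \<times> (int ^ 'n)) list" where
  "trig_sq p = trig_mult p (trig_cnj p)"

lemma trig_eval_sq: "trig_eval (trig_sq p) \<theta> = of_real ((cmod (trig_eval p \<theta>))\<^sup>2)"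
  by (simp only: trig_sq_def trig_eval_mult trig_eval_cnj complex_norm_square)

lemma trig_fun_sq_nonneg:
  assumes "pos_def_Zn \<rho>" shows "Re (trig_fun \<rho> (trig_sq p)) \<ge> 0"
  using trig_fun_mono[OF assms, of "trig_sq p" "[]"] by (simp add: trig_eval_sq del: of_real_power)

lemma trig_fun_sq_le:
  assumes "pos_def_Zn \<rho>" "\<And>\<theta>. cmod (trig_eval p \<theta>) \<le> M"
  shows "Re (trig_fun \<rho> (trig_sq p)) \<le> M\<^sup>2 * Re (\<rho> 0)"
proof -
  have "Re (trig_fun \<rho> (trig_sq p)) \<le> Re (trig_fun \<rho> [(of_real (M\<^sup>2), 0)])"
  proof (rule trig_fun_mono[OF assms(1)])
    fix \<theta> :: "real ^ 'a"
    have "(cmod (trig_eval p \<theta>))\<^sup>2 \<le> M\<^sup>2"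
      using assms(2) by (intro power_mono) auto
    then have "complex_of_real (M\<^sup>2 - (cmod (trig_eval p \<theta>))\<^sup>2) \<in> \<real>\<^sub>\<ge>\<^sub>0"
      by (simp only: nonneg_Reals_of_real_iff)
    then show "trig_eval [(complex_of_real (M\<^sup>2), 0)] \<theta> - trig_eval (trig_sq p) \<theta> \<in> \<real>\<^sub>\<ge>\<^sub>0"
      by (simp only: trig_eval_sq trig_eval_Cons) simp
  qed
  then show ?thesis by (simp add: trig_fun_Cons)
qed

text \<open>\<open>P\<close> is an approximate indicator of the set that carries the mass of
  \<open>D\<close>. The part of \<open>D\<close> off this set has squared norm at most
  \<open>\<delta>\<close>; on the remaining part \<open>trig_form_move\<close> multiplies
  \<open>P\<close> by its transport under \<open>A\<close>, and that product is small.\<close>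

lemma trig_form_cutoff:
  fixes \<psi> :: "(int ^ 'n) \<times> (int ^ 'n ^ 'n) \<Rightarrow> complex"
  assumes pd: "posdef Gn \<psi>" and A: "det A = 1" and one: "Re (\<psi> (0, mat 1)) \<le> 1"
    and D: "\<And>\<theta>. cmod (trig_eval D \<theta>) \<le> 1" and P: "\<And>\<theta>. cmod (trig_eval P \<theta>) \<le> 2"
    and disj: "\<And>\<theta>. cmod (trig_eval P \<theta> * trig_eval P (tmatvec A \<theta>)) \<le> \<eta>"
    and \<delta>: "Re (trig_fun (\<lambda>v. \<psi> (v, mat 1)) (trig_sq (trig_mult ((1, 0) # trig_scale (-1) P) D))) \<le> \<delta>"
  shows "cmod (trig_form \<psi> (w, A) D D) \<le> 3 * sqrt \<delta> + \<eta>"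
proof -
  define \<rho> where "\<rho> = (\<lambda>v. \<psi> (v, mat 1))"
  have pz: "pos_def_Zn \<rho>" unfolding \<rho>_def by (rule pos_def_Zn_restrict[OF pd])
  have r0: "0 \<le> Re (\<rho> 0)" "Re (\<rho> 0) \<le> 1"
    using trig_fun_sq_nonneg[OF pz, of "[(1,0)]"] one
    by (auto simp: \<rho>_def trig_fun_def trig_sq_def trig_mult_def trig_cnj_def)
  define pd' where "pd' = trig_mult P D"
  define rd where "rd = trig_mult ((1, 0) # trig_scale (-1) P) D"
  let ?N = "\<lambda>p. Re (trig_fun \<rho> (trig_sq p))"
  have cs: "cmod (trig_form \<psi> (w, A) p q) \<le> sqrt (?N p) * sqrt (?N q)" for p q
  proof -
    have "(cmod (trig_form \<psi> (w, A) p q))\<^sup>2 \<le> ?N p * ?N q"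
      using trig_form_cauchy_schwarz[OF pd, of "(w, A)" p q] A by (simp add: \<rho>_def trig_sq_def)
    then have "cmod (trig_form \<psi> (w, A) p q) \<le> sqrt (?N p * ?N q)"
      using real_le_rsqrt by blast
    then show ?thesis by (simp add: real_sqrt_mult)
  qed
  have N_le: "sqrt (?N p) \<le> M" if "\<And>\<theta>. cmod (trig_eval p \<theta>) \<le> M" "M \<ge> 0" for p M
  proof -
    have "?N p \<le> M\<^sup>2 * Re (\<rho> 0)" by (rule trig_fun_sq_le[OF pz that(1)])
    also have "\<dots> \<le> M\<^sup>2 * 1" using r0 by (intro mult_left_mono) auto
    finally show ?thesis using that(2) by (simp add: real_le_lsqrt)
  qed
  have ND: "sqrt (?N D) \<le> 1" by (rule N_le[OF D]) simp
  have Npd: "sqrt (?N pd') \<le> 2"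
  proof (rule N_le)
    fix \<theta> show "cmod (trig_eval pd' \<theta>) \<le> 2"
      using mult_mono[OF P D] by (simp add: pd'_def trig_eval_mult norm_mult)
  qed simp
  have Nrd: "sqrt (?N rd) \<le> sqrt \<delta>" using \<delta> by (simp add: rd_def \<rho>_def)
  have N0: "0 \<le> sqrt (?N p)" for p using trig_fun_sq_nonneg[OF pz] by simp
  have d0: "0 \<le> sqrt \<delta>" by (rule order_trans[OF N0 Nrd])
  have split: "trig_mult ((1, 0) # trig_scale (-1) P) D = D @ trig_scale (-1) pd'"
    by (simp add: trig_mult_def trig_scale_def pd'_def case_prod_unfold o_def map_concat)
  have e1: "trig_form \<psi> (w, A) rd D = trig_form \<psi> (w, A) D D - trig_form \<psi> (w, A) pd' D"
    unfolding rd_def split by (simp add: trig_form_append_left trig_form_scale_left)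
  have e2: "trig_form \<psi> (w, A) pd' rd = trig_form \<psi> (w, A) pd' D - trig_form \<psi> (w, A) pd' pd'"
    unfolding rd_def split by (simp add: trig_form_append_right trig_form_scale_right)
  have b1: "cmod (trig_form \<psi> (w, A) rd D) \<le> sqrt \<delta> * 1"
    by (rule order_trans[OF cs mult_mono[OF Nrd ND d0 N0]])
  have b2: "cmod (trig_form \<psi> (w, A) pd' rd) \<le> 2 * sqrt \<delta>"
    by (rule order_trans[OF cs mult_mono[OF Npd Nrd _ N0]]) simp
  have b3: "cmod (trig_form \<psi> (w, A) pd' pd') \<le> \<eta>"
  proof -
    let ?m = "trig_mult pd' (trig_cnj (trig_comp A pd'))"
    have "cmod (trig_eval ?m \<theta>) \<le> \<eta>" for \<theta>
    proof -
      have "cmod (trig_eval ?m \<theta>)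
         = cmod (trig_eval P \<theta> * trig_eval P (tmatvec A \<theta>)) * (cmod (trig_eval D \<theta>) * cmod (trig_eval D (tmatvec A \<theta>)))"
        by (simp add: pd'_def trig_eval_mult trig_eval_cnj trig_eval_comp norm_mult mult_ac)
      also have "\<dots> \<le> \<eta> * (1 * 1)"
        using D disj norm_ge_zero order_trans by (intro mult_mono) (auto intro: order_trans[OF norm_ge_zero disj])
      finally show ?thesis by simp
    qed
    moreover have "\<eta> \<ge> 0" using disj norm_ge_zero order_trans by blast
    ultimately have "sqrt (?N ?m) \<le> \<eta>" by (rule N_le)
    moreover have "sqrt (?N [(1, 0)]) \<le> 1" by (rule N_le) (auto simp: trig_eval_Cons)
    ultimately have "sqrt (?N [(1, 0)]) * sqrt (?N ?m) \<le> 1 * \<eta>"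
      using trig_fun_sq_nonneg[OF pz] by (intro mult_mono) auto
    then show ?thesis using cs[of "[(1, 0)]" ?m] unfolding trig_form_move[of \<psi> w A pd' pd'] by linarith
  qed
  \<comment> \<open>\<open>D\<close> is split as \<open>rd\<close> plus \<open>pd'\<close>, first on
    the left and then on the right; the three terms cost \<open>sqrt \<delta>\<close>,
    \<open>2 * sqrt \<delta>\<close> and \<open>\<eta>\<close>.\<close>
  have "trig_form \<psi> (w, A) D D = trig_form \<psi> (w, A) rd D + trig_form \<psi> (w, A) pd' rd + trig_form \<psi> (w, A) pd' pd'"
    using e1 e2 by simp
  also have "cmod \<dots> \<le> sqrt \<delta> * 1 + 2 * sqrt \<delta> + \<eta>"
    by (intro norm_triangle_le add_mono b1 b2 b3)
  finally show ?thesis by simp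
qed

section \<open>The dual torus and uniform approximation by trigonometric polynomials\<close>

definition torus :: "(complex ^ 'n) set" where
  "torus = {z. \<forall>i. cmod (z $ i) = 1}"

definition torus_point :: "real ^ 'n \<Rightarrow> complex ^ 'n" where
  "torus_point \<theta> = (\<chi> i. echar (\<theta> $ i))"

lemma compact_torus: "compact (torus :: (complex ^ 'n) set)"
proof -
  have "torus = (\<Inter>i. {z :: complex ^ 'n. cmod (z $ i) = 1})" by (auto simp: torus_def)
  also have "closed \<dots>" by (intro closed_INT ballI closed_Collect_eq continuous_intros)
  finally have "closed (torus :: (complex ^ 'n) set)" .
  moreover have "bounded (torus :: (complex ^ 'n) set)"
    unfolding bounded_iff
  proof (intro exI ballI)
    fix z :: "complex ^ 'n" assume z: "z \<in> torus"
    have "norm z \<le> (\<Sum>i\<in>UNIV. cmod (z $ i))" by (simp add: norm_vec_def L2_set_le_sum)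
    then show "norm z \<le> real CARD('n)" using z by (simp add: torus_def)
  qed
  ultimately show ?thesis by (simp add: compact_eq_bounded_closed)
qed

lemma torus_point_in_torus [simp]: "torus_point \<theta> \<in> torus"
  by (simp add: torus_def torus_point_def)

text \<open>Stone-Weierstrass: the real and imaginary parts of the coordinates are trigonometric
  polynomials and separate the points of the compact torus.\<close>

lemma trig_approximation:
  fixes f :: "complex ^ 'n \<Rightarrow> real"
  assumes "continuous_on torus f" "e > 0"
  obtains p where "\<And>\<theta>. trig_eval p \<theta> \<in> \<real>" "\<And>\<theta>. \<bar>f (torus_point \<theta>) - Re (trig_eval p \<theta>)\<bar> < e"
proof -
  let ?P = "\<lambda>f :: complex ^ 'n \<Rightarrow> real. continuous_on torus f \<and> (\<exists>p. \<forall>\<theta>. of_real (f (torus_point \<theta>)) = trig_eval p \<theta>)"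
  have ReIm: "?P (\<lambda>z. Re (z $ i))" "?P (\<lambda>z. Im (z $ i))" for i
  proof -
    have d: "dotp (axis i 1) \<theta> = \<theta> $ i" for \<theta> :: "real ^ 'n"
    proof -
      have "dotp (axis i 1) \<theta> = (\<Sum>j\<in>UNIV. if j = i then \<theta> $ j else 0)"
        unfolding dotp_def by (rule sum.cong) (auto simp: axis_def)
      then show ?thesis by simp
    qed
    have re: "of_real (Re (torus_point \<theta> $ i)) = trig_eval [(1/2, axis i 1), (1/2, - axis i 1)] \<theta>" for \<theta> :: "real ^ 'n"
      by (simp add: torus_point_def trig_eval_Cons d dotp_uminus echar_uminus complex_eq_iff)
    have im: "of_real (Im (torus_point \<theta> $ i)) = trig_eval [(-\<i>/2, axis i 1), (\<i>/2, - axis i 1)] \<theta>" for \<theta> :: "real ^ 'n"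
      by (simp add: torus_point_def trig_eval_Cons d dotp_uminus echar_uminus complex_eq_iff)
    show "?P (\<lambda>z. Re (z $ i))"
      by (intro conjI exI allI, (intro continuous_intros)[1], rule re)
    show "?P (\<lambda>z. Im (z $ i))"
      by (intro conjI exI allI, (intro continuous_intros)[1], rule im)
  qed
  have "\<exists>g. ?P g \<and> (\<forall>x\<in>torus. \<bar>f x - g x\<bar> < e)"
  proof (rule Stone_Weierstrass_HOL[where P = ?P])
    show "compact (torus :: (complex ^ 'n) set)" by (rule compact_torus)
    show "?P (\<lambda>x. c)" for c :: real
      by (auto intro!: exI[of _ "[(of_real c, 0)]"] simp: trig_eval_Cons)
    show "?P (\<lambda>x. f x + g x)" if fg: "?P f \<and> ?P g" for f g
    proof -
      obtain p q where "\<forall>\<theta>. of_real (f (torus_point \<theta>)) = trig_eval p \<theta>" "\<forall>\<theta>. of_real (g (torus_point \<theta>)) = trig_eval q \<theta>"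
        using fg by blast
      then show ?thesis using fg
        by (auto intro!: exI[of _ "p @ q"] continuous_intros simp: trig_eval_append)
    qed
    show "?P (\<lambda>x. f x * g x)" if fg: "?P f \<and> ?P g" for f g
    proof -
      obtain p q where "\<forall>\<theta>. of_real (f (torus_point \<theta>)) = trig_eval p \<theta>" "\<forall>\<theta>. of_real (g (torus_point \<theta>)) = trig_eval q \<theta>"
        using fg by blast
      then show ?thesis using fg
        by (auto intro!: exI[of _ "trig_mult p q"] continuous_intros simp: trig_eval_mult)
    qed
    show "\<exists>f. ?P f \<and> f x \<noteq> f y" if xy: "x \<in> torus \<and> y \<in> torus \<and> x \<noteq> y" for x y
    proof -
      obtain i where "x $ i \<noteq> y $ i" using xy by (auto simp: vec_eq_iff)
      then consider "Re (x $ i) \<noteq> Re (y $ i)" | "Im (x $ i) \<noteq> Im (y $ i)" by (auto simp: complex_eq_iff)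
      then show ?thesis
      proof cases
        case 1 then show ?thesis using ReIm(1)[of i] by (intro exI[of _ "\<lambda>z. Re (z $ i)"]) simp
      next
        case 2 then show ?thesis using ReIm(2)[of i] by (intro exI[of _ "\<lambda>z. Im (z $ i)"]) simp
      qed
    qed
  qed (use assms in auto)
  then obtain g p where g: "\<forall>x\<in>torus. \<bar>f x - g x\<bar> < e" and p: "\<forall>\<theta>. of_real (g (torus_point \<theta>)) = trig_eval p \<theta>"
    by blast
  show ?thesis
  proof (rule that[of p])
    show "trig_eval p \<theta> \<in> \<real>" for \<theta> by (metis p Reals_of_real)
    show "\<bar>f (torus_point \<theta>) - Re (trig_eval p \<theta>)\<bar> < e" for \<theta>
      using g p[rule_format, of \<theta>, symmetric] by simp
  qed
qed

text \<open>For \<open>N > 0\<close> this equals one where \<open>dotp b \<theta>\<close> is an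
  integer and is of order \<open>1 / N\<close> away from there. On the group side it averages over
  translations by multiples of \<open>b\<close>.\<close>

definition dirichlet :: "nat \<Rightarrow> int ^ 'n \<Rightarrow> (complex \<times> (int ^ 'n)) list" where
  "dirichlet N b = map (\<lambda>k. (1 / of_nat N, int k *s b)) [0..<N]"

lemma dotp_smult: "dotp (c *s b) \<theta> = of_int c * dotp b \<theta>"
  by (simp add: dotp_def sum_distrib_left mult_ac)

lemma trig_eval_dirichlet:
  "trig_eval (dirichlet N b) \<theta> = (\<Sum>k<N. echar (dotp b \<theta>) ^ k) / of_nat N"
proof -
  have "trig_eval (dirichlet N b) \<theta> = (\<Sum>k\<leftarrow>[0..<N]. echar (dotp b \<theta>) ^ k / of_nat N)"
    by (simp add: trig_eval_def dirichlet_def o_def dotp_smult echar_mult_nat)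
  then show ?thesis by (simp add: interv_sum_list_conv_sum_set_nat sum_divide_distrib atLeast0LessThan)
qed

lemma norm_dirichlet_le_1: "cmod (trig_eval (dirichlet N b) \<theta>) \<le> 1"
proof -
  have "cmod (\<Sum>k<N. echar (dotp b \<theta>) ^ k) \<le> (\<Sum>k<N. 1)"
    by (rule sum_norm_le) (simp add: norm_power)
  then show ?thesis by (auto simp: trig_eval_dirichlet norm_divide divide_le_eq)
qed

lemma norm_dirichlet_far:
  assumes "cmod (1 - echar (dotp b \<theta>)) \<ge> e" "e > 0" "N > 0"
  shows "cmod (trig_eval (dirichlet N b) \<theta>) \<le> 2 / (e * real N)"
proof -
  let ?z = "echar (dotp b \<theta>)"
  have z: "?z \<noteq> 1" using assms by auto
  have "cmod (\<Sum>k<N. ?z ^ k) = cmod (?z ^ N - 1) / cmod (?z - 1)"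
    using z by (simp add: geometric_sum norm_divide)
  also have "\<dots> \<le> 2 / e"
  proof (rule frac_le)
    show "cmod (?z ^ N - 1) \<le> 2" using norm_triangle_ineq4[of "?z ^ N" 1] by (simp add: norm_power)
    show "e \<le> cmod (?z - 1)" using assms(1) by (simp add: norm_minus_commute)
  qed (use assms in auto)
  finally have "cmod (\<Sum>k<N. ?z ^ k) / real N \<le> 2 / e / real N"
    by (rule divide_right_mono) simp
  then show ?thesis by (simp add: trig_eval_dirichlet norm_divide)
qed

lemma trig_fun_mult:
  "trig_fun \<rho> (trig_mult p q) = (\<Sum>(c, v)\<leftarrow>p. \<Sum>(d, u)\<leftarrow>q. c * d * \<rho> (v + u))"
proof (induction p)
  case (Cons x p)
  have "trig_fun \<rho> (map (\<lambda>(d, u). (fst x * d, snd x + u)) q)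
      = (\<Sum>(d, u)\<leftarrow>q. fst x * d * \<rho> (snd x + u))"
    by (simp add: trig_fun_def case_prod_unfold o_def)
  with Cons show ?case
    by (simp add: trig_mult_def trig_fun_append case_prod_unfold)
qed (simp add: trig_mult_def)

text \<open>Wiener's argument that the subgroup of the torus where \<open>dotp b \<theta>\<close> is
  an integer carries no mass. The functional is the average of \<open>\<rho>\<close> over the
  differences \<open>(k - l) b\<close>, and few pairs \<open>(k, l)\<close> hit the finite set where
  \<open>\<rho>\<close> is large.\<close>

lemma trig_fun_dirichlet_tendsto:
  fixes \<rho> :: "int ^ 'n \<Rightarrow> complex"
  assumes lim: "\<And>e. e > 0 ==> finite {v. cmod (\<rho> v) \<ge> e}" and b: "b \<noteq> 0" and e: "e > 0"
  shows "\<exists>N>0. cmod (trig_fun \<rho> (trig_sq (dirichlet N b))) < e"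
proof -
  have inj: "inj (\<lambda>k::int. k *s b)"
  proof (rule injI)
    fix k l :: int assume kl: "k *s b = l *s b"
    obtain i where "b $ i \<noteq> 0" using b by (auto simp: vec_eq_iff)
    then show "k = l" using arg_cong[OF kl, of "\<lambda>v. v $ i"] by simp
  qed
  define K where "K = {k::int. cmod (\<rho> (k *s b)) \<ge> e / 2}"
  have "K = (\<lambda>k. k *s b) -` {v. cmod (\<rho> v) \<ge> e / 2}" by (auto simp: K_def)
  then have fin: "finite K" by (simp only:) (rule finite_vimageI[OF lim inj], use e in simp)
  obtain B where B: "\<And>k. k \<in> K ==> cmod (\<rho> (k *s b)) \<le> B" "B \<ge> 0"
  proof -
    have "finite ((\<lambda>k. cmod (\<rho> (k *s b))) ` K)" using fin by simp
    then show ?thesis by (intro that[of "Max (insert 0 ((\<lambda>k. cmod (\<rho> (k *s b))) ` K))"]) auto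
  qed
  obtain N where N: "real N > 2 * (real (card K) * B) / e" "N > 0"
  proof -
    obtain N where "real N > max (2 * (real (card K) * B) / e) 0" using reals_Archimedean2 by blast
    then show ?thesis using that by auto
  qed
  let ?f = "\<lambda>k l. cmod (\<rho> ((int k - int l) *s b))"
  have eq: "trig_fun \<rho> (trig_sq (dirichlet N b))
     = (\<Sum>k<N. \<Sum>l<N. \<rho> ((int k - int l) *s b)) / (of_nat N)\<^sup>2"
  proof -
    have "trig_fun \<rho> (trig_sq (dirichlet N b))
       = (\<Sum>k\<leftarrow>[0..<N]. \<Sum>l\<leftarrow>[0..<N]. \<rho> ((int k - int l) *s b) / (of_nat N)\<^sup>2)"
      by (simp add: trig_sq_def trig_fun_mult trig_cnj_def dirichlet_def o_def
          vector_sub_rdistrib power2_eq_square)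
    then show ?thesis by (simp add: interv_sum_list_conv_sum_set_nat sum_divide_distrib atLeast0LessThan)
  qed
  \<comment> \<open>For fixed \<open>k\<close> each element of \<open>K\<close> is the difference
    for at most one \<open>l\<close>.\<close>
  have row: "(\<Sum>l<N. ?f k l) \<le> real N * (e / 2) + real (card K) * B" for k
  proof -
    have "(\<Sum>l<N. ?f k l) \<le> (\<Sum>l<N. e / 2 + (if int k - int l \<in> K then B else 0))"
    proof (rule sum_mono)
      fix l
      show "?f k l \<le> e / 2 + (if int k - int l \<in> K then B else 0)"
        using B(1)[of "int k - int l"] B(2) e by (cases "int k - int l \<in> K") (simp_all add: K_def)
    qed
    also have "\<dots> = real N * (e / 2) + real (card {l. l < N \<and> int k - int l \<in> K}) * B"
      by (simp add: sum.distrib sum.If_cases Int_def lessThan_def)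
    also have "card {l. l < N \<and> int k - int l \<in> K} \<le> card K"
      by (rule card_inj_on_le[where f = "\<lambda>l. int k - int l"]) (auto simp: inj_on_def fin)
    finally show ?thesis using B(2) by (simp add: mult_right_mono)
  qed
  have "cmod (trig_fun \<rho> (trig_sq (dirichlet N b))) \<le> (\<Sum>k<N. \<Sum>l<N. ?f k l) / (real N)\<^sup>2"
    unfolding eq norm_divide by (intro divide_mono sum_norm_le) (auto simp: norm_power norm_sum N intro!: sum_norm_le)
  also have "\<dots> \<le> (\<Sum>k<N. real N * (e / 2) + real (card K) * B) / (real N)\<^sup>2"
    by (intro divide_right_mono sum_mono row) auto
  also have "\<dots> = e / 2 + real (card K) * B / real N"
    using N(2) by (simp add: field_simps power2_eq_square)
  also have "\<dots> < e" using N e by (simp add: field_simps)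
  finally show ?thesis using N(2) by blast
qed

subsection \<open>Conjugates in general position\<close>

lemma dotp_inner: "dotp b x = (\<chi> i. real_of_int (b $ i)) \<bullet> x"
  by (simp add: dotp_def inner_vec_def)

lemma dotp_right_add: "dotp b (x + y) = dotp b x + dotp b y"
  by (simp add: dotp_inner inner_add_right)

lemma dotp_right_scaleR: "dotp b (c *\<^sub>R x) = c * dotp b x"
  by (simp add: dotp_inner)

lemma dotp_right_diff: "dotp b (x - y) = dotp b x - dotp b y"
  by (simp add: dotp_inner inner_diff_right)

lemma continuous_on_dotp [continuous_intros]:
  "continuous_on S f ==> continuous_on S (\<lambda>x. dotp b (f x))"
  unfolding dotp_inner by (intro continuous_intros)

text \<open>On the unit sphere no \<open>R + 1\<close> of the functionals vanish together, so by
  compactness the sum of their absolute values has a positive minimum for each such choice.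
  Homogeneity extends the bound to all \<open>x\<close>.\<close>

lemma general_position_quantitative:
  fixes b :: "'j \<Rightarrow> int ^ 'n"
  assumes fin: "finite J" and gp: "\<And>x. x \<noteq> 0 ==> card {j\<in>J. dotp (b j) x = 0} \<le> R"
  obtains \<delta> where "\<delta> > 0" "\<And>x. x \<noteq> 0 ==> card {j\<in>J. \<bar>dotp (b j) x\<bar> < \<delta> * norm x} \<le> R"
proof -
  let ?Sub = "{S. S \<subseteq> J \<and> card S = Suc R}"
  have "\<exists>m>0. \<forall>x\<in>sphere 0 1. m \<le> (\<Sum>j\<in>S. \<bar>dotp (b j) x\<bar>)" if S: "S \<in> ?Sub" for S
  proof -
    have cont: "continuous_on (sphere 0 1) (\<lambda>x. \<Sum>j\<in>S. \<bar>dotp (b j) x\<bar>)"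
      by (intro continuous_intros)
    have "sphere (0 :: real ^ 'n) 1 \<noteq> {}" by simp
    from continuous_attains_inf[OF compact_sphere this cont]
    obtain x0 where x0: "x0 \<in> sphere (0 :: real ^ 'n) 1"
      "\<And>x. x \<in> sphere 0 1 ==> (\<Sum>j\<in>S. \<bar>dotp (b j) x0\<bar>) \<le> (\<Sum>j\<in>S. \<bar>dotp (b j) x\<bar>)" by blast
    have "(\<Sum>j\<in>S. \<bar>dotp (b j) x0\<bar>) \<noteq> 0"
    proof
      assume z: "(\<Sum>j\<in>S. \<bar>dotp (b j) x0\<bar>) = 0"
      have finS: "finite S" using S fin finite_subset by auto
      have "\<And>j. j \<in> S ==> dotp (b j) x0 = 0"
        using z by (simp add: sum_nonneg_eq_0_iff[OF finS])
      then have "S \<subseteq> {j\<in>J. dotp (b j) x0 = 0}" using S by auto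
      then have "card S \<le> card {j\<in>J. dotp (b j) x0 = 0}" using fin by (intro card_mono) auto
      also have "\<dots> \<le> R" using x0(1) by (intro gp) auto
      finally show False using S by simp
    qed
    then have "0 < (\<Sum>j\<in>S. \<bar>dotp (b j) x0\<bar>)" by (simp add: order_less_le sum_nonneg)
    then show ?thesis using x0(2) by (intro exI[of _ "\<Sum>j\<in>S. \<bar>dotp (b j) x0\<bar>"]) auto
  qed
  then have "\<forall>S\<in>?Sub. \<exists>m>0. \<forall>x\<in>sphere 0 1. m \<le> (\<Sum>j\<in>S. \<bar>dotp (b j) x\<bar>)" by (rule ballI)
  from bchoice[OF this] obtain m where ms:
    "\<forall>S\<in>?Sub. m S > 0 \<and> (\<forall>x\<in>sphere 0 1. m S \<le> (\<Sum>j\<in>S. \<bar>dotp (b j) x\<bar>))" ..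
  have m: "m S > 0" "\<And>x. x \<in> sphere 0 1 ==> m S \<le> (\<Sum>j\<in>S. \<bar>dotp (b j) x\<bar>)"
    if "S \<in> ?Sub" for S
    using bspec[OF ms that] by auto
  have finSub: "finite ?Sub" using fin by auto
  \<comment> \<open>The inserted one covers families with fewer than \<open>R + 1\<close>
    members.\<close>
  define m0 where "m0 = Min (insert 1 (m ` ?Sub))"
  have finm: "finite (insert 1 (m ` ?Sub))" using finSub by (intro finite.insertI finite_imageI)
  have m0: "m0 > 0" using m(1) unfolding m0_def by (subst Min_gr_iff[OF finm]) auto
  have m0': "m0 \<le> m S" if "S \<in> ?Sub" for S
    unfolding m0_def by (rule Min_le[OF finm]) (use that in blast)
  \<comment> \<open>\<open>R + 1\<close> values below \<open>\<delta>\<close> would add up to less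
    than \<open>m0\<close>.\<close>
  define \<delta> where "\<delta> = m0 / real (Suc R)"
  have "card {j\<in>J. \<bar>dotp (b j) x\<bar> < \<delta> * norm x} \<le> R" if x: "x \<noteq> 0" for x
  proof (rule ccontr)
    assume "\<not> ?thesis"
    then have "Suc R \<le> card {j\<in>J. \<bar>dotp (b j) x\<bar> < \<delta> * norm x}" by simp
    then obtain S where S: "S \<subseteq> {j\<in>J. \<bar>dotp (b j) x\<bar> < \<delta> * norm x}" "card S = Suc R"
      by (meson obtain_subset_with_card_n)
    then have SS: "S \<in> ?Sub" by auto
    have finS: "finite S" "S \<noteq> {}" using S(2) by (auto intro: card_ge_0_finite)
    have "norm x > 0" using x by simp
    have "m0 \<le> (\<Sum>j\<in>S. \<bar>dotp (b j) (x /\<^sub>R norm x)\<bar>)"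
      by (rule order_trans[OF m0'[OF SS] m(2)[OF SS]]) (use x in simp)
    also have "\<dots> < (\<Sum>j\<in>S. \<delta>)"
    proof (rule sum_strict_mono[OF finS])
      fix j assume "j \<in> S"
      then have "\<bar>dotp (b j) x\<bar> < \<delta> * norm x" using S by auto
      then show "\<bar>dotp (b j) (x /\<^sub>R norm x)\<bar> < \<delta>"
        using \<open>norm x > 0\<close> by (simp add: dotp_right_scaleR abs_mult field_simps)
    qed
    also have "\<dots> = m0" using S(2) by (simp add: \<delta>_def)
    finally show False by simp
  qed
  then show ?thesis using that[of \<delta>] m0 by (simp add: \<delta>_def)
qed

lemma echar_near_one:
  assumes "\<eta> > 0"
  obtains e where "e > 0" "\<And>t. cmod (1 - echar t) < e ==> \<bar>t - of_int (round t)\<bar> < \<eta>"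
proof -
  let ?K = "{s::real. \<eta> \<le> \<bar>s\<bar> \<and> \<bar>s\<bar> \<le> 1/2}"
  have nz: "cmod (1 - echar s) > 0" if "s \<in> ?K" for s
  proof -
    have "echar s \<noteq> 1"
    proof
      assume "echar s = 1"
      then obtain n :: int where "2 * pi * s = 2 * real_of_int n * pi"
        unfolding echar_def cis_conv_exp exp_eq_1 by auto
      then have "s = of_int n" using pi_gt_zero by simp
      then show False using that assms by (cases "n = 0") auto
    qed
    then show ?thesis by simp
  qed
  have e: "\<exists>e>0. \<forall>s\<in>?K. e \<le> cmod (1 - echar s)"
  proof (cases "?K = {}")
    case True then show ?thesis by (intro exI[of _ 1]) auto
  next
    case False
    have "?K = cball 0 (1/2) \<inter> {s. \<eta> \<le> \<bar>s\<bar>}" by (auto simp: dist_real_def)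
    moreover have "closed {s::real. \<eta> \<le> \<bar>s\<bar>}" by (intro closed_Collect_le continuous_intros)
    ultimately have "compact ?K" by (simp add: compact_Int_closed)
    moreover have "continuous_on ?K (\<lambda>s. cmod (1 - echar s))"
      unfolding echar_def by (intro continuous_intros)
    ultimately obtain s0 where "s0 \<in> ?K" "\<forall>s\<in>?K. cmod (1 - echar s0) \<le> cmod (1 - echar s)"
      using continuous_attains_inf[of ?K] False by blast
    then show ?thesis using nz by blast
  qed
  then obtain e where e: "e > 0" "\<And>s. s \<in> ?K ==> e \<le> cmod (1 - echar s)" by blast
  show ?thesis
  proof (rule that[OF e(1)])
    fix t assume t: "cmod (1 - echar t) < e"
    let ?s = "t - of_int (round t)"
    have "echar ?s = echar t" by (simp add: echar_diff)
    then have "?s \<notin> ?K" using e(2)[of ?s] t by auto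
    moreover have "\<bar>?s\<bar> \<le> 1/2" using of_int_round_abs_le[of t] by (simp add: abs_minus_commute)
    ultimately show "\<bar>?s\<bar> < \<eta>" by auto
  qed
qed

lemma dirichlet_simultaneous_vec:
  fixes \<theta> :: "real ^ 'n" assumes "N > 0"
  obtains q :: nat and z :: "int ^ 'n" where "0 < q" "q \<le> N ^ CARD('n)"
    "\<And>i. \<bar>real q * \<theta> $ i - of_int (z $ i)\<bar> < 1 / real N"
proof -
  obtain e where e: "bij_betw e {0..<CARD('n)} (UNIV :: 'n set)"
    using ex_bij_betw_nat_finite[of "UNIV :: 'n set"] by auto
  obtain q p where qp: "0 < q" "q \<le> int (N ^ CARD('n))"
    "\<And>i. i < CARD('n) ==> \<bar>of_int q * \<theta> $ e i - of_int (p i)\<bar> < 1 / real N"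
    using Dirichlet_approx_simult[OF assms, of "CARD('n)" "\<lambda>i. \<theta> $ e i"] by blast
  define f where "f = inv_into {0..<CARD('n)} e"
  have f: "e (f i) = i" "f i < CARD('n)" for i
    using bij_betw_inv_into_right[OF e, of i] bij_betwE[OF bij_betw_inv_into[OF e]] by (auto simp: f_def)
  show ?thesis
  proof (rule that[of "nat q" "\<chi> i. p (f i)"])
    show "\<bar>real (nat q) * \<theta> $ i - of_int ((\<chi> i. p (f i)) $ i)\<bar> < 1 / real N" for i
      using qp(3)[OF f(2)[of i]] qp(1) by (simp add: f)
    show "nat q \<le> N ^ CARD('n)" using qp(2) by (subst nat_le_iff) simp
  qed (use qp(1) in simp)
qed

text \<open>Dirichlet approximation writes \<open>q \<theta>\<close> as an integer vector plus a
  small error \<open>x\<close>. If \<open>dotp (b j) \<theta>\<close> is nearly an integer, then so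
  is \<open>dotp (b j) x\<close>, and being small it is nearly zero. When this happens for more than
  \<open>R\<close> indices, general position forces \<open>x\<close> to be tiny.\<close>

lemma near_torsion:
  fixes b :: "'j \<Rightarrow> int ^ 'n"
  assumes fin: "finite J" and gp: "\<And>x. x \<noteq> 0 ==> card {j\<in>J. dotp (b j) x = 0} \<le> R"
  obtains d :: nat where "d > 0"
    "\<And>r. r > 0 ==> \<exists>e>0. \<forall>\<theta>. card {j\<in>J. cmod (1 - echar (dotp (b j) \<theta>)) < e} > R
       \<longrightarrow> (\<exists>z x. real d *\<^sub>R \<theta> = ivec z + x \<and> norm x < r)"
proof -
  obtain \<delta> where \<delta>: "\<delta> > 0" "\<And>x. x \<noteq> 0 ==> card {j\<in>J. \<bar>dotp (b j) x\<bar> < \<delta> * norm x} \<le> R"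
    using general_position_quantitative[OF fin gp] by blast
  define B where "B = Max (insert 1 ((\<lambda>j. norm (\<chi> i. real_of_int (b j $ i))) ` J))"
  have B: "B \<ge> 1" "\<And>j. j \<in> J ==> norm (\<chi> i. real_of_int (b j $ i)) \<le> B"
    using fin by (auto simp: B_def)
  have bound: "\<bar>dotp (b j) x\<bar> \<le> B * norm x" if "j \<in> J" for j x
    unfolding dotp_inner using Cauchy_Schwarz_ineq2 B(2)[OF that]
    by (meson mult_right_mono norm_ge_zero order_trans)
  \<comment> \<open>This makes \<open>\<bar>dotp (b j) x\<bar> < 1 / 4\<close> for every Dirichlet
    error \<open>x\<close>, so the integer that it is close to must be zero.\<close>
  obtain N :: nat where N: "real N > 4 * B * real CARD('n)" using reals_Archimedean2 by blast
  then have "real N > 0" using B(1) by (smt (verit) mult_nonneg_nonneg of_nat_0_le_iff)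
  then have N0: "N > 0" by simp
  define Q where "Q = N ^ CARD('n)"
  have Q: "Q > 0" using N0 by (simp add: Q_def)
  show ?thesis
  \<comment> \<open>Every denominator \<open>q \<le> Q\<close> divides \<open>fact Q\<close>, so one
    \<open>d\<close> serves all points and all radii \<open>r\<close>.\<close>
  proof (rule that[of "fact Q"])
    fix r :: real assume r: "r > 0"
    \<comment> \<open>The first bound gives \<open>Q * \<eta> \<le> 1 / 4\<close>, which keeps the
      nearest integer unique; the second makes the final error at most \<open>r / 2\<close>.\<close>
    define \<eta> where "\<eta> = min (1 / (4 * real Q)) (r * \<delta> / (2 * real Q * fact Q))"
    have \<eta>: "\<eta> > 0" using Q r \<delta>(1) by (simp add: \<eta>_def)
    obtain e where e: "e > 0" "\<And>t. cmod (1 - echar t) < e ==> \<bar>t - of_int (round t)\<bar> < \<eta>"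
      using echar_near_one[OF \<eta>] by blast
    show "\<exists>e>0. \<forall>\<theta>. card {j\<in>J. cmod (1 - echar (dotp (b j) \<theta>)) < e} > R
       \<longrightarrow> (\<exists>z x. real (fact Q) *\<^sub>R \<theta> = ivec z + x \<and> norm x < r)"
    proof (intro exI[of _ e] conjI e(1) allI impI)
      fix \<theta> :: "real ^ 'n" assume many: "card {j\<in>J. cmod (1 - echar (dotp (b j) \<theta>)) < e} > R"
      obtain q z where q: "0 < q" "q \<le> Q" and z: "\<And>i. \<bar>real q * \<theta> $ i - of_int (z $ i)\<bar> < 1 / real N"
        using dirichlet_simultaneous_vec[OF N0, of \<theta>] unfolding Q_def by metis
      define x where "x = real q *\<^sub>R \<theta> - (ivec z)"
      have "norm x \<le> (\<Sum>i\<in>UNIV. \<bar>x $ i\<bar>)" by (rule norm_le_l1_cart)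
      also have "\<dots> \<le> (\<Sum>i\<in>(UNIV :: 'n set). 1 / real N)"
        using z by (intro sum_mono) (simp add: x_def less_imp_le)
      also have "\<dots> = real CARD('n) / real N" by simp
      finally have nx: "norm x \<le> real CARD('n) / real N" .
      have Bx: "B * norm x < 1 / 4"
      proof -
        have "B * norm x \<le> B * (real CARD('n) / real N)" using nx B(1) by (intro mult_left_mono) auto
        also have "\<dots> < 1 / 4" using N N0 by (simp add: field_simps)
        finally show ?thesis .
      qed
      have small: "\<bar>dotp (b j) x\<bar> < real Q * \<eta>"
        if j: "j \<in> J" "cmod (1 - echar (dotp (b j) \<theta>)) < e" for j
      proof -
        let ?t = "dotp (b j) \<theta>"
        have "dotp (b j) (\<chi> i. real_of_int (z $ i)) = of_int (\<Sum>i\<in>UNIV. b j $ i * z $ i)"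
          by (simp add: dotp_def)
        then obtain k :: int where k: "dotp (b j) (\<chi> i. real_of_int (z $ i)) = of_int k" by blast
        have tt: "\<bar>?t - of_int (round ?t)\<bar> < \<eta>" by (rule e(2)[OF j(2)])
        have dx: "dotp (b j) x = real q * ?t - of_int k"
          by (simp add: x_def dotp_right_diff dotp_right_scaleR k)
        have "dotp (b j) x - of_int (int q * round ?t - k) = real q * (?t - of_int (round ?t))"
          by (simp add: dx algebra_simps)
        then have "\<bar>dotp (b j) x - of_int (int q * round ?t - k)\<bar> = real q * \<bar>?t - of_int (round ?t)\<bar>"
          by (simp add: abs_mult)
        also have "\<dots> < real Q * \<eta>"
          using tt q Q by (intro mult_le_less_imp_less) auto
        finally have 1: "\<bar>dotp (b j) x - of_int (int q * round ?t - k)\<bar> < real Q * \<eta>" .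
        have "real Q * \<eta> \<le> real Q * (1 / (4 * real Q))" by (intro mult_left_mono) (auto simp: \<eta>_def)
        then have "real Q * \<eta> \<le> 1 / 4" using Q by simp
        moreover have "\<bar>dotp (b j) x\<bar> < 1 / 4" using bound[OF j(1), of x] Bx by linarith
        ultimately have "\<bar>real_of_int (int q * round ?t - k)\<bar> < 1" using 1 by linarith
        then have "int q * round ?t - k = 0" by linarith
        then show ?thesis using 1 by simp
      qed
      have "norm x * \<delta> \<le> real Q * \<eta>"
      proof (cases "x = 0")
        case False
        have "\<not> {j\<in>J. cmod (1 - echar (dotp (b j) \<theta>)) < e} \<subseteq> {j\<in>J. \<bar>dotp (b j) x\<bar> < \<delta> * norm x}"
        proof
          assume "{j\<in>J. cmod (1 - echar (dotp (b j) \<theta>)) < e} \<subseteq> {j\<in>J. \<bar>dotp (b j) x\<bar> < \<delta> * norm x}"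
          then have "card {j\<in>J. cmod (1 - echar (dotp (b j) \<theta>)) < e} \<le> card {j\<in>J. \<bar>dotp (b j) x\<bar> < \<delta> * norm x}"
            using fin by (intro card_mono) auto
          then show False using many \<delta>(2)[OF False] by simp
        qed
        then obtain j where "j \<in> J" "cmod (1 - echar (dotp (b j) \<theta>)) < e" "\<delta> * norm x \<le> \<bar>dotp (b j) x\<bar>"
          by force
        then show ?thesis using small[of j] by (simp add: mult.commute)
      qed (use \<eta> in simp)
      then have nx2: "norm x \<le> real Q * \<eta> / \<delta>" using \<delta>(1) by (simp add: field_simps)
      obtain c :: nat where c: "fact Q = c * q" using q by (metis dvd_fact dvd_def mult.commute less_eq_Suc_le One_nat_def)
      have "c \<le> fact Q" using c q by simp
      then have cF: "real c \<le> real (fact Q)" by (simp only: of_nat_le_iff)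
      show "\<exists>z x. real (fact Q) *\<^sub>R \<theta> = ivec z + x \<and> norm x < r"
      proof (intro exI conjI)
        show "real (fact Q) *\<^sub>R \<theta> = (\<chi> i. of_int ((int c *s z) $ i)) + real c *\<^sub>R x"
          by (simp add: c x_def vec_eq_iff algebra_simps)
        have "norm (real c *\<^sub>R x) = real c * norm x" by simp
        also have "\<dots> \<le> real (fact Q) * (real Q * \<eta> / \<delta>)"
          by (intro mult_mono cF nx2) auto
        also have "\<dots> \<le> real (fact Q) * (real Q * (r * \<delta> / (2 * real Q * fact Q)) / \<delta>)"
          using \<delta>(1) by (intro mult_left_mono divide_right_mono) (auto simp: \<eta>_def)
        also have "\<dots> = r / 2" using \<delta>(1) Q by simp
        finally show "norm (real c *\<^sub>R x) < r" using r by simp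
      qed
    qed
  qed simp
qed

section \<open>Transvections and the displacement of cones\<close>

definition transvection :: "int \<Rightarrow> int ^ 'n \<Rightarrow> int ^ 'n \<Rightarrow> int ^ 'n ^ 'n" where
  "transvection m \<phi> a = (\<chi> p q. (if p = q then 1 else 0) + m * (\<phi> $ p * a $ q))"

lemma transvection_mult_vec:
  "transvection m \<phi> a *v x = x + (m * (\<Sum>q\<in>UNIV. a $ q * x $ q)) *s \<phi>"
proof -
  have "(transvection m \<phi> a *v x) $ p = x $ p + (m * (\<Sum>q\<in>UNIV. a $ q * x $ q)) * \<phi> $ p" for p
  proof -
    have "(transvection m \<phi> a *v x) $ p = (\<Sum>q\<in>UNIV. (if p = q then x $ q else 0) + m * \<phi> $ p * (a $ q * x $ q))"
      unfolding matrix_vector_mult_def transvection_def by (simp, rule sum.cong) (auto simp: algebra_simps)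
    then show ?thesis by (simp add: sum.distrib sum_distrib_left[symmetric] mult_ac)
  qed
  then show ?thesis by (simp add: vec_eq_iff)
qed

lemma matrix_eq_iff_vec: "(A :: int ^ 'n ^ 'n) = B \<longleftrightarrow> (\<forall>x. A *v x = B *v x)"
  by (metis matrix_eq)

lemma transvection_mult:
  assumes "(\<Sum>q\<in>UNIV. a $ q * \<phi> $ q) = 0"
  shows "transvection m \<phi> a ** transvection m' \<phi> a = transvection (m + m') \<phi> a"
proof (subst matrix_eq_iff_vec, intro allI)
  fix x
  have gen: "(\<Sum>q\<in>UNIV. a $ q * (x $ q + c * \<phi> $ q)) = (\<Sum>q\<in>UNIV. a $ q * x $ q)" for c
  proof -
    have "(\<Sum>q\<in>UNIV. a $ q * (x $ q + c * \<phi> $ q))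
        = (\<Sum>q\<in>UNIV. a $ q * x $ q) + c * (\<Sum>q\<in>UNIV. a $ q * \<phi> $ q)"
      by (simp add: algebra_simps sum.distrib sum_distrib_left)
    then show ?thesis using assms by simp
  qed
  show "transvection m \<phi> a ** transvection m' \<phi> a *v x = transvection (m + m') \<phi> a *v x"
    by (simp add: matrix_vector_mul_assoc[symmetric] transvection_mult_vec gen vec_eq_iff distrib_right)
qed

lemma transvection_0 [simp]: "transvection 0 \<phi> a = mat 1"
  by (simp add: transvection_def mat_def vec_eq_iff)

text \<open>The determinant is an integral unit, and doubling \<open>m\<close> squares it.\<close>

lemma det_transvection_even:
  assumes "(\<Sum>q\<in>UNIV. a $ q * \<phi> $ q) = 0"
  shows "det (transvection (2 * m) \<phi> a) = 1"
proof -
  have "det (transvection m \<phi> a) * det (transvection (- m) \<phi> a) = 1"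
    by (simp add: det_mul[symmetric] transvection_mult[OF assms])
  then have "det (transvection m \<phi> a) = 1 \<or> det (transvection m \<phi> a) = - 1"
    using zmult_eq_1_iff by blast
  then have "det (transvection m \<phi> a) * det (transvection m \<phi> a) = 1"
    by auto
  then show ?thesis
    unfolding det_mul[symmetric] transvection_mult[OF assms] mult_2 .
qed

lemma tmatvec_mult: "tmatvec (A ** B) x = tmatvec B (tmatvec A x)"
proof -
  have "(\<Sum>i\<in>UNIV. (\<Sum>k\<in>UNIV. of_int (A $ i $ k) * of_int (B $ k $ j)) * x $ i)
     = (\<Sum>k\<in>UNIV. of_int (B $ k $ j) * (\<Sum>i\<in>UNIV. of_int (A $ i $ k) * x $ i))" for j
  proof -
    have "(\<Sum>i\<in>UNIV. (\<Sum>k\<in>UNIV. of_int (A $ i $ k) * of_int (B $ k $ j)) * x $ i)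
       = (\<Sum>i\<in>UNIV. \<Sum>k\<in>UNIV. of_int (B $ k $ j) * (of_int (A $ i $ k) * x $ i))"
      by (simp add: sum_distrib_left mult_ac)
    also have "\<dots> = (\<Sum>k\<in>UNIV. \<Sum>i\<in>UNIV. of_int (B $ k $ j) * (of_int (A $ i $ k) * x $ i))"
      by (rule sum.swap)
    finally show ?thesis by (simp add: sum_distrib_left)
  qed
  then show ?thesis by (simp add: tmatvec_def vec_eq_iff matrix_matrix_mult_def)
qed

lemma tmatvec_mat_1 [simp]: "tmatvec (mat 1) x = x"
proof -
  have "(\<Sum>i\<in>UNIV. of_int ((mat 1 :: int ^ 'a ^ 'a) $ i $ j) * x $ i) = (\<Sum>i\<in>UNIV. if i = j then x $ i else 0)" for j
    by (rule sum.cong) (auto simp: mat_def)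
  then show ?thesis by (simp add: tmatvec_def vec_eq_iff)
qed

lemma tmatvec_linear: "linear (tmatvec A)"
  by (rule linearI) (auto simp: tmatvec_def vec_eq_iff algebra_simps sum.distrib sum_distrib_left)

text \<open>Transposition exchanges the roles of the two vectors: on the torus the shear is measured
  by \<open>\<phi>\<close> and moves points along \<open>a\<close>.\<close>

lemma tmatvec_transvection:
  "tmatvec (transvection m \<phi> a) x = x + (of_int m * dotp \<phi> x) *\<^sub>R (\<chi> p. of_int (a $ p))"
proof -
  have "(tmatvec (transvection m \<phi> a) x) $ q = x $ q + (of_int m * dotp \<phi> x) * of_int (a $ q)" for q
  proof -
    have "(tmatvec (transvection m \<phi> a) x) $ q
        = (\<Sum>p\<in>UNIV. (if p = q then x $ p else 0) + (of_int m * of_int (a $ q)) * (of_int (\<phi> $ p) * x $ p))"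
      unfolding tmatvec_def transvection_def by (simp, rule sum.cong) (auto simp: algebra_simps)
    also have "\<dots> = x $ q + of_int m * of_int (a $ q) * dotp \<phi> x"
      by (simp only: sum.distrib sum_distrib_left[symmetric] dotp_def) simp
    finally show ?thesis by (simp only: mult_ac)
  qed
  then show ?thesis by (simp add: vec_eq_iff)
qed

text \<open>
  \<open>x \<mapsto> x + m \<phi>(x) a\<close> moves the set \<open>{x. \<bar>\<phi>(x)\<bar> \<ge> \<delta> \<bar>x\<bar>}\<close> close to the line of \<open>a\<close>; if \<open>h\<^sup>T\<close> moves that
  line, the set becomes disjoint from its image under the conjugate of \<open>h\<^sup>T\<close>.
\<close>

lemma transvection_conjugate_disjoint:
  fixes h :: "int ^ 'n ^ 'n" and a \<phi> :: "int ^ 'n"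
  defines "ra \<equiv> (\<chi> p. real_of_int (a $ p))"
  assumes orth: "(\<Sum>q\<in>UNIV. a $ q * \<phi> $ q) = 0" and \<delta>: "\<delta> > 0"
    and minor: "ra $ i * tmatvec h ra $ l - ra $ l * tmatvec h ra $ i \<noteq> 0"
  obtains M :: real where "\<And>m x. real_of_int m \<ge> M ==> x \<noteq> 0 ==> \<bar>dotp \<phi> x\<bar> \<ge> \<delta> * norm x ==>
    \<bar>dotp \<phi> (tmatvec (transvection m \<phi> a ** h ** transvection (- m) \<phi> a) x)\<bar>
      \<ge> \<delta> * norm (tmatvec (transvection m \<phi> a ** h ** transvection (- m) \<phi> a) x) ==> False"
proof -
  define a' where "a' = tmatvec h ra"
  define \<mu> where "\<mu> = \<bar>ra $ i * a' $ l - ra $ l * a' $ i\<bar>"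
  have \<mu>: "\<mu> > 0" using minor by (simp add: \<mu>_def a'_def)
  have bl: "bounded_linear (tmatvec h)"
    using tmatvec_linear by (rule linear_conv_bounded_linear[THEN iffD1])
  obtain B where B: "\<And>x. norm (tmatvec h x) \<le> norm x * B" "B > 0"
    using bounded_linear.pos_bounded[OF bl] by blast
  define C where "C = 2 * (norm ra + norm a') * max 1 B"
  define M where "M = C / (\<mu> * \<delta>) + 1"
  show ?thesis
  proof (rule that[of M])
    fix m and x :: "real ^ 'n"
    assume m: "real_of_int m \<ge> M" and x: "x \<noteq> 0" and px: "\<bar>dotp \<phi> x\<bar> \<ge> \<delta> * norm x"
    define K where "K = tmatvec (transvection m \<phi> a)"
    define x' where "x' = tmatvec (transvection m \<phi> a ** h ** transvection (- m) \<phi> a) x"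
    assume "\<bar>dotp \<phi> (tmatvec (transvection m \<phi> a ** h ** transvection (- m) \<phi> a) x)\<bar>
      \<ge> \<delta> * norm (tmatvec (transvection m \<phi> a ** h ** transvection (- m) \<phi> a) x)"
    then have px': "\<bar>dotp \<phi> x'\<bar> \<ge> \<delta> * norm x'" by (simp add: x'_def)
    \<comment> \<open>Transposition reverses products, so the conjugated matrix acts as
      \<open>K\<close>, then \<open>tmatvec h\<close>, then the inverse of \<open>K\<close>.\<close>
    have Kx': "K x' = tmatvec h (K x)"
      unfolding K_def x'_def
      by (simp add: tmatvec_mult[symmetric] matrix_mul_assoc[symmetric] transvection_mult[OF orth])
    define s where "s = real_of_int m * dotp \<phi> x"
    define s' where "s' = real_of_int m * dotp \<phi> x'"
    have "C \<ge> 0" using B(2) by (simp add: C_def)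
    then have M0: "M > 0" using \<mu> \<delta> by (simp add: M_def add_nonneg_pos)
    then have m0: "real_of_int m > 0" using m by simp
    have "\<delta> * norm x > 0" using \<delta> x by simp
    then have s0: "s \<noteq> 0" using px m0 by (auto simp: s_def)
    have Kx: "K x = x + s *\<^sub>R ra" and Kx2: "K x' = x' + s' *\<^sub>R ra"
      by (simp_all add: K_def s_def s'_def ra_def tmatvec_transvection)
    \<comment> \<open>\<open>X\<close> is small compared with \<open>s\<close> and
      \<open>s'\<close>, because \<open>x\<close> and \<open>x'\<close> both lie in the cone and
      \<open>m\<close> is large. Yet its minors against \<open>ra\<close> and \<open>a'\<close> each
      cancel one of the two summands and recover \<open>\<bar>s\<bar> * \<mu>\<close> and
      \<open>\<bar>s'\<bar> * \<mu>\<close>.\<close>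
    define X where "X = s *\<^sub>R a' - s' *\<^sub>R ra"
    have "tmatvec h (K x) = tmatvec h x + s *\<^sub>R a'"
      unfolding Kx a'_def using linear_add[OF tmatvec_linear] linear_scale[OF tmatvec_linear] by metis
    then have X: "X = x' - tmatvec h x" unfolding X_def using Kx' Kx2 by (simp add: algebra_simps)
    have nx: "norm x \<le> \<bar>s\<bar> / (real_of_int m * \<delta>)" "norm x' \<le> \<bar>s'\<bar> / (real_of_int m * \<delta>)"
      using px px' m0 \<delta> by (simp_all add: s_def s'_def field_simps abs_mult)
    have "norm X \<le> norm x' + norm (tmatvec h x)" unfolding X by (rule norm_triangle_ineq4)
    also have "\<dots> \<le> norm x' * max 1 B + norm x * max 1 B"
    proof (rule add_mono)
      show "norm x' \<le> norm x' * max 1 B" by (simp add: mult_le_cancel_left1)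
      show "norm (tmatvec h x) \<le> norm x * max 1 B"
        by (rule order_trans[OF B(1)]) (intro mult_left_mono, auto)
    qed
    also have "\<dots> \<le> \<bar>s'\<bar> / (real_of_int m * \<delta>) * max 1 B + \<bar>s\<bar> / (real_of_int m * \<delta>) * max 1 B"
      by (intro add_mono mult_right_mono nx) auto
    also have "\<dots> = (\<bar>s\<bar> + \<bar>s'\<bar>) * max 1 B / (real_of_int m * \<delta>)" by (simp add: add_divide_distrib distrib_right)
    finally have nX: "norm X \<le> (\<bar>s\<bar> + \<bar>s'\<bar>) * max 1 B / (real_of_int m * \<delta>)" .
    have comp: "\<bar>X $ p * y $ q - X $ q * y $ p\<bar> \<le> 2 * norm X * norm y" for y :: "real ^ 'n" and p q
    proof -
      have "\<bar>X $ p * y $ q - X $ q * y $ p\<bar> \<le> \<bar>X $ p\<bar> * \<bar>y $ q\<bar> + \<bar>X $ q\<bar> * \<bar>y $ p\<bar>"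
        by (metis abs_mult abs_triangle_ineq4)
      also have "\<dots> \<le> norm X * norm y + norm X * norm y"
        by (intro add_mono mult_mono component_le_norm_cart) auto
      finally show ?thesis by simp
    qed
    have "\<bar>s\<bar> * \<mu> = \<bar>X $ l * ra $ i - X $ i * ra $ l\<bar>"
    proof -
      have "X $ l * ra $ i - X $ i * ra $ l = s * (ra $ i * a' $ l - ra $ l * a' $ i)"
        by (simp add: X_def algebra_simps)
      then show ?thesis by (simp add: \<mu>_def abs_mult)
    qed
    also have "\<dots> \<le> 2 * norm X * norm ra" by (rule comp)
    finally have 1: "\<bar>s\<bar> * \<mu> \<le> 2 * norm X * norm ra" .
    have "\<bar>s'\<bar> * \<mu> = \<bar>X $ l * a' $ i - X $ i * a' $ l\<bar>"
    proof -
      have "X $ l * a' $ i - X $ i * a' $ l = s' * (ra $ i * a' $ l - ra $ l * a' $ i)"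
        by (simp add: X_def algebra_simps)
      then show ?thesis by (simp add: \<mu>_def abs_mult)
    qed
    also have "\<dots> \<le> 2 * norm X * norm a'" by (rule comp)
    finally have "\<bar>s'\<bar> * \<mu> \<le> 2 * norm X * norm a'" .
    with 1 have "(\<bar>s\<bar> + \<bar>s'\<bar>) * \<mu> \<le> norm X * (2 * (norm ra + norm a'))" by (simp add: algebra_simps)
    also have "\<dots> \<le> (\<bar>s\<bar> + \<bar>s'\<bar>) * max 1 B / (real_of_int m * \<delta>) * (2 * (norm ra + norm a'))"
      by (intro mult_right_mono nX) auto
    also have "\<dots> = (\<bar>s\<bar> + \<bar>s'\<bar>) * (C / (real_of_int m * \<delta>))" by (simp add: C_def)
    finally have "\<mu> \<le> C / (real_of_int m * \<delta>)" using s0 by (subst (asm) mult_le_cancel_left) auto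
    then have "real_of_int m * (\<mu> * \<delta>) \<le> C" using m0 \<delta> by (simp add: field_simps)
    moreover have "M * (\<mu> * \<delta>) > C" using \<mu> \<delta> by (simp add: M_def field_simps)
    moreover have "M * (\<mu> * \<delta>) \<le> real_of_int m * (\<mu> * \<delta>)" using m \<mu> \<delta> by (intro mult_right_mono) auto
    ultimately show False by linarith
  qed
qed

text \<open>Otherwise \<open>h\<close> is a scalar \<open>c\<close> whose power with exponent
  \<open>CARD('n)\<close> is one, and such an integer is one or minus one.\<close>

lemma not_scalar_entries:
  fixes h :: "int ^ 'n ^ 'n"
  assumes "det h = 1" "h \<noteq> mat 1" "h \<noteq> - mat 1"
  obtains i l where "i \<noteq> l" "h $ i $ l \<noteq> 0 \<or> h $ i $ i \<noteq> h $ l $ l"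
proof (rule ccontr)
  assume "\<not> thesis"
  with that have *: "h $ i $ l = 0" "h $ i $ i = h $ l $ l" if "i \<noteq> l" for i l using that by blast+
  define c where "c = h $ undefined $ undefined"
  have diag: "h $ i $ i = c" for i unfolding c_def by (cases "i = undefined") (auto dest: *)
  have h: "h = mat c" using diag *(1) by (auto simp: vec_eq_iff mat_def)
  have "det h = (\<Prod>i\<in>UNIV. h $ i $ i)" by (rule det_diagonal) (rule *(1))
  then have "c ^ CARD('n) = 1" using assms(1) diag by simp
  then have "\<bar>c\<bar> ^ CARD('n) = 1" by (simp add: power_abs[symmetric])
  then have "\<bar>c\<bar> = 1"
    by (metis abs_ge_zero linorder_neqE_linordered_idom one_less_power power_less_one_iff
        zero_less_card_finite nless_le less_irrefl)
  then consider "c = 1" | "c = - 1" by linarith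
  then show False
  proof cases
    case 1 then show ?thesis using assms(2) h by simp
  next
    case 2
    then have "h = - mat 1" unfolding h by (simp add: vec_eq_iff mat_def)
    then show ?thesis using assms(3) by simp
  qed
qed

text \<open>Points of a moment curve: the pairing with a fixed \<open>x\<close> is a polynomial in
  \<open>j\<close> whose coefficients are the entries of \<open>x\<close>, so for
  \<open>x \<noteq> 0\<close> it has boundedly many zeros.\<close>

definition moment_vec :: "('n \<Rightarrow> nat) \<Rightarrow> nat \<Rightarrow> int ^ 'n" where
  "moment_vec \<iota> j = (\<chi> p. int j ^ \<iota> p)"

definition moment_poly :: "('n \<Rightarrow> nat) \<Rightarrow> real ^ 'n \<Rightarrow> real poly" where
  "moment_poly \<iota> x = (\<Sum>p\<in>UNIV. monom (x $ p) (\<iota> p))"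

text \<open>Orthogonal to \<open>moment_vec \<iota> j\<close> as soon as
  \<open>\<iota> i = 0\<close> and \<open>\<iota> l = 1\<close>, which is what a transvection built
  from the two vectors requires.\<close>

definition plane_vec :: "'n \<Rightarrow> 'n \<Rightarrow> nat \<Rightarrow> int ^ 'n" where
  "plane_vec i l j = (\<chi> p. if p = i then int j else if p = l then - 1 else 0)"

lemma poly_moment: "poly (moment_poly \<iota> x) (real j) = dotp (moment_vec \<iota> j) x"
  by (simp add: moment_poly_def moment_vec_def dotp_def poly_sum poly_monom mult.commute)

lemma coeff_moment: "inj \<iota> ==> coeff (moment_poly \<iota> x) (\<iota> p) = x $ p"
  by (simp add: moment_poly_def coeff_sum inj_eq)

lemma degree_moment: "(\<And>p. \<iota> p \<le> K) ==> degree (moment_poly \<iota> x) \<le> K"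
  unfolding moment_poly_def by (intro degree_sum_le) (auto intro: order_trans[OF degree_monom_le])

lemma sum_plane_vec:
  assumes "i \<noteq> l"
  shows "(\<Sum>q\<in>UNIV. plane_vec i l j $ q * y $ q) = int j * y $ i - y $ l"
proof -
  have "(\<Sum>q\<in>UNIV. plane_vec i l j $ q * y $ q)
      = (\<Sum>q\<in>UNIV. (if q = i then int j * y $ q else 0) - (if q = l then y $ q else 0))"
    by (rule sum.cong) (use assms in \<open>auto simp: plane_vec_def\<close>)
  then show ?thesis by (simp add: sum_subtractf)
qed

lemma card_poly_zeros_nat:
  assumes "q \<noteq> 0" "\<And>j. P j ==> poly q (real j) = 0"
  shows "card {j\<in>J. P j} \<le> degree q"
proof -
  have "card {j\<in>J. P j} \<le> card {x. poly q x = 0}"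
    by (rule card_inj_on_le[where f = real]) (use assms poly_roots_finite in auto)
  also have "\<dots> \<le> degree q" by (rule card_poly_roots_bound[OF assms(1)])
  finally show ?thesis .
qed

text \<open>The equation for \<open>b j\<close> lets conjugation by multiples of \<open>u j\<close>
  produce translations by multiples of \<open>b j\<close>. The last clause says that the transposed
  conjugate moves the cone where \<open>\<phi> j\<close> dominates off itself. The factor two in the
  clause before it leaves room for a continuous cutoff, and \<open>R\<close> is a separate parameter
  so that the family can grow while \<open>R\<close> stays.\<close>

definition displacing_family ::
  "int ^ 'n ^ 'n \<Rightarrow> nat \<Rightarrow> nat set \<Rightarrow> (nat \<Rightarrow> int ^ 'n ^ 'n) \<Rightarrow> (nat \<Rightarrow> int ^ 'n ^ 'n) \<Rightarrow>
   (nat \<Rightarrow> int ^ 'n) \<Rightarrow> (nat \<Rightarrow> int ^ 'n) \<Rightarrow> (nat \<Rightarrow> int ^ 'n) \<Rightarrow> real \<Rightarrow> bool" where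
  "displacing_family h R J A B \<phi> b u \<delta> \<longleftrightarrow> finite J \<and> \<delta> > 0 \<and>
     (\<forall>j\<in>J. det (A j) = 1 \<and> A j ** B j = mat 1 \<and> B j ** A j = mat 1 \<and>
        b j = u j - (A j ** h ** B j) *v u j) \<and>
     (\<forall>x. x \<noteq> 0 \<longrightarrow> card {j\<in>J. dotp (b j) x = 0} \<le> R) \<and>
     (\<forall>x. x \<noteq> 0 \<longrightarrow> card {j\<in>J. \<bar>dotp (\<phi> j) x\<bar> < 2 * \<delta> * norm x} \<le> R) \<and>
     (\<forall>j\<in>J. \<forall>x. x \<noteq> 0 \<longrightarrow> \<bar>dotp (\<phi> j) x\<bar> \<ge> \<delta> * norm x \<longrightarrow>
        \<bar>dotp (\<phi> j) (tmatvec (A j ** h ** B j) x)\<bar> \<ge> \<delta> * norm (tmatvec (A j ** h ** B j) x) \<longrightarrow> False)"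

text \<open>
  The conjugating matrices are the transvections along \<open>plane_vec i l j\<close> with functional
  \<open>moment_vec \<iota> j\<close>. For fixed \<open>x\<close> both families of functionals are polynomials in \<open>j\<close>, hence vanish
  for few \<open>j\<close> only.
\<close>

lemma conjugates_general_position:
  fixes h :: "int ^ 'n ^ 'n"
  assumes h: "det h = 1" "h \<noteq> mat 1" "h \<noteq> - mat 1"
  obtains R :: nat where "\<And>n0. \<exists>(J :: nat set) A B \<phi> b u \<delta>. card J = n0 \<and> displacing_family h R J A B \<phi> b u \<delta>"
proof -
  obtain i l where il: "i \<noteq> l" "h $ i $ l \<noteq> 0 \<or> h $ i $ i \<noteq> h $ l $ l"
    using not_scalar_entries[OF h] by blast
  obtain \<iota>0 :: "'n \<Rightarrow> nat" where \<iota>0: "inj \<iota>0"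
    using finite_imp_inj_to_nat_seg[of "UNIV :: 'n set"] by auto
  \<comment> \<open>The values zero and one at \<open>i\<close> and \<open>l\<close> give the
    orthogonality to \<open>plane_vec i l j\<close>; the shift by two keeps the remaining exponents
    distinct from them.\<close>
  define \<iota> where "\<iota> p = (if p = i then 0 else if p = l then 1 else \<iota>0 p + 2)" for p
  have \<iota>: "inj \<iota>" "\<iota> i = 0" "\<iota> l = 1"
    using \<iota>0 il(1) by (auto simp: \<iota>_def inj_def)
  define K where "K = Max (range \<iota>)"
  have K: "\<iota> p \<le> K" for p unfolding K_def by (rule Max_ge) auto
  define \<phi> where "\<phi> = moment_vec \<iota>"
  define a where "a = plane_vec i l"
  have orth: "(\<Sum>q\<in>UNIV. a j $ q * \<phi> j $ q) = 0" for j
    unfolding a_def sum_plane_vec[OF il(1)] by (simp add: \<phi>_def moment_vec_def \<iota>)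
  have mp0: "moment_poly \<iota> x = 0 \<longleftrightarrow> x = 0" for x
  proof
    assume z: "moment_poly \<iota> x = 0"
    have "x $ p = 0" for p using coeff_moment[OF \<iota>(1), of x p] z by simp
    then show "x = 0" by (simp add: vec_eq_iff)
  qed (simp add: moment_poly_def)
  have gp\<phi>: "card {j\<in>J. dotp (\<phi> j) x = 0} \<le> Suc K" if "x \<noteq> 0" for J x
  proof -
    have "card {j\<in>J. dotp (\<phi> j) x = 0} \<le> degree (moment_poly \<iota> x)"
      by (rule card_poly_zeros_nat) (use mp0 that in \<open>auto simp: poly_moment \<phi>_def\<close>)
    also have "\<dots> \<le> Suc K" using degree_moment[of \<iota> K x] K by (simp add: le_SucI)
    finally show ?thesis .
  qed
  define ra where "ra j = (\<chi> p. real_of_int (a j $ p))" for j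
  define minor where "minor j = ra j $ i * tmatvec h (ra j) $ l - ra j $ l * tmatvec h (ra j) $ i" for j
  have th: "tmatvec h (ra j) $ p = real j * h $ i $ p - h $ l $ p" for j p
  proof -
    have "tmatvec h (ra j) $ p = of_int (\<Sum>q\<in>UNIV. a j $ q * h $ q $ p)"
      by (simp add: tmatvec_def ra_def mult.commute)
    also have "(\<Sum>q\<in>UNIV. a j $ q * h $ q $ p) = int j * h $ i $ p - h $ l $ p"
      using sum_plane_vec[OF il(1), of j "\<chi> q. h $ q $ p"] by (simp add: a_def)
    finally show ?thesis by simp
  qed
  have ra: "ra j $ i = real j" "ra j $ l = - 1" for j
    using il(1) by (auto simp: ra_def a_def plane_vec_def)
  \<comment> \<open>The minor is quadratic in \<open>j\<close>. Its two upper coefficients do not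
    both vanish, by the choice of \<open>i\<close> and \<open>l\<close>, so only finitely many
    \<open>j\<close> have to be avoided.\<close>
  define mq where "mq = [: - real_of_int (h $ l $ i), real_of_int (h $ i $ i - h $ l $ l), real_of_int (h $ i $ l) :]"
  have minor: "minor j = poly mq (real j)" for j
    by (simp add: minor_def th ra mq_def algebra_simps power2_eq_square)
  have mq0: "mq \<noteq> 0" using il(2) by (auto simp: mq_def)
  define bad where "bad = {j. minor j = 0}"
  have "finite bad"
  proof -
    have "finite (real -` {x. poly mq x = 0})"
      by (rule finite_vimageI[OF poly_roots_finite[OF mq0]]) simp
    moreover have "bad = real -` {x. poly mq x = 0}" by (auto simp: bad_def minor)
    ultimately show ?thesis by simp
  qed
  then have inf: "infinite (- bad)" by simp
  \<comment> \<open>In the three cases the entry of \<open>b\<close> that is nonzero is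
    \<open>- h $ i $ l\<close>, \<open>1 - h $ i $ i\<close> and \<open>1 - h $ l $ l\<close>
    respectively.\<close>
  define u :: "int ^ 'n" where "u = (if h $ i $ l \<noteq> 0 then axis l 1 else if h $ i $ i \<noteq> 1 then axis i 1 else axis l 1)"
  define b where "b = u - h *v u"
  have ax: "axis p (1::int) $ q = (if q = p then 1 else 0)" for p q :: 'n
    by (simp add: axis_def)
  have hax: "(h *v axis q 1) $ p = h $ p $ q" for p q
  proof -
    have "(h *v axis q 1) $ p = (\<Sum>k\<in>UNIV. if k = q then h $ p $ k else 0)"
      unfolding matrix_vector_mult_def vec_lambda_beta by (rule sum.cong) (auto simp: ax)
    then show ?thesis by simp
  qed
  have b: "b $ i \<noteq> 0 \<or> b $ l \<noteq> 0"
    using il by (auto simp: b_def u_def hax ax)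
  show ?thesis
  \<comment> \<open>The bound is a degree: at most \<open>K\<close> for the functionals
    \<open>\<phi> j\<close> and at most \<open>K + 1\<close> for the \<open>bj j\<close>, whatever
    the size of the family.\<close>
  proof (rule that[of "Suc K"])
    fix n0 :: nat
    obtain J where J: "J \<subseteq> - bad" "finite J" "card J = n0"
      using infinite_arbitrarily_large[OF inf] by blast
    obtain \<delta>0 where \<delta>0: "\<delta>0 > 0" "\<And>x. x \<noteq> 0 ==> card {j\<in>J. \<bar>dotp (\<phi> j) x\<bar> < \<delta>0 * norm x} \<le> Suc K"
      using general_position_quantitative[OF J(2), of \<phi> "Suc K"] gp\<phi> by blast
    define \<delta> where "\<delta> = \<delta>0 / 2"
    have \<delta>: "\<delta> > 0" using \<delta>0(1) by (simp add: \<delta>_def)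
    let ?H = "\<lambda>m j. transvection m (\<phi> j) (a j) ** h ** transvection (- m) (\<phi> j) (a j)"
    have "\<forall>j\<in>J. \<exists>M::real. \<forall>m x. real_of_int m \<ge> M \<longrightarrow> x \<noteq> 0 \<longrightarrow> \<bar>dotp (\<phi> j) x\<bar> \<ge> \<delta> * norm x \<longrightarrow>
       \<bar>dotp (\<phi> j) (tmatvec (?H m j) x)\<bar> \<ge> \<delta> * norm (tmatvec (?H m j) x) \<longrightarrow> False"
    proof
      fix j assume "j \<in> J"
      then have "minor j \<noteq> 0" using J(1) by (auto simp: bad_def)
      then have "(\<chi> p. real_of_int (a j $ p)) $ i * tmatvec h (\<chi> p. real_of_int (a j $ p)) $ l
         - (\<chi> p. real_of_int (a j $ p)) $ l * tmatvec h (\<chi> p. real_of_int (a j $ p)) $ i \<noteq> 0"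
        by (simp only: minor_def ra_def not_False_eq_True)
      from transvection_conjugate_disjoint[OF orth \<delta> this]
      show "\<exists>M::real. \<forall>m x. real_of_int m \<ge> M \<longrightarrow> x \<noteq> 0 \<longrightarrow> \<bar>dotp (\<phi> j) x\<bar> \<ge> \<delta> * norm x \<longrightarrow>
       \<bar>dotp (\<phi> j) (tmatvec (?H m j) x)\<bar> \<ge> \<delta> * norm (tmatvec (?H m j) x) \<longrightarrow> False"
        by metis
    qed
    from bchoice[OF this] obtain M where M: "\<forall>j\<in>J. \<forall>m x. real_of_int m \<ge> M j \<longrightarrow> x \<noteq> 0 \<longrightarrow>
       \<bar>dotp (\<phi> j) x\<bar> \<ge> \<delta> * norm x \<longrightarrow>
       \<bar>dotp (\<phi> j) (tmatvec (?H m j) x)\<bar> \<ge> \<delta> * norm (tmatvec (?H m j) x) \<longrightarrow> False" ..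
    define M0 where "M0 = Max (insert 1 (M ` J))"
    have M0: "M0 \<ge> 1" "\<And>j. j \<in> J ==> M j \<le> M0" using J(2) by (auto simp: M0_def)
    \<comment> \<open>Even, so that \<open>det_transvection_even\<close> applies.\<close>
    define m where "m = 2 * \<lceil>M0\<rceil>"
    have m: "real_of_int m \<ge> M0" "m > 0" using M0(1) by (auto simp: m_def) linarith+
    define A where "A j = transvection m (\<phi> j) (a j)" for j
    define B where "B j = transvection (- m) (\<phi> j) (a j)" for j
    have AB: "det (A j) = 1" "A j ** B j = mat 1" "B j ** A j = mat 1" for j
      using det_transvection_even[OF orth[of j]] transvection_mult[OF orth[of j]]
      by (simp_all add: A_def B_def m_def)
    define bj where "bj j = A j *v b" for j
    have bju: "bj j = A j *v u - (A j ** h ** B j) *v (A j *v u)" for j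
    proof -
      have "(A j ** h ** B j) *v (A j *v u) = A j *v (h *v ((B j ** A j) *v u))"
        by (simp add: matrix_vector_mul_assoc matrix_mul_assoc)
      then show ?thesis by (simp add: bj_def b_def AB matrix_vector_mult_diff_distrib)
    qed
    have bjd: "dotp (bj j) x = dotp b x + of_int m * (real j * of_int (b $ i) - of_int (b $ l)) * dotp (\<phi> j) x" for j x
      by (simp add: bj_def A_def transvection_mult_vec dotp_add dotp_smult a_def sum_plane_vec[OF il(1)])
    have gpb: "card {j\<in>J. dotp (bj j) x = 0} \<le> Suc K" if x: "x \<noteq> 0" for x
    proof -
      define lin where "lin = [: - of_int m * real_of_int (b $ l), of_int m * real_of_int (b $ i) :]"
      define q where "q = [: dotp b x :] + lin * moment_poly \<iota> x"
      have q: "dotp (bj j) x = poly q (real j)" for j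
        by (simp add: q_def lin_def bjd poly_moment \<phi>_def algebra_simps)
      \<comment> \<open>If the product cancelled the constant, both of its factors would be
        constant. Then \<open>b $ i = 0\<close> and \<open>x\<close> is supported at
        \<open>i\<close>, so \<open>dotp b x\<close> itself vanishes and the product of two nonzero
        polynomials would be zero.\<close>
      have q0: "q \<noteq> 0"
      proof
        assume "q = 0"
        then have e: "lin * moment_poly \<iota> x = [: - dotp b x :]" by (simp add: q_def add_eq_0_iff)
        have lin0: "lin \<noteq> 0" using b m by (auto simp: lin_def)
        have "degree lin + degree (moment_poly \<iota> x) = 0"
          using degree_mult_eq[OF lin0, of "moment_poly \<iota> x"] e mp0 x by simp
        then have d: "degree lin = 0" "degree (moment_poly \<iota> x) = 0" by auto
        have bi: "b $ i = 0" using d(1) m by (auto simp: lin_def split: if_splits)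
        have xp: "x $ p = 0" if "p \<noteq> i" for p
        proof -
          have "\<iota> p \<noteq> 0" using \<iota> that by (metis injD)
          then show ?thesis using coeff_moment[OF \<iota>(1), of x p] d(2) by (simp add: coeff_eq_0)
        qed
        have "dotp b x = 0" unfolding dotp_def
        proof (intro sum.neutral ballI)
          fix p show "real_of_int (b $ p) * x $ p = 0" using xp bi by (cases "p = i") auto
        qed
        then have "lin * moment_poly \<iota> x = 0" using e by simp
        then show False using lin0 mp0 x by simp
      qed
      have "card {j\<in>J. dotp (bj j) x = 0} \<le> degree q"
        by (rule card_poly_zeros_nat[OF q0]) (simp add: q)
      also have "\<dots> \<le> Suc K"
      proof -
        have "degree (lin * moment_poly \<iota> x) \<le> degree lin + degree (moment_poly \<iota> x)" by (rule degree_mult_le)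
        also have "\<dots> \<le> 1 + K" using degree_moment[of \<iota> K x] K by (intro add_mono) (auto simp: lin_def)
        finally show ?thesis unfolding q_def by (intro degree_add_le) auto
      qed
      finally show ?thesis .
    qed
    show "\<exists>(J :: nat set) A B \<phi> b u \<delta>. card J = n0 \<and> displacing_family h (Suc K) J A B \<phi> b u \<delta>"
    proof (rule exI[of _ J], rule exI[of _ A], rule exI[of _ B], rule exI[of _ \<phi>], rule exI[of _ bj],
        rule exI[of _ "\<lambda>j. A j *v u"], rule exI[of _ \<delta>], unfold displacing_family_def, intro conjI ballI allI impI)
      fix j x assume "j \<in> J" "x \<noteq> 0" "\<bar>dotp (\<phi> j) x\<bar> \<ge> \<delta> * norm x"
        "\<bar>dotp (\<phi> j) (tmatvec (A j ** h ** B j) x)\<bar> \<ge> \<delta> * norm (tmatvec (A j ** h ** B j) x)"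
      moreover have "real_of_int m \<ge> M j" using M0(2)[OF \<open>j \<in> J\<close>] m(1) by linarith
      ultimately show False using M unfolding A_def B_def by blast
    qed (use J \<delta> AB bju gpb \<delta>0 in \<open>auto simp: \<delta>_def\<close>)
  qed
qed

section \<open>Continuous cutoffs near the identity of the torus\<close>

definition clamp01 :: "real \<Rightarrow> real" where "clamp01 t = max 0 (min 1 t)"

lemma clamp01_bounds: "0 \<le> clamp01 t" "clamp01 t \<le> 1"
  by (auto simp: clamp01_def)

lemma continuous_on_clamp01 [continuous_intros]:
  "continuous_on S f ==> continuous_on S (\<lambda>x. clamp01 (f x))"
  unfolding clamp01_def by (intro continuous_intros)

definition torus_defect :: "complex ^ 'n \<Rightarrow> real" where
  "torus_defect z = (\<Sum>i\<in>UNIV. 1 - Re (z $ i))"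

text \<open>Continuous on the whole torus, but inverse to \<open>torus_point\<close> only where all
  coordinates of the lift are below \<open>1 / 4\<close> in absolute value. The cutoffs below vanish
  elsewhere.\<close>

definition torus_angle :: "complex ^ 'n \<Rightarrow> real ^ 'n" where
  "torus_angle z = (\<chi> i. arcsin (Im (z $ i)) / (2 * pi))"

lemma torus_point_periodic: "torus_point ((ivec z) + x) = torus_point x"
  by (simp add: torus_point_def vec_eq_iff echar_add)

lemma torus_angle_point:
  assumes "\<And>i. \<bar>x $ i\<bar> < 1 / 4" shows "torus_angle (torus_point x) = x"
proof -
  have "arcsin (sin (2 * pi * x $ i)) = 2 * pi * x $ i" for i
  proof -
    have "\<bar>2 * pi * x $ i\<bar> \<le> pi / 2" using assms[of i] pi_gt_zero by (simp add: abs_mult)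
    then show ?thesis by (intro arcsin_sin) linarith+
  qed
  then show ?thesis by (simp add: torus_angle_def torus_point_def echar_def vec_eq_iff)
qed

lemma torus_entry_bounds:
  assumes "z \<in> torus" shows "\<bar>Re (z $ i)\<bar> \<le> 1" "\<bar>Im (z $ i)\<bar> \<le> 1"
  using assms abs_Re_le_cmod[of "z $ i"] abs_Im_le_cmod[of "z $ i"] by (auto simp: torus_def)

lemma continuous_on_torus_defect: "continuous_on S torus_defect"
  unfolding torus_defect_def by (intro continuous_intros)

lemma continuous_on_torus_angle: "continuous_on torus torus_angle"
  unfolding torus_angle_def
  by (intro continuous_intros continuous_on_arcsin) (use torus_entry_bounds(2) in \<open>auto simp: abs_le_iff minus_le_iff\<close>)

lemma continuous_on_torus_point: "continuous_on S torus_point"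
  unfolding torus_point_def echar_def by (intro continuous_intros)

text \<open>\<open>r1\<close> is chosen before \<open>r\<close>: in the application \<open>r\<close>
  depends on the positive definite function, whereas \<open>r1\<close> determines the averaging
  polynomials and must not.\<close>

lemma cutoff_exists:
  fixes r0 :: real assumes r0: "r0 > 0"
  obtains r1 where "r1 > 0"
    "\<And>(\<phi> :: int ^ 'n) \<delta> r. \<delta> > 0 ==> r > 0 ==> \<exists>f :: complex ^ 'n \<Rightarrow> real. continuous_on torus f \<and>
      (\<forall>z. 0 \<le> f z \<and> f z \<le> 1) \<and>
      (\<forall>x. norm x < r1 \<longrightarrow> r \<le> norm x \<longrightarrow> 2 * \<delta> * norm x \<le> \<bar>dotp \<phi> x\<bar> \<longrightarrow> f (torus_point x) = 1) \<and>
      (\<forall>y. f (torus_point y) \<noteq> 0 \<longrightarrow> (\<exists>z x. y = ivec z + x \<and> norm x < r0 \<and> x \<noteq> 0 \<and> \<bar>dotp \<phi> x\<bar> \<ge> \<delta> * norm x))"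
proof -
  \<comment> \<open>The bound \<open>1 / 4\<close> is what \<open>torus_angle_point\<close> needs;
    the other one bounds the norm by \<open>r0\<close> through the sum of the coordinates.\<close>
  define \<eta> where "\<eta> = min (1 / 4) (r0 / real CARD('n))"
  have \<eta>: "\<eta> > 0" using r0 by (simp add: \<eta>_def)
  obtain e where e: "e > 0" "\<And>t. cmod (1 - echar t) < e ==> \<bar>t - of_int (round t)\<bar> < \<eta>"
    using echar_near_one[OF \<eta>] by blast
  \<comment> \<open>The squared distance of \<open>echar t\<close> from one is
    \<open>2 * (1 - Re (echar t))\<close>, so a defect below \<open>2 * \<kappa>\<close> brings
    every coordinate within distance \<open>e\<close> of one.\<close>
  define \<kappa> where "\<kappa> = e\<^sup>2 / 4"
  have \<kappa>: "\<kappa> > 0" using e(1) by (simp add: \<kappa>_def)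
  have near: "\<exists>z x. y = ivec z + x \<and> norm x < r0 \<and> (\<forall>i. \<bar>x $ i\<bar> < 1 / 4)"
    if y: "torus_defect (torus_point y) < 2 * \<kappa>" for y :: "real ^ 'n"
  proof -
    define x where "x = (\<chi> i. y $ i - of_int (round (y $ i)))"
    have x: "\<bar>x $ i\<bar> < \<eta>" for i
    proof -
      have "1 - Re (torus_point y $ i) \<le> torus_defect (torus_point y)"
        unfolding torus_defect_def
        by (rule member_le_sum) (use torus_entry_bounds(1)[OF torus_point_in_torus] in \<open>auto simp: abs_le_iff\<close>)
      then have "1 - Re (echar (y $ i)) < 2 * \<kappa>" using y by (simp add: torus_point_def)
      moreover have "(cmod (1 - echar (y $ i)))\<^sup>2 = 2 * (1 - Re (echar (y $ i)))"
      proof -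
        have "(Re (echar (y $ i)))\<^sup>2 + (Im (echar (y $ i)))\<^sup>2 = 1"
          using norm_echar[of "y $ i"] by (simp add: cmod_def)
        then show ?thesis by (simp add: cmod_power2 power2_diff algebra_simps)
      qed
      ultimately have "(cmod (1 - echar (y $ i)))\<^sup>2 < e\<^sup>2" by (simp add: \<kappa>_def)
      then have "cmod (1 - echar (y $ i)) < e" using e(1) by (simp add: power2_less_imp_less)
      from e(2)[OF this] show ?thesis by (simp add: x_def)
    qed
    have "norm x \<le> (\<Sum>i\<in>UNIV. \<bar>x $ i\<bar>)" by (rule norm_le_l1_cart)
    also have "\<dots> < (\<Sum>i\<in>(UNIV :: 'n set). \<eta>)" by (rule sum_strict_mono) (use x in auto)
    also have "\<dots> \<le> real CARD('n) * (r0 / real CARD('n))"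
      unfolding sum_constant \<eta>_def by (intro mult_left_mono min.cobounded2) simp
    finally have "norm x < r0" by simp
    moreover have "y = (\<chi> i. of_int ((\<chi> i. round (y $ i)) $ i)) + x" by (simp add: x_def vec_eq_iff)
    moreover have "\<bar>x $ i\<bar> < 1 / 4" for i using x[of i] by (simp add: \<eta>_def)
    ultimately show ?thesis by blast
  qed
  have "continuous_on UNIV (\<lambda>x :: real ^ 'n. torus_defect (torus_point x))"
    by (intro continuous_on_compose2[OF continuous_on_torus_defect continuous_on_torus_point]) auto
  then have "isCont (\<lambda>x :: real ^ 'n. torus_defect (torus_point x)) 0"
    by (simp add: continuous_on_eq_continuous_at)
  moreover have z: "torus_defect (torus_point (0 :: real ^ 'n)) = 0"
    by (simp add: torus_defect_def torus_point_def)
  ultimately obtain s where s: "s > 0" "\<And>x :: real ^ 'n. norm x < s ==> \<bar>torus_defect (torus_point x)\<bar> < \<kappa>"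
    using \<kappa> unfolding continuous_at_eps_delta by (auto simp: dist_real_def)
  define r1 where "r1 = min s (1 / 4)"
  show ?thesis
  proof (rule that[of r1])
    show "r1 > 0" using s by (simp add: r1_def)
    fix \<phi> :: "int ^ 'n" and \<delta> r :: real assume \<delta>: "\<delta> > 0" and r: "r > 0"
    \<comment> \<open>The first factor localises at the identity. For \<open>r \<le> norm x\<close>
      the second rises from zero to one while \<open>\<bar>dotp \<phi> x\<bar>\<close> grows from
      \<open>\<delta> * norm x\<close> to \<open>2 * \<delta> * norm x\<close>; the maximum with
      \<open>r\<close> keeps it continuous at the origin.\<close>
    define f where "f z = clamp01 (2 - torus_defect z / \<kappa>) *
      clamp01 ((\<bar>dotp \<phi> (torus_angle z)\<bar> - \<delta> * norm (torus_angle z)) / (\<delta> * max (norm (torus_angle z)) r))" for z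
    have den: "\<delta> * max t r \<noteq> 0" for t using \<delta> r by (auto simp: max_def)
    show "\<exists>f :: complex ^ 'n \<Rightarrow> real. continuous_on torus f \<and>
      (\<forall>z. 0 \<le> f z \<and> f z \<le> 1) \<and>
      (\<forall>x. norm x < r1 \<longrightarrow> r \<le> norm x \<longrightarrow> 2 * \<delta> * norm x \<le> \<bar>dotp \<phi> x\<bar> \<longrightarrow> f (torus_point x) = 1) \<and>
      (\<forall>y. f (torus_point y) \<noteq> 0 \<longrightarrow> (\<exists>z x. y = ivec z + x \<and> norm x < r0 \<and> x \<noteq> 0 \<and> \<bar>dotp \<phi> x\<bar> \<ge> \<delta> * norm x))"
    proof (intro exI[of _ f] conjI allI impI)
      show "continuous_on torus f"
        unfolding f_def
        by (intro continuous_intros continuous_on_torus_defect continuous_on_torus_angle)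
           (use \<kappa> den in auto)
      show "0 \<le> f z" for z unfolding f_def by (intro mult_nonneg_nonneg clamp01_bounds)
      show "f z \<le> 1" for z unfolding f_def by (intro mult_le_one clamp01_bounds)
    next
      fix x :: "real ^ 'n" assume x: "norm x < r1" "r \<le> norm x" "2 * \<delta> * norm x \<le> \<bar>dotp \<phi> x\<bar>"
      have "\<bar>x $ i\<bar> < 1 / 4" for i using component_le_norm_cart[of x i] x(1) by (simp add: r1_def)
      then have ang: "torus_angle (torus_point x) = x" by (rule torus_angle_point)
      have "torus_defect (torus_point x) < \<kappa>" using s(2)[of x] x(1) by (simp add: r1_def)
      then have "2 - torus_defect (torus_point x) / \<kappa> \<ge> 1" using \<kappa> by (simp add: field_simps)
      moreover have "(\<bar>dotp \<phi> x\<bar> - \<delta> * norm x) / (\<delta> * max (norm x) r) \<ge> 1"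
      proof -
        have "max (norm x) r = norm x" "norm x > 0" using x(2) r by auto
        then show ?thesis using x(3) \<delta> by (simp add: le_divide_eq)
      qed
      ultimately show "f (torus_point x) = 1" unfolding f_def ang by (simp add: clamp01_def)
    next
      fix y assume "f (torus_point y) \<noteq> 0"
      then have c: "clamp01 (2 - torus_defect (torus_point y) / \<kappa>) \<noteq> 0"
        "clamp01 ((\<bar>dotp \<phi> (torus_angle (torus_point y))\<bar> - \<delta> * norm (torus_angle (torus_point y)))
          / (\<delta> * max (norm (torus_angle (torus_point y))) r)) \<noteq> 0"
        by (auto simp: f_def)
      have "2 - torus_defect (torus_point y) / \<kappa> > 0" using c(1) by (auto simp: clamp01_def max_def split: if_splits)
      then have "torus_defect (torus_point y) < 2 * \<kappa>" using \<kappa> by (simp add: field_simps)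
      from near[OF this] obtain z x where zx: "y = ivec z + x" "norm x < r0" "\<And>i. \<bar>x $ i\<bar> < 1 / 4"
        by blast
      have "torus_angle (torus_point y) = x"
        unfolding zx(1) torus_point_periodic by (rule torus_angle_point[OF zx(3)])
      with c(2) have "(\<bar>dotp \<phi> x\<bar> - \<delta> * norm x) / (\<delta> * max (norm x) r) > 0"
        by (auto simp: clamp01_def max_def split: if_splits)
      moreover have "\<delta> * max (norm x) r > 0" using \<delta> r by (intro mult_pos_pos) auto
      ultimately have "\<bar>dotp \<phi> x\<bar> > \<delta> * norm x" by (simp add: zero_less_divide_iff)
      moreover from this have "x \<noteq> 0" by (auto simp: dotp_def)
      ultimately show "\<exists>z x. y = ivec z + x \<and> norm x < r0 \<and> x \<noteq> 0 \<and> \<bar>dotp \<phi> x\<bar> \<ge> \<delta> * norm x"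
        using zx by (intro exI[of _ z] exI[of _ x]) auto
    qed
  qed
qed

subsection \<open>Vanishing of limits of positive definite functions\<close>

lemma trig_fun_concat:
  "trig_fun \<rho> (concat ps) = (\<Sum>p\<leftarrow>ps. trig_fun \<rho> p)"
  by (induction ps) (auto simp: trig_fun_append)

lemma trig_eval_concat: "trig_eval (concat ps) \<theta> = (\<Sum>p\<leftarrow>ps. trig_eval p \<theta>)"
  by (induction ps) (auto simp: trig_eval_append)

lemma matrix_vector_smult: "(A :: int ^ 'n ^ 'n) *v (c *s v) = c *s (A *v v)"
  by (simp add: matrix_vector_mult_def vec_eq_iff sum_distrib_left mult_ac)

lemma sum_le_card:
  fixes g :: "'j \<Rightarrow> real"
  assumes "finite J" "\<And>j. j \<in> J ==> g j \<le> 1" "\<And>j. j \<in> J ==> \<not> P j ==> g j \<le> e"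
    and "card {j\<in>J. P j} \<le> R" "e \<ge> 0"
  shows "sum g J \<le> real R + real (card J) * e"
proof -
  have "sum g J \<le> (\<Sum>j\<in>J. (if P j then 1 else 0) + e)"
    using assms(2,3,5) by (intro sum_mono) (auto intro: add_increasing2)
  also have "\<dots> = real (card {j\<in>J. P j}) + real (card J) * e"
    using assms(1) by (simp add: sum.distrib sum.If_cases Int_def)
  finally show ?thesis using assms(4) by linarith
qed

text \<open>
  A conjugation invariant pointwise limit \<open>c\<close> of positive definite functions vanishing at infinity
  on \<open>\<int>\<^sup>n\<close>: if \<open>c (w, h) \<noteq> 0\<close>, the spectral measure of \<open>\<int>\<^sup>n\<close> near the torsion points of the dual
  torus would have to be concentrated, in most of the directions \<open>\<phi> j\<close>, on sets which are displaced
  by the conjugates of \<open>h\<close>.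
\<close>

theorem Gn_character_vanishes:
  fixes c :: "(int ^ 'n) \<times> (int ^ 'n ^ 'n) \<Rightarrow> complex"
  assumes conj: "\<And>g x. g \<in> carrier Gn ==> x \<in> carrier Gn ==> c (g \<otimes>\<^bsub>Gn\<^esub> x \<otimes>\<^bsub>Gn\<^esub> inv\<^bsub>Gn\<^esub> g) = c x"
    and approx: "\<And>E e. finite E ==> E \<subseteq> carrier Gn ==> e > 0 ==> \<exists>\<psi>. posdef Gn \<psi> \<and> Re (\<psi> (0, mat 1)) \<le> 1 \<and>
       (\<forall>e>0. finite {v. cmod (\<psi> (v, mat 1)) \<ge> e}) \<and> (\<forall>g\<in>E. cmod (\<psi> g - c g) < e)"
    and h: "det h = 1" "h \<noteq> mat 1" "h \<noteq> - mat 1"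
  shows "c (w, h) = 0"
proof (rule ccontr)
  assume c0: "c (w, h) \<noteq> 0"
  define \<gamma> where "\<gamma> = cmod (c (w, h))"
  have \<gamma>: "\<gamma> > 0" using c0 by (simp add: \<gamma>_def)
  obtain R where R: "\<And>n0. \<exists>(J :: nat set) A B \<phi> b u \<delta>. card J = n0 \<and> displacing_family h R J A B \<phi> b u \<delta>"
    using conjugates_general_position[OF h] by blast
  \<comment> \<open>This is the bound from \<open>trig_form_cutoff\<close> for the best member of a
    family of size \<open>n\<close>. As \<open>R\<close> is already fixed, it can be pushed below
    \<open>\<gamma> / 2\<close>.\<close>
  have "(\<lambda>n. 3 * sqrt ((real R + 6) / real n) + 2 / real n) \<longlonglongrightarrow> 3 * sqrt 0 + 0"
  proof (intro tendsto_add tendsto_mult tendsto_const tendsto_real_sqrt)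
    show "(\<lambda>n. (real R + 6) / real n) \<longlonglongrightarrow> 0" by real_asymp
    show "(\<lambda>n. 2 / real n) \<longlonglongrightarrow> 0" by real_asymp
  qed
  then have "eventually (\<lambda>n. 3 * sqrt ((real R + 6) / real n) + 2 / real n < \<gamma> / 2) sequentially"
    using \<gamma> by (intro order_tendstoD) auto
  then have "eventually (\<lambda>n. 3 * sqrt ((real R + 6) / real n) + 2 / real n < \<gamma> / 2 \<and> n > 0) sequentially"
    using eventually_gt_at_top[of 0] by eventually_elim auto
  then obtain n0 where n0: "3 * sqrt ((real R + 6) / real n0) + 2 / real n0 < \<gamma> / 2" "n0 > 0"
    using eventually_happens'[OF sequentially_bot] by blast
  obtain J A B \<phi> b u \<delta> where cardJ: "card J = n0" and fam: "displacing_family h R J A B \<phi> b u \<delta>"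
    using R[of n0] by (elim exE conjE)
  define H where "H j = A j ** h ** B j" for j
  note fam = fam[unfolded displacing_family_def, folded H_def]
  have J: "finite J" "card J = n0" and \<delta>: "\<delta> > 0" using fam cardJ by simp_all
  have AB: "\<forall>j\<in>J. det (A j) = 1 \<and> A j ** B j = mat 1 \<and> B j ** A j = mat 1 \<and> b j = u j - H j *v u j"
    and gpb': "\<forall>x. x \<noteq> 0 \<longrightarrow> card {j\<in>J. dotp (b j) x = 0} \<le> R"
    and gp\<phi>': "\<forall>x. x \<noteq> 0 \<longrightarrow> card {j\<in>J. \<bar>dotp (\<phi> j) x\<bar> < 2 * \<delta> * norm x} \<le> R"
    and disj': "\<forall>j\<in>J. \<forall>x. x \<noteq> 0 \<longrightarrow> \<bar>dotp (\<phi> j) x\<bar> \<ge> \<delta> * norm x \<longrightarrow>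
        \<bar>dotp (\<phi> j) (tmatvec (H j) x)\<bar> \<ge> \<delta> * norm (tmatvec (H j) x) \<longrightarrow> False"
    by (rule fam[THEN conjunct2, THEN conjunct2, THEN conjunct1],
        rule fam[THEN conjunct2, THEN conjunct2, THEN conjunct2, THEN conjunct1],
        rule fam[THEN conjunct2, THEN conjunct2, THEN conjunct2, THEN conjunct2, THEN conjunct1],
        rule fam[THEN conjunct2, THEN conjunct2, THEN conjunct2, THEN conjunct2, THEN conjunct2])
  have gpb: "card {j\<in>J. dotp (b j) x = 0} \<le> R" if "x \<noteq> 0" for x
    using gpb'[rule_format, OF that] .
  have gp\<phi>: "card {j\<in>J. \<bar>dotp (\<phi> j) x\<bar> < 2 * \<delta> * norm x} \<le> R" if "x \<noteq> 0" for x
    using gp\<phi>'[rule_format, OF that] .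
  have disj: False if "j \<in> J" "x \<noteq> 0" "\<bar>dotp (\<phi> j) x\<bar> \<ge> \<delta> * norm x"
      "\<bar>dotp (\<phi> j) (tmatvec (H j) x)\<bar> \<ge> \<delta> * norm (tmatvec (H j) x)" for j x
    using disj'[rule_format, OF that] .
  have detA: "det (A j) = 1" and AB1: "A j ** B j = mat 1" and BA1: "B j ** A j = mat 1"
    and bu: "b j = u j - H j *v u j" if "j \<in> J" for j
    using bspec[OF AB that] by simp_all
  have detB: "det (B j) = 1" if "j \<in> J" for j
  proof -
    have "det (A j) * det (B j) = det (mat 1 :: int ^ 'n ^ 'n)"
      unfolding det_mul[symmetric] AB1[OF that] ..
    then show ?thesis unfolding detA[OF that] by simp
  qed
  have detH: "det (H j) = 1" if "j \<in> J" for j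
    using detA[OF that] detB[OF that] h(1) by (simp add: H_def det_mul)
  \<comment> \<open>Conjugation by \<open>(0, A j)\<close> turns \<open>h\<close> into
    \<open>H j\<close>. Conjugation by the translation \<open>y\<close> then adds
    \<open>y - H j *v y\<close>, and for this \<open>y\<close> the relation between
    \<open>u j\<close> and \<open>b j\<close> yields the stated vector.\<close>
  have cH: "c (A j *v w + H j *v (int l *s b j) - int k *s b j, H j) = c (w, h)" if j: "j \<in> J" for j k l
  proof -
    define y where "y = int l *s (H j *v u j) - int k *s u j"
    have "c (A j *v w, H j) = c (w, h)"
      using conj[of "(0, A j)" "(w, h)"] detA[OF j] detB[OF j] h(1)
      by (simp add: inv_Gn[OF detA[OF j] BA1[OF j] detB[OF j]] H_def matrix_mul_assoc)
    moreover have "c ((y, mat 1) \<otimes>\<^bsub>Gn\<^esub> (A j *v w, H j) \<otimes>\<^bsub>Gn\<^esub> inv\<^bsub>Gn\<^esub> (y, mat 1)) = c (A j *v w, H j)"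
      by (rule conj) (use detH[OF j] in auto)
    moreover have eq: "y - H j *v y = H j *v (int l *s b j) - int k *s b j"
      unfolding y_def bu[OF j]
      by (simp add: matrix_vector_mult_diff_distrib matrix_vector_smult vector_ssub_ldistrib)
    moreover have "y + A j *v w + H j *v - y = A j *v w + H j *v (int l *s b j) - int k *s b j"
    proof -
      have "H j *v - y = - (H j *v y)" by (simp add: matrix_vector_mult_def vec_eq_iff sum_negf)
      then have "y + A j *v w + H j *v - y = A j *v w + (y - H j *v y)" by simp
      then show ?thesis unfolding eq by simp
    qed
    ultimately show ?thesis by simp
  qed
  obtain d :: nat where d: "d > 0" and nt:
    "\<And>r. r > 0 ==> \<exists>e>0. \<forall>\<theta>. card {j\<in>J. cmod (1 - echar (dotp (b j) \<theta>)) < e} > R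
       \<longrightarrow> (\<exists>z x. real d *\<^sub>R \<theta> = ivec z + x \<and> norm x < r)"
    using near_torsion[OF J(1), of b R] gpb by blast
  have "\<exists>C>0. \<forall>j\<in>J. \<forall>x. norm (tmatvec (H j) x) \<le> C * norm x"
  proof -
    have "\<forall>j\<in>J. \<exists>C. \<forall>x. norm (tmatvec (H j) x) \<le> norm x * C"
      using tmatvec_linear linear_conv_bounded_linear bounded_linear.bounded by blast
    then obtain C where C: "\<And>j x. j \<in> J ==> norm (tmatvec (H j) x) \<le> norm x * C j" by metis
    define C0 where "C0 = Max (insert 1 (C ` J))"
    have C0: "C0 \<ge> 1" "\<And>j. j \<in> J ==> C j \<le> C0" using J(1) by (auto simp: C0_def)
    have "norm (tmatvec (H j) x) \<le> C0 * norm x" if "j \<in> J" for j x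
    proof -
      have "norm x * C j \<le> norm x * C0" using C0(2)[OF that] by (intro mult_left_mono) auto
      then show ?thesis using C[OF that, of x] by (simp add: mult.commute)
    qed
    then show ?thesis using C0(1) by (intro exI[of _ C0]) auto
  qed
  then obtain C where C: "C > 0" "\<And>j x. j \<in> J ==> norm (tmatvec (H j) x) \<le> C * norm x" by blast
  \<comment> \<open>Displacement is known for vectors, while cutoffs live on the torus. If
    \<open>x\<close> and \<open>x'\<close> are in the supports and
    \<open>x' - tmatvec (H j) x\<close> is an integer vector, its norm is below
    \<open>r0 + C * r0 = 1\<close>, so it is zero.\<close>
  define r0 where "r0 = 1 / (C + 1)"
  have r0: "r0 > 0" using C(1) by (simp add: r0_def)
  obtain r1 where r1: "r1 > 0" and cut:
    "\<And>(\<phi> :: int ^ 'n) \<delta> r. \<delta> > 0 ==> r > 0 ==> \<exists>f :: complex ^ 'n \<Rightarrow> real. continuous_on torus f \<and>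
      (\<forall>z. 0 \<le> f z \<and> f z \<le> 1) \<and>
      (\<forall>x. norm x < r1 \<longrightarrow> r \<le> norm x \<longrightarrow> 2 * \<delta> * norm x \<le> \<bar>dotp \<phi> x\<bar> \<longrightarrow> f (torus_point x) = 1) \<and>
      (\<forall>y. f (torus_point y) \<noteq> 0 \<longrightarrow> (\<exists>z x. y = ivec z + x \<and> norm x < r0 \<and> x \<noteq> 0 \<and> \<bar>dotp \<phi> x\<bar> \<ge> \<delta> * norm x))"
    by (rule cutoff_exists[OF r0], rule that)
  obtain e where e: "e > 0" and ne: "\<And>\<theta>. card {j\<in>J. cmod (1 - echar (dotp (b j) \<theta>)) < e} > R
       ==> (\<exists>z x. real d *\<^sub>R \<theta> = ivec z + x \<and> norm x < r1)"
    using nt[OF r1] by blast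
  define \<epsilon> where "\<epsilon> = 1 / real n0"
  have \<epsilon>: "\<epsilon> > 0" "\<epsilon> \<le> 1" using n0(2) by (auto simp: \<epsilon>_def)
  have "(\<lambda>N. (2 / (e * real N))\<^sup>2) \<longlonglongrightarrow> 0"
    using e by real_asymp
  then have "eventually (\<lambda>N. (2 / (e * real N))\<^sup>2 < \<epsilon>) sequentially"
    using \<epsilon> by (intro order_tendstoD) auto
  then have "eventually (\<lambda>N. (2 / (e * real N))\<^sup>2 < \<epsilon> \<and> N > 0) sequentially"
    using eventually_gt_at_top[of 0] by eventually_elim auto
  then obtain N where N: "(2 / (e * real N))\<^sup>2 < \<epsilon>" "N > 0"
    using eventually_happens'[OF sequentially_bot] by blast
  define D where "D j = dirichlet N (b j)" for j
  let ?D = "\<lambda>j \<theta>. (cmod (trig_eval (D j) \<theta>))\<^sup>2"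
  have D1: "cmod (trig_eval (D j) \<theta>) \<le> 1" for j \<theta> by (simp add: D_def norm_dirichlet_le_1)
  have Dfar: "?D j \<theta> \<le> \<epsilon>" if "cmod (1 - echar (dotp (b j) \<theta>)) \<ge> e" for j \<theta>
  proof -
    have "?D j \<theta> \<le> (2 / (e * real N))\<^sup>2"
      unfolding D_def by (intro power_mono norm_dirichlet_far that e N(2)) auto
    then show ?thesis using N(1) by simp
  qed
  \<comment> \<open>All group elements that occur when \<open>trig_form\<close> is expanded at
    \<open>D j\<close>: finitely many, and determined before \<open>\<psi>\<close> is
    chosen.\<close>
  define E where "E = (\<lambda>(j, k, l). (A j *v w + H j *v (int l *s b j) - int k *s b j, H j)) ` (J \<times> {..<N} \<times> {..<N})"
  have "finite E" "E \<subseteq> carrier Gn" using J(1) detH by (auto simp: E_def)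
  from approx[OF this, of "\<gamma> / 2"] \<gamma> obtain \<psi> where \<psi>: "posdef Gn \<psi>" "Re (\<psi> (0, mat 1)) \<le> 1"
    "\<And>e. e > 0 ==> finite {v. cmod (\<psi> (v, mat 1)) \<ge> e}" and \<psi>c: "\<And>g. g \<in> E ==> cmod (\<psi> g - c g) < \<gamma> / 2"
    by auto
  define \<rho> where "\<rho> = (\<lambda>v. \<psi> (v, mat 1))"
  have pz: "pos_def_Zn \<rho>" unfolding \<rho>_def by (rule pos_def_Zn_restrict[OF \<psi>(1)])
  have \<rho>0: "0 \<le> Re (\<rho> 0)" "Re (\<rho> 0) \<le> 1"
    using trig_fun_sq_nonneg[OF pz, of "[(1,0)]"] \<psi>(2)
    by (auto simp: \<rho>_def trig_fun_def trig_sq_def trig_mult_def trig_cnj_def)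
  define e1 :: "int ^ 'n" where "e1 = axis undefined 1"
  have e1: "e1 \<noteq> 0" by (simp add: e1_def)
  have de1: "int d *s e1 \<noteq> 0"
  proof
    assume "int d *s e1 = 0"
    then have "(int d *s e1) $ undefined = 0" by (simp only: zero_index)
    then show False using d by (simp add: e1_def axis_def)
  qed
  obtain N' where N': "N' > 0" "cmod (trig_fun \<rho> (trig_sq (dirichlet N' (int d *s e1)))) < \<epsilon>"
    using trig_fun_dirichlet_tendsto[OF _ de1 \<epsilon>(1), of \<rho>] \<psi>(3) unfolding \<rho>_def by blast
  \<comment> \<open>\<open>F\<close> detects the neighbourhood of the \<open>d\<close>-torsion
    points: near them it is at least \<open>1 / 2\<close>, while by Wiener's argument the spectral
    functional gives it a value below \<open>\<epsilon>\<close>.\<close>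
  define F where "F = trig_sq (dirichlet N' (int d *s e1))"
  have F: "trig_eval F \<theta> = of_real ((cmod (trig_eval (dirichlet N' e1) x))\<^sup>2)"
    if "real d *\<^sub>R \<theta> = ivec z + x" for \<theta> x :: "real ^ 'n" and z :: "int ^ 'n"
  proof -
    have "dotp (int d *s e1) \<theta> = dotp e1 (real d *\<^sub>R \<theta>)" by (simp add: dotp_smult dotp_right_scaleR)
    also have "\<dots> = of_int (\<Sum>i\<in>UNIV. e1 $ i * z $ i) + dotp e1 x"
      unfolding that dotp_right_add by (simp add: dotp_def)
    finally have "echar (dotp (int d *s e1) \<theta>) = echar (dotp e1 x)"
      by (simp only: echar_add echar_of_int mult_1)
    then show ?thesis by (simp only: F_def trig_eval_sq trig_eval_dirichlet)
  qed
  have Fnn: "0 \<le> Re (trig_eval F \<theta>)" for \<theta> by (simp add: F_def trig_eval_sq del: of_real_power)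
  obtain r where r: "r > 0" "\<And>x. norm x < r ==> (cmod (trig_eval (dirichlet N' e1) x))\<^sup>2 \<ge> 1 / 2"
  proof -
    have "continuous_on UNIV (\<lambda>x. (cmod (trig_eval (dirichlet N' e1) x))\<^sup>2)"
      unfolding trig_eval_dirichlet echar_def by (intro continuous_intros) (use N' in auto)
    then have "isCont (\<lambda>x. (cmod (trig_eval (dirichlet N' e1) x))\<^sup>2) 0"
      by (simp add: continuous_on_eq_continuous_at)
    moreover have "(cmod (trig_eval (dirichlet N' e1) 0))\<^sup>2 = 1"
      using N'(1) by (simp add: trig_eval_dirichlet dotp_inner)
    ultimately have "\<exists>r>0. \<forall>x. norm x < r \<longrightarrow> \<bar>(cmod (trig_eval (dirichlet N' e1) x))\<^sup>2 - 1\<bar> < 1 / 2"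
      unfolding continuous_at_eps_delta by (auto simp: dist_real_def dest!: spec[of _ "1/2"])
    then obtain r where r: "r > 0" "\<And>x. norm x < r ==> \<bar>(cmod (trig_eval (dirichlet N' e1) x))\<^sup>2 - 1\<bar> < 1 / 2"
      by blast
    have "(cmod (trig_eval (dirichlet N' e1) x))\<^sup>2 \<ge> 1 / 2" if "norm x < r" for x
      using r(2)[OF that] unfolding abs_less_iff by linarith
    then show ?thesis using that r(1) by blast
  qed
  have "\<forall>j\<in>J. \<exists>f :: complex ^ 'n \<Rightarrow> real. continuous_on torus f \<and> (\<forall>z. 0 \<le> f z \<and> f z \<le> 1) \<and>
      (\<forall>x. norm x < r1 \<longrightarrow> r \<le> norm x \<longrightarrow> 2 * \<delta> * norm x \<le> \<bar>dotp (\<phi> j) x\<bar> \<longrightarrow> f (torus_point x) = 1) \<and>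
      (\<forall>y. f (torus_point y) \<noteq> 0 \<longrightarrow> (\<exists>z x. y = ivec z + x \<and> norm x < r0 \<and> x \<noteq> 0 \<and> \<bar>dotp (\<phi> j) x\<bar> \<ge> \<delta> * norm x))"
    using cut[OF \<delta> r(1)] by (intro ballI)
  from bchoice[OF this] obtain f :: "nat \<Rightarrow> complex ^ 'n \<Rightarrow> real" where
    f: "\<forall>j\<in>J. continuous_on torus (f j) \<and> (\<forall>z. 0 \<le> f j z \<and> f j z \<le> 1) \<and>
      (\<forall>x. norm x < r1 \<longrightarrow> r \<le> norm x \<longrightarrow> 2 * \<delta> * norm x \<le> \<bar>dotp (\<phi> j) x\<bar> \<longrightarrow> f j (torus_point x) = 1) \<and>
      (\<forall>y. f j (torus_point y) \<noteq> 0 \<longrightarrow> (\<exists>z x. y = ivec z + x \<and> norm x < r0 \<and> x \<noteq> 0 \<and> \<bar>dotp (\<phi> j) x\<bar> \<ge> \<delta> * norm x))" ..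
  \<comment> \<open>Multiplication by \<open>d\<close> sends all \<open>d\<close>-torsion points to
    the identity, so a single cutoff there handles them simultaneously.\<close>
  define fd where "fd j \<theta> = f j (torus_point (real d *\<^sub>R \<theta>))" for j \<theta>
  have fd01: "0 \<le> fd j \<theta>" "fd j \<theta> \<le> 1" if "j \<in> J" for j \<theta> using f that by (auto simp: fd_def)
  have fd1: "fd j \<theta> = 1" if "j \<in> J" "real d *\<^sub>R \<theta> = ivec z + x" "norm x < r1" "r \<le> norm x"
      "2 * \<delta> * norm x \<le> \<bar>dotp (\<phi> j) x\<bar>" for j \<theta> x and z :: "int ^ 'n"
    using f that unfolding fd_def that(2) torus_point_periodic by blast
  have fdd: "fd j \<theta> * fd j (tmatvec (H j) \<theta>) = 0" if j: "j \<in> J" for j \<theta>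
  proof (rule ccontr)
    assume "\<not> ?thesis"
    then have nz: "f j (torus_point (real d *\<^sub>R \<theta>)) \<noteq> 0" "f j (torus_point (real d *\<^sub>R tmatvec (H j) \<theta>)) \<noteq> 0"
      by (auto simp: fd_def)
    have supp: "\<And>y. f j (torus_point y) \<noteq> 0 ==> (\<exists>z x. y = ivec z + x \<and> norm x < r0 \<and> x \<noteq> 0 \<and> \<bar>dotp (\<phi> j) x\<bar> \<ge> \<delta> * norm x)"
      using f j by blast
    obtain z x where x: "real d *\<^sub>R \<theta> = ivec z + x" "norm x < r0" "x \<noteq> 0" "\<bar>dotp (\<phi> j) x\<bar> \<ge> \<delta> * norm x"
      using supp[OF nz(1)] by blast
    obtain z' x' where x': "real d *\<^sub>R tmatvec (H j) \<theta> = ivec z' + x'" "norm x' < r0" "x' \<noteq> 0" "\<bar>dotp (\<phi> j) x'\<bar> \<ge> \<delta> * norm x'"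
      using supp[OF nz(2)] by blast
    define zz :: "int ^ 'n" where "zz = (\<chi> q. \<Sum>p\<in>UNIV. H j $ p $ q * z $ p) - z'"
    have "real d *\<^sub>R tmatvec (H j) \<theta> = tmatvec (H j) (ivec z) + tmatvec (H j) x"
      using x(1) linear_scale[OF tmatvec_linear] linear_add[OF tmatvec_linear] by metis
    moreover have "tmatvec (H j) (ivec z) = (\<chi> i. of_int ((zz + z') $ i))"
      by (simp add: tmatvec_def zz_def vec_eq_iff)
    ultimately have eq: "x' - tmatvec (H j) x = (ivec zz)"
      using x'(1) by (simp add: vec_eq_iff algebra_simps)
    have "norm (x' - tmatvec (H j) x) \<le> norm x' + norm (tmatvec (H j) x)" by (rule norm_triangle_ineq4)
    also have "\<dots> \<le> norm x' + C * norm x" using C(2)[OF j, of x] by simp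
    also have "\<dots> < r0 + C * r0" using x(2) x'(2) C(1) by (intro add_strict_mono) auto
    also have "\<dots> = (C + 1) * r0" by (simp add: distrib_right)
    also have "\<dots> = 1" using C(1) by (simp add: r0_def)
    finally have lt: "norm (x' - tmatvec (H j) x) < 1" .
    have "zz $ i = 0" for i
    proof -
      have "\<bar>real_of_int (zz $ i)\<bar> < 1"
        using component_le_norm_cart[of "x' - tmatvec (H j) x" i] lt unfolding eq by simp
      then show ?thesis by linarith
    qed
    then have "x' = tmatvec (H j) x" using eq by (simp add: vec_eq_iff)
    then show False using disj[OF j x(3,4)] x'(4) by (simp add: H_def)
  qed
  have "\<forall>j\<in>J. \<exists>p. \<forall>\<theta>. trig_eval p \<theta> \<in> \<real> \<and> \<bar>fd j \<theta> - Re (trig_eval p \<theta>)\<bar> < \<epsilon>"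
  proof
    fix j assume j: "j \<in> J"
    let ?pow = "\<lambda>z :: complex ^ 'n. (\<chi> i. (z $ i) ^ d) :: complex ^ 'n"
    have pow: "?pow (torus_point \<theta>) = torus_point (real d *\<^sub>R \<theta>)" for \<theta> :: "real ^ 'n"
      by (simp add: torus_point_def vec_eq_iff echar_mult_nat)
    have "continuous_on torus (\<lambda>z. f j (?pow z))"
    proof (rule continuous_on_compose2[of torus "f j"])
      show "continuous_on torus (f j)" using f j by blast
      show "continuous_on torus ?pow" by (intro continuous_intros)
      show "?pow ` torus \<subseteq> torus" by (auto simp: torus_def norm_power)
    qed
    from trig_approximation[OF this \<epsilon>(1)] obtain p where
      "\<And>\<theta>. trig_eval p \<theta> \<in> \<real>" "\<And>\<theta>. \<bar>f j (?pow (torus_point \<theta>)) - Re (trig_eval p \<theta>)\<bar> < \<epsilon>" by blast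
    then show "\<exists>p. \<forall>\<theta>. trig_eval p \<theta> \<in> \<real> \<and> \<bar>fd j \<theta> - Re (trig_eval p \<theta>)\<bar> < \<epsilon>"
      unfolding pow fd_def by blast
  qed
  from bchoice[OF this] obtain p where p: "\<forall>j\<in>J. \<forall>\<theta>. trig_eval (p j) \<theta> \<in> \<real> \<and> \<bar>fd j \<theta> - Re (trig_eval (p j) \<theta>)\<bar> < \<epsilon>" ..
  define P where "P j \<theta> = Re (trig_eval (p j) \<theta>)" for j \<theta>
  have P: "trig_eval (p j) \<theta> = of_real (P j \<theta>)" "\<bar>fd j \<theta> - P j \<theta>\<bar> < \<epsilon>" if "j \<in> J" for j \<theta>
    using p that by (auto simp: P_def complex_is_Real_iff complex_eq_iff)
  define q where "q j = trig_sq (trig_mult ((1, 0) # trig_scale (-1) (p j)) (D j))" for j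
  have qe: "trig_eval (q j) \<theta> = of_real (?D j \<theta> * (1 - P j \<theta>)\<^sup>2)" if "j \<in> J" for j \<theta>
  proof -
    have "trig_eval (trig_mult ((1, 0) # trig_scale (-1) (p j)) (D j)) \<theta> = of_real (1 - P j \<theta>) * trig_eval (D j) \<theta>"
      using P(1)[OF that, of \<theta>] by (simp add: trig_eval_mult trig_eval_Cons trig_eval_scale)
    then show ?thesis
      by (simp only: q_def trig_eval_sq norm_mult norm_of_real power_mult_distrib power2_abs mult.commute)
  qed
  \<comment> \<open>Three regions. Where at most \<open>R\<close> of the
    \<open>dotp (b j) \<theta>\<close> are near integers, the other \<open>D j\<close> are small.
    Elsewhere \<open>real d *\<^sub>R \<theta>\<close> lies within \<open>r1\<close> of an integer
    vector: at distance below \<open>r\<close> the term with \<open>F\<close> dominates, and from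
    \<open>r\<close> on all but \<open>R\<close> of the cutoffs equal one.\<close>
  have pointwise: "(\<Sum>j\<in>J. ?D j \<theta> * (1 - P j \<theta>)\<^sup>2) \<le> real R + 4 + 2 * real n0 * Re (trig_eval F \<theta>)" for \<theta>
  proof -
    let ?g = "\<lambda>j. ?D j \<theta> * (1 - fd j \<theta>)\<^sup>2"
    have Dsq: "0 \<le> ?D j \<theta>" "?D j \<theta> \<le> 1" for j
      using D1[of j \<theta>] by (auto simp: power_le_one)
    have fsq: "0 \<le> (1 - fd j \<theta>)\<^sup>2" "(1 - fd j \<theta>)\<^sup>2 \<le> 1" if "j \<in> J" for j
      using fd01[OF that, of \<theta>] by (auto simp: power_le_one)
    have g1: "?g j \<le> 1" if "j \<in> J" for j using Dsq fsq[OF that] by (intro mult_le_one) auto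
    have step: "?D j \<theta> * (1 - P j \<theta>)\<^sup>2 \<le> ?g j + 3 * \<epsilon>" if j: "j \<in> J" for j
    proof -
      have "(1 - P j \<theta>)\<^sup>2 - (1 - fd j \<theta>)\<^sup>2 = (fd j \<theta> - P j \<theta>) * (2 - P j \<theta> - fd j \<theta>)"
        by (simp add: power2_eq_square algebra_simps)
      also have "\<dots> \<le> \<bar>fd j \<theta> - P j \<theta>\<bar> * \<bar>2 - P j \<theta> - fd j \<theta>\<bar>" by (metis abs_ge_self abs_mult)
      also have "\<dots> \<le> \<epsilon> * 3"
        using P(2)[OF j, of \<theta>] fd01[OF j, of \<theta>] \<epsilon> by (intro mult_mono) auto
      finally have "(1 - P j \<theta>)\<^sup>2 \<le> (1 - fd j \<theta>)\<^sup>2 + 3 * \<epsilon>" by simp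
      then have "?D j \<theta> * (1 - P j \<theta>)\<^sup>2
          \<le> ?D j \<theta> * ((1 - fd j \<theta>)\<^sup>2 + 3 * \<epsilon>)"
        by (intro mult_left_mono Dsq(1))
      also have "\<dots> \<le> ?g j + 1 * (3 * \<epsilon>)"
        unfolding distrib_left by (intro add_left_mono mult_right_mono Dsq(2)) (use \<epsilon> in simp)
      finally show ?thesis by simp
    qed
    have main: "sum ?g J \<le> real R + 1 + 2 * real n0 * Re (trig_eval F \<theta>)"
    proof (cases "card {j\<in>J. cmod (1 - echar (dotp (b j) \<theta>)) < e} > R")
      case False
      have "sum ?g J \<le> real R + real (card J) * \<epsilon>"
      proof (rule sum_le_card[OF J(1) g1])
        show "card {j\<in>J. cmod (1 - echar (dotp (b j) \<theta>)) < e} \<le> R" using False by simp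
        show "?g j \<le> \<epsilon>" if "j \<in> J" "\<not> cmod (1 - echar (dotp (b j) \<theta>)) < e" for j
        proof -
          have "?g j \<le> \<epsilon> * 1" using Dfar[of j \<theta>] that fsq[OF that(1)] \<epsilon> by (intro mult_mono) auto
          then show ?thesis by simp
        qed
      qed (use \<epsilon> in auto)
      also have "\<dots> = real R + 1" using n0(2) J(2) by (simp add: \<epsilon>_def)
      finally show ?thesis using Fnn[of \<theta>] by (simp add: add_increasing2)
    next
      case True
      from ne[OF this] obtain z x where zx: "real d *\<^sub>R \<theta> = ivec z + x" "norm x < r1" by blast
      show ?thesis
      proof (cases "norm x < r")
        case True
        have "sum ?g J \<le> (\<Sum>j\<in>J. 1)" using g1 by (intro sum_mono) auto
        also have "\<dots> = real n0" by (simp add: J(2))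
        also have "\<dots> \<le> 2 * real n0 * Re (trig_eval F \<theta>)"
        proof -
          have "Re (trig_eval F \<theta>) \<ge> 1 / 2" using r(2)[OF True] unfolding F[OF zx(1)] by simp
          then have "2 * real n0 * (1 / 2) \<le> 2 * real n0 * Re (trig_eval F \<theta>)" by (intro mult_left_mono) auto
          then show ?thesis by simp
        qed
        finally show ?thesis by simp
      next
        case False
        then have x0: "x \<noteq> 0" using r(1) by auto
        have "sum ?g J \<le> real R + real (card J) * 0"
        proof (rule sum_le_card[OF J(1) g1])
          show "card {j\<in>J. \<bar>dotp (\<phi> j) x\<bar> < 2 * \<delta> * norm x} \<le> R" by (rule gp\<phi>[OF x0])
          show "?g j \<le> 0" if "j \<in> J" "\<not> \<bar>dotp (\<phi> j) x\<bar> < 2 * \<delta> * norm x" for j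
            using fd1[OF that(1) zx] False that(2) by simp
        qed auto
        then show ?thesis using Fnn[of \<theta>] by (simp add: add_increasing2)
      qed
    qed
    have "(\<Sum>j\<in>J. ?D j \<theta> * (1 - P j \<theta>)\<^sup>2) \<le> (\<Sum>j\<in>J. ?g j + 3 * \<epsilon>)"
      by (intro sum_mono step)
    also have "\<dots> = sum ?g J + 3" using J(2) n0(2) by (simp add: sum.distrib \<epsilon>_def)
    finally show ?thesis using main by linarith
  qed
  \<comment> \<open>Positivity of the functional integrates the pointwise bound: the constant
    contributes at most \<open>R + 4\<close> and \<open>F\<close> at most
    \<open>2 * n0 * \<epsilon> = 2\<close>.\<close>
  have total: "(\<Sum>j\<in>J. Re (trig_fun \<rho> (q j))) \<le> real R + 6"
  proof -
    define xs where "xs = sorted_list_of_set J"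
    have xs: "set xs = J" "distinct xs" using J(1) by (auto simp: xs_def)
    have "Re (trig_fun \<rho> (concat (map q xs)))
       \<le> Re (trig_fun \<rho> ((of_real (real R + 4), 0) # trig_scale (of_real (2 * real n0)) F))"
    proof (rule trig_fun_mono[OF pz])
      fix \<theta>
      have "trig_eval (concat (map q xs)) \<theta> = (\<Sum>j\<in>J. trig_eval (q j) \<theta>)"
        by (simp add: trig_eval_concat o_def sum_list_distinct_conv_sum_set xs)
      also have "\<dots> = of_real (\<Sum>j\<in>J. ?D j \<theta> * (1 - P j \<theta>)\<^sup>2)"
        unfolding of_real_sum by (intro sum.cong refl qe)
      finally have 1: "trig_eval (concat (map q xs)) \<theta> = of_real (\<Sum>j\<in>J. ?D j \<theta> * (1 - P j \<theta>)\<^sup>2)" .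
      have Fr: "trig_eval F \<theta> = of_real (Re (trig_eval F \<theta>))"
        unfolding F_def trig_eval_sq by simp
      have 2: "trig_eval ((of_real (real R + 4), 0) # trig_scale (of_real (2 * real n0)) F) \<theta>
          = of_real (real R + 4 + 2 * real n0 * Re (trig_eval F \<theta>))"
        by (subst trig_eval_Cons, subst trig_eval_scale, subst Fr) simp
      show "trig_eval ((of_real (real R + 4), 0) # trig_scale (of_real (2 * real n0)) F) \<theta>
          - trig_eval (concat (map q xs)) \<theta> \<in> \<real>\<^sub>\<ge>\<^sub>0"
        unfolding 1 2 of_real_diff[symmetric] nonneg_Reals_of_real_iff using pointwise[of \<theta>] by simp
    qed
    also have "\<dots> = (real R + 4) * Re (\<rho> 0) + 2 * real n0 * Re (trig_fun \<rho> F)"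
      by (simp add: trig_fun_Cons trig_fun_scale)
    also have "\<dots> \<le> (real R + 4) * 1 + 2 * real n0 * \<epsilon>"
    proof (intro add_mono mult_left_mono)
      show "Re (trig_fun \<rho> F) \<le> \<epsilon>"
        using N'(2) complex_Re_le_cmod[of "trig_fun \<rho> F"] unfolding F_def by linarith
    qed (use \<rho>0 in auto)
    also have "\<dots> = real R + 6" using n0(2) by (simp add: \<epsilon>_def)
    finally have "Re (trig_fun \<rho> (concat (map q xs))) \<le> real R + 6" .
    moreover have "trig_fun \<rho> (concat (map q xs)) = (\<Sum>j\<in>J. trig_fun \<rho> (q j))"
      by (simp add: trig_fun_concat o_def sum_list_distinct_conv_sum_set xs)
    ultimately show ?thesis by simp
  qed
  have "\<exists>j\<in>J. Re (trig_fun \<rho> (q j)) \<le> (real R + 6) / real n0"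
  proof (rule ccontr)
    assume "\<not> ?thesis"
    then have *: "(real R + 6) / real n0 < Re (trig_fun \<rho> (q j))" if "j \<in> J" for j
      using that unfolding bex_simps not_le by (rule bspec)
    have ne0: "J \<noteq> {}" using J n0(2) by auto
    have "(\<Sum>j\<in>J. (real R + 6) / real n0) < (\<Sum>j\<in>J. Re (trig_fun \<rho> (q j)))"
      by (rule sum_strict_mono[OF J(1) ne0 *])
    moreover have "(\<Sum>j\<in>J. (real R + 6) / real n0) = real R + 6" using n0(2) J(2) by simp
    ultimately have "real R + 6 < (\<Sum>j\<in>J. Re (trig_fun \<rho> (q j)))" by (simp only:)
    from less_le_trans[OF this total] show False by simp
  qed
  then obtain j where j: "j \<in> J" "Re (trig_fun \<rho> (q j)) \<le> (real R + 6) / real n0" by (rule bexE)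
  have small: "cmod (trig_form \<psi> (A j *v w, H j) (D j) (D j)) \<le> 3 * sqrt ((real R + 6) / real n0) + 2 / real n0"
  proof (rule trig_form_cutoff[OF \<psi>(1) detH[OF j(1)] \<psi>(2) D1, where P = "p j"])
    show "cmod (trig_eval (p j) \<theta>) \<le> 2" for \<theta>
      using P[OF j(1), of \<theta>] fd01[OF j(1), of \<theta>] \<epsilon> by simp
    show "cmod (trig_eval (p j) \<theta> * trig_eval (p j) (tmatvec (H j) \<theta>)) \<le> 2 / real n0" for \<theta>
    proof -
      have le: "\<bar>P j \<theta>\<bar> \<le> 2" for \<theta> using P(2)[OF j(1), of \<theta>] fd01[OF j(1), of \<theta>] \<epsilon> by linarith
      have "\<bar>P j \<theta>\<bar> * \<bar>P j (tmatvec (H j) \<theta>)\<bar> \<le> 2 * \<epsilon>"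
      proof (cases "fd j \<theta> = 0")
        case True
        then have "\<bar>P j \<theta>\<bar> \<le> \<epsilon>" using P(2)[OF j(1), of \<theta>] by simp
        then have "\<bar>P j \<theta>\<bar> * \<bar>P j (tmatvec (H j) \<theta>)\<bar> \<le> \<epsilon> * 2" using le \<epsilon> by (intro mult_mono) auto
        then show ?thesis by simp
      next
        case False
        then have "fd j (tmatvec (H j) \<theta>) = 0" using fdd[OF j(1), of \<theta>] by simp
        then have "\<bar>P j (tmatvec (H j) \<theta>)\<bar> \<le> \<epsilon>" using P(2)[OF j(1), of "tmatvec (H j) \<theta>"] by simp
        then show ?thesis using le \<epsilon> by (intro mult_mono) auto
      qed
      then show ?thesis by (simp add: P(1)[OF j(1)] norm_mult \<epsilon>_def)
    qed
    show "Re (trig_fun (\<lambda>v. \<psi> (v, mat 1)) (trig_sq (trig_mult ((1, 0) # trig_scale (- 1) (p j)) (D j)))) \<le> (real R + 6) / real n0"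
      using j(2) unfolding q_def \<rho>_def .
  qed
  \<comment> \<open>By \<open>cH\<close> the number \<open>c (w, h)\<close> is the average of
    \<open>c\<close> over the same \<open>N * N\<close> elements over which \<open>trig_form\<close>
    averages \<open>\<psi>\<close>.\<close>
  have "cmod (trig_form \<psi> (A j *v w, H j) (D j) (D j) - c (w, h)) \<le> \<gamma> / 2"
  proof -
    let ?e = "\<lambda>k l. (A j *v w + H j *v (int l *s b j) - int k *s b j, H j)"
    have form: "trig_form \<psi> (A j *v w, H j) (D j) (D j) = (\<Sum>l<N. \<Sum>k<N. \<psi> (?e k l)) / (of_nat N)\<^sup>2"
      by (simp add: trig_form_eq D_def dirichlet_def o_def interv_sum_list_conv_sum_set_nat
          sum_divide_distrib atLeast0LessThan power2_eq_square)
    have const: "c (w, h) = (\<Sum>l<N. \<Sum>k<N. c (?e k l)) / (of_nat N)\<^sup>2"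
      unfolding cH[OF j(1)] using N(2) by (simp add: power2_eq_square)
    have diff: "trig_form \<psi> (A j *v w, H j) (D j) (D j) - c (w, h)
        = (\<Sum>l<N. \<Sum>k<N. \<psi> (?e k l) - c (?e k l)) / (of_nat N)\<^sup>2"
      unfolding form by (subst const) (simp only: sum_subtractf diff_divide_distrib)
    have "cmod (\<Sum>l<N. \<Sum>k<N. \<psi> (?e k l) - c (?e k l)) \<le> (\<Sum>l<N. \<Sum>k<N. \<gamma> / 2)"
    proof (intro sum_norm_le)
      fix l k assume "l \<in> {..<N}" "k \<in> {..<N}"
      then have "?e k l \<in> E" using j(1) by (force simp: E_def)
      from \<psi>c[OF this] show "cmod (\<psi> (?e k l) - c (?e k l)) \<le> \<gamma> / 2" by simp
    qed
    then have "cmod (\<Sum>l<N. \<Sum>k<N. \<psi> (?e k l) - c (?e k l)) / (real N)\<^sup>2 \<le> (\<Sum>l<N. \<Sum>k<N. \<gamma> / 2) / (real N)\<^sup>2"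
      by (rule divide_right_mono) simp
    also have "\<dots> = \<gamma> / 2" using N(2) by (simp add: power2_eq_square)
    finally show ?thesis unfolding diff by (simp add: norm_divide norm_power)
  qed
  then have "\<gamma> \<le> cmod (trig_form \<psi> (A j *v w, H j) (D j) (D j)) + \<gamma> / 2"
    unfolding \<gamma>_def using norm_triangle_sub[of "c (w, h)" "trig_form \<psi> (A j *v w, H j) (D j) (D j)"]
    by (simp add: norm_minus_commute)
  with small n0(1) show False by linarith
qed

subsection \<open>The Hilbert space\<close>

abbreviation (input) "ip \<equiv> ell2_inner"

abbreviation (input) "nrm \<equiv> ell2_norm"

abbreviation (input) "vsc \<equiv> vec_scale"

abbreviation (input) "wot \<equiv> weak_operator_topology"

abbreviation (input) "lreg \<equiv> left_regular"

lemma ell2_iff: "f \<in> ell2 S \<longleftrightarrow> (\<forall>x. x \<notin> S \<longrightarrow> f x = 0) \<and> (\<lambda>x. (cmod (f x))\<^sup>2) summable_on UNIV"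
proof -
  have "(\<lambda>x. (cmod (f x))\<^sup>2) summable_on S \<longleftrightarrow> (\<lambda>x. (cmod (f x))\<^sup>2) summable_on UNIV"
    if "\<forall>x. x \<notin> S \<longrightarrow> f x = 0"
    by (rule summable_on_cong_neutral) (use that in auto)
  then show ?thesis by (auto simp: ell2_def)
qed

lemma ell2_summable: "f \<in> ell2 S ==> (\<lambda>x. (cmod (f x))\<^sup>2) summable_on UNIV"
  by (simp add: ell2_iff)

lemma ell2_outside: "f \<in> ell2 S ==> x \<notin> S ==> f x = 0"
  by (simp add: ell2_iff)

lemma ell2_0 [simp]: "0 \<in> ell2 S"
  by (simp add: ell2_iff)

lemma ip_abs_summable:
  assumes "f \<in> ell2 S" "g \<in> ell2 T"
  shows "(\<lambda>x. norm (f x * cnj (g x))) summable_on UNIV"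
proof (rule abs_summable_product)
  show "(\<lambda>i. norm (f i * f i)) summable_on UNIV"
    using ell2_summable[OF assms(1)] by (simp add: norm_mult power2_eq_square)
  show "(\<lambda>i. norm (cnj (g i) * cnj (g i))) summable_on UNIV"
    using ell2_summable[OF assms(2)] by (simp add: norm_mult power2_eq_square)
qed

lemma ip_summable:
  assumes "f \<in> ell2 S" "g \<in> ell2 T"
  shows "(\<lambda>x. f x * cnj (g x)) summable_on UNIV"
  using ip_abs_summable[OF assms] by (rule abs_summable_summable)

lemma ell2_add [intro]:
  assumes "f \<in> ell2 S" "g \<in> ell2 S" shows "f + g \<in> ell2 S"
proof -
  have "(\<lambda>x. 2 * (cmod (f x))\<^sup>2 + 2 * (cmod (g x))\<^sup>2) summable_on UNIV"
    by (intro summable_on_add summable_on_cmult_right ell2_summable[OF assms(1)] ell2_summable[OF assms(2)])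
  then have "(\<lambda>x. (cmod (f x + g x))\<^sup>2) summable_on UNIV"
  proof (rule summable_on_comparison_test)
    fix x
    have "(cmod (f x + g x))\<^sup>2 \<le> (cmod (f x) + cmod (g x))\<^sup>2"
      by (intro power_mono norm_triangle_ineq) auto
    also have "\<dots> \<le> 2 * (cmod (f x))\<^sup>2 + 2 * (cmod (g x))\<^sup>2"
      using sum_squares_bound[of "cmod (f x)" "cmod (g x)"] by (simp add: power2_sum)
    finally show "(cmod (f x + g x))\<^sup>2 \<le> 2 * (cmod (f x))\<^sup>2 + 2 * (cmod (g x))\<^sup>2" .
  qed auto
  then show ?thesis using assms by (auto simp: ell2_iff)
qed

lemma ell2_scale [intro]: "f \<in> ell2 S ==> vsc c f \<in> ell2 S"
  by (auto simp: ell2_iff vec_scale_def norm_mult power_mult_distrib intro: summable_on_cmult_right)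

lemma vsc_apply [simp]: "vsc c f x = c * f x"
  by (simp add: vec_scale_def)

lemma vsc_simps [simp]: "vsc 1 f = f" "vsc c 0 = 0" "vsc 0 f = 0"
  "vsc a (vsc b f) = vsc (a * b) f"
  by (auto simp: fun_eq_iff mult.assoc)

lemma vsc_add: "vsc c (f + g) = vsc c f + vsc c g"
  by (auto simp: fun_eq_iff algebra_simps)

lemma minus_vsc: "f - g = f + vsc (- 1) (g :: 'a vec2)"
  by (auto simp: fun_eq_iff)

lemma ell2_minus [intro]: "f \<in> ell2 S ==> g \<in> ell2 S ==> f - g \<in> ell2 S"
  unfolding minus_vsc by (intro ell2_add ell2_scale)

lemma ell2_sum [intro]: "(\<And>i. i \<in> A ==> f i \<in> ell2 S) ==> sum f A \<in> ell2 S"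
  by (induction A rule: infinite_finite_induct) auto

lemma ell2_finite_support:
  assumes "finite F" "F \<subseteq> S" "\<And>x. x \<notin> F ==> f x = 0" shows "f \<in> ell2 S"
proof -
  have "(\<lambda>x. (cmod (f x))\<^sup>2) summable_on F" using assms(1) by simp
  also have "?this \<longleftrightarrow> (\<lambda>x. (cmod (f x))\<^sup>2) summable_on UNIV"
    by (rule summable_on_cong_neutral) (use assms(3) in auto)
  finally show ?thesis using assms(2,3) by (auto simp: ell2_iff)
qed

lemma delta_in_ell2 [intro, simp]: "a \<in> S ==> delta a \<in> ell2 S"
  by (rule ell2_finite_support[of "{a}"]) (auto simp: delta_def)

lemma ip_add_left:
  "f \<in> ell2 S ==> g \<in> ell2 S ==> k \<in> ell2 T ==> ip (f + g) k = ip f k + ip g k"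
  unfolding ell2_inner_def
  by (simp add: distrib_right infsum_add ip_summable)

lemma ip_scale_left: "ip (vsc c f) k = c * ip f k"
  unfolding ell2_inner_def by (simp add: mult.assoc infsum_cmult_right')

lemma ip_commute: "ip g f = cnj (ip f g)"
  unfolding ell2_inner_def infsum_cnj[symmetric] by (simp add: mult.commute)

lemma ip_add_right:
  "f \<in> ell2 S ==> g \<in> ell2 S ==> k \<in> ell2 T ==> ip k (f + g) = ip k f + ip k g"
  using ip_add_left[of f S g k T] by (subst (1 2 3) ip_commute) simp

lemma ip_scale_right: "ip k (vsc c f) = cnj c * ip k f"
  by (subst (1 2) ip_commute) (simp add: ip_scale_left)

lemma ip_0 [simp]: "ip 0 f = 0" "ip f 0 = 0"
  by (auto simp: ell2_inner_def)

lemma ip_diff_left: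
  "f \<in> ell2 S ==> g \<in> ell2 S ==> k \<in> ell2 T ==> ip (f - g) k = ip f k - ip g k"
  unfolding minus_vsc by (subst ip_add_left) (auto simp: ip_scale_left)

lemma ip_diff_right:
  "f \<in> ell2 S ==> g \<in> ell2 S ==> k \<in> ell2 T ==> ip k (f - g) = ip k f - ip k g"
  unfolding minus_vsc by (subst ip_add_right) (auto simp: ip_scale_right)

lemma ip_sum_left:
  "(\<And>i. i \<in> A ==> f i \<in> ell2 S) ==> k \<in> ell2 T ==> ip (sum f A) k = (\<Sum>i\<in>A. ip (f i) k)"
  by (induction A rule: infinite_finite_induct) (auto simp: ip_add_left[of _ S _ _ T] ell2_sum)

lemma ip_sum_right:
  "(\<And>i. i \<in> A ==> f i \<in> ell2 S) ==> k \<in> ell2 T ==> ip k (sum f A) = (\<Sum>i\<in>A. ip k (f i))"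
  by (induction A rule: infinite_finite_induct) (auto simp: ip_add_right[of _ S _ _ T] ell2_sum)

lemma nrm_nonneg [simp]: "0 \<le> nrm f"
  unfolding ell2_norm_def by (intro real_sqrt_ge_zero infsum_nonneg) auto

lemma nrm_sq: "(nrm f)\<^sup>2 = (\<Sum>\<^sub>\<infinity>x. (cmod (f x))\<^sup>2)"
  unfolding ell2_norm_def by (simp add: infsum_nonneg)

lemma infsum_complex_of_real: "(\<Sum>\<^sub>\<infinity>x\<in>A. complex_of_real (f x)) = of_real (\<Sum>\<^sub>\<infinity>x\<in>A. f x)"
proof (cases "f summable_on A")
  case True
  then show ?thesis
    by (intro infsumI has_sum_bounded_linear[OF bounded_linear_of_real]) simp
next
  case False
  then have "\<not> (\<lambda>x. complex_of_real (f x)) summable_on A"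
    using summable_on_Re[of "\<lambda>x. complex_of_real (f x)" A] by auto
  then show ?thesis using False by (simp add: infsum_not_exists)
qed

lemma ip_self: "ip f f = of_real ((nrm f)\<^sup>2)"
proof -
  have "ip f f = (\<Sum>\<^sub>\<infinity>x. complex_of_real ((cmod (f x))\<^sup>2))"
    unfolding ell2_inner_def by (simp only: complex_norm_square)
  also have "\<dots> = of_real (\<Sum>\<^sub>\<infinity>x. (cmod (f x))\<^sup>2)"
    by (rule infsum_complex_of_real)
  finally show ?thesis by (simp only: nrm_sq)
qed

lemma ip_cauchy_schwarz:
  assumes "f \<in> ell2 S" "g \<in> ell2 S"
  shows "cmod (ip f g) \<le> nrm f * nrm g"
proof -
  have "\<alpha> * cnj \<alpha> * ip f f + \<beta> * cnj \<beta> * ip g g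
      + \<alpha> * cnj \<beta> * ip f g + \<beta> * cnj \<alpha> * ip g f \<in> \<real>\<^sub>\<ge>\<^sub>0" for \<alpha> \<beta>
  proof -
    have "ip (vsc \<alpha> f + vsc \<beta> g) (vsc \<alpha> f + vsc \<beta> g) \<in> \<real>\<^sub>\<ge>\<^sub>0"
      unfolding ip_self by (simp del: of_real_power)
    also have "ip (vsc \<alpha> f + vsc \<beta> g) (vsc \<alpha> f + vsc \<beta> g)
       = \<alpha> * cnj \<alpha> * ip f f + \<beta> * cnj \<beta> * ip g g
      + \<alpha> * cnj \<beta> * ip f g + \<beta> * cnj \<alpha> * ip g f"
      using assms
      by (simp add: ip_add_left[of _ S _ _ S] ip_add_right[of _ S _ _ S]
          ip_scale_left ip_scale_right ell2_scale ell2_add algebra_simps)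
    finally show ?thesis .
  qed
  from cauchy_schwarz_form(1)[OF this]
  have "(cmod (ip f g))\<^sup>2 \<le> (nrm f * nrm g)\<^sup>2"
    by (simp add: ip_self power_mult_distrib del: of_real_power)
  then show ?thesis by (rule power2_le_imp_le) simp
qed

lemma nrm_triangle:
  assumes "f \<in> ell2 S" "g \<in> ell2 S"
  shows "nrm (f + g) \<le> nrm f + nrm g"
proof -
  have "of_real ((nrm (f + g))\<^sup>2) = ip f f + ip g g + (ip f g + cnj (ip f g))"
    unfolding ip_self[symmetric] using assms
    by (simp add: ip_add_left[of _ S _ _ S] ip_add_right[of _ S _ _ S] ell2_add
        ip_commute[of g f])
  also have "\<dots> = of_real ((nrm f)\<^sup>2 + (nrm g)\<^sup>2 + 2 * Re (ip f g))"
    by (simp add: ip_self complex_add_cnj)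
  finally have "(nrm (f + g))\<^sup>2 = (nrm f)\<^sup>2 + (nrm g)\<^sup>2 + 2 * Re (ip f g)"
    by (simp only: of_real_eq_iff)
  also have "\<dots> \<le> (nrm f + nrm g)\<^sup>2"
    using ip_cauchy_schwarz[OF assms] complex_Re_le_cmod[of "ip f g"]
    by (simp add: power2_sum)
  finally show ?thesis by (rule power2_le_imp_le) simp
qed

lemma nrm_scale: "nrm (vsc c f) = cmod c * nrm f"
proof -
  have "(nrm (vsc c f))\<^sup>2 = (cmod c * nrm f)\<^sup>2"
    unfolding nrm_sq power_mult_distrib
    by (simp add: norm_mult power_mult_distrib infsum_cmult_right')
  then show ?thesis by (rule power2_eq_imp_eq) auto
qed

lemma nrm_0 [simp]: "nrm 0 = 0"
  by (simp add: ell2_norm_def)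

lemma nrm_minus_commute: "nrm (f - g) = nrm (g - f)"
  unfolding ell2_norm_def by (simp add: norm_minus_commute)

lemma nrm_diff_triangle:
  assumes "f \<in> ell2 S" "g \<in> ell2 S" "h \<in> ell2 S"
  shows "nrm (f - h) \<le> nrm (f - g) + nrm (g - h)"
  using nrm_triangle[of "f - g" S "g - h"] assms by (simp add: ell2_minus)

lemma nrm_triangle_diff:
  assumes "f \<in> ell2 S" "g \<in> ell2 S"
  shows "nrm (f - g) \<le> nrm f + nrm g"
  using nrm_diff_triangle[of f S 0 g] assms nrm_minus_commute[of 0 g] by simp

lemma ip_delta_right [simp]: "ip f (delta a) = f a"
proof -
  have "ip f (delta a) = (\<Sum>\<^sub>\<infinity>x\<in>{a}. f x * cnj (delta a x))"
    unfolding ell2_inner_def by (rule infsum_cong_neutral) (auto simp: delta_def)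
  then show ?thesis by (simp add: delta_def)
qed

lemma ip_delta_left [simp]: "ip (delta a) f = cnj (f a)"
  by (subst ip_commute) simp

lemma nrm_delta [simp]: "nrm (delta a) = 1"
proof -
  have "complex_of_real ((nrm (delta a))\<^sup>2) = 1"
    unfolding ip_self[symmetric] ip_delta_right by (simp add: delta_def)
  then have "(nrm (delta a))\<^sup>2 = 1" by (simp only: of_real_eq_1_iff)
  then show ?thesis using nrm_nonneg[of "delta a"] by (auto simp: power2_eq_1_iff)
qed

lemma nrm_component:
  assumes "f \<in> ell2 S" shows "cmod (f x) \<le> nrm f"
proof (cases "x \<in> S")
  case True
  then show ?thesis using ip_cauchy_schwarz[OF assms, of "delta x"] by simp
qed (simp add: ell2_outside[OF assms])

lemma nrm_eq_0_iff: "f \<in> ell2 S ==> nrm f = 0 \<longleftrightarrow> f = 0"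
  using nrm_component[of f S] by (fastforce simp: fun_eq_iff)

lemma ell2_eqI:
  assumes "f \<in> ell2 S" "g \<in> ell2 S" "\<And>x. x \<in> S ==> f x = g x" shows "f = g"
  by (rule ext) (metis assms ell2_outside)

lemma Metric_space_ell2: "Metric_space (ell2 S) (\<lambda>f g. nrm (f - g))"
proof
  show "nrm (f - g) = 0 \<longleftrightarrow> f = g" if "f \<in> ell2 S" "g \<in> ell2 S" for f g
    using nrm_eq_0_iff[OF ell2_minus[OF that]] by (simp add: fun_eq_iff)
  show "nrm (f - h) \<le> nrm (f - g) + nrm (g - h)"
    if "f \<in> ell2 S" "g \<in> ell2 S" "h \<in> ell2 S" for f g h
    by (rule nrm_diff_triangle[OF that])
qed (auto simp: nrm_minus_commute)

lemma finite_sum_le_nrm: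
  assumes "f \<in> ell2 S" "finite F" shows "(\<Sum>x\<in>F. (cmod (f x))\<^sup>2) \<le> (nrm f)\<^sup>2"
  unfolding nrm_sq using ell2_summable[OF assms(1)] assms(2)
  by (intro finite_sum_le_infsum) auto

text \<open>Membership and norm bound come from one finite estimate; restrictions, limits and
  operators given by coordinates are all handled through it.\<close>

lemma ell2_bounded_finite_sums:
  assumes "\<And>x. x \<notin> S ==> f x = 0" "\<And>F. finite F ==> F \<subseteq> S ==> (\<Sum>x\<in>F. (cmod (f x))\<^sup>2) \<le> C\<^sup>2" "C \<ge> 0"
  shows "f \<in> ell2 S" "nrm f \<le> C"
proof -
  have *: "(\<Sum>x\<in>F. (cmod (f x))\<^sup>2) \<le> C\<^sup>2" if "finite F" for F
  proof -
    have "(\<Sum>x\<in>F. (cmod (f x))\<^sup>2) = (\<Sum>x\<in>F \<inter> S. (cmod (f x))\<^sup>2)"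
      using that assms(1) by (intro sum.mono_neutral_right) auto
    then show ?thesis using assms(2)[of "F \<inter> S"] that by simp
  qed
  have "(\<lambda>x. (cmod (f x))\<^sup>2) summable_on UNIV"
    by (rule nonneg_bdd_above_summable_on) (auto intro!: bdd_aboveI2[where M = "C\<^sup>2"] *)
  then show f: "f \<in> ell2 S" using assms(1) by (simp add: ell2_iff)
  have "(nrm f)\<^sup>2 \<le> C\<^sup>2" unfolding nrm_sq
    by (rule infsum_le_finite_sums[OF ell2_summable[OF f]]) (use * in auto)
  then show "nrm f \<le> C" using assms(3) by (rule power2_le_imp_le)
qed

definition restr :: "'a vec2 \<Rightarrow> 'a set \<Rightarrow> 'a vec2" where
  "restr f F = (\<lambda>x. if x \<in> F then f x else 0)"

lemma restr_sum:
  assumes "finite F" shows "restr f F = (\<Sum>x\<in>F. vsc (f x) (delta x))"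
proof
  have ap: "(\<Sum>x\<in>F. vsc (f x) (delta x)) y = (\<Sum>x\<in>F. f x * delta x y)" for y
    using assms by (induction F rule: finite_induct) auto
  show "restr f F y = (\<Sum>x\<in>F. vsc (f x) (delta x)) y" for y
  proof -
    have "(\<Sum>x\<in>F. f x * delta x y) = (\<Sum>x\<in>F. if x = y then f x else 0)"
      by (rule sum.cong) (auto simp: delta_def)
    then show ?thesis unfolding ap using assms by (simp add: restr_def)
  qed
qed

lemma restr_ell2:
  assumes "f \<in> ell2 S" shows "restr f F \<in> ell2 S" "nrm (restr f F) \<le> nrm f"
proof -
  have "(\<Sum>x\<in>G. (cmod (restr f F x))\<^sup>2) \<le> (nrm f)\<^sup>2" if "finite G" for G
  proof -
    have "(\<Sum>x\<in>G. (cmod (restr f F x))\<^sup>2) \<le> (\<Sum>x\<in>G. (cmod (f x))\<^sup>2)"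
      by (rule sum_mono) (auto simp: restr_def)
    then show ?thesis using finite_sum_le_nrm[OF assms that] by linarith
  qed
  from ell2_bounded_finite_sums[of S "restr f F", OF _ this] assms
  show "restr f F \<in> ell2 S" "nrm (restr f F) \<le> nrm f"
    by (auto simp: restr_def ell2_outside)
qed

lemma ell2_finite_approx:
  assumes f: "f \<in> ell2 S" and e: "e > 0"
  obtains F where "finite F" "F \<subseteq> S" "\<And>F'. F \<subseteq> F' ==> F' \<subseteq> S ==> nrm (f - restr f F') < e"
proof -
  have s: "((\<lambda>x. (cmod (f x))\<^sup>2) has_sum (nrm f)\<^sup>2) UNIV"
    unfolding nrm_sq using ell2_summable[OF f] by simp
  from has_sum_finite_approximation[OF s, of "(e / 2)\<^sup>2"] e
  obtain F where F: "finite F" "dist (\<Sum>x\<in>F. (cmod (f x))\<^sup>2) ((nrm f)\<^sup>2) \<le> (e / 2)\<^sup>2" by auto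
  have "nrm (f - restr f F') < e" if F': "F \<inter> S \<subseteq> F'" "F' \<subseteq> S" for F'
  proof -
    have "nrm (f - restr f F') \<le> e / 2"
    proof (rule ell2_bounded_finite_sums(2))
      show "(f - restr f F') x = 0" if "x \<notin> S" for x
        using f that by (auto simp: restr_def ell2_outside)
      fix G :: "'a set" assume G: "finite G"
      have "(\<Sum>x\<in>G. (cmod ((f - restr f F') x))\<^sup>2) = (\<Sum>x\<in>G - F'. (cmod (f x))\<^sup>2)"
        using G by (intro sum.mono_neutral_cong_right) (auto simp: restr_def)
      also have "\<dots> \<le> (\<Sum>x\<in>G - (F \<inter> S). (cmod (f x))\<^sup>2)"
        using G F' by (intro sum_mono2) auto
      also have "\<dots> = (\<Sum>x\<in>G - F. (cmod (f x))\<^sup>2)"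
        using G f by (intro sum.mono_neutral_right) (auto simp: ell2_outside)
      also have "\<dots> + (\<Sum>x\<in>F. (cmod (f x))\<^sup>2) = (\<Sum>x\<in>G \<union> F. (cmod (f x))\<^sup>2)"
        using G F(1) by (metis Un_Diff_cancel2 Diff_disjoint finite_Diff inf_commute sum.union_disjoint)
      then have "(\<Sum>x\<in>G - F. (cmod (f x))\<^sup>2) \<le> (nrm f)\<^sup>2 - (\<Sum>x\<in>F. (cmod (f x))\<^sup>2)"
        using finite_sum_le_nrm[OF f, of "G \<union> F"] G F(1) by simp
      also have "\<dots> \<le> (e / 2)\<^sup>2" using F(2) by (simp add: dist_real_def abs_le_iff)
      finally show "(\<Sum>x\<in>G. (cmod ((f - restr f F') x))\<^sup>2) \<le> (e / 2)\<^sup>2" .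
    qed (use e in simp)
    then show ?thesis using e by simp
  qed
  then show ?thesis using that[of "F \<inter> S"] F(1) by blast
qed

lemma ell2_finite_approx1:
  assumes f: "f \<in> ell2 S" and e: "e > 0"
  obtains F where "finite F" "F \<subseteq> S" "nrm (f - restr f F) < e"
  by (rule ell2_finite_approx[OF assms]) (rule that, assumption, assumption, simp)

text \<open>The coordinates converge, and a bound on finite sums of squares survives the
  coordinatewise limit.\<close>

lemma ell2_complete:
  assumes f: "\<And>n. f n \<in> ell2 S"
    and cauchy: "\<And>e. e > 0 ==> \<exists>N. \<forall>m\<ge>N. \<forall>n\<ge>N. nrm (f m - f n) < e"
  obtains l where "l \<in> ell2 S" "(\<lambda>n. nrm (f n - l)) \<longlonglongrightarrow> 0"
proof -
  have "Cauchy (\<lambda>n. f n x)" for x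
  proof (rule CauchyI)
    fix e :: real assume "e > 0"
    then obtain N where N: "\<And>m n. m \<ge> N ==> n \<ge> N ==> nrm (f m - f n) < e" using cauchy by blast
    have "cmod (f m x - f n x) < e" if "m \<ge> N" "n \<ge> N" for m n
      using nrm_component[OF ell2_minus[OF f f], of m n x] N[OF that] by simp
    then show "\<exists>M. \<forall>m\<ge>M. \<forall>n\<ge>M. cmod (f m x - f n x) < e" by blast
  qed
  then have conv: "(\<lambda>n. f n x) \<longlonglongrightarrow> lim (\<lambda>n. f n x)" for x
    by (simp add: Cauchy_convergent_iff convergent_LIMSEQ_iff)
  define l where "l x = lim (\<lambda>n. f n x)" for x
  have lim: "(\<lambda>n. f n x) \<longlonglongrightarrow> l x" for x using conv by (simp add: l_def)
  have l0: "l x = 0" if "x \<notin> S" for x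
    using lim[of x] by (simp add: ell2_outside[OF f that] LIMSEQ_const_iff)
  have close: "f n - l \<in> ell2 S \<and> nrm (f n - l) \<le> e"
    if N: "\<And>m n. m \<ge> N ==> n \<ge> N ==> nrm (f m - f n) < e" "n \<ge> N" "e > 0" for N n e
  proof -
    have "(\<Sum>x\<in>F. (cmod ((f n - l) x))\<^sup>2) \<le> e\<^sup>2" if F: "finite F" for F
    proof (rule LIMSEQ_le_const2)
      show "(\<lambda>m. \<Sum>x\<in>F. (cmod (f n x - f m x))\<^sup>2) \<longlonglongrightarrow> (\<Sum>x\<in>F. (cmod ((f n - l) x))\<^sup>2)"
        unfolding minus_apply by (intro tendsto_intros lim)
      have "(\<Sum>x\<in>F. (cmod (f n x - f m x))\<^sup>2) \<le> e\<^sup>2" if "m \<ge> N" for m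
      proof -
        have "(\<Sum>x\<in>F. (cmod ((f n - f m) x))\<^sup>2) \<le> (nrm (f n - f m))\<^sup>2"
          by (rule finite_sum_le_nrm[OF ell2_minus[OF f f] F])
        also have "\<dots> \<le> e\<^sup>2" using N(1)[OF N(2) that] by (intro power_mono) auto
        finally show ?thesis by simp
      qed
      then show "\<exists>M. \<forall>m\<ge>M. (\<Sum>x\<in>F. (cmod (f n x - f m x))\<^sup>2) \<le> e\<^sup>2" by blast
    qed
    moreover have "(f n - l) x = 0" if "x \<notin> S" for x using that by (simp add: ell2_outside[OF f that] l0)
    ultimately show ?thesis using ell2_bounded_finite_sums[of S "f n - l" e] N(3) by auto
  qed
  obtain N1 where N1: "\<And>m n. m \<ge> N1 ==> n \<ge> N1 ==> nrm (f m - f n) < 1" using cauchy[of 1] by auto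
  have "f N1 - (f N1 - l) \<in> ell2 S" by (intro ell2_minus f close[OF N1, THEN conjunct1]) auto
  moreover have "f N1 - (f N1 - l) = l" by (simp add: fun_eq_iff)
  ultimately have l: "l \<in> ell2 S" by simp
  have "(\<lambda>n. nrm (f n - l)) \<longlonglongrightarrow> 0"
  proof (rule LIMSEQ_I)
    fix r :: real assume r: "r > 0"
    then obtain N where N: "\<And>m n. m \<ge> N ==> n \<ge> N ==> nrm (f m - f n) < r / 2"
      using cauchy[of "r / 2"] by auto
    have "norm (nrm (f n - l) - 0) < r" if "n \<ge> N" for n
      using close[OF N that] r by auto
    then show "\<exists>no. \<forall>n\<ge>no. norm (nrm (f n - l) - 0) < r" by blast
  qed
  then show ?thesis using that l by blast
qed

subsection \<open>Orthogonal projections\<close>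

lemma ell2_parallelogram:
  assumes "f \<in> ell2 S" "g \<in> ell2 S"
  shows "(nrm (f + g))\<^sup>2 + (nrm (f - g))\<^sup>2 = 2 * (nrm f)\<^sup>2 + 2 * (nrm g)\<^sup>2"
proof -
  have "complex_of_real ((nrm (f + g))\<^sup>2 + (nrm (f - g))\<^sup>2)
     = of_real (2 * (nrm f)\<^sup>2 + 2 * (nrm g)\<^sup>2)"
    unfolding of_real_add of_real_mult ip_self[symmetric] using assms
    by (simp add: ip_add_left[of _ S _ _ S] ip_add_right[of _ S _ _ S]
        ip_diff_left[of _ S _ _ S] ip_diff_right[of _ S _ _ S] ell2_add ell2_minus)
  then show ?thesis by (simp only: of_real_eq_iff)
qed

definition closed_subspace :: "'a set \<Rightarrow> 'a vec2 set \<Rightarrow> bool" where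
  "closed_subspace S K \<longleftrightarrow> K \<subseteq> ell2 S \<and> 0 \<in> K \<and> (\<forall>f\<in>K. \<forall>g\<in>K. f + g \<in> K) \<and>
     (\<forall>c. \<forall>f\<in>K. vsc c f \<in> K) \<and>
     (\<forall>f l. (\<forall>n. f n \<in> K) \<longrightarrow> l \<in> ell2 S \<longrightarrow> (\<lambda>n. nrm (f n - l)) \<longlonglongrightarrow> 0 \<longrightarrow> l \<in> K)"

lemma closed_subspaceD:
  assumes "closed_subspace S K"
  shows "K \<subseteq> ell2 S" "0 \<in> K" "\<And>f g. f \<in> K ==> g \<in> K ==> f + g \<in> K"
    "\<And>c f. f \<in> K ==> vsc c f \<in> K" "\<And>f g. f \<in> K ==> g \<in> K ==> f - g \<in> K"
    "\<And>f l. (\<And>n::nat. f n \<in> K) ==> l \<in> ell2 S ==> (\<lambda>n. nrm (f n - l)) \<longlonglongrightarrow> 0 ==> l \<in> K"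
proof -
  note K = assms[unfolded closed_subspace_def]
  show "K \<subseteq> ell2 S" "0 \<in> K" and add: "\<And>f g. f \<in> K ==> g \<in> K ==> f + g \<in> K"
    and sc: "\<And>c f. f \<in> K ==> vsc c f \<in> K" using K by simp_all
  show "f - g \<in> K" if "f \<in> K" "g \<in> K" for f g
    unfolding minus_vsc by (intro add sc that)
  show "l \<in> K" if "\<And>n::nat. f n \<in> K" "l \<in> ell2 S" "(\<lambda>n. nrm (f n - l)) \<longlonglongrightarrow> 0" for f l
    using K that by blast
qed

text \<open>A minimising sequence for the distance is Cauchy by the parallelogram identity, because
  midpoints stay in \<open>K\<close>.\<close>

lemma orthogonal_projection_exists:
  assumes K: "closed_subspace S K" and f: "f \<in> ell2 S"
  obtains p where "p \<in> K" "\<And>k. k \<in> K ==> ip (f - p) k = 0"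
proof -
  note Ks = closed_subspaceD[OF K]
  have KS: "k \<in> ell2 S" if "k \<in> K" for k using Ks(1) that by auto
  define d where "d = (INF k\<in>K. (nrm (f - k))\<^sup>2)"
  have bdd: "bdd_below ((\<lambda>k. (nrm (f - k))\<^sup>2) ` K)" by (rule bdd_belowI2[where m = 0]) simp
  have d_le: "d \<le> (nrm (f - k))\<^sup>2" if "k \<in> K" for k
    unfolding d_def by (rule cINF_lower[OF bdd that])
  have "\<exists>k\<in>K. (nrm (f - k))\<^sup>2 < d + 1 / real (Suc n)" for n
  proof -
    have "(INF k\<in>K. (nrm (f - k))\<^sup>2) < d + 1 / real (Suc n)" by (simp add: d_def)
    then show ?thesis using Ks(2) bdd by (subst (asm) cINF_less_iff) auto
  qed
  then obtain k where k: "\<And>n. k n \<in> K" "\<And>n. (nrm (f - k n))\<^sup>2 < d + 1 / real (Suc n)" by metis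
  have close: "(nrm (k m - k n))\<^sup>2 \<le> 2 / real (Suc m) + 2 / real (Suc n)" for m n
  proof -
    let ?u = "f - k m" and ?v = "f - k n"
    have uv: "?u \<in> ell2 S" "?v \<in> ell2 S" using f KS k(1) by (auto intro: ell2_minus)
    have mid: "vsc (1/2) (k m + k n) \<in> K" using Ks(3,4) k(1) by auto
    have "?u + ?v = vsc 2 (f - vsc (1/2) (k m + k n))"
      by (auto simp: fun_eq_iff algebra_simps)
    then have "(nrm (?u + ?v))\<^sup>2 = 4 * (nrm (f - vsc (1/2) (k m + k n)))\<^sup>2"
      by (simp add: nrm_scale power_mult_distrib)
    also have "\<dots> \<ge> 4 * d" using d_le[OF mid] by simp
    finally have 1: "4 * d \<le> (nrm (?u + ?v))\<^sup>2" .
    have "?v - ?u = k m - k n" by (auto simp: fun_eq_iff)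
    then have 2: "nrm (?u - ?v) = nrm (k m - k n)" by (metis nrm_minus_commute)
    show ?thesis
      using ell2_parallelogram[OF uv] 1 k(2)[of m] k(2)[of n] unfolding 2 by (simp add: divide_inverse)
  qed
  obtain p where p: "p \<in> ell2 S" "(\<lambda>n. nrm (k n - p)) \<longlonglongrightarrow> 0"
  proof (rule ell2_complete)
    show "k n \<in> ell2 S" for n using KS k(1) by blast
    fix e :: real assume e: "e > 0"
    obtain N where N: "4 / real (Suc N) < e\<^sup>2"
    proof -
      have "(\<lambda>N. 4 / real (Suc N)) \<longlonglongrightarrow> 0" by real_asymp
      then have "eventually (\<lambda>N. 4 / real (Suc N) < e\<^sup>2) sequentially"
        using e by (intro order_tendstoD) auto
      then show ?thesis using that eventually_happens'[OF sequentially_bot] by blast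
    qed
    have "nrm (k m - k n) < e" if "m \<ge> N" "n \<ge> N" for m n
    proof -
      have "2 / real (Suc m) \<le> 2 / real (Suc N)" "2 / real (Suc n) \<le> 2 / real (Suc N)"
        using that by (auto intro!: divide_left_mono)
      then have "(nrm (k m - k n))\<^sup>2 < e\<^sup>2" using close[of m n] N by simp
      then show ?thesis using e by (simp add: power2_less_imp_less)
    qed
    then show "\<exists>N. \<forall>m\<ge>N. \<forall>n\<ge>N. nrm (k m - k n) < e" by blast
  qed
  have pK: "p \<in> K" by (rule Ks(6)[OF k(1) p])
  have min: "(nrm (f - p))\<^sup>2 \<le> d"
  proof -
    have "nrm (f - p) \<le> sqrt (d + 1 / real (Suc n)) + nrm (k n - p)" for n
    proof -
      have "nrm (f - k n) \<le> sqrt (d + 1 / real (Suc n))"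
        using k(2)[of n] by (intro real_le_rsqrt) simp
      then show ?thesis using nrm_diff_triangle[OF f KS[OF k(1)] p(1), of n] by linarith
    qed
    moreover have "(\<lambda>n. sqrt (d + 1 / real (Suc n)) + nrm (k n - p)) \<longlonglongrightarrow> sqrt (d + 0) + 0"
    proof (intro tendsto_intros p(2))
      show "(\<lambda>n. 1 / real (Suc n)) \<longlonglongrightarrow> 0" by real_asymp
    qed
    ultimately have "nrm (f - p) \<le> sqrt (d + 0) + 0"
      by (intro LIMSEQ_le_const[of _ _ "nrm (f - p)"]) auto
    then have "(nrm (f - p))\<^sup>2 \<le> (sqrt d)\<^sup>2" by (intro power_mono) auto
    moreover have "d \<ge> 0" unfolding d_def using Ks(2) by (intro cINF_greatest) auto
    ultimately show ?thesis by simp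
  qed
  have "ip (f - p) q = 0" if q: "q \<in> K" for q
  proof (cases "q = 0")
    case False
    define z where "z = ip (f - p) q"
    have nq: "(nrm q)\<^sup>2 > 0" using nrm_eq_0_iff[OF KS[OF q]] False by simp
    \<comment> \<open>Moving \<open>p\<close> by this multiple of \<open>q\<close> would lower the
      squared distance by \<open>(cmod z)\<^sup>2 / (nrm q)\<^sup>2\<close>, against
      minimality.\<close>
    define c where "c = z / of_real ((nrm q)\<^sup>2)"
    have fp: "f - p \<in> ell2 S" "vsc c q \<in> ell2 S" using f p(1) KS[OF q] by (auto intro: ell2_minus ell2_scale)
    have "p + vsc c q \<in> K" using Ks(3,4) pK q by blast
    from d_le[OF this] have "d \<le> (nrm (f - p - vsc c q))\<^sup>2" by (simp add: diff_diff_add)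
    also have "complex_of_real \<dots> = of_real ((nrm (f - p))\<^sup>2 - (cmod z)\<^sup>2 / (nrm q)\<^sup>2)"
    proof -
      have "complex_of_real ((nrm (f - p - vsc c q))\<^sup>2)
         = ip (f - p) (f - p) - cnj c * z - c * cnj z + c * cnj c * of_real ((nrm q)\<^sup>2)"
        unfolding ip_self[symmetric] z_def using fp KS[OF q]
        by (simp add: ip_diff_left[of _ S _ _ S] ip_diff_right[of _ S _ _ S]
            ell2_minus ip_scale_left ip_scale_right ip_commute[of q "f - p"] del: fp)
           (simp add: algebra_simps)
      also have "c * cnj c * of_real ((nrm q)\<^sup>2) = c * cnj z"
      proof -
        have "complex_of_real ((nrm q)\<^sup>2) \<noteq> 0" using nq by (simp only: of_real_eq_0_iff)
        then show ?thesis by (simp add: c_def del: of_real_power)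
      qed
      also have "cnj c * z = of_real ((cmod z)\<^sup>2 / (nrm q)\<^sup>2)"
        by (simp add: c_def complex_norm_square[symmetric] mult.commute del: of_real_power)
      finally show ?thesis by (simp only: ip_self of_real_diff diff_add_cancel)
    qed
    then have "(nrm (f - p - vsc c q))\<^sup>2 = (nrm (f - p))\<^sup>2 - (cmod z)\<^sup>2 / (nrm q)\<^sup>2"
      by (simp only: of_real_eq_iff)
    finally have "(cmod z)\<^sup>2 / (nrm q)\<^sup>2 \<le> 0" using min by simp
    then have "(cmod z)\<^sup>2 \<le> 0" using nq by (simp add: divide_le_0_iff)
    then show ?thesis by (simp add: z_def)
  qed simp
  then show ?thesis using that pK by blast
qed

subsection \<open>Bounded operators and adjoints\<close>

lemma bopsD:
  assumes "A \<in> bounded_ops S"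
  shows "f \<in> ell2 S ==> A f \<in> ell2 S"
    and "f \<in> ell2 S ==> g \<in> ell2 S ==> A (f + g) = A f + A g"
    and "f \<in> ell2 S ==> A (vsc c f) = vsc c (A f)"
    and "f \<notin> ell2 S ==> A f = 0"
    and "A 0 = 0"
    and "f \<in> ell2 S ==> g \<in> ell2 S ==> A (f - g) = A f - A g"
proof -
  note A = assms[unfolded bounded_ops_def linear_map_on_def mem_Collect_eq]
  show 1: "f \<in> ell2 S ==> A f \<in> ell2 S"
    and 2: "f \<in> ell2 S ==> g \<in> ell2 S ==> A (f + g) = A f + A g"
    and "f \<notin> ell2 S ==> A f = 0" using A by blast+
  show 3: "f \<in> ell2 S ==> A (vsc c f) = vsc c (A f)" for f c using A by blast
  show "A 0 = 0" using 3[of 0 0] by simp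
  show "f \<in> ell2 S ==> g \<in> ell2 S ==> A (f - g) = A f - A g"
    unfolding minus_vsc using A by (simp add: ell2_scale)
qed

lemma bounded_ops_bound:
  assumes "A \<in> bounded_ops S" shows "\<exists>C>0. \<forall>f\<in>ell2 S. nrm (A f) \<le> C * nrm f"
proof -
  obtain C where C: "\<forall>f\<in>ell2 S. nrm (A f) \<le> C * nrm f"
    using assms unfolding bounded_ops_def by blast
  have "nrm (A f) \<le> max C 1 * nrm f" if "f \<in> ell2 S" for f
    using C that mult_right_mono[of C "max C 1" "nrm f"] by fastforce
  then show ?thesis by (intro exI[of _ "max C 1"]) auto
qed

lemma bounded_opsI:
  assumes "\<And>f. f \<in> ell2 S ==> A f \<in> ell2 S"
    and "\<And>f g. f \<in> ell2 S ==> g \<in> ell2 S ==> A (f + g) = A f + A g"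
    and "\<And>c f. f \<in> ell2 S ==> A (vsc c f) = vsc c (A f)"
    and "\<And>f. f \<notin> ell2 S ==> A f = 0"
    and "\<And>f. f \<in> ell2 S ==> nrm (A f) \<le> C * nrm f"
  shows "A \<in> bounded_ops S"
  unfolding bounded_ops_def linear_map_on_def mem_Collect_eq
proof (intro conjI ballI allI impI exI[of _ C])
qed (rule assms, assumption+)+

lemma bounded_ops_sum:
  assumes "A \<in> bounded_ops S" "\<And>i. i \<in> I ==> f i \<in> ell2 S"
  shows "A (sum f I) = (\<Sum>i\<in>I. A (f i))"
  using assms(2)
proof (induction I rule: infinite_finite_induct)
  case (insert i I)
  then have "sum f I \<in> ell2 S" "f i \<in> ell2 S" by (auto intro!: ell2_sum)
  moreover from insert have "A (sum f I) = (\<Sum>i\<in>I. A (f i))" by simp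
  ultimately show ?case by (simp only: sum.insert[OF insert(1,2)] bopsD(2)[OF assms(1)])
next
  case empty
  show ?case by (simp only: sum.empty bopsD(5)[OF assms(1)])
next
  case (infinite I)
  show ?case unfolding sum.infinite[OF infinite(1)] by (rule bopsD(5)[OF assms(1)])
qed

lemma bounded_ops_eqI:
  assumes "A \<in> bounded_ops S" "B \<in> bounded_ops S"
    "\<And>f g. f \<in> ell2 S ==> g \<in> ell2 S ==> ip (A f) g = ip (B f) g"
  shows "A = B"
proof
  fix f
  show "A f = B f"
  proof (cases "f \<in> ell2 S")
    case True
    show ?thesis
    proof (rule ell2_eqI)
      show "A f x = B f x" if "x \<in> S" for x
        using assms(3)[OF True, of "delta x"] that by simp
    qed (rule bopsD(1)[OF assms(1) True] bopsD(1)[OF assms(2) True])+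
  qed (simp add: bopsD(4)[OF assms(1)] bopsD(4)[OF assms(2)])
qed

lemma functional_restrict_vec:
  fixes L :: "'a vec2 \<Rightarrow> complex"
  assumes add: "\<And>f g. f \<in> ell2 S ==> g \<in> ell2 S ==> L (f + g) = L f + L g"
    and scale: "\<And>c f. f \<in> ell2 S ==> L (vsc c f) = c * L f"
    and U: "finite U" "U \<subseteq> S"
  shows "L (restr f U) = (\<Sum>s\<in>U. f s * L (delta s))"
  unfolding restr_sum[OF U(1)] using U
proof (induction U rule: finite_induct)
  case empty
  show ?case using scale[OF ell2_0, of 0] by (simp only: sum.empty vsc_simps mult_zero_left)
next
  case (insert s U)
  have d: "delta s \<in> ell2 S" and U: "U \<subseteq> S" "(\<Sum>s\<in>U. vsc (f s) (delta s)) \<in> ell2 S" using insert.prems by auto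
  show ?case
    by (simp only: sum.insert[OF insert.hyps] add[OF ell2_scale[OF d] U(2)] scale[OF d] insert.IH[OF U(1)])
qed

text \<open>Finite combinations of the \<open>delta s\<close> are dense, and the uniform bound
  \<open>C\<close> controls what is left over.\<close>

lemma functional_tendsto_0:
  fixes L :: "nat \<Rightarrow> 'a vec2 \<Rightarrow> complex"
  assumes add: "\<And>n f g. f \<in> ell2 S ==> g \<in> ell2 S ==> L n (f + g) = L n f + L n g"
    and scale: "\<And>n c f. f \<in> ell2 S ==> L n (vsc c f) = c * L n f"
    and bound: "\<And>n f. f \<in> ell2 S ==> cmod (L n f) \<le> C * nrm f"
    and lim: "\<And>s. s \<in> S ==> (\<lambda>n. L n (delta s)) \<longlonglongrightarrow> 0"
    and f: "f \<in> ell2 S"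
  shows "(\<lambda>n. L n f) \<longlonglongrightarrow> 0"
proof (rule LIMSEQ_I)
  fix e :: real assume e: "e > 0"
  have eC: "e / (2 * (\<bar>C\<bar> + 1)) > 0" using e by (simp add: add_nonneg_pos)
  obtain U where U: "finite U" "U \<subseteq> S" "nrm (f - restr f U) < e / (2 * (\<bar>C\<bar> + 1))"
    by (rule ell2_finite_approx1[OF f eC])
  have "(\<lambda>n. \<Sum>s\<in>U. f s * L n (delta s)) \<longlonglongrightarrow> (\<Sum>s\<in>U. f s * 0)"
    by (intro tendsto_intros lim) (use U(2) in blast)
  then have "(\<lambda>n. \<Sum>s\<in>U. f s * L n (delta s)) \<longlonglongrightarrow> 0" by simp
  from LIMSEQ_D[OF this, of "e / 2"] e obtain n0 where
    n0: "\<And>n. n \<ge> n0 ==> cmod (\<Sum>s\<in>U. f s * L n (delta s)) < e / 2" by auto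
  show "\<exists>no. \<forall>n\<ge>no. norm (L n f - 0) < e"
  proof (intro exI allI impI)
    fix n assume n: "n \<ge> n0"
    have r: "restr f U \<in> ell2 S" by (rule restr_ell2(1)[OF f])
    have "L n f = L n (f - restr f U) + L n (restr f U)" using add[OF ell2_minus[OF f r] r, of n] by simp
    moreover have "cmod (L n (f - restr f U)) < e / 2"
    proof -
      have "cmod (L n (f - restr f U)) \<le> C * nrm (f - restr f U)" by (rule bound[OF ell2_minus[OF f r]])
      also have "\<dots> \<le> (\<bar>C\<bar> + 1) * nrm (f - restr f U)" by (intro mult_right_mono) auto
      also have "\<dots> < e / 2" using U(3) by (simp add: pos_less_divide_eq add_nonneg_pos algebra_simps)
      finally show ?thesis .
    qed
    moreover have "cmod (L n (restr f U)) < e / 2"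
      using n0[OF n] functional_restrict_vec[of S "L n", OF add scale U(1,2)] by simp
    ultimately show "norm (L n f - 0) < e"
      using norm_triangle_ineq[of "L n (f - restr f U)" "L n (restr f U)"] by simp
  qed
qed

lemma functional_eq_0:
  fixes L :: "'a vec2 \<Rightarrow> complex"
  assumes "\<And>f g. f \<in> ell2 S ==> g \<in> ell2 S ==> L (f + g) = L f + L g"
    and "\<And>c f. f \<in> ell2 S ==> L (vsc c f) = c * L f"
    and "\<And>f. f \<in> ell2 S ==> cmod (L f) \<le> C * nrm f"
    and "\<And>s. s \<in> S ==> L (delta s) = 0" and "f \<in> ell2 S"
  shows "L f = 0"
  using functional_tendsto_0[of S "\<lambda>_. L" C f] assms by (simp add: LIMSEQ_const_iff)

text \<open>The Riesz representation in coordinates: the entry of \<open>A f\<close> at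
  \<open>x\<close> has to be \<open>B f (delta x)\<close>. Adjoints and limits of directed sets are
  constructed from it.\<close>

lemma sesquilinear_form_operator:
  assumes add1: "\<And>f f' g. f \<in> ell2 S ==> f' \<in> ell2 S ==> g \<in> ell2 S ==> B (f + f') g = B f g + B f' g"
    and sc1: "\<And>c f g. f \<in> ell2 S ==> g \<in> ell2 S ==> B (vsc c f) g = c * B f g"
    and add2: "\<And>f g g'. f \<in> ell2 S ==> g \<in> ell2 S ==> g' \<in> ell2 S ==> B f (g + g') = B f g + B f g'"
    and sc2: "\<And>c f g. f \<in> ell2 S ==> g \<in> ell2 S ==> B f (vsc c g) = cnj c * B f g"
    and bound: "\<And>f g. f \<in> ell2 S ==> g \<in> ell2 S ==> cmod (B f g) \<le> C * nrm f * nrm g"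
  obtains A where "A \<in> bounded_ops S" "\<And>f g. f \<in> ell2 S ==> g \<in> ell2 S ==> ip (A f) g = B f g"
    "\<And>f. f \<in> ell2 S ==> nrm (A f) \<le> \<bar>C\<bar> * nrm f"
proof -
  define A where "A f = (if f \<in> ell2 S then (\<lambda>x. if x \<in> S then B f (delta x) else 0) else 0)" for f
  have Bsum: "B f (restr g F) = (\<Sum>x\<in>F. cnj (g x) * B f (delta x))"
    if f: "f \<in> ell2 S" and F: "finite F" "F \<subseteq> S" for f g F
  proof -
    have "cnj (B f (restr g F)) = (\<Sum>x\<in>F. g x * cnj (B f (delta x)))"
      by (rule functional_restrict_vec[where L = "\<lambda>g. cnj (B f g)", OF _ _ F]) (simp_all add: add2[OF f] sc2[OF f])
    from arg_cong[of _ _ cnj, OF this] show ?thesis by simp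
  qed
  have A_ell2: "A f \<in> ell2 S \<and> nrm (A f) \<le> \<bar>C\<bar> * nrm f" if f: "f \<in> ell2 S" for f
  proof -
    have "(\<Sum>x\<in>F. (cmod (A f x))\<^sup>2) \<le> (\<bar>C\<bar> * nrm f)\<^sup>2" if F: "finite F" "F \<subseteq> S" for F
    proof -
      define s where "s = (\<Sum>x\<in>F. (cmod (A f x))\<^sup>2)"
      have s0: "s \<ge> 0" unfolding s_def by (intro sum_nonneg) auto
      have Af: "A f x = B f (delta x)" if "x \<in> F" for x using that F f by (auto simp: A_def)
      \<comment> \<open>Testing the form against the truncation of \<open>A f\<close> gives
        \<open>s = B f g\<close> with \<open>nrm g = sqrt s\<close>, so the bound on
        \<open>B\<close> becomes a bound on \<open>sqrt s\<close>.\<close>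
      define g where "g = restr (A f) F"
      have g: "g \<in> ell2 S" unfolding g_def by (rule ell2_finite_support[OF F]) (simp add: restr_def)
      have "B f g = (\<Sum>x\<in>F. cnj (A f x) * A f x)"
        unfolding g_def Bsum[OF f F] by (intro sum.cong refl) (simp add: Af)
      also have "\<dots> = of_real s"
        unfolding s_def of_real_sum by (intro sum.cong refl) (simp only: complex_norm_square mult.commute)
      finally have 1: "B f g = of_real s" .
      have "(nrm g)\<^sup>2 = s"
      proof -
        have "(nrm g)\<^sup>2 = (\<Sum>\<^sub>\<infinity>x\<in>F. (cmod (g x))\<^sup>2)"
          unfolding nrm_sq by (rule infsum_cong_neutral) (auto simp: g_def restr_def)
        then show ?thesis using F(1) by (simp add: s_def g_def restr_def)
      qed
      then have ng: "nrm g = sqrt s" by (metis nrm_nonneg real_sqrt_unique)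
      have "s \<le> C * nrm f * sqrt s" using bound[OF f g] s0 unfolding 1 ng by simp
      also have "\<dots> \<le> \<bar>C\<bar> * nrm f * sqrt s" by (intro mult_right_mono) (use s0 in auto)
      finally have "sqrt s * sqrt s \<le> \<bar>C\<bar> * nrm f * sqrt s" using s0 by simp
      then have "sqrt s \<le> \<bar>C\<bar> * nrm f"
        using s0 by (cases "s = 0") (auto simp: mult_le_cancel_right simp del: real_sqrt_mult_self)
      then have "(sqrt s)\<^sup>2 \<le> (\<bar>C\<bar> * nrm f)\<^sup>2" using s0 by (intro power_mono) auto
      then show ?thesis using s0 by (simp add: s_def)
    qed
    from ell2_bounded_finite_sums[of S "A f", OF _ this] show ?thesis by (auto simp: A_def)
  qed
  have Ain: "ip (A f) g = B f g" if f: "f \<in> ell2 S" and g: "g \<in> ell2 S" for f g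
  proof -
    have Af: "A f \<in> ell2 S" using A_ell2[OF f] ..
    have "cnj (ip (A f) g) - cnj (B f g) = 0"
    proof (rule functional_eq_0[where L = "\<lambda>g. cnj (ip (A f) g) - cnj (B f g)" and C = "nrm (A f) + C * nrm f", OF _ _ _ _ g])
      fix h k c assume h: "h \<in> ell2 S"
      show "cnj (ip (A f) (h + k)) - cnj (B f (h + k)) = cnj (ip (A f) h) - cnj (B f h) + (cnj (ip (A f) k) - cnj (B f k))"
        if k: "k \<in> ell2 S" unfolding ip_add_right[OF h k Af] add2[OF f h k] by simp
      show "cnj (ip (A f) (vsc c h)) - cnj (B f (vsc c h)) = c * (cnj (ip (A f) h) - cnj (B f h))"
        unfolding ip_scale_right sc2[OF f h] by (simp add: algebra_simps)
      show "cmod (cnj (ip (A f) h) - cnj (B f h)) \<le> (nrm (A f) + C * nrm f) * nrm h"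
        unfolding distrib_right
        by (rule order_trans[OF norm_triangle_ineq4 add_mono])
          (simp_all only: complex_mod_cnj ip_cauchy_schwarz[OF Af h] bound[OF f h])
    next
      fix s assume s: "s \<in> S"
      then have "A f s = B f (delta s)" using f by (simp add: A_def)
      then show "cnj (ip (A f) (delta s)) - cnj (B f (delta s)) = 0" by simp
    qed
    then show ?thesis by (simp flip: complex_cnj_diff)
  qed
  have "A \<in> bounded_ops S"
  proof (rule bounded_opsI)
    show "A (f + g) = A f + A g" if "f \<in> ell2 S" "g \<in> ell2 S" for f g
      using that add1 by (auto simp: A_def fun_eq_iff ell2_add)
    show "A (vsc c f) = vsc c (A f)" if "f \<in> ell2 S" for c f
      using that sc1 by (auto simp: A_def fun_eq_iff ell2_scale)
  qed (use A_ell2 in \<open>auto simp: A_def\<close>)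
  then show ?thesis using that Ain A_ell2 by blast
qed

lemma adjoint_exists:
  assumes A: "A \<in> bounded_ops S"
  obtains B where "B \<in> bounded_ops S" "\<And>f g. f \<in> ell2 S ==> g \<in> ell2 S ==> ip (A f) g = ip f (B g)"
proof -
  obtain C where C: "C > 0" "\<And>f. f \<in> ell2 S ==> nrm (A f) \<le> C * nrm f"
    using bounded_ops_bound[OF A] by blast
  note AD = bopsD[OF A]
  obtain B where B: "B \<in> bounded_ops S" "\<And>f g. f \<in> ell2 S ==> g \<in> ell2 S ==> ip (B f) g = ip f (A g)"
  proof (rule sesquilinear_form_operator[of S "\<lambda>f g. ip f (A g)" C])
    show "cmod (ip f (A g)) \<le> C * nrm f * nrm g" if "f \<in> ell2 S" "g \<in> ell2 S" for f g
    proof -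
      have "cmod (ip f (A g)) \<le> nrm f * nrm (A g)"
        by (rule ip_cauchy_schwarz[OF that(1) AD(1)[OF that(2)]])
      also have "\<dots> \<le> nrm f * (C * nrm g)" by (intro mult_left_mono C(2) that) simp
      finally show ?thesis by (simp add: mult_ac)
    qed
  qed (auto simp: AD ip_add_left[of _ S _ _ S] ip_add_right[of _ S _ _ S]
        ip_scale_left ip_scale_right)
  show ?thesis
  proof (rule that[OF B(1)])
    show "ip (A f) g = ip f (B g)" if "f \<in> ell2 S" "g \<in> ell2 S" for f g
      by (subst (1 2) ip_commute) (simp only: B(2)[OF that(2,1)])
  qed
qed

lemma adj_unique:
  assumes "B \<in> bounded_ops S" "\<And>f g. f \<in> ell2 S ==> g \<in> ell2 S ==> ip (A f) g = ip f (B g)"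
  shows "adj S A = B"
  unfolding adj_def
proof (rule the_equality)
  show "B \<in> bounded_ops S \<and> (\<forall>f\<in>ell2 S. \<forall>g\<in>ell2 S. ip (A f) g = ip f (B g))"
    using assms by blast
  fix B' assume B': "B' \<in> bounded_ops S \<and> (\<forall>f\<in>ell2 S. \<forall>g\<in>ell2 S. ip (A f) g = ip f (B' g))"
  show "B' = B"
  proof (rule bounded_ops_eqI)
    show "ip (B' f) g = ip (B f) g" if "f \<in> ell2 S" "g \<in> ell2 S" for f g
    proof -
      have "ip (A g) f = ip g (B' f)" using B' that by blast
      then have "ip g (B' f) = ip g (B f)" using assms(2)[OF that(2,1)] by simp
      then show ?thesis by (subst (1 2) ip_commute) simp
    qed
  qed (use B' assms in auto)
qed

lemma adj_bounded_ops [intro]: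
  assumes "A \<in> bounded_ops S" shows "adj S A \<in> bounded_ops S"
proof -
  obtain B where B: "B \<in> bounded_ops S" "\<And>f g. f \<in> ell2 S ==> g \<in> ell2 S ==> ip (A f) g = ip f (B g)"
    using adjoint_exists[OF assms] by blast
  have "adj S A = B" by (rule adj_unique[OF B])
  then show ?thesis using B(1) by simp
qed

lemma adj_inner:
  assumes "A \<in> bounded_ops S" "f \<in> ell2 S" "g \<in> ell2 S"
  shows "ip (A f) g = ip f (adj S A g)" and "ip (adj S A f) g = ip f (A g)"
proof -
  obtain B where B: "B \<in> bounded_ops S" "\<And>f g. f \<in> ell2 S ==> g \<in> ell2 S ==> ip (A f) g = ip f (B g)"
    using adjoint_exists[OF assms(1)] by blast
  have eq: "adj S A = B" by (rule adj_unique[OF B])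
  show "ip (A f) g = ip f (adj S A g)" unfolding eq by (rule B(2)[OF assms(2,3)])
  show "ip (adj S A f) g = ip f (A g)"
    unfolding eq by (subst (1 2) ip_commute) (simp only: B(2)[OF assms(3,2)])
qed

lemma bounded_ops_add [intro]:
  assumes "A \<in> bounded_ops S" "B \<in> bounded_ops S" shows "A + B \<in> bounded_ops S"
proof -
  obtain C where C: "C > 0" "\<And>f. f \<in> ell2 S ==> nrm (A f) \<le> C * nrm f"
    using bounded_ops_bound[OF assms(1)] by blast
  obtain D where D: "D > 0" "\<And>f. f \<in> ell2 S ==> nrm (B f) \<le> D * nrm f"
    using bounded_ops_bound[OF assms(2)] by blast
  note AD = bopsD[OF assms(1)] and BD = bopsD[OF assms(2)]
  show ?thesis
  proof (rule bounded_opsI[where C = "C + D"])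
    show "nrm ((A + B) f) \<le> (C + D) * nrm f" if "f \<in> ell2 S" for f
      using nrm_triangle[OF AD(1)[OF that] BD(1)[OF that]] C(2)[OF that] D(2)[OF that]
      by (simp add: distrib_right)
  qed (auto simp: AD BD vsc_add)
qed

lemma bounded_ops_comp [intro]:
  assumes "A \<in> bounded_ops S" "B \<in> bounded_ops S" shows "A \<circ> B \<in> bounded_ops S"
proof -
  obtain C where C: "C > 0" "\<And>f. f \<in> ell2 S ==> nrm (A f) \<le> C * nrm f"
    using bounded_ops_bound[OF assms(1)] by blast
  obtain D where D: "D > 0" "\<And>f. f \<in> ell2 S ==> nrm (B f) \<le> D * nrm f"
    using bounded_ops_bound[OF assms(2)] by blast
  note AD = bopsD[OF assms(1)] and BD = bopsD[OF assms(2)]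
  show ?thesis
  proof (rule bounded_opsI[where C = "C * D"])
    show "nrm ((A \<circ> B) f) \<le> (C * D) * nrm f" if "f \<in> ell2 S" for f
    proof -
      have "nrm (A (B f)) \<le> C * nrm (B f)" by (rule C(2)[OF BD(1)[OF that]])
      also have "\<dots> \<le> C * (D * nrm f)" using D(2)[OF that] C(1) by (intro mult_left_mono) auto
      finally show ?thesis by (simp add: mult_ac)
    qed
  qed (auto simp: AD BD)
qed

lemma bounded_ops_scale [intro]:
  assumes "A \<in> bounded_ops S" shows "op_scale c A \<in> bounded_ops S"
proof -
  obtain C where C: "C > 0" "\<And>f. f \<in> ell2 S ==> nrm (A f) \<le> C * nrm f"
    using bounded_ops_bound[OF assms(1)] by blast
  note AD = bopsD[OF assms(1)]
  show ?thesis
  proof (rule bounded_opsI[where C = "cmod c * C"])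
    show "nrm (op_scale c A f) \<le> (cmod c * C) * nrm f" if "f \<in> ell2 S" for f
      using mult_left_mono[OF C(2)[OF that], of "cmod c"] by (simp add: op_scale_def nrm_scale mult_ac)
  qed (auto simp: AD vsc_add op_scale_def mult.commute)
qed

lemma bounded_ops_id [intro]: "op_id S \<in> bounded_ops S"
  by (rule bounded_opsI[where C = 1]) (auto simp: op_id_def)

lemma bounded_ops_0 [intro]: "0 \<in> bounded_ops S"
  by (rule bounded_opsI[where C = 0]) (auto simp: fun_eq_iff)

lemma op_minus_scale: "A - B = A + op_scale (- 1) (B :: 'a op2)"
  by (simp add: fun_eq_iff op_scale_def)

lemma bounded_ops_minus [intro]:
  "A \<in> bounded_ops S ==> B \<in> bounded_ops S ==> A - B \<in> bounded_ops S"
  unfolding op_minus_scale by blast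

lemma bounded_ops_eq_on_delta:
  assumes A: "A \<in> bounded_ops S" and B: "B \<in> bounded_ops S" and eq: "\<And>x. x \<in> S ==> A (delta x) = B (delta x)"
  shows "A = B"
proof (rule bounded_ops_eqI[OF A B])
  fix f g assume f: "f \<in> ell2 S" and g: "g \<in> ell2 S"
  have D: "A - B \<in> bounded_ops S" by (rule bounded_ops_minus[OF A B])
  obtain C where C: "\<forall>f\<in>ell2 S. nrm ((A - B) f) \<le> C * nrm f" using bounded_ops_bound[OF D] by (elim exE conjE)
  have "ip ((A - B) f) g = 0"
  proof (rule functional_eq_0[where L = "\<lambda>f. ip ((A - B) f) g" and C = "C * nrm g", OF _ _ _ _ f])
    fix h k c assume h: "h \<in> ell2 S"
    note Dh = bopsD(1)[OF D h]
    show "ip ((A - B) (h + k)) g = ip ((A - B) h) g + ip ((A - B) k) g" if k: "k \<in> ell2 S"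
      unfolding bopsD(2)[OF D h k] by (rule ip_add_left[OF Dh bopsD(1)[OF D k] g])
    show "ip ((A - B) (vsc c h)) g = c * ip ((A - B) h) g"
      unfolding bopsD(3)[OF D h] by (rule ip_scale_left)
    have "cmod (ip ((A - B) h) g) \<le> nrm ((A - B) h) * nrm g" by (rule ip_cauchy_schwarz[OF Dh g])
    also have "\<dots> \<le> C * nrm h * nrm g" using C h by (intro mult_right_mono) auto
    finally show "cmod (ip ((A - B) h) g) \<le> C * nrm g * nrm h" by (simp only: mult_ac)
  qed (simp add: eq)
  then show "ip (A f) g = ip (B f) g"
    by (simp add: ip_diff_left[OF bopsD(1)[OF A f] bopsD(1)[OF B f] g])
qed

lemma adj_adj: "A \<in> bounded_ops S ==> adj S (adj S A) = A"
  by (rule adj_unique) (auto simp: adj_inner(2))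

lemma adj_id [simp]: "adj S (op_id S) = op_id S"
  by (rule adj_unique[OF bounded_ops_id]) (simp add: op_id_def)

lemma op_id_comp [simp]:
  assumes "A \<in> bounded_ops S" shows "op_id S \<circ> A = A" "A \<circ> op_id S = A"
proof -
  have "A f = 0" if "A f \<notin> ell2 S" for f
    using that bopsD(1,4)[OF assms] by blast
  then show "op_id S \<circ> A = A" by (auto simp: op_id_def o_def)
  have "A f = 0" if "f \<notin> ell2 S" for f using bopsD(4)[OF assms that] .
  then show "A \<circ> op_id S = A" by (auto simp: op_id_def o_def bopsD(5)[OF assms])
qed

subsection \<open>Von Neumann algebras\<close>

lemma topspace_wot [simp]: "topspace (wot S) = bounded_ops S"
proof -
  have "\<exists>f g U. {A \<in> bounded_ops S. ip (A f) g \<in> U} = bounded_ops S \<and> f \<in> ell2 S \<and> g \<in> ell2 S \<and> open U"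
    by (intro exI[of _ 0] exI[of _ UNIV]) auto
  then show ?thesis
    unfolding weak_operator_topology_def topology_generated_by_topspace by blast
qed

lemma continuous_map_wot:
  assumes "f \<in> ell2 S" "g \<in> ell2 S"
  shows "continuous_map (wot S) euclidean (\<lambda>A. ip (A f) g)"
  unfolding continuous_map_def
proof (intro conjI allI impI)
  fix U :: "complex set" assume "openin euclidean U"
  then have "{A \<in> bounded_ops S. ip (A f) g \<in> U} \<in>
      {{A \<in> bounded_ops S. ip (A f) g \<in> U} | f g U. f \<in> ell2 S \<and> g \<in> ell2 S \<and> open U}"
    using assms by auto
  then show "openin (wot S) {A \<in> topspace (wot S). ip (A f) g \<in> U}"
    unfolding topspace_wot unfolding weak_operator_topology_def by (rule topology_generated_by_Basis)
qed simp

lemma limitin_wot: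
  assumes "A \<in> bounded_ops S" "\<And>n. B n \<in> bounded_ops S"
    "\<And>f g. f \<in> ell2 S ==> g \<in> ell2 S ==> ((\<lambda>n. ip (B n f) g) \<longlongrightarrow> ip (A f) g) F"
  shows "limitin (wot S) B A F"
proof -
  let ?\<B> = "{{A \<in> bounded_ops S. ip (A f) g \<in> U} | f g U. f \<in> ell2 S \<and> g \<in> ell2 S \<and> open U}"
  have "\<forall>\<^sub>F n in F. B n \<in> V" if "generate_topology_on ?\<B> V" "A \<in> V" for V
    using that
  proof (induction rule: generate_topology_on.induct)
    case (Int a b)
    then have "\<forall>\<^sub>F n in F. B n \<in> a" "\<forall>\<^sub>F n in F. B n \<in> b" by auto
    then show ?case by eventually_elim simp
  next
    case (UN K)
    then obtain k where k: "k \<in> K" "A \<in> k" by auto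
    then have "\<forall>\<^sub>F n in F. B n \<in> k" using UN by auto
    then show ?case using k(1) by (auto elim: eventually_mono)
  next
    case (Basis s)
    then obtain f g U where s: "s = {A \<in> bounded_ops S. ip (A f) g \<in> U}" "f \<in> ell2 S" "g \<in> ell2 S" "open U"
      by blast
    have "\<forall>\<^sub>F n in F. ip (B n f) g \<in> U"
      by (rule topological_tendstoD[OF assms(3)[OF s(2,3)] s(4)]) (use Basis s(1) in simp)
    then show ?case by (rule eventually_mono) (simp add: s(1) assms(2))
  qed simp
  then show ?thesis
    unfolding limitin_def topspace_wot
    using assms(1) by (auto simp: weak_operator_topology_def openin_topology_generated_by_iff)
qed

text \<open>\<open>F\<close> may be any proper filter. Suprema of directed sets are limits along a
  filter that need not come from a sequence.\<close>

lemma vna_sequentially_closed: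
  assumes P: "von_neumann_algebra S P" and "F \<noteq> bot" "A \<in> bounded_ops S" "\<And>n. B n \<in> P"
    "\<And>f g. f \<in> ell2 S ==> g \<in> ell2 S ==> ((\<lambda>n. ip (B n f) g) \<longlongrightarrow> ip (A f) g) F"
  shows "A \<in> P"
proof -
  have P': "P \<subseteq> bounded_ops S" "closedin (wot S) P"
    using P by (auto simp: von_neumann_algebra_def)
  have "limitin (wot S) B A F"
    by (rule limitin_wot) (use assms P' in auto)
  then show ?thesis
    using limitin_closedin[OF _ P'(2)] assms(2,4) by (metis always_eventually)
qed

lemma closedin_wot_equations:
  assumes "\<And>f g f' g'. (f, g, f', g') \<in> I ==> f \<in> ell2 S \<and> g \<in> ell2 S \<and> f' \<in> ell2 S \<and> g' \<in> ell2 S"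
  shows "closedin (wot S)
    {A \<in> bounded_ops S. \<forall>(f, g, f', g')\<in>I. ip (A f) g = ip (A f') g'}"
proof -
  let ?C = "\<lambda>(f, g, f', g'). {A \<in> bounded_ops S. ip (A f) g = ip (A f') g'}"
  have "closedin (wot S) (?C i)" if "i \<in> I" for i
  proof -
    obtain f g f' g' where i: "i = (f, g, f', g')" by (cases i)
    have m: "f \<in> ell2 S" "g \<in> ell2 S" "f' \<in> ell2 S" "g' \<in> ell2 S" using assms that unfolding i by blast+
    have "closedin (wot S)
        {A \<in> topspace (wot S). ip (A f) g = ip (A f') g'}"
      by (rule closedin_continuous_maps_eq[of euclidean])
         (simp_all add: continuous_map_wot m Hausdorff_space_euclidean)
    then show ?thesis by (simp add: i)
  qed
  moreover have "closedin (wot S) (bounded_ops S)"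
    using closedin_topspace[of "wot S"] by simp
  ultimately have "closedin (wot S) (\<Inter> (insert (bounded_ops S) (?C ` I)))"
    by (intro closedin_Inter) auto
  also have "\<Inter> (insert (bounded_ops S) (?C ` I))
      = {A \<in> bounded_ops S. \<forall>(f, g, f', g')\<in>I. ip (A f) g = ip (A f') g'}"
    by auto
  finally show ?thesis .
qed

lemma vnaD:
  assumes "von_neumann_algebra S P"
  shows "P \<subseteq> bounded_ops S" "op_id S \<in> P" "\<And>A B. A \<in> P ==> B \<in> P ==> A + B \<in> P"
    "\<And>A B. A \<in> P ==> B \<in> P ==> A \<circ> B \<in> P" "\<And>c A. A \<in> P ==> op_scale c A \<in> P"
    "\<And>A. A \<in> P ==> adj S A \<in> P" "\<And>A B. A \<in> P ==> B \<in> P ==> A - B \<in> P" "0 \<in> P"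
    "closedin (wot S) P"
proof -
  note P = assms[unfolded von_neumann_algebra_def]
  show "P \<subseteq> bounded_ops S" "op_id S \<in> P" "closedin (wot S) P"
    and a: "\<And>A B. A \<in> P ==> B \<in> P ==> A + B \<in> P"
    and "\<And>A B. A \<in> P ==> B \<in> P ==> A \<circ> B \<in> P" and s: "\<And>c A. A \<in> P ==> op_scale c A \<in> P"
    and "\<And>A. A \<in> P ==> adj S A \<in> P" using P by blast+
  show m: "\<And>A B. A \<in> P ==> B \<in> P ==> A - B \<in> P" unfolding op_minus_scale by (intro a s)
  show "0 \<in> P" using m[OF \<open>op_id S \<in> P\<close> \<open>op_id S \<in> P\<close>] by simp
qed

lemma vna_sum: "von_neumann_algebra S P ==> (\<And>i. i \<in> I ==> f i \<in> P) ==> sum f I \<in> P"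
  by (induction I rule: infinite_finite_induct) (auto intro: vnaD)

lemma adj_add:
  assumes "A \<in> bounded_ops S" "B \<in> bounded_ops S" shows "adj S (A + B) = adj S A + adj S B"
proof (rule adj_unique)
  show "adj S A + adj S B \<in> bounded_ops S" using assms by blast
  fix f g assume fg: "f \<in> ell2 S" "g \<in> ell2 S"
  note m = bopsD(1)[OF assms(1) fg(1)] bopsD(1)[OF assms(2) fg(1)]
    bopsD(1)[OF adj_bounded_ops[OF assms(1)] fg(2)] bopsD(1)[OF adj_bounded_ops[OF assms(2)] fg(2)]
  show "ip ((A + B) f) g = ip f ((adj S A + adj S B) g)"
    unfolding plus_fun_apply ip_add_left[OF m(1,2) fg(2)] ip_add_right[OF m(3,4) fg(1)]
    by (simp only: adj_inner(1)[OF assms(1) fg] adj_inner(1)[OF assms(2) fg])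
qed

lemma adj_scale:
  assumes "A \<in> bounded_ops S" shows "adj S (op_scale c A) = op_scale (cnj c) (adj S A)"
proof (rule adj_unique)
  show "op_scale (cnj c) (adj S A) \<in> bounded_ops S" using assms by blast
  fix f g assume fg: "f \<in> ell2 S" "g \<in> ell2 S"
  show "ip (op_scale c A f) g = ip f (op_scale (cnj c) (adj S A) g)"
    by (simp add: op_scale_def ip_scale_left ip_scale_right adj_inner(1)[OF assms fg])
qed

lemma von_neumann_algebra_bounded_ops: "von_neumann_algebra S (bounded_ops S)"
  unfolding von_neumann_algebra_def using closedin_topspace[of "wot S"] by auto

lemma von_neumann_algebra_Inter:
  assumes "\<P> \<noteq> {}" "\<And>P. P \<in> \<P> ==> von_neumann_algebra S P"
  shows "von_neumann_algebra S (\<Inter>\<P>)"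
  unfolding von_neumann_algebra_def
proof (intro conjI ballI allI)
  show "closedin (wot S) (\<Inter>\<P>)"
    by (rule closedin_Inter[OF assms(1)]) (rule vnaD(9)[OF assms(2)])
qed (use assms in \<open>auto intro: vnaD\<close>, use assms vnaD(1) in blast)

lemma von_neumann_algebra_generated:
  assumes "X \<subseteq> bounded_ops S" shows "von_neumann_algebra S (vn_generated S X)"
  unfolding vn_generated_def
  by (rule von_neumann_algebra_Inter) (use assms von_neumann_algebra_bounded_ops in auto)

lemma vn_generated_superset: "X \<subseteq> vn_generated S X"
  unfolding vn_generated_def by blast

lemma vn_generated_minimal: "von_neumann_algebra S P ==> X \<subseteq> P ==> vn_generated S X \<subseteq> P"
  unfolding vn_generated_def by blast

definition commutant :: "'a set \<Rightarrow> 'a op2 set \<Rightarrow> 'a op2 set" where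
  "commutant S \<U> = {A \<in> bounded_ops S. \<forall>U\<in>\<U>. \<forall>f\<in>ell2 S. A (U f) = U (A f)}"

text \<open>With the adjoint moved to the second argument, commuting with \<open>U\<close> becomes a
  family of equations between matrix coefficients, which is closed in the weak operator
  topology.\<close>

lemma von_neumann_algebra_commutant:
  assumes \<U>: "\<And>U. U \<in> \<U> ==> U \<in> bounded_ops S" "\<And>U. U \<in> \<U> ==> adj S U \<in> \<U>"
  shows "von_neumann_algebra S (commutant S \<U>)"
proof -
  let ?P = "commutant S \<U>" and ?I = "{(U f, g, f, adj S U g) | U f g. U \<in> \<U> \<and> f \<in> ell2 S \<and> g \<in> ell2 S}"
  have Uf: "U f \<in> ell2 S" "adj S U f \<in> ell2 S" if "U \<in> \<U>" "f \<in> ell2 S" for U f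
    using bopsD(1)[OF \<U>(1) that(2)] \<U>(2) that(1) by blast+
  have Ae: "A f \<in> ell2 S" if "A \<in> ?P" "f \<in> ell2 S" for A f
    using that bopsD(1) unfolding commutant_def by blast
  have eq: "A (U f) = U (A f)" if "A \<in> bounded_ops S" "U \<in> \<U>" "f \<in> ell2 S"
    "\<And>g. g \<in> ell2 S ==> ip (A (U f)) g = ip (A f) (adj S U g)" for A U f
  proof (rule ell2_eqI)
    note Af = bopsD(1)[OF that(1)]
    show "A (U f) \<in> ell2 S" "U (A f) \<in> ell2 S" using Af Uf(1) that(2,3) by blast+
    fix x assume "x \<in> S"
    then have x: "delta x \<in> ell2 S" by simp
    show "A (U f) x = U (A f) x"
      using that(4)[OF x] adj_inner(1)[OF \<U>(1)[OF that(2)] Af[OF that(3)] x] by simp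
  qed
  have "?P = {A \<in> bounded_ops S. \<forall>(f, g, f', g')\<in>?I. ip (A f) g = ip (A f') g'}" (is "_ = ?R")
  proof (intro equalityI subsetI)
    fix A assume "A \<in> ?P"
    then have A: "A \<in> bounded_ops S" "\<And>U f. U \<in> \<U> ==> f \<in> ell2 S ==> A (U f) = U (A f)"
      by (auto simp: commutant_def)
    then show "A \<in> ?R" using adj_inner(1)[OF \<U>(1) bopsD(1)[OF A(1)]] by auto
  next
    fix A assume "A \<in> ?R"
    then have A: "A \<in> bounded_ops S" and "\<And>U f g. U \<in> \<U> ==> f \<in> ell2 S ==> g \<in> ell2 S ==>
       ip (A (U f)) g = ip (A f) (adj S U g)" by (simp, fastforce)
    then show "A \<in> ?P" unfolding commutant_def using eq[OF A] by simp
  qed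
  moreover have "closedin (wot S) ?R"
    by (rule closedin_wot_equations) (use Uf in auto)
  ultimately have "closedin (wot S) ?P" by simp
  moreover have "adj S A \<in> ?P" if A: "A \<in> ?P" for A
  proof -
    have b: "A \<in> bounded_ops S" using A by (simp add: commutant_def)
    have "adj S A (U f) = U (adj S A f)" if U: "U \<in> \<U>" "f \<in> ell2 S" for U f
    proof (rule eq[OF adj_bounded_ops[OF b] U])
      fix g assume g: "g \<in> ell2 S"
      have "A (adj S U g) = adj S U (A g)" using A \<U>(2)[OF U(1)] g unfolding commutant_def by blast
      then show "ip (adj S A (U f)) g = ip (adj S A f) (adj S U g)"
        by (simp only: adj_inner(2)[OF b Uf(1)[OF U] g] adj_inner(2)[OF b U(2) Uf(2)[OF U(1) g]]
            adj_inner(1)[OF \<U>(1)[OF U(1)] U(2) Ae[OF A g]])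
    qed
    then show ?thesis using adj_bounded_ops[OF b] by (simp add: commutant_def)
  qed
  moreover have "op_id S \<in> ?P" using Uf(1) by (auto simp: commutant_def op_id_def bounded_ops_id[unfolded op_id_def])
  moreover have "A + B \<in> ?P" "A \<circ> B \<in> ?P" "op_scale c A \<in> ?P" if P: "A \<in> ?P" "B \<in> ?P" for A B c
  proof -
    have b: "A \<in> bounded_ops S" "B \<in> bounded_ops S" using P by (auto simp: commutant_def)
    have comm: "A' (U f) = U (A' f)" if "A' \<in> ?P" "U \<in> \<U>" "f \<in> ell2 S" for A' U f
      using that unfolding commutant_def by blast
    have "(A + B) (U f) = U ((A + B) f)" "(A \<circ> B) (U f) = U ((A \<circ> B) f)" "op_scale c A (U f) = U (op_scale c A f)"
      if U: "U \<in> \<U>" "f \<in> ell2 S" for U f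
      by (simp_all only: plus_fun_apply o_apply op_scale_def comm[OF P(1) U] comm[OF P(2) U] comm[OF P(1) U(1) Ae[OF P(2) U(2)]]
          bopsD(2)[OF \<U>(1)[OF U(1)] Ae[OF P(1) U(2)] Ae[OF P(2) U(2)]] bopsD(3)[OF \<U>(1)[OF U(1)] Ae[OF P(1) U(2)]])
    then show "A + B \<in> ?P" "A \<circ> B \<in> ?P" "op_scale c A \<in> ?P"
      using bounded_ops_add[OF b] bounded_ops_comp[OF b] bounded_ops_scale[OF b(1)] unfolding commutant_def by blast+
  qed
  ultimately show ?thesis unfolding von_neumann_algebra_def by (auto simp: commutant_def)
qed

definition perm_op :: "'a set \<Rightarrow> ('a \<Rightarrow> 'a) \<Rightarrow> 'a op2" where
  "perm_op S \<pi> = (\<lambda>f. if f \<in> ell2 S then (\<lambda>x. if x \<in> S then f (\<pi> x) else 0) else 0)"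

lemma perm_op:
  assumes \<pi>: "bij_betw \<pi> S S" and \<pi>': "bij_betw \<pi>' S S" and inv: "\<And>x. x \<in> S ==> \<pi>' (\<pi> x) = x" "\<And>x. x \<in> S ==> \<pi> (\<pi>' x) = x"
  shows perm_op_norm: "f \<in> ell2 S ==> nrm (perm_op S \<pi> f) = nrm f"
    and perm_op_bounded: "perm_op S \<pi> \<in> bounded_ops S"
    and perm_op_adj: "adj S (perm_op S \<pi>) = perm_op S \<pi>'"
    and perm_op_delta: "a \<in> S ==> perm_op S \<pi> (delta a) = delta (\<pi>' a)"
proof -
  have 1: "perm_op S \<pi> f \<in> ell2 S" "nrm (perm_op S \<pi> f) = nrm f"
    if \<pi>: "bij_betw \<pi> S S" and f: "f \<in> ell2 S" for f \<pi>
  proof -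
    have eq: "(cmod (perm_op S \<pi> f x))\<^sup>2 = (if x \<in> S then (cmod (f (\<pi> x)))\<^sup>2 else 0)" for x
      using f by (simp add: perm_op_def)
    have "(\<lambda>x. (cmod (f x))\<^sup>2) summable_on S" using f by (simp add: ell2_def)
    then have "(\<lambda>x. (cmod (f (\<pi> x)))\<^sup>2) summable_on S"
      using summable_on_reindex_bij_betw[OF \<pi>, of "\<lambda>x. (cmod (f x))\<^sup>2"] by simp
    then have "(\<lambda>x. (cmod (perm_op S \<pi> f x))\<^sup>2) summable_on S"
      by (rule summable_on_cong[THEN iffD1, rotated]) (simp add: eq)
    then show "perm_op S \<pi> f \<in> ell2 S" by (simp add: ell2_def perm_op_def f)
    have "(\<Sum>\<^sub>\<infinity>x. (cmod (perm_op S \<pi> f x))\<^sup>2) = (\<Sum>\<^sub>\<infinity>x\<in>S. (cmod (f (\<pi> x)))\<^sup>2)"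
      by (rule infsum_cong_neutral) (auto simp: eq)
    also have "\<dots> = (\<Sum>\<^sub>\<infinity>x\<in>S. (cmod (f x))\<^sup>2)"
      by (rule infsum_reindex_bij_betw[OF \<pi>])
    also have "\<dots> = (\<Sum>\<^sub>\<infinity>x. (cmod (f x))\<^sup>2)"
      by (rule infsum_cong_neutral) (auto simp: ell2_outside[OF f])
    finally show "nrm (perm_op S \<pi> f) = nrm f" by (simp add: ell2_norm_def)
  qed
  show "f \<in> ell2 S ==> nrm (perm_op S \<pi> f) = nrm f" by (rule 1(2)[OF \<pi>])
  have b: "perm_op S \<pi> \<in> bounded_ops S" if \<pi>: "bij_betw \<pi> S S" for \<pi>
  proof (rule bounded_opsI[where C = 1])
    show "perm_op S \<pi> (f + g) = perm_op S \<pi> f + perm_op S \<pi> g" if "f \<in> ell2 S" "g \<in> ell2 S" for f g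
      using that ell2_add[OF that] by (simp add: perm_op_def fun_eq_iff)
    show "perm_op S \<pi> (vsc c f) = vsc c (perm_op S \<pi> f)" if "f \<in> ell2 S" for c f
      using that ell2_scale[OF that, of c] by (simp add: perm_op_def fun_eq_iff)
    show "perm_op S \<pi> f = 0" if "f \<notin> ell2 S" for f using that by (simp add: perm_op_def)
  qed (simp_all add: 1[OF \<pi>])
  show "perm_op S \<pi> \<in> bounded_ops S" by (rule b[OF \<pi>])
  show "adj S (perm_op S \<pi>) = perm_op S \<pi>'"
  proof (rule adj_unique[OF b[OF \<pi>']])
    fix f g assume fg: "f \<in> ell2 S" "g \<in> ell2 S"
    have "ip (perm_op S \<pi> f) g = (\<Sum>\<^sub>\<infinity>x\<in>S. f (\<pi> x) * cnj (g (\<pi>' (\<pi> x))))"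
      unfolding ell2_inner_def by (rule infsum_cong_neutral) (auto simp: perm_op_def fg inv)
    also have "\<dots> = (\<Sum>\<^sub>\<infinity>x\<in>S. f x * cnj (g (\<pi>' x)))"
      by (rule infsum_reindex_bij_betw[OF \<pi>])
    also have "\<dots> = ip f (perm_op S \<pi>' g)"
      unfolding ell2_inner_def by (rule infsum_cong_neutral) (auto simp: perm_op_def fg)
    finally show "ip (perm_op S \<pi> f) g = ip f (perm_op S \<pi>' g)" .
  qed
  show "perm_op S \<pi> (delta a) = delta (\<pi>' a)" if a: "a \<in> S"
  proof
    fix x
    have "\<pi>' a \<in> S" using bij_betwE[OF \<pi>'] a by blast
    moreover have "perm_op S \<pi> (delta a) x = (if x \<in> S then delta a (\<pi> x) else 0)"
      using a by (simp add: perm_op_def)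
    moreover have "\<pi> x = a \<longleftrightarrow> x = \<pi>' a" if "x \<in> S" using inv(1)[OF that] inv(2)[OF a] by auto
    ultimately show "perm_op S \<pi> (delta a) x = delta (\<pi>' a) x" by (auto simp: delta_def)
  qed
qed

subsection \<open>Group von Neumann algebras\<close>

definition rreg :: "('a, 'b) monoid_scheme \<Rightarrow> 'a \<Rightarrow> 'a op2" where
  "rreg G s = perm_op (carrier G) (\<lambda>x. x \<otimes>\<^bsub>G\<^esub> s)"

text \<open>The commutant of the right translations. Its elements act as left convolution by the
  vector \<open>A (delta \<one>)\<close>, so membership and positivity questions turn into
  statements about coefficients.\<close>

definition convolvers :: "('a, 'b) monoid_scheme \<Rightarrow> 'a op2 set" where
  "convolvers G = {A \<in> bounded_ops (carrier G).
     \<forall>s\<in>carrier G. \<forall>f\<in>ell2 (carrier G). A (rreg G s f) = rreg G s (A f)}"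

context group
begin

abbreviation (input) "tvec \<equiv> delta \<one>"

lemma lreg_perm: "lreg G g = perm_op (carrier G) (\<lambda>x. inv g \<otimes> x)"
  by (simp add: left_regular_def perm_op_def)

lemma bij_left: "g \<in> carrier G ==> bij_betw (\<lambda>x. g \<otimes> x) (carrier G) (carrier G)"
  by (rule bij_betwI[where g = "\<lambda>x. inv g \<otimes> x"]) (auto simp: m_assoc[symmetric])

lemma bij_right: "g \<in> carrier G ==> bij_betw (\<lambda>x. x \<otimes> g) (carrier G) (carrier G)"
  by (rule bij_betwI[where g = "\<lambda>x. x \<otimes> inv g"]) (auto simp: m_assoc)

lemma
  assumes g: "g \<in> carrier G"
  shows lreg_norm: "f \<in> ell2 (carrier G) ==> nrm (lreg G g f) = nrm f"
    and lreg_bounded: "lreg G g \<in> bounded_ops (carrier G)"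
    and lreg_adj: "adj (carrier G) (lreg G g) = lreg G (inv g)"
    and lreg_delta: "a \<in> carrier G ==> lreg G g (delta a) = delta (g \<otimes> a)"
proof -
  note * = perm_op[OF bij_left bij_left, of "inv g" g]
  have i: "\<And>x. x \<in> carrier G ==> g \<otimes> (inv g \<otimes> x) = x" "\<And>x. x \<in> carrier G ==> inv g \<otimes> (g \<otimes> x) = x"
    using g by (auto simp: m_assoc[symmetric])
  show "f \<in> ell2 (carrier G) ==> nrm (lreg G g f) = nrm f"
    unfolding lreg_perm by (rule *(1)) (use g i in auto)
  show "lreg G g \<in> bounded_ops (carrier G)"
    unfolding lreg_perm by (rule *(2)) (use g i in auto)
  show "adj (carrier G) (lreg G g) = lreg G (inv g)"
  proof -
    have "lreg G (inv g) = perm_op (carrier G) (\<lambda>x. g \<otimes> x)" using g by (simp add: lreg_perm)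
    then show ?thesis unfolding lreg_perm[of g] using *(3) g i by simp
  qed
  show "a \<in> carrier G ==> lreg G g (delta a) = delta (g \<otimes> a)"
    unfolding lreg_perm by (rule *(4)) (use g i in auto)
qed

lemma
  assumes g: "g \<in> carrier G"
  shows rreg_norm: "f \<in> ell2 (carrier G) ==> nrm (rreg G g f) = nrm f"
    and rreg_bounded: "rreg G g \<in> bounded_ops (carrier G)"
    and rreg_adj: "adj (carrier G) (rreg G g) = rreg G (inv g)"
    and rreg_delta: "a \<in> carrier G ==> rreg G g (delta a) = delta (a \<otimes> inv g)"
proof -
  note * = perm_op[OF bij_right bij_right, of g "inv g"]
  have i: "\<And>x. x \<in> carrier G ==> x \<otimes> g \<otimes> inv g = x" "\<And>x. x \<in> carrier G ==> x \<otimes> inv g \<otimes> g = x"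
    using g by (auto simp: m_assoc)
  show "f \<in> ell2 (carrier G) ==> nrm (rreg G g f) = nrm f"
    unfolding rreg_def by (rule *(1)) (use g i in auto)
  show "rreg G g \<in> bounded_ops (carrier G)"
    unfolding rreg_def by (rule *(2)) (use g i in auto)
  show "adj (carrier G) (rreg G g) = rreg G (inv g)"
    unfolding rreg_def by (rule *(3)) (use g i in auto)
  show "a \<in> carrier G ==> rreg G g (delta a) = delta (a \<otimes> inv g)"
    unfolding rreg_def by (rule *(4)) (use g i in auto)
qed

lemma rreg_apply:
  "f \<in> ell2 (carrier G) ==> x \<in> carrier G ==> rreg G g f x = f (x \<otimes> g)"
  by (simp add: rreg_def perm_op_def)

lemma lreg_apply:
  "f \<in> ell2 (carrier G) ==> x \<in> carrier G ==> lreg G g f x = f (inv g \<otimes> x)"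
  by (simp add: left_regular_def)

lemma rreg_inner:
  assumes "s \<in> carrier G" "f \<in> ell2 (carrier G)" "g \<in> ell2 (carrier G)"
  shows "ip (rreg G s f) g = ip f (rreg G (inv s) g)"
  using adj_inner(1)[OF rreg_bounded[OF assms(1)] assms(2,3)] rreg_adj[OF assms(1)] by simp

lemma delta_right: "a \<in> carrier G ==> delta a = rreg G (inv a) tvec"
  by (simp add: rreg_delta)

lemma lreg_one: "lreg G \<one> = op_id (carrier G)"
proof (rule bounded_ops_eq_on_delta)
  show "lreg G \<one> (delta x) = op_id (carrier G) (delta x)" if "x \<in> carrier G" for x
    using that by (simp add: lreg_delta op_id_def)
qed (auto intro: lreg_bounded)

lemma lreg_mult:
  assumes "g \<in> carrier G" "h \<in> carrier G"
  shows "lreg G g \<circ> lreg G h = lreg G (g \<otimes> h)"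
proof (rule bounded_ops_eq_on_delta)
  show "(lreg G g \<circ> lreg G h) (delta x) = lreg G (g \<otimes> h) (delta x)" if "x \<in> carrier G" for x
    using that assms by (simp add: lreg_delta m_assoc)
qed (use assms in \<open>auto intro: lreg_bounded\<close>)

lemma convolversD:
  assumes "A \<in> convolvers G"
  shows "A \<in> bounded_ops (carrier G)"
    "\<And>s f. s \<in> carrier G ==> f \<in> ell2 (carrier G) ==> A (rreg G s f) = rreg G s (A f)"
  using assms by (auto simp: convolvers_def)

lemma von_neumann_algebra_convolvers: "von_neumann_algebra (carrier G) (convolvers G)"
proof -
  have "convolvers G = commutant (carrier G) (rreg G ` carrier G)"
    by (auto simp: convolvers_def commutant_def)
  then show ?thesis
    by (simp only:) (rule von_neumann_algebra_commutant; auto simp: rreg_bounded rreg_adj)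
qed

lemma lreg_convolver:
  assumes "g \<in> carrier G" shows "lreg G g \<in> convolvers G"
proof -
  have "lreg G g \<circ> rreg G s = rreg G s \<circ> lreg G g" if s: "s \<in> carrier G" for s
  proof (rule bounded_ops_eq_on_delta)
    show "(lreg G g \<circ> rreg G s) (delta x) = (rreg G s \<circ> lreg G g) (delta x)"
      if "x \<in> carrier G" for x
      using that s assms by (simp add: lreg_delta rreg_delta m_assoc)
  qed (use s assms in \<open>auto intro: lreg_bounded rreg_bounded\<close>)
  then show ?thesis using lreg_bounded[OF assms] by (auto simp: convolvers_def fun_eq_iff)
qed

lemma subgroup_vna_convolvers: "H \<subseteq> carrier G ==> subgroup_vna G H \<subseteq> convolvers G"
  unfolding subgroup_vna_def
  by (rule vn_generated_minimal[OF von_neumann_algebra_convolvers]) (auto intro: lreg_convolver)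

lemma von_neumann_algebra_subgroup_vna:
  "H \<subseteq> carrier G ==> von_neumann_algebra (carrier G) (subgroup_vna G H)"
  unfolding subgroup_vna_def
  by (rule von_neumann_algebra_generated) (auto intro: lreg_bounded)

lemma subgroup_vna_mono: "H \<subseteq> H' ==> H' \<subseteq> carrier G ==> subgroup_vna G H \<subseteq> subgroup_vna G H'"
  by (rule subset_trans[OF _ vn_generated_minimal[OF von_neumann_algebra_subgroup_vna]])
     (auto simp: subgroup_vna_def intro!: vn_generated_minimal[OF von_neumann_algebra_generated]
       intro: lreg_bounded vn_generated_superset[THEN subsetD])

text \<open>\<open>delta s\<close> is a right translate of \<open>delta \<one>\<close>, and
  \<open>A\<close> commutes with right translations.\<close>

lemma convolver_delta:
  assumes "A \<in> convolvers G" "s \<in> carrier G" "t \<in> carrier G"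
  shows "A (delta s) t = A tvec (t \<otimes> inv s)"
proof -
  have "A (delta s) = rreg G (inv s) (A tvec)"
    using convolversD(2)[OF assms(1), of "inv s" "tvec"] assms(2) by (simp add: delta_right[symmetric])
  then show ?thesis
    using assms bopsD(1)[OF convolversD(1)[OF assms(1)], of "tvec"] by (simp add: rreg_apply)
qed

lemma convolver_adj:
  assumes "A \<in> convolvers G" "g \<in> carrier G"
  shows "adj (carrier G) A tvec g = cnj (A tvec (inv g))"
proof -
  have "adj (carrier G) A tvec g = cnj (A (delta g) \<one>)"
    using adj_inner(2)[OF convolversD(1)[OF assms(1)], of "tvec" "delta g"] assms(2) by simp
  then show ?thesis using convolver_delta[OF assms(1,2) one_closed] assms(2) by simp
qed

text \<open>The inverses arrange that the matrix entries depend on \<open>inv t \<otimes> s\<close>,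
  the shape of the argument in \<open>posdef\<close>.\<close>

lemma convolver_coefficient:
  assumes "A \<in> convolvers G" "s \<in> carrier G" "t \<in> carrier G"
  shows "ip (A (delta (inv s))) (delta (inv t)) = ip (A tvec) (delta (inv t \<otimes> s))"
  using convolver_delta[OF assms(1), of "inv s" "inv t"] assms by simp

lemma trace_norm2_eq:
  assumes "x \<in> bounded_ops (carrier G)" shows "trace_norm2 G x = nrm (x tvec)"
proof -
  have "canonical_trace G (adj (carrier G) x \<circ> x) = ip (x tvec) (x tvec)"
    unfolding canonical_trace_def o_def
    by (rule adj_inner(2)[OF assms]) (auto intro: bopsD(1)[OF assms])
  then show ?thesis by (simp add: trace_norm2_def ip_self del: of_real_power)
qed

end

subsection \<open>Moment functionals\<close>

text \<open>The integral of \<open>p\<close> against a measure, expressed through the moments alone.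
  It supplies the part of spectral theory that operator matrices need below.\<close>

definition moment :: "(nat \<Rightarrow> real) \<Rightarrow> real poly \<Rightarrow> real" where
  "moment \<mu> p = (\<Sum>n\<le>degree p. coeff p n * \<mu> n)"

lemma moment_eq:
  assumes "degree p \<le> N" shows "moment \<mu> p = (\<Sum>n\<le>N. coeff p n * \<mu> n)"
  unfolding moment_def
  by (rule sum.mono_neutral_left) (use assms in \<open>auto simp: coeff_eq_0\<close>)

lemma moment_add: "moment \<mu> (p + q) = moment \<mu> p + moment \<mu> q"
  by (subst (1 2 3) moment_eq[of _ "max (degree p) (degree q)"])
     (auto intro: degree_add_le simp: algebra_simps sum.distrib)

lemma moment_smult: "moment \<mu> (smult c p) = c * moment \<mu> p"
  by (subst (1 2) moment_eq[of _ "degree p"])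
     (auto intro: degree_smult_le simp: sum_distrib_left mult_ac)

lemma moment_diff: "moment \<mu> (p - q) = moment \<mu> p - moment \<mu> q"
  using moment_add[of \<mu> p "smult (-1) q"] unfolding moment_smult by simp

lemma moment_0 [simp]: "moment \<mu> 0 = 0"
  by (simp add: moment_def)

lemma moment_sum: "moment \<mu> (sum f A) = (\<Sum>i\<in>A. moment \<mu> (f i))"
  by (induction A rule: infinite_finite_induct) (auto simp: moment_add)

lemma moment_monom: "moment \<mu> (monom c n) = c * \<mu> n"
proof -
  have "moment \<mu> (monom c n) = (\<Sum>k\<le>n. if k = n then c * \<mu> n else 0)"
    unfolding moment_eq[OF degree_monom_le] by (rule sum.cong) auto
  then show ?thesis by simp
qed

lemma moment_mult:
  "moment \<mu> (p * q) = (\<Sum>i\<le>degree p. \<Sum>j\<le>degree q. coeff p i * coeff q j * \<mu> (i + j))"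
proof -
  have "p * q = (\<Sum>i\<le>degree p. monom (coeff p i) i) * (\<Sum>j\<le>degree q. monom (coeff q j) j)"
    by (simp only: poly_as_sum_of_monoms)
  also have "\<dots> = (\<Sum>i\<le>degree p. \<Sum>j\<le>degree q. monom (coeff p i * coeff q j) (i + j))"
    by (simp add: sum_product mult_monom)
  finally show ?thesis by (simp add: moment_sum moment_monom)
qed

text \<open>The moments of a positive measure on the unit interval.\<close>

definition interval_moments :: "(nat \<Rightarrow> real) \<Rightarrow> bool" where
  "interval_moments \<mu> \<longleftrightarrow> (\<forall>q. 0 \<le> moment \<mu> (q * q) \<and>
     0 \<le> moment \<mu> ([:0, 1:] * (q * q)) \<and> 0 \<le> moment \<mu> ([:1, -1:] * (q * q)))"

text \<open>Squares can be split off, leaving each factor at most once. The mixed product is reduced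
  by multiplying with \<open>t + s = 1\<close>, where \<open>t\<close> and \<open>s\<close> are the
  two linear factors: \<open>t s\<close> becomes \<open>s\<close> times a square plus
  \<open>t\<close> times a square.\<close>

lemma interval_moments_power_nonneg:
  assumes "interval_moments \<mu>"
  shows "0 \<le> moment \<mu> ([:0, 1:] ^ l * [:1, -1:] ^ r)"
proof -
  let ?t = "[:0, 1:] :: real poly" and ?s = "[:1, -1:] :: real poly"
  note pos = assms[unfolded interval_moments_def, rule_format]
  define q where "q = ?t ^ (l div 2) * ?s ^ (r div 2)"
  have l: "?t ^ l = (if even l then 1 else ?t) * (?t ^ (l div 2) * ?t ^ (l div 2))"
    by (cases "even l") (auto simp flip: power_add mult_2 power_Suc)
  have r: "?s ^ r = (if even r then 1 else ?s) * (?s ^ (r div 2) * ?s ^ (r div 2))"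
    by (cases "even r") (auto simp flip: power_add mult_2 power_Suc)
  have eq: "?t ^ l * ?s ^ r = (if even l then 1 else ?t) * (if even r then 1 else ?s) * (q * q)"
    unfolding l r q_def by (simp only: mult_ac)
  consider "even l" "even r" | "odd l" "even r" | "even l" "odd r" | "odd l" "odd r" by blast
  then show ?thesis
  proof cases
    case 4
    have ts: "?t + ?s = 1" by simp
    have "?t * ?s * (q * q) = (?t + ?s) * (?t * ?s * (q * q))" unfolding ts by simp
    also have "\<dots> = ?s * ((?t * q) * (?t * q)) + ?t * ((?s * q) * (?s * q))"
      by (simp only: distrib_right distrib_left mult_ac)
    finally have "?t ^ l * ?s ^ r = ?s * ((?t * q) * (?t * q)) + ?t * ((?s * q) * (?s * q))"
      using 4 unfolding eq by simp
    then show ?thesis using pos[of "?t * q"] pos[of "?s * q"] by (simp only: moment_add) simp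
  qed (use pos[of q] eq in simp_all)
qed

definition bernstein_poly :: "nat \<Rightarrow> nat \<Rightarrow> real poly" where
  "bernstein_poly m j = smult (of_nat (m choose j)) ([:0, 1:] ^ j * [:1, -1:] ^ (m - j))"

lemma poly_bernstein: "poly (bernstein_poly m j) x = Bernstein m j x"
  by (simp add: bernstein_poly_def Bernstein_def)

text \<open>The Bernstein approximant of the positive part of \<open>2 x - 1\<close>. The break
  point is \<open>1 / 2\<close> because operator matrices are rescaled to the unit interval with
  zero moved there.\<close>

definition positive_part_poly :: "nat \<Rightarrow> real poly" where
  "positive_part_poly m = (\<Sum>j\<le>m. smult (max 0 (2 * real j / real m - 1)) (bernstein_poly m j))"

definition negative_part_poly :: "nat \<Rightarrow> real poly" where
  "negative_part_poly m = (\<Sum>j\<le>m. smult (max 0 (1 - 2 * real j / real m)) (bernstein_poly m j))"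

text \<open>The coefficients differ by \<open>2 * j / m - 1\<close>, and Bernstein approximation
  reproduces affine functions.\<close>

lemma part_poly_diff:
  assumes "m > 0" shows "positive_part_poly m - negative_part_poly m = [:-1, 2:]"
proof (rule poly_eq_poly_eq_iff[THEN iffD1], rule ext)
  fix x
  have "poly (positive_part_poly m - negative_part_poly m) x
      = (\<Sum>j\<le>m. (max 0 (2 * real j / real m - 1) - max 0 (1 - 2 * real j / real m)) * Bernstein m j x)"
    by (simp add: positive_part_poly_def negative_part_poly_def poly_sum poly_bernstein sum_subtractf left_diff_distrib)
  also have "\<dots> = (\<Sum>j\<le>m. 2 / real m * (real j * Bernstein m j x) - Bernstein m j x)"
    by (rule sum.cong) (auto simp: max_def algebra_simps)
  also have "\<dots> = 2 / real m * (\<Sum>j\<le>m. real j * Bernstein m j x) - (\<Sum>j\<le>m. Bernstein m j x)"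
    by (simp only: sum_subtractf sum_distrib_left)
  also have "\<dots> = poly [:-1, 2:] x" unfolding sum_k_Bernstein sum_Bernstein using assms by simp
  finally show "poly (positive_part_poly m - negative_part_poly m) x = poly [:-1, 2:] x" .
qed

lemma bernstein_nonneg: "interval_moments \<mu> ==> 0 \<le> moment \<mu> (bernstein_poly m j)"
  unfolding bernstein_poly_def moment_smult
  by (intro mult_nonneg_nonneg interval_moments_power_nonneg) auto

lemma bernstein_mult_nonneg:
  assumes "interval_moments \<mu>" shows "0 \<le> moment \<mu> (bernstein_poly m i * bernstein_poly m j)"
proof -
  have "bernstein_poly m i * bernstein_poly m j
      = smult (of_nat (m choose i) * of_nat (m choose j)) ([:0, 1:] ^ (i + j) * [:1, -1:] ^ (m - i + (m - j)))"
    unfolding bernstein_poly_def power_add by (simp add: mult_ac)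
  then show ?thesis
    unfolding moment_smult
    by (auto simp only: moment_smult intro!: mult_nonneg_nonneg interval_moments_power_nonneg[OF assms])
qed

lemma part_poly_nonneg:
  assumes "interval_moments \<mu>"
  shows "0 \<le> moment \<mu> (positive_part_poly m)" "0 \<le> moment \<mu> (negative_part_poly m)"
  unfolding positive_part_poly_def negative_part_poly_def moment_sum moment_smult
  by (intro sum_nonneg mult_nonneg_nonneg bernstein_nonneg[OF assms] max.cobounded1)+

text \<open>
  Since \<open>max 0 (2x - 1) \<cdot> max 0 (1 - 2y) \<le> (x - y)\<^sup>2\<close>, the product of the two parts is dominated by the
  variance of the Bernstein approximation.
\<close>

lemma part_poly_product_le:
  assumes \<mu>: "interval_moments \<mu>" and m: "m > 0"
  shows "moment \<mu> (positive_part_poly m * negative_part_poly m) \<le> 2 * \<mu> 0 / real m"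
proof -
  let ?b = "bernstein_poly m" and ?L = "moment \<mu>" and ?r = "\<lambda>i::nat. real i / real m"
  have "positive_part_poly m * negative_part_poly m = (\<Sum>i\<le>m. \<Sum>j\<le>m.
      smult (max 0 (2 * real i / real m - 1) * max 0 (1 - 2 * real j / real m)) (?b i * ?b j))"
    unfolding positive_part_poly_def negative_part_poly_def sum_product
    by (intro sum.cong refl) (simp add: mult_ac)
  then have "?L (positive_part_poly m * negative_part_poly m) = (\<Sum>i\<le>m. \<Sum>j\<le>m.
      (max 0 (2 * real i / real m - 1) * max 0 (1 - 2 * real j / real m)) * ?L (?b i * ?b j))"
    by (simp only: moment_sum moment_smult)
  also have "\<dots> \<le> (\<Sum>i\<le>m. \<Sum>j\<le>m. (?r i - ?r j)\<^sup>2 * ?L (?b i * ?b j))"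
  proof (intro sum_mono mult_right_mono bernstein_mult_nonneg[OF \<mu>])
    fix i j
    define x where "x = real i / real m"
    define y where "y = real j / real m"
    \<comment> \<open>The inequality \<open>4 * u * v \<le> (u + v)\<^sup>2\<close> for
      \<open>u = 2 * x - 1\<close> and \<open>v = 1 - 2 * y\<close>, whose sum is
      \<open>2 * (x - y)\<close>.\<close>
    have key: "max 0 (2 * x - 1) * max 0 (1 - 2 * y) \<le> (x - y)\<^sup>2"
    proof (cases "2 * x - 1 \<ge> 0 \<and> 1 - 2 * y \<ge> 0")
      case True
      have "0 \<le> ((2 * x - 1) - (1 - 2 * y))\<^sup>2" by simp
      then have "(2 * x - 1) * (1 - 2 * y) \<le> (x - y)\<^sup>2" by (simp add: power2_eq_square algebra_simps)
      then show ?thesis using True by (simp add: max_def)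
    qed (auto simp: max_def)
    show "max 0 (2 * real i / real m - 1) * max 0 (1 - 2 * real j / real m) \<le> (?r i - ?r j)\<^sup>2"
      using key by (simp add: x_def y_def)
  qed
  also have "\<dots> = ?L (\<Sum>i\<le>m. \<Sum>j\<le>m. smult ((?r i - ?r j)\<^sup>2) (?b i * ?b j))"
    by (simp only: moment_sum moment_smult)
  \<comment> \<open>The mean squared difference of two independent copies is twice the variance, and
    the Bernstein weights have variance \<open>x * (1 - x) / m\<close>.\<close>
  also have "(\<Sum>i\<le>m. \<Sum>j\<le>m. smult ((?r i - ?r j)\<^sup>2) (?b i * ?b j)) = smult (2 / real m) ([:0, 1:] * [:1, -1:])"
  proof (rule poly_eq_poly_eq_iff[THEN iffD1], rule ext)
    fix x
    let ?B = "\<lambda>i. Bernstein m i x"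
    have S0: "(\<Sum>i\<le>m. ?B i) = 1" by simp
    have S1: "(\<Sum>i\<le>m. ?r i * ?B i) = x"
    proof -
      have "(\<Sum>i\<le>m. ?r i * ?B i) = (\<Sum>i\<le>m. real i * ?B i) / real m"
        unfolding sum_divide_distrib by (rule sum.cong) auto
      then show ?thesis unfolding sum_k_Bernstein using m by simp
    qed
    have S2: "(\<Sum>i\<le>m. (?r i)\<^sup>2 * ?B i) = x\<^sup>2 + x * (1 - x) / real m"
    proof -
      have "(\<Sum>i\<le>m. (?r i)\<^sup>2 * ?B i)
          = ((\<Sum>i\<le>m. real i * (real i - 1) * ?B i) + (\<Sum>i\<le>m. real i * ?B i)) / (real m)\<^sup>2"
        unfolding sum.distrib[symmetric] sum_divide_distrib
        by (rule sum.cong) (auto simp: power2_eq_square algebra_simps add_divide_distrib diff_divide_distrib)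
      also have "\<dots> = x\<^sup>2 + x * (1 - x) / real m"
        unfolding sum_k_Bernstein sum_kk_Bernstein using m by (simp add: field_simps power2_eq_square)
      finally show ?thesis .
    qed
    have "poly (\<Sum>i\<le>m. \<Sum>j\<le>m. smult ((?r i - ?r j)\<^sup>2) (?b i * ?b j)) x
        = (\<Sum>i\<le>m. \<Sum>j\<le>m. (?r i)\<^sup>2 * ?B i * ?B j - 2 * (?r i * ?B i) * (?r j * ?B j)
            + ?B i * ((?r j)\<^sup>2 * ?B j))"
      by (simp add: poly_sum poly_bernstein power2_eq_square algebra_simps)
    also have "\<dots> = (\<Sum>i\<le>m. (?r i)\<^sup>2 * ?B i) * (\<Sum>j\<le>m. ?B j)
        - 2 * ((\<Sum>i\<le>m. ?r i * ?B i) * (\<Sum>j\<le>m. ?r j * ?B j))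
        + (\<Sum>i\<le>m. ?B i) * (\<Sum>j\<le>m. (?r j)\<^sup>2 * ?B j)"
    proof -
      have "(\<Sum>i\<le>m. \<Sum>j\<le>m. (?r i)\<^sup>2 * ?B i * ?B j) = (\<Sum>i\<le>m. (?r i)\<^sup>2 * ?B i) * (\<Sum>j\<le>m. ?B j)"
        by (simp only: sum_product)
      moreover have "(\<Sum>i\<le>m. \<Sum>j\<le>m. 2 * (?r i * ?B i) * (?r j * ?B j))
          = 2 * ((\<Sum>i\<le>m. ?r i * ?B i) * (\<Sum>j\<le>m. ?r j * ?B j))"
        unfolding sum_product by (simp only: sum_distrib_left mult.assoc)
      moreover have "(\<Sum>i\<le>m. \<Sum>j\<le>m. ?B i * ((?r j)\<^sup>2 * ?B j)) = (\<Sum>i\<le>m. ?B i) * (\<Sum>j\<le>m. (?r j)\<^sup>2 * ?B j)"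
        by (simp only: sum_product)
      ultimately show ?thesis by (simp only: sum.distrib sum_subtractf)
    qed
    also have "\<dots> = poly (smult (2 / real m) ([:0, 1:] * [:1, -1:])) x"
      unfolding S0 S1 S2 by (simp add: power2_eq_square algebra_simps diff_divide_distrib)
    finally show "poly (\<Sum>i\<le>m. \<Sum>j\<le>m. smult ((?r i - ?r j)\<^sup>2) (?b i * ?b j)) x
       = poly (smult (2 / real m) ([:0, 1:] * [:1, -1:])) x" .
  qed
  also have "?L (smult (2 / real m) ([:0, 1:] * [:1, -1:])) \<le> 2 / real m * \<mu> 0"
    unfolding moment_smult
  proof (rule mult_left_mono)
    note pos = \<mu>[unfolded interval_moments_def, rule_format]
    have "?L ([:0, 1:] * [:1, -1:]) = ?L [:0, 1:] - ?L ([:0, 1:] * [:0, 1:])"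
      unfolding moment_diff[symmetric] by simp
    moreover have "?L [:0, 1:] + ?L [:1, -1:] = ?L 1"
      unfolding moment_add[symmetric] by (simp add: one_pCons)
    moreover have "?L 1 = \<mu> 0" by (simp add: moment_def)
    moreover have "0 \<le> ?L ([:0, 1:] * [:0, 1:])" using pos[of "[:0, 1:]"] by blast
    moreover have "0 \<le> ?L [:1, -1:]" using pos[of 1] by simp
    ultimately show "?L ([:0, 1:] * [:1, -1:]) \<le> \<mu> 0" by linarith
  qed simp
  finally show ?thesis by simp
qed

subsection \<open>Matrices of operators\<close>

definition mat_apply :: "nat \<Rightarrow> (nat \<Rightarrow> nat \<Rightarrow> 'a op2) \<Rightarrow> (nat \<Rightarrow> 'a vec2) \<Rightarrow> nat \<Rightarrow> 'a vec2" where
  "mat_apply k X \<xi> = (\<lambda>i. \<Sum>j<k. X i j (\<xi> j))"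

definition mat_inner :: "nat \<Rightarrow> (nat \<Rightarrow> 'a vec2) \<Rightarrow> (nat \<Rightarrow> 'a vec2) \<Rightarrow> complex" where
  "mat_inner k \<xi> \<eta> = (\<Sum>i<k. ip (\<xi> i) (\<eta> i))"

definition mat_vecs :: "'a set \<Rightarrow> nat \<Rightarrow> (nat \<Rightarrow> 'a vec2) set" where
  "mat_vecs S k = {\<xi>. \<forall>i<k. \<xi> i \<in> ell2 S}"

text \<open>Kept as matrices of operators, so that all entries remain in the algebra that contains
  the entries of \<open>X\<close>.\<close>

primrec mat_pow :: "'a set \<Rightarrow> nat \<Rightarrow> (nat \<Rightarrow> nat \<Rightarrow> 'a op2) \<Rightarrow> nat \<Rightarrow> nat \<Rightarrow> nat \<Rightarrow> 'a op2" where
  "mat_pow S k X 0 = (\<lambda>i j. if i = j then op_id S else 0)"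
| "mat_pow S k X (Suc n) = (\<lambda>i j. \<Sum>l<k. X i l \<circ> mat_pow S k X n l j)"

definition mat_poly :: "'a set \<Rightarrow> nat \<Rightarrow> (nat \<Rightarrow> nat \<Rightarrow> 'a op2) \<Rightarrow> real poly \<Rightarrow> nat \<Rightarrow> nat \<Rightarrow> 'a op2" where
  "mat_poly S k X p = (\<lambda>i j. \<Sum>n\<le>degree p. op_scale (of_real (coeff p n)) (mat_pow S k X n i j))"

lemma sum_op_apply: "(\<Sum>i\<in>A. F i) f = (\<Sum>i\<in>A. (F i :: 'a op2) f)"
  by (induction A rule: infinite_finite_induct) auto

lemma sum_vec_apply: "(\<Sum>i\<in>A. F i) x = (\<Sum>i\<in>A. (F i :: 'a vec2) x)"
  by (induction A rule: infinite_finite_induct) auto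

lemma mat_form_expand:
  assumes "\<And>i j. i < k ==> j < k ==> b i j \<in> bounded_ops S" "\<eta> \<in> mat_vecs S k"
  shows "mat_inner k (mat_apply k b \<eta>) \<eta> = (\<Sum>i<k. \<Sum>j<k. ip (b i j (\<eta> j)) (\<eta> i))"
  unfolding mat_inner_def mat_apply_def
proof (rule sum.cong[OF refl])
  fix i assume i: "i \<in> {..<k}"
  show "ip (\<Sum>j<k. b i j (\<eta> j)) (\<eta> i) = (\<Sum>j<k. ip (b i j (\<eta> j)) (\<eta> i))"
  proof (rule ip_sum_left[of _ _ S _ S])
    show "b i j (\<eta> j) \<in> ell2 S" if "j \<in> {..<k}" for j
      by (rule bopsD(1)[OF assms(1)]) (use i that assms(2) in \<open>auto simp: mat_vecs_def\<close>)
    show "\<eta> i \<in> ell2 S" using i assms(2) by (simp add: mat_vecs_def)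
  qed
qed

lemma matrix_pos_iff:
  assumes "\<And>i j. i < k ==> j < k ==> X i j \<in> bounded_ops S"
  shows "matrix_pos S k X \<longleftrightarrow> (\<forall>\<xi>\<in>mat_vecs S k. mat_inner k (mat_apply k X \<xi>) \<xi> \<in> \<real>\<^sub>\<ge>\<^sub>0)"
  using mat_form_expand[of k X S, OF assms] by (simp add: matrix_pos_def) (auto simp: mat_vecs_def)

lemma mat_inner_sum_left:
  assumes "\<And>n i. n \<in> A ==> i < k ==> F n i \<in> ell2 S" "\<eta> \<in> mat_vecs S k"
  shows "mat_inner k (\<lambda>i. \<Sum>n\<in>A. vsc (c n) (F n i)) \<eta> = (\<Sum>n\<in>A. c n * mat_inner k (F n) \<eta>)"
proof -
  have "mat_inner k (\<lambda>i. \<Sum>n\<in>A. vsc (c n) (F n i)) \<eta> = (\<Sum>i<k. \<Sum>n\<in>A. c n * ip (F n i) (\<eta> i))"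
    unfolding mat_inner_def
  proof (rule sum.cong[OF refl])
    fix i assume "i \<in> {..<k}"
    then have m: "\<And>n. n \<in> A ==> vsc (c n) (F n i) \<in> ell2 S" "\<eta> i \<in> ell2 S"
      using assms by (auto simp: mat_vecs_def intro!: ell2_scale)
    show "ip (\<Sum>n\<in>A. vsc (c n) (F n i)) (\<eta> i) = (\<Sum>n\<in>A. c n * ip (F n i) (\<eta> i))"
      by (subst ip_sum_left[OF m]) (simp_all only: ip_scale_left)
  qed
  also have "\<dots> = (\<Sum>n\<in>A. c n * mat_inner k (F n) \<eta>)"
    by (subst sum.swap) (simp only: mat_inner_def sum_distrib_left)
  finally show ?thesis .
qed

lemma mat_inner_commute: "mat_inner k \<eta> \<xi> = cnj (mat_inner k \<xi> \<eta>)"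
  unfolding mat_inner_def cnj_sum by (rule sum.cong[OF refl]) (rule ip_commute)

lemma mat_inner_sum_right:
  assumes "\<And>n i. n \<in> A ==> i < k ==> F n i \<in> ell2 S" "\<eta> \<in> mat_vecs S k"
  shows "mat_inner k \<eta> (\<lambda>i. \<Sum>n\<in>A. vsc (c n) (F n i)) = (\<Sum>n\<in>A. cnj (c n) * mat_inner k \<eta> (F n))"
proof -
  have "mat_inner k \<eta> (\<lambda>i. \<Sum>n\<in>A. vsc (c n) (F n i)) = cnj (\<Sum>n\<in>A. c n * mat_inner k (F n) \<eta>)"
    by (subst mat_inner_commute) (simp only: mat_inner_sum_left[OF assms])
  then show ?thesis by (simp only: cnj_sum complex_cnj_mult mat_inner_commute[of k \<eta>])
qed

lemma mat_inner_self: "mat_inner k \<xi> \<xi> = of_real (\<Sum>i<k. (nrm (\<xi> i))\<^sup>2)"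
  by (simp add: mat_inner_def ip_self)

lemma mat_inner_cong:
  "(\<And>i. i < k ==> \<xi> i = \<xi>' i) ==> (\<And>i. i < k ==> \<eta> i = \<eta>' i) ==> mat_inner k \<xi> \<eta> = mat_inner k \<xi>' \<eta>'"
  by (simp add: mat_inner_def)

locale selfadjoint_matrix =
  fixes S :: "'a set" and P :: "'a op2 set" and k :: nat and X :: "nat \<Rightarrow> nat \<Rightarrow> 'a op2"
  assumes P: "von_neumann_algebra S P"
    and XP: "\<And>i j. i < k ==> j < k ==> X i j \<in> P"
    and Xadj: "\<And>i j. i < k ==> j < k ==> adj S (X i j) = X j i"
begin

lemma Xb: "i < k ==> j < k ==> X i j \<in> bounded_ops S"
  using XP vnaD(1)[OF P] by blast

lemma pow_P: "i < k ==> j < k ==> mat_pow S k X n i j \<in> P"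
proof (induction n arbitrary: i j)
  case 0
  then show ?case using vnaD(2,8)[OF P] by simp
next
  case (Suc n)
  then show ?case by (auto intro!: vna_sum[OF P] vnaD(4)[OF P] XP)
qed

lemma poly_P: "i < k ==> j < k ==> mat_poly S k X p i j \<in> P"
  unfolding mat_poly_def by (intro vna_sum[OF P] vnaD(5)[OF P] pow_P)

lemma apply_vecs: "\<xi> \<in> mat_vecs S k ==> mat_apply k X \<xi> \<in> mat_vecs S k"
  by (auto simp: mat_vecs_def mat_apply_def intro!: ell2_sum bopsD(1)[OF Xb])

lemma iterate_vecs: "\<xi> \<in> mat_vecs S k ==> (mat_apply k X ^^ n) \<xi> \<in> mat_vecs S k"
  by (induction n) (auto intro: apply_vecs)

lemma iterate_ell2: "\<xi> \<in> mat_vecs S k ==> i < k ==> (mat_apply k X ^^ n) \<xi> i \<in> ell2 S"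
  using iterate_vecs by (auto simp: mat_vecs_def)

lemma mat_apply_pow:
  assumes "\<xi> \<in> mat_vecs S k" "i < k"
  shows "mat_apply k (mat_pow S k X n) \<xi> i = (mat_apply k X ^^ n) \<xi> i"
  using assms(2)
proof (induction n arbitrary: i)
  case 0
  have "(\<Sum>j<k. (if i = j then op_id S else 0) (\<xi> j)) = (\<Sum>j<k. if j = i then \<xi> i else 0)"
    using assms(1) by (intro sum.cong) (auto simp: op_id_def mat_vecs_def)
  then show ?case using 0 by (simp add: mat_apply_def)
next
  case (Suc n)
  have m: "mat_pow S k X n l j (\<xi> j) \<in> ell2 S" if "l < k" "j < k" for l j
  proof -
    have "mat_pow S k X n l j \<in> bounded_ops S" using pow_P[OF that] vnaD(1)[OF P] by blast
    from bopsD(1)[OF this] show ?thesis using assms(1) that by (simp add: mat_vecs_def)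
  qed
  have "mat_apply k (mat_pow S k X (Suc n)) \<xi> i = (\<Sum>j<k. \<Sum>l<k. X i l (mat_pow S k X n l j (\<xi> j)))"
    by (simp only: mat_apply_def mat_pow.simps sum_op_apply o_apply)
  also have "\<dots> = (\<Sum>l<k. \<Sum>j<k. X i l (mat_pow S k X n l j (\<xi> j)))"
    by (rule sum.swap)
  also have "\<dots> = (\<Sum>l<k. X i l (mat_apply k (mat_pow S k X n) \<xi> l))"
  proof (rule sum.cong[OF refl])
    fix l assume l: "l \<in> {..<k}"
    show "(\<Sum>j<k. X i l (mat_pow S k X n l j (\<xi> j))) = X i l (mat_apply k (mat_pow S k X n) \<xi> l)"
      unfolding mat_apply_def
      by (rule bounded_ops_sum[symmetric, OF Xb]) (use l m Suc.prems in auto)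
  qed
  also have "\<dots> = (\<Sum>l<k. X i l ((mat_apply k X ^^ n) \<xi> l))"
    using Suc.IH by (intro sum.cong) auto
  also have "\<dots> = (mat_apply k X ^^ Suc n) \<xi> i"
    by (simp only: funpow.simps o_apply mat_apply_def[of k X "(mat_apply k X ^^ n) \<xi>"])
  finally show ?case .
qed

text \<open>The vector \<open>p(X) \<xi>\<close> obtained by iterating \<open>X\<close> on vectors.
  Inner products are easier to compute in this form, and \<open>mat_apply_poly\<close> identifies it
  with the action of \<open>mat_poly\<close>.\<close>

definition poly_vec :: "real poly \<Rightarrow> (nat \<Rightarrow> 'a vec2) \<Rightarrow> nat \<Rightarrow> 'a vec2" where
  "poly_vec p \<xi> = (\<lambda>i. \<Sum>n\<le>degree p. vsc (of_real (coeff p n)) ((mat_apply k X ^^ n) \<xi> i))"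

lemma poly_vec_vecs: "\<xi> \<in> mat_vecs S k ==> poly_vec p \<xi> \<in> mat_vecs S k"
  unfolding poly_vec_def mat_vecs_def
  by (auto intro!: ell2_sum ell2_scale iterate_ell2[unfolded mat_vecs_def])

lemma mat_apply_poly:
  assumes "\<xi> \<in> mat_vecs S k" "i < k"
  shows "mat_apply k (mat_poly S k X p) \<xi> i = poly_vec p \<xi> i"
proof -
  have "mat_apply k (mat_poly S k X p) \<xi> i
      = (\<Sum>j<k. \<Sum>n\<le>degree p. vsc (of_real (coeff p n)) (mat_pow S k X n i j (\<xi> j)))"
    by (simp only: mat_apply_def mat_poly_def sum_op_apply op_scale_def)
  also have "\<dots> = (\<Sum>n\<le>degree p. \<Sum>j<k. vsc (of_real (coeff p n)) (mat_pow S k X n i j (\<xi> j)))"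
    by (rule sum.swap)
  also have "\<dots> = (\<Sum>n\<le>degree p. vsc (of_real (coeff p n)) (mat_apply k (mat_pow S k X n) \<xi> i))"
  proof (rule sum.cong[OF refl], rule ext)
    fix n x
    show "(\<Sum>j<k. vsc (of_real (coeff p n)) (mat_pow S k X n i j (\<xi> j))) x
        = vsc (of_real (coeff p n)) (mat_apply k (mat_pow S k X n) \<xi> i) x"
      by (simp only: mat_apply_def sum_vec_apply vsc_apply sum_distrib_left)
  qed
  finally show ?thesis by (simp only: poly_vec_def mat_apply_pow[OF assms])
qed

lemma mat_apply_selfadjoint:
  assumes "\<xi> \<in> mat_vecs S k" "\<eta> \<in> mat_vecs S k"
  shows "mat_inner k (mat_apply k X \<xi>) \<eta> = mat_inner k \<xi> (mat_apply k X \<eta>)"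
proof -
  have v: "\<xi> i \<in> ell2 S" "\<eta> i \<in> ell2 S" if "i < k" for i using assms that by (auto simp: mat_vecs_def)
  have "mat_inner k (mat_apply k X \<xi>) \<eta> = (\<Sum>i<k. \<Sum>j<k. ip (X i j (\<xi> j)) (\<eta> i))"
    unfolding mat_inner_def mat_apply_def
    by (intro sum.cong refl ip_sum_left[of _ _ S _ S]) (auto intro!: bopsD(1)[OF Xb] v)
  also have "\<dots> = (\<Sum>i<k. \<Sum>j<k. ip (\<xi> j) (X j i (\<eta> i)))"
    by (intro sum.cong refl) (simp add: adj_inner(1)[OF Xb] v Xadj)
  also have "\<dots> = (\<Sum>j<k. \<Sum>i<k. ip (\<xi> j) (X j i (\<eta> i)))"
    by (rule sum.swap)
  also have "\<dots> = mat_inner k \<xi> (mat_apply k X \<eta>)"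
    unfolding mat_inner_def mat_apply_def
    by (intro sum.cong refl ip_sum_right[of _ _ S _ S, symmetric]) (auto intro!: bopsD(1)[OF Xb] v)
  finally show ?thesis .
qed

lemma iterate_selfadjoint:
  assumes "\<xi> \<in> mat_vecs S k" "\<eta> \<in> mat_vecs S k"
  shows "mat_inner k ((mat_apply k X ^^ (n + m)) \<xi>) \<eta> = mat_inner k ((mat_apply k X ^^ n) \<xi>) ((mat_apply k X ^^ m) \<eta>)"
  using assms(2)
proof (induction m arbitrary: \<eta>)
  case (Suc m)
  have "mat_inner k ((mat_apply k X ^^ (n + Suc m)) \<xi>) \<eta> = mat_inner k (mat_apply k X ((mat_apply k X ^^ (n + m)) \<xi>)) \<eta>"
    by simp
  also have "\<dots> = mat_inner k ((mat_apply k X ^^ (n + m)) \<xi>) (mat_apply k X \<eta>)"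
    by (rule mat_apply_selfadjoint[OF iterate_vecs[OF assms(1)] Suc.prems])
  also have "\<dots> = mat_inner k ((mat_apply k X ^^ n) \<xi>) ((mat_apply k X ^^ m) (mat_apply k X \<eta>))"
    by (rule Suc.IH[OF apply_vecs[OF Suc.prems]])
  finally show ?case by (simp add: funpow_swap1)
qed simp

text \<open>The moments of the spectral measure of \<open>X\<close> at \<open>\<xi>\<close>; they
  are real because \<open>X\<close> is self-adjoint.\<close>

definition moments :: "(nat \<Rightarrow> 'a vec2) \<Rightarrow> nat \<Rightarrow> real" where
  "moments \<xi> n = Re (mat_inner k ((mat_apply k X ^^ n) \<xi>) \<xi>)"

lemma moments_real:
  assumes "\<xi> \<in> mat_vecs S k"
  shows "mat_inner k ((mat_apply k X ^^ n) \<xi>) \<xi> = of_real (moments \<xi> n)"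
proof -
  have "mat_inner k ((mat_apply k X ^^ (0 + n)) \<xi>) \<xi> = mat_inner k \<xi> ((mat_apply k X ^^ n) \<xi>)"
    using iterate_selfadjoint[OF assms assms, of 0 n] by simp
  then have "mat_inner k ((mat_apply k X ^^ n) \<xi>) \<xi> = cnj (mat_inner k ((mat_apply k X ^^ n) \<xi>) \<xi>)"
    by (simp add: mat_inner_commute[of k \<xi>])
  then show ?thesis by (simp add: moments_def complex_eq_iff)
qed

text \<open>Self-adjointness moves powers of \<open>X\<close> across the inner product, so only the
  product polynomial is seen. One more application of \<open>X\<close> is the factor
  \<open>[:0, 1:]\<close>.\<close>

lemma poly_vec_inner:
  assumes \<xi>: "\<xi> \<in> mat_vecs S k"
  shows "mat_inner k (poly_vec p \<xi>) (poly_vec q \<xi>) = of_real (moment (moments \<xi>) (p * q))"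
    and "mat_inner k (poly_vec p \<xi>) \<xi> = of_real (moment (moments \<xi>) p)"
    and "mat_inner k (mat_apply k X (poly_vec p \<xi>)) (poly_vec p \<xi>)
      = of_real (moment (moments \<xi>) ([:0, 1:] * (p * p)))"
proof -
  have 1: "mat_inner k (poly_vec p \<xi>) \<eta> = (\<Sum>n\<le>degree p. of_real (coeff p n) * mat_inner k ((mat_apply k X ^^ n) \<xi>) \<eta>)"
    if "\<eta> \<in> mat_vecs S k" for p \<eta>
    unfolding poly_vec_def by (rule mat_inner_sum_left[OF _ that]) (rule iterate_ell2[OF \<xi>])
  have 2: "mat_inner k \<eta> (poly_vec q \<xi>) = (\<Sum>n\<le>degree q. of_real (coeff q n) * mat_inner k \<eta> ((mat_apply k X ^^ n) \<xi>))"
    if "\<eta> \<in> mat_vecs S k" for q \<eta>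
    unfolding poly_vec_def
    by (subst mat_inner_sum_right[OF _ that]) (simp_all add: iterate_ell2[OF \<xi>])
  have 3: "mat_inner k ((mat_apply k X ^^ n) \<xi>) ((mat_apply k X ^^ m) \<xi>) = of_real (moments \<xi> (n + m))" for n m
    using iterate_selfadjoint[OF \<xi> \<xi>, of n m] moments_real[OF \<xi>] by simp
  show "mat_inner k (poly_vec p \<xi>) (poly_vec q \<xi>) = of_real (moment (moments \<xi>) (p * q))"
    by (simp add: 1[OF poly_vec_vecs[OF \<xi>]] 2[OF iterate_vecs[OF \<xi>]] 3 moment_mult sum_distrib_left mult.assoc)
  show "mat_inner k (poly_vec p \<xi>) \<xi> = of_real (moment (moments \<xi>) p)"
    by (simp add: 1[OF \<xi>] moments_real[OF \<xi>] moment_def)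
  have shift: "moment \<mu> ([:0, 1:] * r) = moment (\<lambda>n. \<mu> (Suc n)) r" for \<mu> r
  proof -
    have "moment \<mu> ([:0, 1:] * r) = (\<Sum>n\<le>Suc (degree r). coeff ([:0, 1:] * r) n * \<mu> n)"
      by (rule moment_eq) (simp add: degree_pCons_le)
    also have "\<dots> = (\<Sum>n\<le>degree r. coeff r n * \<mu> (Suc n))"
      by (subst sum.atMost_Suc_shift) simp
    finally show ?thesis by (simp add: moment_def)
  qed
  have "mat_inner k (mat_apply k X (poly_vec p \<xi>)) (poly_vec p \<xi>) = mat_inner k (poly_vec p \<xi>) (mat_apply k X (poly_vec p \<xi>))"
    by (rule mat_apply_selfadjoint[OF poly_vec_vecs[OF \<xi>] poly_vec_vecs[OF \<xi>]])
  also have "\<dots> = (\<Sum>n\<le>degree p. of_real (coeff p n) * mat_inner k ((mat_apply k X ^^ Suc n) \<xi>) (poly_vec p \<xi>))"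
    by (simp add: 1[OF apply_vecs[OF poly_vec_vecs[OF \<xi>]]]
        mat_apply_selfadjoint[OF iterate_vecs[OF \<xi>] poly_vec_vecs[OF \<xi>], symmetric])
  also have "\<dots> = (\<Sum>n\<le>degree p. of_real (coeff p n) * (\<Sum>m\<le>degree p. of_real (coeff p m) * of_real (moments \<xi> (Suc (n + m)))))"
  proof -
    have "mat_inner k ((mat_apply k X ^^ Suc n) \<xi>) (poly_vec p \<xi>)
       = (\<Sum>m\<le>degree p. of_real (coeff p m) * of_real (moments \<xi> (Suc (n + m))))" for n
      unfolding 2[OF iterate_vecs[OF \<xi>]] 3 by simp
    then show ?thesis by (simp only:)
  qed
  also have "\<dots> = of_real (moment (moments \<xi>) ([:0, 1:] * (p * p)))"
    unfolding shift by (simp only: moment_mult of_real_sum of_real_mult sum_distrib_left mult.assoc)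
  finally show "mat_inner k (mat_apply k X (poly_vec p \<xi>)) (poly_vec p \<xi>)
      = of_real (moment (moments \<xi>) ([:0, 1:] * (p * p)))" .
qed

text \<open>The hypotheses say that \<open>X\<close> lies between zero and one as a form; they are
  evaluated at the vectors \<open>poly_vec q \<xi>\<close>.\<close>

lemma interval_moments:
  assumes "\<And>\<eta>. \<eta> \<in> mat_vecs S k ==> 0 \<le> Re (mat_inner k (mat_apply k X \<eta>) \<eta>)"
    and "\<And>\<eta>. \<eta> \<in> mat_vecs S k ==> Re (mat_inner k (mat_apply k X \<eta>) \<eta>) \<le> Re (mat_inner k \<eta> \<eta>)"
    and \<xi>: "\<xi> \<in> mat_vecs S k"
  shows "interval_moments (moments \<xi>)"
  unfolding interval_moments_def
proof (intro allI conjI)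
  fix q
  note v = poly_vec_vecs[OF \<xi>, of q]
  have a: "moment (moments \<xi>) (q * q) = Re (mat_inner k (poly_vec q \<xi>) (poly_vec q \<xi>))"
    by (simp add: poly_vec_inner(1)[OF \<xi>])
  have b: "moment (moments \<xi>) ([:0, 1:] * (q * q)) = Re (mat_inner k (mat_apply k X (poly_vec q \<xi>)) (poly_vec q \<xi>))"
    unfolding poly_vec_inner(3)[OF \<xi>] by simp
  show "0 \<le> moment (moments \<xi>) (q * q)"
    unfolding a mat_inner_self by (simp add: sum_nonneg)
  show "0 \<le> moment (moments \<xi>) ([:0, 1:] * (q * q))"
    unfolding b by (rule assms(1)[OF v])
  have "[:1, -1:] * (q * q) = q * q - [:0, 1:] * (q * q)"
    by (simp add: algebra_simps)
  then have "moment (moments \<xi>) ([:1, -1:] * (q * q))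
      = moment (moments \<xi>) (q * q) - moment (moments \<xi>) ([:0, 1:] * (q * q))"
    by (simp only: moment_diff)
  then show "0 \<le> moment (moments \<xi>) ([:1, -1:] * (q * q))"
    using assms(2)[OF v] a b by linarith
qed

end

subsection \<open>The space \<open>L\<^sup>2(P, \<tau>)\<close>\<close>

lemma mtotally_boundedD:
  assumes "compactin (ell2_topology S) (ell2_topology S closure_of A)" "A \<subseteq> ell2 S" "e > 0"
  obtains N where "finite N" "N \<subseteq> ell2 S" "\<And>f. f \<in> A ==> \<exists>c\<in>N. nrm (f - c) < e"
proof -
  interpret M: Metric_space "ell2 S" "\<lambda>f g. nrm (f - g)" by (rule Metric_space_ell2)
  let ?B = "ell2_topology S closure_of A"
  have tb: "M.mtotally_bounded ?B"
    using assms(1) unfolding ell2_topology_def by (rule M.compactin_imp_mtotally_bounded)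
  from tb[unfolded M.mtotally_bounded_def, rule_format, OF assms(3)]
  obtain N where N: "finite N" "N \<subseteq> ?B" "?B \<subseteq> (\<Union>c\<in>N. M.mball c e)" by (elim exE conjE)
  have AB: "A \<subseteq> ?B" unfolding ell2_topology_def
    by (rule closure_of_subset) (simp add: M.topspace_mtopology assms(2))
  have B: "?B \<subseteq> ell2 S" using closure_of_subset_topspace[of "ell2_topology S" A]
    by (simp add: ell2_topology_def M.topspace_mtopology)
  show ?thesis
  proof (rule that[OF N(1)])
    show "N \<subseteq> ell2 S" using N(2) B by blast
    fix f assume "f \<in> A"
    then obtain c where "c \<in> N" "f \<in> M.mball c e" using AB N(3) by blast
    then show "\<exists>c\<in>N. nrm (f - c) < e" by (auto simp: M.in_mball nrm_minus_commute)
  qed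
qed

lemma ell2_topology_closure_of:
  assumes "A \<subseteq> ell2 S"
  shows "ell2_topology S closure_of A = {f \<in> ell2 S. \<forall>e>0. \<exists>a\<in>A. nrm (f - a) < e}"
proof -
  interpret M: Metric_space "ell2 S" "\<lambda>f g. nrm (f - g)" by (rule Metric_space_ell2)
  show ?thesis unfolding ell2_topology_def M.metric_closure_of M.in_mball using assms by blast
qed

lemma closed_subspace_closure:
  assumes A: "A \<subseteq> ell2 S" "0 \<in> A" "\<And>f g. f \<in> A ==> g \<in> A ==> f + g \<in> A" "\<And>c f. f \<in> A ==> vsc c f \<in> A"
  shows "closed_subspace S (ell2_topology S closure_of A)"
  unfolding closed_subspace_def ell2_topology_closure_of[OF A(1)]
proof (intro conjI ballI allI impI)
  show "0 \<in> {f \<in> ell2 S. \<forall>e>0. \<exists>a\<in>A. nrm (f - a) < e}" using A(2) by (auto intro!: bexI[of _ 0])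
next
  fix f g assume f: "f \<in> {f \<in> ell2 S. \<forall>e>0. \<exists>a\<in>A. nrm (f - a) < e}"
    and g: "g \<in> {f \<in> ell2 S. \<forall>e>0. \<exists>a\<in>A. nrm (f - a) < e}"
  show "f + g \<in> {f \<in> ell2 S. \<forall>e>0. \<exists>a\<in>A. nrm (f - a) < e}"
  proof (intro CollectI conjI allI impI)
    show "f + g \<in> ell2 S" using f g by auto
    fix e :: real assume "e > 0"
    then have "e / 2 > 0" by simp
    then obtain a b where ab: "a \<in> A" "nrm (f - a) < e / 2" "b \<in> A" "nrm (g - b) < e / 2"
      using f g by blast
    have "f + g - (a + b) = (f - a) + (g - b)" by simp
    moreover have "nrm ((f - a) + (g - b)) \<le> nrm (f - a) + nrm (g - b)"
      using f g ab A(1) by (intro nrm_triangle) auto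
    ultimately have "nrm (f + g - (a + b)) < e" using ab by (simp only:)
    then show "\<exists>a\<in>A. nrm (f + g - a) < e" using A(3) ab by blast
  qed
next
  fix c f assume f: "f \<in> {f \<in> ell2 S. \<forall>e>0. \<exists>a\<in>A. nrm (f - a) < e}"
  show "vsc c f \<in> {f \<in> ell2 S. \<forall>e>0. \<exists>a\<in>A. nrm (f - a) < e}"
  proof (intro CollectI conjI allI impI)
    show "vsc c f \<in> ell2 S" using f by auto
    fix e :: real assume e: "e > 0"
    then have "e / (1 + cmod c) > 0" by (simp add: add_pos_nonneg)
    then obtain a where a: "a \<in> A" "nrm (f - a) < e / (1 + cmod c)" using f by blast
    have "vsc c f - vsc c a = vsc c (f - a)" by (auto simp: fun_eq_iff algebra_simps)
    then have "nrm (vsc c f - vsc c a) = cmod c * nrm (f - a)" by (simp add: nrm_scale)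
    also have "\<dots> \<le> (1 + cmod c) * nrm (f - a)" by (intro mult_right_mono) auto
    also have "\<dots> < e" using a(2) by (simp add: pos_less_divide_eq add_pos_nonneg mult.commute)
    finally show "\<exists>a\<in>A. nrm (vsc c f - a) < e" using A(4)[OF a(1)] by blast
  qed
next
  fix f l assume f: "\<forall>n::nat. f n \<in> {f \<in> ell2 S. \<forall>e>0. \<exists>a\<in>A. nrm (f - a) < e}"
    and l: "l \<in> ell2 S" and lim: "(\<lambda>n. nrm (f n - l)) \<longlonglongrightarrow> 0"
  show "l \<in> {f \<in> ell2 S. \<forall>e>0. \<exists>a\<in>A. nrm (f - a) < e}"
  proof (intro CollectI conjI allI impI l)
    fix e :: real assume "e > 0"
    then have e: "e / 2 > 0" by simp
    from order_tendstoD(2)[OF lim e] obtain n where n: "nrm (f n - l) < e / 2"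
      by (auto simp: eventually_sequentially)
    obtain a where a: "a \<in> A" "nrm (f n - a) < e / 2" using f e by blast
    have "nrm (l - a) \<le> nrm (l - f n) + nrm (f n - a)"
      using f l a A(1) by (intro nrm_diff_triangle[of _ S]) auto
    then have "nrm (l - a) < e" using n a(2) nrm_minus_commute[of l "f n"] by linarith
    then show "\<exists>a\<in>A. nrm (l - a) < e" using a(1) by blast
  qed
qed auto

locale group_subalgebra = group G for G (structure) +
  fixes P :: "'a op2 set"
  assumes P: "von_neumann_algebra (carrier G) P" and PL: "P \<subseteq> convolvers G"
begin

abbreviation L2 :: "'a vec2 set" where "L2 \<equiv> L2_space G P"

lemma P_bounded: "x \<in> P ==> x \<in> bounded_ops (carrier G)"
  using vnaD(1)[OF P] by blast

lemma P_delta: "x \<in> P ==> x tvec \<in> ell2 (carrier G)"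
  by (rule bopsD(1)[OF P_bounded]) auto

lemma in_L2_iff: "f \<in> L2 \<longleftrightarrow> f \<in> ell2 (carrier G) \<and> (\<forall>e>0. \<exists>x\<in>P. nrm (f - x tvec) < e)"
proof -
  have "(\<lambda>x. x tvec) ` P \<subseteq> ell2 (carrier G)" using P_delta by blast
  then show ?thesis unfolding L2_space_def by (subst ell2_topology_closure_of) auto
qed

lemma L2_ell2: "f \<in> L2 ==> f \<in> ell2 (carrier G)"
  by (simp add: in_L2_iff)

lemma P_delta_L2: "x \<in> P ==> x tvec \<in> L2"
  using P_delta by (auto simp: in_L2_iff intro!: bexI[of _ x])

lemma closed_subspace_L2: "closed_subspace (carrier G) L2"
  unfolding L2_space_def
proof (rule closed_subspace_closure)
  show "(\<lambda>x. x tvec) ` P \<subseteq> ell2 (carrier G)" using P_delta by blast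
  have "(0 :: 'a vec2) = (0 :: 'a op2) tvec" by simp
  then show "0 \<in> (\<lambda>x. x tvec) ` P" using vnaD(8)[OF P] by blast
  fix f g assume "f \<in> (\<lambda>x. x tvec) ` P" "g \<in> (\<lambda>x. x tvec) ` P"
  then obtain x y where "x \<in> P" "y \<in> P" "f = x tvec" "g = y tvec" by blast
  then show "f + g \<in> (\<lambda>x. x tvec) ` P" using vnaD(3)[OF P] by (intro image_eqI[of _ _ "x + y"]) auto
next
  fix c f assume "f \<in> (\<lambda>x. x tvec) ` P"
  then obtain x where "x \<in> P" "f = x tvec" by blast
  then show "vsc c f \<in> (\<lambda>x. x tvec) ` P"
    using vnaD(5)[OF P] by (intro image_eqI[of _ _ "op_scale c x"]) (auto simp: op_scale_def)
qed

text \<open>A density argument. \<open>W\<close> is only required to preserve distances, since it is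
  applied to the conjugate linear \<open>modular_conj\<close> as well as to conjugation by group
  elements.\<close>

lemma L2_induct:
  assumes "f \<in> L2" "\<And>x. x \<in> P ==> W (x tvec) \<in> L2"
    and W: "\<And>f. f \<in> ell2 (carrier G) ==> W f \<in> ell2 (carrier G)"
      "\<And>f g. f \<in> ell2 (carrier G) ==> g \<in> ell2 (carrier G) ==> nrm (W f - W g) = nrm (f - g)"
  shows "W f \<in> L2"
proof -
  have f: "f \<in> ell2 (carrier G)" using assms(1) by (rule L2_ell2)
  have "\<exists>x\<in>P. nrm (W f - x tvec) < e" if "e > 0" for e
  proof -
    have e: "e / 2 > 0" using that by simp
    obtain x where x: "x \<in> P" "nrm (f - x tvec) < e / 2" using assms(1) e in_L2_iff by blast
    obtain y where y: "y \<in> P" "nrm (W (x tvec) - y tvec) < e / 2"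
      using assms(2)[OF x(1)] e in_L2_iff by blast
    have "nrm (W f - y tvec) \<le> nrm (W f - W (x tvec)) + nrm (W (x tvec) - y tvec)"
      by (rule nrm_diff_triangle[OF W(1)[OF f] W(1)[OF P_delta[OF x(1)]] P_delta[OF y(1)]])
    then have "nrm (W f - y tvec) < e" using x(2) y(2) W(2)[OF f P_delta[OF x(1)]] by linarith
    then show ?thesis using y(1) by blast
  qed
  then show ?thesis using W(1)[OF f] in_L2_iff by blast
qed

text \<open>The reproducing kernel of \<open>L\<^sup>2(P)\<close>; \<open>kvec g\<close> is the projection of \<open>\<delta>\<^sub>g\<close>.\<close>

definition kvec :: "'a \<Rightarrow> 'a vec2" where
  "kvec g = (SOME p. p \<in> L2 \<and> (\<forall>k\<in>L2. ip k p = k g))"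

lemma
  assumes g: "g \<in> carrier G"
  shows kvec_L2: "kvec g \<in> L2" and kvec_inner: "k \<in> L2 ==> ip k (kvec g) = k g"
proof -
  have d: "delta g \<in> ell2 (carrier G)" using g by simp
  obtain p where p: "p \<in> L2" "\<And>k. k \<in> L2 ==> ip (delta g - p) k = 0"
    using orthogonal_projection_exists[OF closed_subspace_L2 d] by blast
  have "ip k p = k g" if k: "k \<in> L2" for k
  proof -
    have "ip (delta g - p) k = cnj (k g) - ip p k"
      by (simp add: ip_diff_left[OF d L2_ell2[OF p(1)] L2_ell2[OF k]])
    then have "ip p k = cnj (k g)" using p(2)[OF k] by simp
    then show ?thesis by (subst ip_commute) simp
  qed
  then have "\<exists>p. p \<in> L2 \<and> (\<forall>k\<in>L2. ip k p = k g)" using p(1) by blast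
  then have *: "kvec g \<in> L2 \<and> (\<forall>k\<in>L2. ip k (kvec g) = k g)"
    unfolding kvec_def by (rule someI_ex)
  show "kvec g \<in> L2" using * by blast
  show "k \<in> L2 ==> ip k (kvec g) = k g" using * by blast
qed

lemma kvec_unique:
  assumes g: "g \<in> carrier G" and p: "p \<in> L2" "\<And>k. k \<in> L2 ==> ip k p = k g"
  shows "kvec g = p"
proof -
  let ?d = "kvec g - p"
  have d: "?d \<in> L2" by (rule closed_subspaceD(5)[OF closed_subspace_L2 kvec_L2[OF g] p(1)])
  have "ip ?d ?d = 0"
    using kvec_inner[OF g d] p(2)[OF d]
    by (simp add: ip_diff_right[OF L2_ell2[OF kvec_L2[OF g]] L2_ell2[OF p(1)] L2_ell2[OF d]])
  then have "nrm ?d = 0" by (simp add: ip_self)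
  then have "?d = 0" using nrm_eq_0_iff[OF L2_ell2[OF d]] by blast
  then show ?thesis by simp
qed

lemma kvec_one: "kvec \<one> = tvec"
proof (rule kvec_unique)
  have "op_id (carrier G) tvec = tvec" by (simp add: op_id_def)
  then show "tvec \<in> L2" using P_delta_L2[OF vnaD(2)[OF P]] by simp
qed auto

text \<open>\<open>kvec g g\<close> is the squared norm of \<open>kvec g\<close>; if it vanishes, so
  does the projection of \<open>delta g\<close>, and evaluation at \<open>g\<close> is zero on
  \<open>L2\<close>.\<close>

lemma L2_vanishing:
  assumes "f \<in> L2" "g \<in> carrier G" "kvec g g = 0" shows "f g = 0"
proof -
  have "ip (kvec g) (kvec g) = 0"
    using kvec_inner[OF assms(2) kvec_L2[OF assms(2)]] assms(3) by simp
  then have "kvec g = 0"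
    using nrm_eq_0_iff[OF L2_ell2[OF kvec_L2[OF assms(2)]]] by (simp add: ip_self)
  then show ?thesis using kvec_inner[OF assms(2,1)] by simp
qed

text \<open>The modular conjugation of the trace: it sends \<open>x tvec\<close> to
  \<open>adj (carrier G) x tvec\<close>, and this is why it preserves \<open>L2\<close>.\<close>

definition modular_conj :: "'a vec2 \<Rightarrow> 'a vec2" where
  "modular_conj f = (\<lambda>x. if x \<in> carrier G then cnj (f (inv x)) else 0)"

lemma bij_inv: "bij_betw (\<lambda>x. inv x) (carrier G) (carrier G)"
  by (rule bij_betwI[where g = "\<lambda>x. inv x"]) auto

lemma modular_conj_ell2:
  assumes "f \<in> ell2 (carrier G)" shows "modular_conj f \<in> ell2 (carrier G)"
proof -
  have "(\<lambda>x. (cmod (f x))\<^sup>2) summable_on carrier G" using assms by (simp add: ell2_def)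
  then have "(\<lambda>x. (cmod (f (inv x)))\<^sup>2) summable_on carrier G"
    using summable_on_reindex_bij_betw[OF bij_inv, of "\<lambda>x. (cmod (f x))\<^sup>2"] by simp
  then have "(\<lambda>x. (cmod (modular_conj f x))\<^sup>2) summable_on carrier G"
    by (rule summable_on_cong[THEN iffD1, rotated]) (simp add: modular_conj_def)
  then show ?thesis by (simp add: ell2_def modular_conj_def)
qed

lemma modular_conj_inner:
  assumes "f \<in> ell2 (carrier G)" "h \<in> ell2 (carrier G)"
  shows "ip (modular_conj f) h = ip (modular_conj h) f"
proof -
  have "ip (modular_conj f) h = (\<Sum>\<^sub>\<infinity>x\<in>carrier G. cnj (f (inv x)) * cnj (h x))"
    unfolding ell2_inner_def by (rule infsum_cong_neutral) (auto simp: modular_conj_def)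
  also have "\<dots> = (\<Sum>\<^sub>\<infinity>x\<in>carrier G. cnj (f (inv (inv x))) * cnj (h (inv x)))"
    using infsum_reindex_bij_betw[OF bij_inv, of "\<lambda>x. cnj (f (inv x)) * cnj (h x)"] by simp
  also have "\<dots> = ip (modular_conj h) f"
    unfolding ell2_inner_def by (rule infsum_cong_neutral) (auto simp: modular_conj_def mult.commute)
  finally show ?thesis .
qed

lemma modular_conj_twice: "f \<in> ell2 (carrier G) ==> modular_conj (modular_conj f) = f"
  by (auto simp: modular_conj_def fun_eq_iff ell2_outside)

lemma modular_conj_norm:
  assumes "f \<in> ell2 (carrier G)" shows "nrm (modular_conj f) = nrm f"
proof -
  have "ip (modular_conj f) (modular_conj f) = ip f f"
    by (simp add: modular_conj_inner[OF assms modular_conj_ell2[OF assms]] modular_conj_twice[OF assms])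
  then have "(nrm (modular_conj f))\<^sup>2 = (nrm f)\<^sup>2"
    unfolding ip_self of_real_eq_iff .
  then show ?thesis by (simp add: power2_eq_iff_nonneg)
qed

lemma modular_conj_diff: "modular_conj (f - g) = modular_conj f - modular_conj g"
  by (auto simp: modular_conj_def fun_eq_iff)

lemma modular_conj_adj:
  assumes x: "x \<in> P" shows "modular_conj (x tvec) = adj (carrier G) x tvec"
proof (rule ell2_eqI)
  show "adj (carrier G) x tvec \<in> ell2 (carrier G)" by (rule P_delta[OF vnaD(6)[OF P x]])
  show "modular_conj (x tvec) \<in> ell2 (carrier G)" by (rule modular_conj_ell2[OF P_delta[OF x]])
  fix g assume g: "g \<in> carrier G"
  have "x \<in> convolvers G" using x PL by blast
  from convolver_adj[OF this g] show "modular_conj (x tvec) g = adj (carrier G) x tvec g"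
    using g by (simp add: modular_conj_def)
qed

lemma modular_conj_L2:
  assumes "f \<in> L2" shows "modular_conj f \<in> L2"
proof (rule L2_induct[where W = modular_conj, OF assms])
  show "modular_conj (x tvec) \<in> L2" if "x \<in> P" for x
    unfolding modular_conj_adj[OF that] by (rule P_delta_L2[OF vnaD(6)[OF P that]])
  show "nrm (modular_conj f - modular_conj g) = nrm (f - g)"
    if "f \<in> ell2 (carrier G)" "g \<in> ell2 (carrier G)" for f g
    by (subst modular_conj_diff[symmetric]) (rule modular_conj_norm[OF ell2_minus[OF that]])
qed (rule modular_conj_ell2)

lemma modular_conj_kernel_vec:
  assumes g: "g \<in> carrier G" shows "modular_conj (kvec g) = kvec (inv g)"
proof (rule kvec_unique[symmetric])
  show "inv g \<in> carrier G" using g by simp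
  show "modular_conj (kvec g) \<in> L2" by (rule modular_conj_L2[OF kvec_L2[OF g]])
  fix k assume k: "k \<in> L2"
  have "ip k (modular_conj (kvec g)) = cnj (ip (modular_conj (kvec g)) k)"
    by (rule ip_commute)
  also have "\<dots> = cnj (ip (modular_conj k) (kvec g))"
    by (simp only: modular_conj_inner[OF L2_ell2[OF kvec_L2[OF g]] L2_ell2[OF k]])
  also have "\<dots> = cnj (modular_conj k g)"
    by (simp only: kvec_inner[OF g modular_conj_L2[OF k]])
  also have "\<dots> = k (inv g)" using g by (simp add: modular_conj_def)
  finally show "ip k (modular_conj (kvec g)) = k (inv g)" .
qed

text \<open>Simultaneous left and right translation by \<open>s\<close> is a unitary that maps
  \<open>delta g\<close> to the delta at the conjugate. By invariance of \<open>P\<close> it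
  preserves \<open>L2\<close>, so it carries one reproducing vector to the other.\<close>

lemma kvec_conj:
  assumes inv: "\<And>x. x \<in> P ==> lreg G s \<circ> x \<circ> adj (carrier G) (lreg G s) \<in> P"
      "\<And>x. x \<in> P ==> lreg G (inv s) \<circ> x \<circ> adj (carrier G) (lreg G (inv s)) \<in> P"
    and s: "s \<in> carrier G" and g: "g \<in> carrier G"
  shows "kvec (s \<otimes> g \<otimes> inv s) (s \<otimes> g \<otimes> inv s) = kvec g g"
proof -
  define W where "W t f = lreg G t (rreg G t f)" for t f
  have We: "W t f \<in> ell2 (carrier G)" if "t \<in> carrier G" "f \<in> ell2 (carrier G)" for t f
    using that unfolding W_def
    by (intro bopsD(1)[OF lreg_bounded] bopsD(1)[OF rreg_bounded]) auto
  have Wa: "W t f x = f (inv t \<otimes> x \<otimes> t)" if "t \<in> carrier G" "f \<in> ell2 (carrier G)" "x \<in> carrier G" for t f x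
  proof -
    have "rreg G t f \<in> ell2 (carrier G)" using that by (intro bopsD(1)[OF rreg_bounded])
    then show ?thesis using that by (simp add: W_def lreg_apply rreg_apply)
  qed
  have WL: "W t f \<in> L2" if t: "t \<in> carrier G" and f: "f \<in> L2"
    and i: "\<And>x. x \<in> P ==> lreg G t \<circ> x \<circ> adj (carrier G) (lreg G t) \<in> P" for t f
  proof (rule L2_induct[where W = "W t", OF f])
    show "W t (x tvec) \<in> L2" if x: "x \<in> P" for x
    proof -
      have "(lreg G t \<circ> x \<circ> adj (carrier G) (lreg G t)) tvec = lreg G t (x (delta (inv t)))"
        using t by (simp add: lreg_adj lreg_delta)
      also have "delta (inv t) = rreg G t tvec"
        using t by (simp add: rreg_delta)
      also have "lreg G t (x (rreg G t tvec)) = W t (x tvec)"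
        unfolding W_def using convolversD(2)[of x t "tvec"] x PL t by auto
      finally show ?thesis using P_delta_L2[OF i[OF x]] by simp
    qed
    show "nrm (W t f - W t g) = nrm (f - g)" if fg: "f \<in> ell2 (carrier G)" "g \<in> ell2 (carrier G)" for f g
    proof -
      have r: "rreg G t f \<in> ell2 (carrier G)" "rreg G t g \<in> ell2 (carrier G)"
        using t fg by (auto intro!: bopsD(1)[OF rreg_bounded])
      have "W t f - W t g = W t (f - g)"
        unfolding W_def bopsD(6)[OF lreg_bounded[OF t] r, symmetric]
          bopsD(6)[OF rreg_bounded[OF t] fg, symmetric] ..
      moreover have "rreg G t (f - g) \<in> ell2 (carrier G)"
        using t fg by (intro bopsD(1)[OF rreg_bounded]) auto
      ultimately show ?thesis
        using fg t by (simp add: W_def lreg_norm rreg_norm ell2_minus)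
    qed
  qed (rule We[OF t])
  let ?t = "s \<otimes> g \<otimes> inv s"
  have t: "?t \<in> carrier G" using s g by simp
  have sI: "inv s \<in> carrier G" using s by simp
  have z: "kvec g \<in> L2" by (rule kvec_L2[OF g])
  have eq: "kvec ?t = W s (kvec g)"
  proof (rule kvec_unique[OF t])
    show "W s (kvec g) \<in> L2" by (rule WL[OF s z inv(1)])
    fix k assume k: "k \<in> L2"
    have Wk: "W (inv s) k \<in> L2" by (rule WL[OF sI k inv(2)])
    have rz: "rreg G s (kvec g) \<in> ell2 (carrier G)"
      by (rule bopsD(1)[OF rreg_bounded[OF s] L2_ell2[OF z]])
    have lk: "lreg G (inv s) k \<in> ell2 (carrier G)"
      by (rule bopsD(1)[OF lreg_bounded[OF sI] L2_ell2[OF k]])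
    have "ip k (W s (kvec g)) = ip (lreg G (inv s) k) (rreg G s (kvec g))"
      unfolding W_def using adj_inner(2)[OF lreg_bounded[OF s] L2_ell2[OF k] rz] lreg_adj[OF s] by simp
    also have "\<dots> = ip (rreg G (inv s) (lreg G (inv s) k)) (kvec g)"
      using rreg_inner[OF sI lk L2_ell2[OF z]] s by simp
    also have "rreg G (inv s) (lreg G (inv s) k) = W (inv s) k"
      unfolding W_def using convolversD(2)[OF lreg_convolver[OF sI] sI L2_ell2[OF k]] by simp
    also have "ip (W (inv s) k) (kvec g) = W (inv s) k g"
      by (rule kvec_inner[OF g Wk])
    also have "\<dots> = k ?t" using Wa[OF sI L2_ell2[OF k] g] s by simp
    finally show "ip k (W s (kvec g)) = k ?t" .
  qed
  have "?t \<otimes> s = s \<otimes> g" using s g by (simp add: m_assoc)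
  then have "inv s \<otimes> ?t \<otimes> s = inv s \<otimes> (s \<otimes> g)" using m_assoc[OF sI t s] by (simp only:)
  also have "\<dots> = g" using s g by (simp add: m_assoc[symmetric])
  finally have "inv s \<otimes> ?t \<otimes> s = g" .
  then show ?thesis unfolding eq using Wa[OF s L2_ell2[OF z] t] by simp
qed

end

lemma mat_form_bound:
  assumes b: "\<And>i j. i < k ==> j < k ==> b i j \<in> bounded_ops S"
  obtains C where "C > 0"
    "\<And>\<eta>. \<eta> \<in> mat_vecs S k ==> \<bar>Re (mat_inner k (mat_apply k b \<eta>) \<eta>)\<bar> \<le> C * Re (mat_inner k \<eta> \<eta>)"
proof -
  have "\<forall>p\<in>{..<k} \<times> {..<k}. \<exists>C>0. \<forall>f\<in>ell2 S. nrm (b (fst p) (snd p) f) \<le> C * nrm f"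
  proof
    fix p assume "p \<in> {..<k} \<times> {..<k}"
    then have "b (fst p) (snd p) \<in> bounded_ops S" using b by auto
    then show "\<exists>C>0. \<forall>f\<in>ell2 S. nrm (b (fst p) (snd p) f) \<le> C * nrm f" by (rule bounded_ops_bound)
  qed
  from bchoice[OF this] obtain c where
    c: "\<forall>p\<in>{..<k} \<times> {..<k}. c p > 0 \<and> (\<forall>f\<in>ell2 S. nrm (b (fst p) (snd p) f) \<le> c p * nrm f)" ..
  define C0 where "C0 = sum c ({..<k} \<times> {..<k})"
  have C0: "c p \<le> C0" if "p \<in> {..<k} \<times> {..<k}" for p
    unfolding C0_def by (rule member_le_sum[OF that]) (use c in \<open>auto intro: less_imp_le\<close>)
  have C0n: "C0 \<ge> 0" unfolding C0_def by (rule sum_nonneg) (use c in \<open>auto intro: less_imp_le\<close>)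
  show ?thesis
  proof (rule that[of "real k * real k * C0 + 1"])
    show "real k * real k * C0 + 1 > 0" using C0n by (simp add: add_nonneg_pos)
    fix \<eta> assume \<eta>: "\<eta> \<in> mat_vecs S k"
    define N where "N = (\<Sum>i<k. (nrm (\<eta> i))\<^sup>2)"
    have N: "Re (mat_inner k \<eta> \<eta>) = N" by (simp add: mat_inner_self N_def)
    have Nn: "N \<ge> 0" unfolding N_def by (simp add: sum_nonneg)
    have entry: "cmod (ip (b i j (\<eta> j)) (\<eta> i)) \<le> C0 * N" if ij: "i < k" "j < k" for i j
    proof -
      have e: "\<eta> i \<in> ell2 S" "\<eta> j \<in> ell2 S" using \<eta> ij by (auto simp: mat_vecs_def)
      have p: "(i, j) \<in> {..<k} \<times> {..<k}" using ij by simp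
      have n: "nrm (\<eta> l) ^ 2 \<le> N" if "l < k" for l
        unfolding N_def by (rule member_le_sum) (use that in auto)
      have "2 * (nrm (\<eta> j) * nrm (\<eta> i)) \<le> (nrm (\<eta> j))\<^sup>2 + (nrm (\<eta> i))\<^sup>2"
        using sum_squares_bound[of "nrm (\<eta> j)" "nrm (\<eta> i)"] by simp
      then have pr: "nrm (\<eta> j) * nrm (\<eta> i) \<le> N" using n[OF ij(1)] n[OF ij(2)] by linarith
      have "cmod (ip (b i j (\<eta> j)) (\<eta> i)) \<le> nrm (b i j (\<eta> j)) * nrm (\<eta> i)"
        by (rule ip_cauchy_schwarz[OF bopsD(1)[OF b[OF ij] e(2)] e(1)])
      also have "\<dots> \<le> (c (i, j) * nrm (\<eta> j)) * nrm (\<eta> i)"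
        using c p e by (intro mult_right_mono) auto
      also have "\<dots> = c (i, j) * (nrm (\<eta> j) * nrm (\<eta> i))" by simp
      also have "\<dots> \<le> C0 * N" using pr C0[OF p] C0n Nn by (intro mult_mono) auto
      finally show ?thesis .
    qed
    have "mat_inner k (mat_apply k b \<eta>) \<eta> = (\<Sum>i<k. \<Sum>j<k. ip (b i j (\<eta> j)) (\<eta> i))"
      by (rule mat_form_expand[OF _ \<eta>]) (rule b)
    then have "\<bar>Re (mat_inner k (mat_apply k b \<eta>) \<eta>)\<bar> \<le> cmod (\<Sum>i<k. \<Sum>j<k. ip (b i j (\<eta> j)) (\<eta> i))"
      using abs_Re_le_cmod[of "mat_inner k (mat_apply k b \<eta>) \<eta>"] by simp
    also have "\<dots> \<le> (\<Sum>i<k. \<Sum>j<k. cmod (ip (b i j (\<eta> j)) (\<eta> i)))"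
      by (rule order_trans[OF norm_sum sum_mono[OF norm_sum]])
    also have "\<dots> \<le> (\<Sum>i<k. \<Sum>j<k. C0 * N)" by (intro sum_mono entry) auto
    also have "\<dots> = real k * real k * C0 * N" by simp
    also have "\<dots> \<le> (real k * real k * C0 + 1) * N" using Nn by (simp add: distrib_right)
    finally show "\<bar>Re (mat_inner k (mat_apply k b \<eta>) \<eta>)\<bar> \<le> (real k * real k * C0 + 1) * Re (mat_inner k \<eta> \<eta>)"
      unfolding N .
  qed
qed

lemma mat_apply_single:
  assumes "\<And>j. j < k ==> Y i j 0 = 0" "j < k"
  shows "mat_apply k Y (\<lambda>l. if l = j then f else 0) i = Y i j f"
proof -
  have "mat_apply k Y (\<lambda>l. if l = j then f else 0) i = (\<Sum>l<k. if l = j then Y i j f else 0)"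
    unfolding mat_apply_def by (rule sum.cong) (use assms(1) in auto)
  then show ?thesis using assms(2) by simp
qed

context selfadjoint_matrix
begin

lemma poly_vec_eq:
  assumes "degree p \<le> N"
  shows "poly_vec p \<xi> i = (\<Sum>n\<le>N. vsc (of_real (coeff p n)) ((mat_apply k X ^^ n) \<xi> i))"
  unfolding poly_vec_def by (rule sum.mono_neutral_left) (use assms in \<open>auto simp: coeff_eq_0\<close>)

lemma poly_vec_diff: "poly_vec p \<xi> i - poly_vec q \<xi> i = poly_vec (p - q) \<xi> i"
proof -
  let ?N = "max (degree p) (degree q)"
  have d: "degree p \<le> ?N" "degree q \<le> ?N" "degree (p - q) \<le> ?N" using degree_diff_le_max by auto
  show ?thesis unfolding poly_vec_eq[OF d(1)] poly_vec_eq[OF d(2)] poly_vec_eq[OF d(3)]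
    unfolding sum_subtractf[symmetric]
    by (rule sum.cong) (auto simp: fun_eq_iff algebra_simps)
qed

end

text \<open>Expand the square of \<open>(w - y) + z\<close> and drop the square of \<open>z\<close>.
  In the application \<open>y\<close> and \<open>z\<close> are the positive and negative parts of an
  approximation of \<open>w\<close>: the first cross term has a favourable total, and the second is
  small because the parts are nearly orthogonal.\<close>

lemma defect_bound:
  assumes "w \<in> ell2 S" "y \<in> ell2 S" "z \<in> ell2 S"
  shows "(nrm (w - y))\<^sup>2 \<le> (nrm (w - (y - z)))\<^sup>2 - 2 * Re (ip w z) + 2 * Re (ip y z)"
proof -
  let ?d = "w - y"
  have d: "?d \<in> ell2 S" using assms by auto
  have "ip (?d + z) (?d + z) = ip ?d ?d + ip ?d z + (ip z ?d + ip z z)"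
    by (simp add: ip_add_left[OF d assms(3), of _ S] ip_add_right[OF d assms(3), of _ S] d assms ell2_add)
  moreover have "Re (ip z ?d) = Re (ip ?d z)" by (subst ip_commute) simp
  ultimately have "Re (ip (?d + z) (?d + z)) = Re (ip ?d ?d) + 2 * Re (ip ?d z) + Re (ip z z)"
    by simp
  then have "(nrm (?d + z))\<^sup>2 = (nrm ?d)\<^sup>2 + 2 * Re (ip ?d z) + (nrm z)\<^sup>2"
    by (simp only: ip_self Re_complex_of_real)
  moreover have "Re (ip ?d z) = Re (ip w z) - Re (ip y z)"
    by (simp add: ip_diff_left[OF assms(1,2,3)])
  moreover have "(nrm z)\<^sup>2 \<ge> 0" by simp
  ultimately have "(nrm ?d)\<^sup>2 \<le> (nrm (?d + z))\<^sup>2 - 2 * Re (ip w z) + 2 * Re (ip y z)"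
    by linarith
  moreover have "w - (y - z) = ?d + z" by simp
  ultimately show ?thesis by (simp only:)
qed

context group_subalgebra
begin

text \<open>Averaging an approximant of the entry \<open>(i, j)\<close> with the adjoint of that of
  \<open>(j, i)\<close> costs no accuracy, because \<open>modular_conj\<close> is isometric and
  exchanges the two kernel vectors.\<close>

lemma kernel_matrix_selfadjoint_approx:
  assumes g: "\<And>i. i < k ==> g i \<in> carrier G" and e: "e > 0"
  obtains b where "\<And>i j. i < k ==> j < k ==> b i j \<in> P"
    "\<And>i j. i < k ==> j < k ==> adj (carrier G) (b i j) = b j i"
    "\<And>i j. i < k ==> j < k ==> nrm (kvec (inv (g i) \<otimes> g j) - b i j tvec) < e"
proof -
  define w where "w i j = kvec (inv (g i) \<otimes> g j)" for i j
  have w: "w i j \<in> L2" if "i < k" "j < k" for i j unfolding w_def using that g by (intro kvec_L2) auto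
  have Jw: "modular_conj (w j i) = w i j" if "i < k" "j < k" for i j
    using that g by (simp add: w_def modular_conj_kernel_vec inv_mult_group)
  have "\<forall>p\<in>{..<k} \<times> {..<k}. \<exists>x\<in>P. nrm (w (fst p) (snd p) - x tvec) < e"
    using w e in_L2_iff by (metis SigmaE fst_conv snd_conv lessThan_iff)
  from bchoice[OF this[unfolded Bex_def]] obtain a where
    a: "\<forall>p\<in>{..<k} \<times> {..<k}. a p \<in> P \<and> nrm (w (fst p) (snd p) - a p tvec) < e" ..
  have aP: "a (i, j) \<in> P" "nrm (w i j - a (i, j) tvec) < e" if "i < k" "j < k" for i j
    using a[rule_format, of "(i, j)"] that by auto
  define b where "b i j = op_scale (1 / 2) (a (i, j) + adj (carrier G) (a (j, i)))" for i j
  show ?thesis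
  proof (rule that[of b])
    fix i j assume ij: "i < k" "j < k"
    note A = P_bounded[OF aP(1)[OF ij]] and B = P_bounded[OF aP(1)[OF ij(2,1)]]
    note Ad = vnaD(6)[OF P aP(1)[OF ij(2,1)]]
    show "b i j \<in> P" unfolding b_def by (rule vnaD(5)[OF P vnaD(3)[OF P aP(1)[OF ij] Ad]])
    show "adj (carrier G) (b i j) = b j i"
      unfolding b_def
      by (simp add: adj_scale[OF bounded_ops_add[OF A adj_bounded_ops[OF B]]] adj_add[OF A adj_bounded_ops[OF B]]
          adj_adj[OF B] add.commute)
    have wl: "w i j \<in> ell2 (carrier G)" by (rule L2_ell2[OF w[OF ij]])
    have d1: "w i j - a (i, j) tvec \<in> ell2 (carrier G)" by (rule ell2_minus[OF wl P_delta[OF aP(1)[OF ij]]])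
    have d2: "w i j - adj (carrier G) (a (j, i)) tvec \<in> ell2 (carrier G)" by (rule ell2_minus[OF wl P_delta[OF Ad]])
    have "w i j - adj (carrier G) (a (j, i)) tvec = modular_conj (w j i - a (j, i) tvec)"
      by (simp only: modular_conj_diff Jw[OF ij] modular_conj_adj[OF aP(1)[OF ij(2,1)]])
    then have n2: "nrm (w i j - adj (carrier G) (a (j, i)) tvec) < e"
      using modular_conj_norm[OF ell2_minus[OF L2_ell2[OF w[OF ij(2,1)]] P_delta[OF aP(1)[OF ij(2,1)]]]]
        aP(2)[OF ij(2,1)] by simp
    have "w i j - b i j tvec = vsc (1 / 2) ((w i j - a (i, j) tvec) + (w i j - adj (carrier G) (a (j, i)) tvec))"
      by (auto simp: b_def op_scale_def fun_eq_iff field_simps)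
    then have "nrm (w i j - b i j tvec)
        = 1 / 2 * nrm ((w i j - a (i, j) tvec) + (w i j - adj (carrier G) (a (j, i)) tvec))"
      by (simp only: nrm_scale) simp
    also have "\<dots> < e" using nrm_triangle[OF d1 d2] n2 aP(2)[OF ij] by linarith
    finally show "nrm (kvec (inv (g i) \<otimes> g j) - b i j tvec) < e" by (simp only: w_def)
  qed
qed

text \<open>
  The matrix \<open>(e\<^sub>P(\<delta>\<^bsub>g\<^sub>i\<inverse>g\<^sub>j\<^esub>))\<close> would be the image of the positive matrix \<open>(u\<^bsub>g\<^sub>i\<inverse>g\<^sub>j\<^esub>)\<close> under the conditional
  expectation onto \<open>P\<close>. Instead of constructing the expectation, take the positive part (up to a
  small error) of a self-adjoint approximation with entries in \<open>P\<close>: its negative part pairs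
  nonnegatively with the kernel matrix, so discarding it only improves the approximation.
\<close>

lemma kernel_matrix_positive_approx:
  assumes g: "\<And>i. i < k ==> g i \<in> carrier G" and e: "e > 0"
  obtains Y where "\<And>i j. i < k ==> j < k ==> Y i j \<in> P" "matrix_pos (carrier G) k Y"
    "\<And>i j. i < k ==> j < k ==> nrm (kvec (inv (g i) \<otimes> g j) - Y i j tvec) < e"
proof -
  define w where "w i j = kvec (inv (g i) \<otimes> g j)" for i j
  define e1 where "e1 = e / (2 * (real k + 1))"
  have e1: "e1 > 0" using e by (simp add: e1_def)
  obtain b where b: "\<And>i j. i < k ==> j < k ==> b i j \<in> P"
    "\<And>i j. i < k ==> j < k ==> adj (carrier G) (b i j) = b j i"
    "\<And>i j. i < k ==> j < k ==> nrm (w i j - b i j tvec) < e1"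
    using kernel_matrix_selfadjoint_approx[of k g e1, OF g e1] unfolding w_def by blast
  have w: "w i j \<in> L2" if "i < k" "j < k" for i j unfolding w_def using that g by (intro kvec_L2) auto
  obtain C where C: "C > 0" "\<And>\<eta>. \<eta> \<in> mat_vecs (carrier G) k ==>
      \<bar>Re (mat_inner k (mat_apply k b \<eta>) \<eta>)\<bar> \<le> C * Re (mat_inner k \<eta> \<eta>)"
    using mat_form_bound[of k b "carrier G"] b(1) P_bounded by blast
  \<comment> \<open>Large enough that the cross terms of all \<open>k\<close> columns together are
    at most \<open>e\<^sup>2 / 8\<close>.\<close>
  obtain m :: nat where m: "16 * real k * C\<^sup>2 / e\<^sup>2 < real m" using reals_Archimedean2 by blast
  have "0 \<le> 16 * real k * C\<^sup>2 / e\<^sup>2" by simp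
  then have "real m > 0" using m by linarith
  then have m0: "m > 0" by simp
  \<comment> \<open>The form of \<open>b\<close> lies between \<open>- C\<close> and
    \<open>C\<close> times the norm; the affine change moves it into the unit interval and sends
    zero to \<open>1 / 2\<close>.\<close>
  define X where "X i j = op_scale (1 / 2) (if i = j then op_id (carrier G) else 0) + op_scale (of_real (1 / (2 * C))) (b i j)" for i j
  have S: "selfadjoint_matrix (carrier G) P k X"
  proof
    show "von_neumann_algebra (carrier G) P" by (rule P)
    fix i j assume ij: "i < k" "j < k"
    have I: "(if i = j then op_id (carrier G) else 0) \<in> P" using vnaD(2,8)[OF P] by simp
    show "X i j \<in> P" unfolding X_def by (intro vnaD(3,5)[OF P] I b(1) ij)
    have z: "adj (carrier G) (0 :: 'a op2) = 0" by (rule adj_unique) (auto intro: bounded_ops_0)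
    note Ib = P_bounded[OF I] and bb = P_bounded[OF b(1)[OF ij]]
    have "adj (carrier G) (X i j) = op_scale (1 / 2) (adj (carrier G) (if i = j then op_id (carrier G) else 0)) + op_scale (of_real (1 / (2 * C))) (b j i)"
      unfolding X_def
      by (simp add: adj_add[OF bounded_ops_scale[OF Ib] bounded_ops_scale[OF bb]] adj_scale[OF Ib] adj_scale[OF bb] b(2)[OF ij])
    also have "\<dots> = X j i" unfolding X_def by (simp add: z eq_commute)
    finally show "adj (carrier G) (X i j) = X j i" .
  qed
  interpret X: selfadjoint_matrix "carrier G" P k X by (rule S)
  have Xapp: "mat_apply k X \<xi> i = vsc (1 / 2) (\<xi> i) + vsc (of_real (1 / (2 * C))) (mat_apply k b \<xi> i)"
    if \<xi>: "\<xi> \<in> mat_vecs (carrier G) k" and i: "i < k" for \<xi> i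
  proof
    fix x
    have "X i j (\<xi> j) x = (if j = i then 1 / 2 * \<xi> i x else 0) + of_real (1 / (2 * C)) * b i j (\<xi> j) x" if "j < k" for j
      using \<xi> that by (auto simp: X_def op_scale_def op_id_def mat_vecs_def)
    then have "mat_apply k X \<xi> i x = (\<Sum>j<k. (if j = i then 1 / 2 * \<xi> i x else 0) + of_real (1 / (2 * C)) * b i j (\<xi> j) x)"
      unfolding mat_apply_def sum_vec_apply by (intro sum.cong) auto
    also have "\<dots> = 1 / 2 * \<xi> i x + of_real (1 / (2 * C)) * (\<Sum>j<k. b i j (\<xi> j) x)"
      using i by (simp add: sum.distrib sum_distrib_left)
    finally show "mat_apply k X \<xi> i x = (vsc (1 / 2) (\<xi> i) + vsc (of_real (1 / (2 * C))) (mat_apply k b \<xi> i)) x"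
      by (simp add: mat_apply_def sum_vec_apply)
  qed
  have bv: "mat_apply k b \<xi> i \<in> ell2 (carrier G)" if "\<xi> \<in> mat_vecs (carrier G) k" "i < k" for \<xi> i
    unfolding mat_apply_def
    by (rule ell2_sum, rule bopsD(1)[OF P_bounded[OF b(1)]]) (use that in \<open>auto simp: mat_vecs_def\<close>)
  have form: "Re (mat_inner k (mat_apply k X \<eta>) \<eta>) = Re (mat_inner k \<eta> \<eta>) / 2 + Re (mat_inner k (mat_apply k b \<eta>) \<eta>) / (2 * C)"
    if \<eta>: "\<eta> \<in> mat_vecs (carrier G) k" for \<eta>
  proof -
    have "mat_inner k (mat_apply k X \<eta>) \<eta> = (\<Sum>i<k. 1 / 2 * ip (\<eta> i) (\<eta> i) + of_real (1 / (2 * C)) * ip (mat_apply k b \<eta> i) (\<eta> i))"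
      unfolding mat_inner_def
    proof (rule sum.cong[OF refl])
      fix i assume i: "i \<in> {..<k}"
      have e: "\<eta> i \<in> ell2 (carrier G)" using \<eta> i by (simp add: mat_vecs_def)
      show "ip (mat_apply k X \<eta> i) (\<eta> i) = 1 / 2 * ip (\<eta> i) (\<eta> i) + of_real (1 / (2 * C)) * ip (mat_apply k b \<eta> i) (\<eta> i)"
        using i by (simp only: Xapp[OF \<eta>] lessThan_iff
            ip_add_left[OF ell2_scale[OF e] ell2_scale[OF bv[OF \<eta>]] e] ip_scale_left)
    qed
    also have "\<dots> = 1 / 2 * mat_inner k \<eta> \<eta> + of_real (1 / (2 * C)) * mat_inner k (mat_apply k b \<eta>) \<eta>"
      by (simp only: sum.distrib sum_distrib_left mat_inner_def)
    finally show ?thesis by (simp del: of_real_divide of_real_mult)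
  qed
  have mom: "interval_moments (X.moments \<xi>)" if "\<xi> \<in> mat_vecs (carrier G) k" for \<xi>
  proof (rule X.interval_moments[OF _ _ that])
    fix \<eta> assume \<eta>: "\<eta> \<in> mat_vecs (carrier G) k"
    have "\<bar>Re (mat_inner k (mat_apply k b \<eta>) \<eta>)\<bar> / (2 * C) \<le> C * Re (mat_inner k \<eta> \<eta>) / (2 * C)"
      using C(1) by (intro divide_right_mono C(2)[OF \<eta>]) auto
    also have "\<dots> = Re (mat_inner k \<eta> \<eta>) / 2" using C(1) by simp
    finally have "\<bar>Re (mat_inner k (mat_apply k b \<eta>) \<eta>) / (2 * C)\<bar> \<le> Re (mat_inner k \<eta> \<eta>) / 2" using C(1) by simp
    then show "0 \<le> Re (mat_inner k (mat_apply k X \<eta>) \<eta>)" "Re (mat_inner k (mat_apply k X \<eta>) \<eta>) \<le> Re (mat_inner k \<eta> \<eta>)"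
      unfolding form[OF \<eta>] by linarith+
  qed
  \<comment> \<open>Scaled by \<open>C\<close> so that \<open>p - q = C * (2 x - 1)\<close>, which
    undoes the affine change: the difference of the two parts is \<open>b\<close> on the vectors
    that matter.\<close>
  define p q where "p = smult C (positive_part_poly m)" and "q = smult C (negative_part_poly m)"
  define Y Z where "Y = mat_poly (carrier G) k X p" and "Z = mat_poly (carrier G) k X q"
  have YP: "Y i j \<in> P" "Z i j \<in> P" if "i < k" "j < k" for i j
    using X.poly_P that unfolding Y_def Z_def by blast+
  have pos: "matrix_pos (carrier G) k (mat_poly (carrier G) k X r)"
    if r: "\<And>\<mu>. interval_moments \<mu> ==> 0 \<le> moment \<mu> r" for r
  proof (subst matrix_pos_iff)
    show "mat_poly (carrier G) k X r i j \<in> bounded_ops (carrier G)" if "i < k" "j < k" for i j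
      using X.poly_P that P_bounded by blast
    show "\<forall>\<xi>\<in>mat_vecs (carrier G) k. mat_inner k (mat_apply k (mat_poly (carrier G) k X r) \<xi>) \<xi> \<in> \<real>\<^sub>\<ge>\<^sub>0"
    proof
      fix \<xi> assume \<xi>: "\<xi> \<in> mat_vecs (carrier G) k"
      have "mat_inner k (mat_apply k (mat_poly (carrier G) k X r) \<xi>) \<xi> = mat_inner k (X.poly_vec r \<xi>) \<xi>"
        by (rule mat_inner_cong) (auto simp: X.mat_apply_poly[OF \<xi>])
      then show "mat_inner k (mat_apply k (mat_poly (carrier G) k X r) \<xi>) \<xi> \<in> \<real>\<^sub>\<ge>\<^sub>0"
        using r[OF mom[OF \<xi>]] by (simp add: X.poly_vec_inner(2)[OF \<xi>])
    qed
  qed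
  have Ypos: "matrix_pos (carrier G) k Y" unfolding Y_def p_def
    by (rule pos) (use C(1) part_poly_nonneg(1) in \<open>simp add: moment_smult\<close>)
  have Zpos: "matrix_pos (carrier G) k Z" unfolding Z_def q_def
    by (rule pos) (use C(1) part_poly_nonneg(2) in \<open>simp add: moment_smult\<close>)
  \<comment> \<open>Applying a matrix to this vector reads off its column \<open>j\<close> at
    \<open>tvec\<close>; the two parts are compared with the kernel column by column.\<close>
  define \<epsilon> :: "nat \<Rightarrow> nat \<Rightarrow> 'a vec2" where "\<epsilon> j = (\<lambda>l. if l = j then tvec else 0)" for j
  have \<epsilon>: "\<epsilon> j \<in> mat_vecs (carrier G) k" for j by (auto simp: \<epsilon>_def mat_vecs_def)
  have col: "mat_apply k A (\<epsilon> j) i = A i j tvec"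
    if "\<And>j. j < k ==> A i j \<in> P" "j < k" for A i j
    unfolding \<epsilon>_def by (rule mat_apply_single[of k A i j, OF bopsD(5)[OF P_bounded[OF that(1)]] that(2)])
  have colp: "X.poly_vec r (\<epsilon> j) i = mat_poly (carrier G) k X r i j tvec" if ij: "i < k" "j < k" for i j r
  proof -
    have "mat_apply k (mat_poly (carrier G) k X r) (\<epsilon> j) i = mat_poly (carrier G) k X r i j tvec"
      by (rule col[where A = "mat_poly (carrier G) k X r" and i = i]) (use X.poly_P ij in blast)+
    then show ?thesis by (simp only: X.mat_apply_poly[OF \<epsilon> ij(1)])
  qed
  note Yc = colp[of _ _ p, folded Y_def] and Zc = colp[of _ _ q, folded Z_def]
  have diff: "Y i j tvec - Z i j tvec = b i j tvec" if ij: "i < k" "j < k" for i j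
  proof -
    have "p - q = smult C (positive_part_poly m - negative_part_poly m)" by (simp add: p_def q_def smult_diff_right)
    then have pq: "p - q = [:- C, 2 * C:]" by (simp add: part_poly_diff[OF m0])
    have dg: "degree (p - q) \<le> 1" by (simp add: pq)
    have "Y i j tvec - Z i j tvec = X.poly_vec (p - q) (\<epsilon> j) i"
      by (simp only: Yc[OF ij, symmetric] Zc[OF ij, symmetric] X.poly_vec_diff)
    also have "\<dots> = vsc (of_real (- C)) (\<epsilon> j i) + vsc (of_real (2 * C)) (mat_apply k X (\<epsilon> j) i)"
      by (simp only: X.poly_vec_eq[OF dg]) (simp add: pq)
    also have "\<dots> = mat_apply k b (\<epsilon> j) i"
      unfolding Xapp[OF \<epsilon> ij(1)] using C(1) by (auto simp: fun_eq_iff field_simps)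
    also have "\<dots> = b i j tvec" by (rule col) (use b(1) ij in auto)
    finally show ?thesis .
  qed
  have prod: "(\<Sum>i<k. Re (ip (Y i j tvec) (Z i j tvec))) \<le> 2 * C\<^sup>2 / real m" if j: "j < k" for j
  proof -
    have "(\<Sum>i<k. Re (ip (Y i j tvec) (Z i j tvec))) = Re (mat_inner k (X.poly_vec p (\<epsilon> j)) (X.poly_vec q (\<epsilon> j)))"
      unfolding mat_inner_def Re_sum by (rule sum.cong) (auto simp: Yc Zc j)
    also have "\<dots> = C\<^sup>2 * moment (X.moments (\<epsilon> j)) (positive_part_poly m * negative_part_poly m)"
      unfolding X.poly_vec_inner(1)[OF \<epsilon>] p_def q_def
      by (simp add: moment_smult power2_eq_square)
    also have "\<dots> \<le> C\<^sup>2 * (2 * X.moments (\<epsilon> j) 0 / real m)"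
      by (rule mult_left_mono[OF part_poly_product_le[OF mom[OF \<epsilon>] m0]]) simp
    also have "X.moments (\<epsilon> j) 0 = 1"
    proof -
      have "(\<Sum>i<k. (nrm (\<epsilon> j i))\<^sup>2) = (\<Sum>i<k. if i = j then 1 else 0)"
        by (rule sum.cong) (auto simp: \<epsilon>_def)
      then show ?thesis using j by (simp add: X.moments_def mat_inner_self)
    qed
    finally show ?thesis by (simp add: mult.commute)
  qed
  \<comment> \<open>The reproducing property turns each term into the conjugate of a coefficient of
    \<open>Z\<close>, and the sum of these is the positive form of \<open>Z\<close> at the vectors
    \<open>delta (inv (g j))\<close>.\<close>
  have neg: "0 \<le> (\<Sum>i<k. \<Sum>j<k. Re (ip (w i j) (Z i j tvec)))"
  proof -
    have "ip (w i j) (Z i j tvec) = cnj (ip (Z i j (delta (inv (g j)))) (delta (inv (g i))))"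
      if ij: "i < k" "j < k" for i j
    proof -
      have "Z i j \<in> convolvers G" using YP(2)[OF ij] PL by blast
      note cc = convolver_coefficient[OF this g[OF ij(2)] g[OF ij(1)]]
      have "ip (Z i j tvec) (w i j) = Z i j tvec (inv (g i) \<otimes> g j)"
        unfolding w_def by (rule kvec_inner) (use g ij P_delta_L2[OF YP(2)[OF ij]] in auto)
      then show ?thesis unfolding cc by (subst ip_commute) simp
    qed
    then have "(\<Sum>i<k. \<Sum>j<k. Re (ip (w i j) (Z i j tvec)))
        = Re (\<Sum>i<k. \<Sum>j<k. ip (Z i j (delta (inv (g j)))) (delta (inv (g i))))"
      by simp
    moreover have "(\<Sum>i<k. \<Sum>j<k. ip (Z i j (delta (inv (g j)))) (delta (inv (g i)))) \<in> \<real>\<^sub>\<ge>\<^sub>0"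
      using Zpos[unfolded matrix_pos_def, rule_format, of "\<lambda>j. delta (inv (g j))"] g by simp
    ultimately show ?thesis by (simp add: complex_nonneg_Reals_iff)
  qed
  \<comment> \<open>The approximation errors contribute at most \<open>e\<^sup>2 / 4\<close> and the
    products of the two parts at most \<open>2 * (e\<^sup>2 / 8)\<close>; the pairing with
    \<open>Z\<close> only helps, by \<open>neg\<close>.\<close>
  have total: "(\<Sum>i<k. \<Sum>j<k. (nrm (w i j - Y i j tvec))\<^sup>2) < e\<^sup>2"
  proof -
    have each: "(nrm (w i j - Y i j tvec))\<^sup>2 \<le> e1\<^sup>2 - 2 * Re (ip (w i j) (Z i j tvec))
        + 2 * Re (ip (Y i j tvec) (Z i j tvec))" if ij: "i < k" "j < k" for i j
    proof -
      have "(nrm (w i j - b i j tvec))\<^sup>2 \<le> e1\<^sup>2" using b(3)[OF ij] by (intro power_mono) auto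
      then show ?thesis
        using defect_bound[OF L2_ell2[OF w[OF ij]] P_delta[OF YP(1)[OF ij]] P_delta[OF YP(2)[OF ij]]]
        unfolding diff[OF ij] by linarith
    qed
    have "(\<Sum>i<k. \<Sum>j<k. (nrm (w i j - Y i j tvec))\<^sup>2)
        \<le> (\<Sum>i<k. \<Sum>j<k. e1\<^sup>2 - 2 * Re (ip (w i j) (Z i j tvec)) + 2 * Re (ip (Y i j tvec) (Z i j tvec)))"
      using each by (intro sum_mono) auto
    also have "\<dots> = real k * real k * e1\<^sup>2 - 2 * (\<Sum>i<k. \<Sum>j<k. Re (ip (w i j) (Z i j tvec)))
        + 2 * (\<Sum>i<k. \<Sum>j<k. Re (ip (Y i j tvec) (Z i j tvec)))"
      by (simp only: sum.distrib sum_subtractf sum_distrib_left[symmetric]) simp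
    also have "(\<Sum>i<k. \<Sum>j<k. Re (ip (Y i j tvec) (Z i j tvec))) = (\<Sum>j<k. \<Sum>i<k. Re (ip (Y i j tvec) (Z i j tvec)))"
      by (rule sum.swap)
    finally have "(\<Sum>i<k. \<Sum>j<k. (nrm (w i j - Y i j tvec))\<^sup>2) \<le> real k * real k * e1\<^sup>2
        + 2 * (\<Sum>j<k. \<Sum>i<k. Re (ip (Y i j tvec) (Z i j tvec)))" using neg by linarith
    moreover have "(\<Sum>j<k. \<Sum>i<k. Re (ip (Y i j tvec) (Z i j tvec))) \<le> (\<Sum>j<k. 2 * C\<^sup>2 / real m)"
      by (rule sum_mono) (use prod in auto)
    moreover have "(\<Sum>j<k. 2 * C\<^sup>2 / real m) \<le> e\<^sup>2 / 8"
    proof -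
      have "16 * real k * C\<^sup>2 < real m * e\<^sup>2" using m e by (simp add: pos_divide_less_eq)
      then show ?thesis using m0 by (simp add: field_simps)
    qed
    moreover have "real k * real k * e1\<^sup>2 \<le> e\<^sup>2 / 4"
    proof -
      have "real k * e1 \<le> e / 2" using e by (simp add: e1_def field_simps)
      then have "(real k * e1)\<^sup>2 \<le> (e / 2)\<^sup>2" using e1 by (intro power_mono) auto
      then show ?thesis by (simp add: power_divide power2_eq_square mult_ac)
    qed
    moreover have "e\<^sup>2 > 0" using e by simp
    ultimately show ?thesis by linarith
  qed
  show ?thesis
  proof (rule that[OF YP(1) Ypos])
    fix i j assume ij: "i < k" "j < k"
    have "(nrm (w i j - Y i j tvec))\<^sup>2 \<le> (\<Sum>j<k. (nrm (w i j - Y i j tvec))\<^sup>2)"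
      by (rule member_le_sum[where f = "\<lambda>j. (nrm (w i j - Y i j tvec))\<^sup>2"]) (use ij in auto)
    also have "\<dots> \<le> (\<Sum>i<k. \<Sum>j<k. (nrm (w i j - Y i j tvec))\<^sup>2)"
      by (rule member_le_sum[where f = "\<lambda>i. \<Sum>j<k. (nrm (w i j - Y i j tvec))\<^sup>2"]) (use ij in \<open>auto intro: sum_nonneg\<close>)
    finally have "(nrm (w i j - Y i j tvec))\<^sup>2 < e\<^sup>2" using total by linarith
    then show "nrm (kvec (inv (g i) \<otimes> g j) - Y i j tvec) < e"
      unfolding w_def using e by (simp add: power_less_imp_less_base)
  qed
qed

end

subsection \<open>Positive definite functions from the Haagerup property\<close>

lemma nonneg_Reals_self: "ip f f \<in> \<real>\<^sub>\<ge>\<^sub>0"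
  by (simp add: ip_self)

lemma op_pos_id: "op_pos S (op_id S)"
  by (simp add: op_pos_def op_id_def nonneg_Reals_self)

lemma op_pos_square:
  assumes "x \<in> bounded_ops S" shows "op_pos S (adj S x \<circ> x)"
  unfolding op_pos_def
proof
  fix f assume f: "f \<in> ell2 S"
  have "ip ((adj S x \<circ> x) f) f = ip (x f) (x f)"
    using adj_inner(2)[OF assms bopsD(1)[OF assms f] f] by simp
  then show "ip ((adj S x \<circ> x) f) f \<in> \<real>\<^sub>\<ge>\<^sub>0" by (simp add: nonneg_Reals_self)
qed

lemma sum_lessThan_2: "(\<Sum>i<(2::nat). f i) = f 0 + (f 1 :: complex)"
  by (simp add: numeral_2_eq_2)

lemma matrix_pos_2_cauchy_schwarz:
  assumes X: "\<And>i j. X i j \<in> bounded_ops S" "matrix_pos S 2 X" and f: "f \<in> ell2 S" and g: "g \<in> ell2 S"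
  shows "(cmod (ip (X 0 1 f) g))\<^sup>2 \<le> Re (ip (X 0 0 g) g) * Re (ip (X 1 1 f) f)"
    and "0 \<le> Re (ip (X 1 1 f) f)"
proof -
  have nn: "\<alpha> * cnj \<alpha> * ip (X 1 1 f) f + \<beta> * cnj \<beta> * ip (X 0 0 g) g
      + \<alpha> * cnj \<beta> * ip (X 0 1 f) g + \<beta> * cnj \<alpha> * ip (X 1 0 g) f \<in> \<real>\<^sub>\<ge>\<^sub>0" for \<alpha> \<beta>
  proof -
    define \<xi> where "\<xi> i = (if i = (0::nat) then vsc \<beta> g else vsc \<alpha> f)" for i
    have "\<xi> i \<in> ell2 S" for i using f g by (auto simp: \<xi>_def)
    from X(2)[unfolded matrix_pos_def, rule_format, of \<xi>, OF this]
    have "(\<Sum>i<2. \<Sum>j<2. ip (X i j (\<xi> j)) (\<xi> i)) \<in> \<real>\<^sub>\<ge>\<^sub>0" .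
    moreover have "\<xi> 0 = vsc \<beta> g" "\<xi> 1 = vsc \<alpha> f" by (simp_all add: \<xi>_def)
    ultimately show ?thesis
      by (simp only: sum_lessThan_2 bopsD(3)[OF X(1) f] bopsD(3)[OF X(1) g]
          ip_scale_left ip_scale_right mult_ac add_ac)
  qed
  show "(cmod (ip (X 0 1 f) g))\<^sup>2 \<le> Re (ip (X 0 0 g) g) * Re (ip (X 1 1 f) f)"
    using cauchy_schwarz_form(1)[OF nn] by (simp only: mult.commute)
  show "0 \<le> Re (ip (X 1 1 f) f)" using nn[of 1 0] by (simp add: complex_nonneg_Reals_iff)
qed

context group_subalgebra
begin

lemma canonical_trace_id: "canonical_trace G (op_id (carrier G)) = 1"
proof -
  have "tvec \<one> = (1 :: complex)" by (simp add: delta_def)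
  then show ?thesis by (simp add: canonical_trace_def op_id_def)
qed

text \<open>A Kadison-Schwarz argument: apply \<open>\<phi>\<close> to a positive 2 by 2 matrix with
  off-diagonal entry \<open>x\<close> and use Cauchy-Schwarz at \<open>tvec\<close> and
  \<open>delta g\<close>. The two diagonal values are traces, which subtraciality bounds by one and
  by the squared norm of \<open>x tvec\<close>.\<close>

lemma cp_coefficient_bound:
  assumes cp: "completely_positive (carrier G) P \<phi>" and st: "subtracial G P \<phi>"
    and x: "x \<in> P" and g: "g \<in> carrier G"
  shows "cmod (\<phi> x tvec g) \<le> nrm (x tvec)"
proof -
  let ?S = "carrier G"
  note xb = P_bounded[OF x]
  \<comment> \<open>The matrix with rows \<open>(1, x)\<close> and \<open>(x^*, x^* x)\<close>, that
    is, the product of the adjoint of the row \<open>(1, x)\<close> with that row.\<close>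
  define M where "M i j = (if i = 0 then (if j = 0 then op_id ?S else x) else (if j = 0 then adj ?S x else adj ?S x \<circ> x))" for i j :: nat
  have xP: "adj ?S x \<in> P" "adj ?S x \<circ> x \<in> P" "op_id ?S \<in> P" using vnaD(2,4,6)[OF P] x by auto
  have MP: "M i j \<in> P" for i j using xP x by (simp add: M_def)
  have Mpos: "matrix_pos ?S 2 M"
    unfolding matrix_pos_def
  proof (intro allI impI)
    fix \<xi> :: "nat \<Rightarrow> 'a vec2" assume "\<forall>i<2. \<xi> i \<in> ell2 ?S"
    then have v: "\<xi> 0 \<in> ell2 ?S" "\<xi> 1 \<in> ell2 ?S" by auto
    note xv = bopsD(1)[OF xb v(2)]
    have "(\<Sum>i<2. \<Sum>j<2. ip (M i j (\<xi> j)) (\<xi> i))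
      = ip (\<xi> 0) (\<xi> 0) + ip (x (\<xi> 1)) (\<xi> 0) + (ip (adj ?S x (\<xi> 0)) (\<xi> 1) + ip (adj ?S x (x (\<xi> 1))) (\<xi> 1))"
      using v by (simp add: sum_lessThan_2 M_def op_id_def)
    also have "\<dots> = ip (\<xi> 0) (\<xi> 0) + ip (x (\<xi> 1)) (\<xi> 0) + (ip (\<xi> 0) (x (\<xi> 1)) + ip (x (\<xi> 1)) (x (\<xi> 1)))"
      by (simp only: adj_inner(2)[OF xb v] adj_inner(2)[OF xb xv v(2)])
    also have "\<dots> = ip (\<xi> 0 + x (\<xi> 1)) (\<xi> 0 + x (\<xi> 1))"
      by (simp only: ip_add_left[OF v(1) xv ell2_add[OF v(1) xv]] ip_add_right[OF v(1) xv v(1)]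
          ip_add_right[OF v(1) xv xv] add_ac)
    finally show "(\<Sum>i<2. \<Sum>j<2. ip (M i j (\<xi> j)) (\<xi> i)) \<in> \<real>\<^sub>\<ge>\<^sub>0" by (simp only: nonneg_Reals_self)
  qed
  have cpD: "\<phi> y \<in> P" if "y \<in> P" for y using cp that by (simp add: completely_positive_def)
  have \<phi>pos: "matrix_pos ?S 2 (\<lambda>i j. \<phi> (M i j))"
    using cp MP Mpos unfolding completely_positive_def by blast
  define A where "A = ip (\<phi> (op_id ?S) (delta g)) (delta g)"
  define D where "D = ip (\<phi> (adj ?S x \<circ> x) tvec) tvec"
  define Z where "Z = ip (\<phi> x tvec) (delta g)"
  have dl: "delta g \<in> ell2 ?S" "tvec \<in> ell2 ?S" using g by auto
  have ZZ: "(cmod Z)\<^sup>2 \<le> Re A * Re D" and D0: "0 \<le> Re D"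
    using matrix_pos_2_cauchy_schwarz[OF P_bounded[OF cpD[OF MP]] \<phi>pos dl(2,1)]
    by (simp_all add: A_def D_def Z_def M_def)
  have "\<phi> (op_id ?S) \<in> convolvers G" using cpD xP(3) PL by blast
  from convolver_delta[OF this g g] have "A = canonical_trace G (\<phi> (op_id ?S))"
    using g by (simp add: A_def canonical_trace_def)
  then have A1: "Re A \<le> 1"
    using st[unfolded subtracial_def, rule_format, OF xP(3) op_pos_id[of ?S]] canonical_trace_id by simp
  have "canonical_trace G (adj ?S x \<circ> x) = ip (x tvec) (x tvec)"
    unfolding canonical_trace_def using adj_inner(2)[OF xb P_delta[OF x] dl(2)] by simp
  then have "Re (canonical_trace G (adj ?S x \<circ> x)) = (nrm (x tvec))\<^sup>2" by (simp add: ip_self)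
  then have D1: "Re D \<le> (nrm (x tvec))\<^sup>2"
    using st[unfolded subtracial_def, rule_format, OF xP(2) op_pos_square[OF xb]] by (simp add: D_def canonical_trace_def)
  have "Re A * Re D \<le> 1 * (nrm (x tvec))\<^sup>2" by (rule mult_mono[OF A1 D1]) (use D0 in auto)
  then have "(cmod Z)\<^sup>2 \<le> (nrm (x tvec))\<^sup>2" using ZZ by linarith
  from power2_le_imp_le[OF this nrm_nonneg] show ?thesis by (simp add: Z_def)
qed

lemma L2_minus: "f \<in> L2 ==> f' \<in> L2 ==> f - f' \<in> L2"
  by (rule closed_subspaceD(5)[OF closed_subspace_L2])

text \<open>Compactness is turned into finite nets for the image of the unit ball. The coefficient
  bound with constant one passes from \<open>P\<close> to \<open>L2\<close> by density, using the
  cruder norm bound on \<open>T\<close> that a finite net provides.\<close>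

lemma compact_extension:
  assumes cp: "completely_positive (carrier G) P \<phi>" and st: "subtracial G P \<phi>" and comp: "L2_compact G P \<phi>"
  obtains T where "\<And>f f'. f \<in> L2 ==> f' \<in> L2 ==> T (f - f') = T f - T f'"
    "\<And>x. x \<in> P ==> T (x tvec) = \<phi> x tvec"
    "\<And>f g. f \<in> L2 ==> g \<in> carrier G ==> cmod (T f g) \<le> nrm f"
    "\<And>f. f \<in> L2 ==> T f \<in> ell2 (carrier G)"
    "\<And>e. e > 0 ==> \<exists>N. finite N \<and> N \<subseteq> ell2 (carrier G) \<and> (\<forall>f\<in>L2. nrm f \<le> 1 \<longrightarrow> (\<exists>c\<in>N. nrm (T f - c) < e))"
proof -
  let ?S = "carrier G"
  obtain T where T: "compact_operator_on ?S L2 T" and T\<phi>: "\<And>x. x \<in> P ==> T (x tvec) = \<phi> x tvec"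
    using comp unfolding L2_compact_def by blast
  have lin: "\<And>f. f \<in> L2 ==> T f \<in> L2" "\<And>f f'. f \<in> L2 ==> f' \<in> L2 ==> T (f + f') = T f + T f'"
    "\<And>c f. f \<in> L2 ==> T (vsc c f) = vsc c (T f)"
    using T unfolding compact_operator_on_def linear_map_on_def by auto
  note sub = closed_subspaceD[OF closed_subspace_L2]
  have Tdiff: "T (f - f') = T f - T f'" if "f \<in> L2" "f' \<in> L2" for f f'
    unfolding minus_vsc using lin(2)[OF that(1) sub(4)[OF that(2)]] lin(3)[OF that(2)] by (simp only:)
  have comp': "compactin (ell2_topology ?S) (ell2_topology ?S closure_of (T ` {f \<in> L2. nrm f \<le> 1}))"
    using T unfolding compact_operator_on_def by blast
  have ball: "T ` {f \<in> L2. nrm f \<le> 1} \<subseteq> ell2 ?S" using lin(1) L2_ell2 by blast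
  have tb: "\<exists>N. finite N \<and> N \<subseteq> ell2 ?S \<and> (\<forall>f\<in>L2. nrm f \<le> 1 \<longrightarrow> (\<exists>c\<in>N. nrm (T f - c) < e))" if e: "e > 0" for e
  proof (rule mtotally_boundedD[OF comp' ball e])
    fix N assume N: "finite N" "N \<subseteq> ell2 ?S"
      "\<And>h. h \<in> T ` {f \<in> L2. nrm f \<le> 1} ==> \<exists>c\<in>N. nrm (h - c) < e"
    have "\<forall>f\<in>L2. nrm f \<le> 1 \<longrightarrow> (\<exists>c\<in>N. nrm (T f - c) < e)"
      by (intro ballI impI N(3)) auto
    then show ?thesis using N(1,2) by blast
  qed
  obtain N where N: "finite N" "N \<subseteq> ell2 ?S" "\<forall>f\<in>L2. nrm f \<le> 1 \<longrightarrow> (\<exists>c\<in>N. nrm (T f - c) < 1)"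
    using tb[of 1] by auto
  \<comment> \<open>Every image of the unit ball is within one of some net point, and no net point
    has norm above the sum.\<close>
  define C where "C = 1 + sum nrm N"
  have C0: "C > 0" unfolding C_def by (simp add: add_pos_nonneg sum_nonneg)
  have ub: "nrm (T f) \<le> C" if f: "f \<in> L2" "nrm f \<le> 1" for f
  proof -
    obtain c where c: "c \<in> N" "nrm (T f - c) < 1" using N(3) f by blast
    have cl: "c \<in> ell2 ?S" using c(1) N(2) by blast
    have "nrm ((T f - c) + c) \<le> nrm (T f - c) + nrm c"
      by (rule nrm_triangle[OF ell2_minus[OF L2_ell2[OF lin(1)[OF f(1)]] cl] cl])
    moreover have "nrm c \<le> sum nrm N" by (rule member_le_sum[OF c(1)]) (use N(1) in auto)
    ultimately show ?thesis using c(2) by (simp add: C_def)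
  qed
  have bd: "nrm (T f) \<le> C * nrm f" if f: "f \<in> L2" for f
  proof (cases "nrm f = 0")
    case True
    then have "f = 0" using nrm_eq_0_iff[OF L2_ell2[OF f]] by blast
    then have "T f = 0" using lin(3)[OF f, of 0] by simp
    then show ?thesis using True by simp
  next
    case False
    let ?n = "nrm f"
    have n: "?n > 0" using False by (simp add: less_le)
    let ?h = "vsc (of_real (1 / ?n)) f"
    have "nrm ?h = 1" using n by (simp add: nrm_scale norm_divide)
    then have "nrm (T ?h) \<le> C" by (intro ub sub(4) f) simp
    then have "1 / ?n * nrm (T f) \<le> C" using n by (simp add: lin(3)[OF f] nrm_scale norm_divide)
    then show ?thesis using n by (simp add: field_simps)
  qed
  have coeff: "cmod (T f g) \<le> nrm f" if f: "f \<in> L2" and g: "g \<in> ?S" for f g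
  proof (rule field_le_epsilon)
    fix e :: real assume e: "e > 0"
    define e' where "e' = e / (1 + C)"
    have e': "e' > 0" using e C0 by (simp add: e'_def)
    obtain x where x: "x \<in> P" "nrm (f - x tvec) < e'" using f e' in_L2_iff by blast
    have d: "f - x tvec \<in> L2" by (rule L2_minus[OF f P_delta_L2[OF x(1)]])
    have "T f g = T (f - x tvec) g + \<phi> x tvec g"
      using Tdiff[OF f P_delta_L2[OF x(1)]] T\<phi>[OF x(1)] by simp
    then have "cmod (T f g) \<le> cmod (T (f - x tvec) g) + cmod (\<phi> x tvec g)" by (simp add: norm_triangle_ineq)
    moreover have "cmod (T (f - x tvec) g) \<le> C * nrm (f - x tvec)"
      by (rule order_trans[OF nrm_component[OF L2_ell2[OF lin(1)[OF d]]] bd[OF d]])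
    moreover have "C * nrm (f - x tvec) \<le> C * e'" using x(2) C0 by (intro mult_left_mono) auto
    moreover have "cmod (\<phi> x tvec g) \<le> nrm (x tvec)" by (rule cp_coefficient_bound[OF cp st x(1) g])
    moreover have "nrm (x tvec) \<le> nrm f + nrm (f - x tvec)"
      using nrm_triangle_diff[OF L2_ell2[OF f] L2_ell2[OF d]] by simp
    ultimately have "cmod (T f g) \<le> nrm f + (e' + C * e')" using x(2) by linarith
    also have "e' + C * e' = (1 + C) * e'" by (simp add: distrib_right)
    also have "\<dots> = e" using C0 by (simp add: e'_def)
    finally show "cmod (T f g) \<le> nrm f + e" .
  qed
  show ?thesis by (rule that[of T]) (fact Tdiff T\<phi> coeff L2_ell2[OF lin(1)] tb)+
qed

text \<open>\<open>T (kvec g) g\<close> plays the role of the trace of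
  \<open>\<phi>(E(u_g)) u_g^*\<close> with \<open>E\<close> the expectation onto \<open>P\<close>.
  Complete positivity is applied to positive matrices over \<open>P\<close> close to the kernel
  matrix, and closedness of the nonnegative reals removes the error.\<close>

lemma positive_definite_multiplier:
  assumes cp: "completely_positive (carrier G) P \<phi>"
    and T: "\<And>f f'. f \<in> L2 ==> f' \<in> L2 ==> T (f - f') = T f - T f'"
      "\<And>x. x \<in> P ==> T (x tvec) = \<phi> x tvec"
      "\<And>f g. f \<in> L2 ==> g \<in> carrier G ==> cmod (T f g) \<le> nrm f"
  shows "posdef G (\<lambda>g. T (kvec g) g)"
  unfolding posdef_def
proof (intro allI impI)
  fix k :: nat and g :: "nat \<Rightarrow> 'a" and a :: "nat \<Rightarrow> complex"
  assume "\<forall>i<k. g i \<in> carrier G"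
  then have g: "\<And>i. i < k ==> g i \<in> carrier G" by blast
  let ?h = "\<lambda>i j. inv (g i) \<otimes> g j"
  let ?s = "\<Sum>i<k. \<Sum>j<k. cnj (a i) * a j * T (kvec (?h i j)) (?h i j)"
  have "\<exists>y\<in>\<real>\<^sub>\<ge>\<^sub>0. dist y ?s < e" if e: "e > 0" for e
  proof -
    define M where "M = (\<Sum>i<k. \<Sum>j<k. cmod (a i) * cmod (a j))"
    have M0: "M \<ge> 0" by (simp add: M_def sum_nonneg)
    define e' where "e' = e / (M + 1)"
    have e': "e' > 0" using e M0 by (simp add: e'_def)
    obtain Y where Y: "\<And>i j. i < k ==> j < k ==> Y i j \<in> P" "matrix_pos (carrier G) k Y"
      "\<And>i j. i < k ==> j < k ==> nrm (kvec (?h i j) - Y i j tvec) < e'"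
      using kernel_matrix_positive_approx[of k g e', OF g e'] by blast
    let ?t = "\<Sum>i<k. \<Sum>j<k. cnj (a i) * a j * \<phi> (Y i j) tvec (?h i j)"
    have \<phi>P: "\<phi> (Y i j) \<in> P" if "i < k" "j < k" for i j
      using cp Y(1)[OF that] by (simp add: completely_positive_def)
    have "matrix_pos (carrier G) k (\<lambda>i j. \<phi> (Y i j))"
      using cp Y(1,2) unfolding completely_positive_def by blast
    from this[unfolded matrix_pos_def, rule_format, of "\<lambda>j. vsc (a j) (delta (inv (g j)))"]
    have "(\<Sum>i<k. \<Sum>j<k. ip (\<phi> (Y i j) (vsc (a j) (delta (inv (g j))))) (vsc (a i) (delta (inv (g i))))) \<in> \<real>\<^sub>\<ge>\<^sub>0"
      using g by (simp add: ell2_scale)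
    also have "(\<Sum>i<k. \<Sum>j<k. ip (\<phi> (Y i j) (vsc (a j) (delta (inv (g j))))) (vsc (a i) (delta (inv (g i))))) = ?t"
    proof (intro sum.cong refl)
      fix i j assume "i \<in> {..<k}" "j \<in> {..<k}"
      then have ij: "i < k" "j < k" by auto
      have d: "delta (inv (g j)) \<in> ell2 (carrier G)" using g[OF ij(2)] by simp
      have cv: "\<phi> (Y i j) \<in> convolvers G" using \<phi>P[OF ij] PL by blast
      have "ip (\<phi> (Y i j) (vsc (a j) (delta (inv (g j))))) (vsc (a i) (delta (inv (g i))))
          = a j * (cnj (a i) * ip (\<phi> (Y i j) (delta (inv (g j)))) (delta (inv (g i))))"
        by (simp only: bopsD(3)[OF P_bounded[OF \<phi>P[OF ij]] d] ip_scale_left ip_scale_right mult_ac)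
      also have "\<dots> = cnj (a i) * a j * \<phi> (Y i j) tvec (?h i j)"
        using convolver_coefficient[OF cv g[OF ij(2)] g[OF ij(1)]] by simp
      finally show "ip (\<phi> (Y i j) (vsc (a j) (delta (inv (g j))))) (vsc (a i) (delta (inv (g i))))
          = cnj (a i) * a j * \<phi> (Y i j) tvec (?h i j)" .
    qed
    finally have t: "?t \<in> \<real>\<^sub>\<ge>\<^sub>0" .
    have "cmod (?t - ?s) = cmod (\<Sum>i<k. \<Sum>j<k. cnj (a i) * a j * (\<phi> (Y i j) tvec (?h i j) - T (kvec (?h i j)) (?h i j)))"
      by (simp only: sum_subtractf[symmetric] right_diff_distrib)
    also have "\<dots> \<le> (\<Sum>i<k. \<Sum>j<k. cmod (cnj (a i) * a j * (\<phi> (Y i j) tvec (?h i j) - T (kvec (?h i j)) (?h i j))))"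
      by (rule order_trans[OF norm_sum sum_mono[OF norm_sum]])
    also have "\<dots> \<le> (\<Sum>i<k. \<Sum>j<k. cmod (a i) * cmod (a j) * e')"
    proof (intro sum_mono)
      fix i j assume "i \<in> {..<k}" "j \<in> {..<k}"
      then have ij: "i < k" "j < k" by auto
      have h: "?h i j \<in> carrier G" using g ij by simp
      have d: "kvec (?h i j) - Y i j tvec \<in> L2" by (rule L2_minus[OF kvec_L2[OF h] P_delta_L2[OF Y(1)[OF ij]]])
      have "T (kvec (?h i j) - Y i j tvec) (?h i j) = T (kvec (?h i j)) (?h i j) - \<phi> (Y i j) tvec (?h i j)"
        by (simp add: T(1)[OF kvec_L2[OF h] P_delta_L2[OF Y(1)[OF ij]]] T(2)[OF Y(1)[OF ij]])
      then have "cmod (\<phi> (Y i j) tvec (?h i j) - T (kvec (?h i j)) (?h i j)) \<le> e'"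
        using T(3)[OF d h] Y(3)[OF ij] by (simp add: norm_minus_commute)
      then show "cmod (cnj (a i) * a j * (\<phi> (Y i j) tvec (?h i j) - T (kvec (?h i j)) (?h i j))) \<le> cmod (a i) * cmod (a j) * e'"
        unfolding norm_mult complex_mod_cnj by (intro mult_left_mono) auto
    qed
    also have "\<dots> = M * e'" by (simp add: M_def sum_distrib_right)
    also have "\<dots> < e" using e M0 by (simp add: e'_def pos_divide_less_eq)
    finally show ?thesis using t by (auto simp: dist_norm)
  qed
  then show "?s \<in> \<real>\<^sub>\<ge>\<^sub>0"
    using closed_approachable[OF closed_nonneg_Reals_complex] by blast
qed

text \<open>Vanishing at infinity is where compactness enters: \<open>T\<close> maps the vectors
  \<open>kvec g\<close>, all of norm at most one, near a finite net, and each net vector has only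
  finitely many coordinates that are not small.\<close>

theorem haagerup_characters:
  assumes H: "haagerup G P" and E: "finite E" "E \<subseteq> carrier G" and e: "e > 0"
  shows "\<exists>\<psi>. posdef G \<psi> \<and> Re (\<psi> \<one>) \<le> 1 \<and> (\<forall>e>0. finite {g \<in> carrier G. cmod (\<psi> g) \<ge> e}) \<and>
    (\<forall>g\<in>E. cmod (\<psi> g - kvec g g) < e)"
proof -
  let ?S = "carrier G"
  obtain F where F: "F \<noteq> bot"
    "\<forall>\<^sub>F \<phi> in F. completely_positive ?S P \<phi> \<and> normal_map ?S P \<phi> \<and> subtracial G P \<phi> \<and> L2_compact G P \<phi>"
    "\<And>x. x \<in> P ==> ((\<lambda>\<phi>. trace_norm2 G (\<phi> x - x)) \<longlongrightarrow> 0) F"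
    using H unfolding haagerup_def by blast
  have e3: "e / 3 > 0" using e by simp
  have "\<forall>g\<in>E. \<exists>x. x \<in> P \<and> nrm (kvec g - x tvec) < e / 3"
  proof
    fix g assume "g \<in> E"
    then have "kvec g \<in> L2" using E(2) by (intro kvec_L2) blast
    then show "\<exists>x. x \<in> P \<and> nrm (kvec g - x tvec) < e / 3" using e3 in_L2_iff by blast
  qed
  from bchoice[OF this] obtain x where x: "\<forall>g\<in>E. x g \<in> P \<and> nrm (kvec g - x g tvec) < e / 3" ..
  have "\<forall>\<^sub>F \<phi> in F. \<forall>g\<in>E. trace_norm2 G (\<phi> (x g) - x g) < e / 3"
    by (rule eventually_ball_finite[OF E(1)]) (use x order_tendstoD(2)[OF F(3) e3] in blast)
  from eventually_happens'[OF F(1) eventually_conj[OF F(2) this]]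
  obtain \<phi> where \<phi>: "completely_positive ?S P \<phi>" "subtracial G P \<phi>" "L2_compact G P \<phi>"
    "\<forall>g\<in>E. trace_norm2 G (\<phi> (x g) - x g) < e / 3" by (elim exE conjE)
  show ?thesis
  proof (rule compact_extension[OF \<phi>(1-3)])
    fix T assume T: "\<And>f f'. f \<in> L2 ==> f' \<in> L2 ==> T (f - f') = T f - T f'"
    "\<And>x. x \<in> P ==> T (x tvec) = \<phi> x tvec"
    "\<And>f g. f \<in> L2 ==> g \<in> carrier G ==> cmod (T f g) \<le> nrm f"
    "\<And>f. f \<in> L2 ==> T f \<in> ell2 ?S"
    "\<And>e. e > 0 ==> \<exists>N. finite N \<and> N \<subseteq> ell2 ?S \<and> (\<forall>f\<in>L2. nrm f \<le> 1 \<longrightarrow> (\<exists>c\<in>N. nrm (T f - c) < e))"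
    have cpP: "\<phi> y \<in> P" if "y \<in> P" for y using \<phi>(1) that by (simp add: completely_positive_def)
    let ?\<psi> = "\<lambda>g. T (kvec g) g"
    \<comment> \<open>The squared norm is the coordinate \<open>kvec g g\<close>, which is itself at
      most the norm.\<close>
    have kn: "nrm (kvec g) \<le> 1" if g: "g \<in> ?S" for g
    proof -
      have "(nrm (kvec g))\<^sup>2 = cmod (ip (kvec g) (kvec g))"
        unfolding ip_self norm_of_real by simp
      also have "\<dots> = cmod (kvec g g)" by (simp only: kvec_inner[OF g kvec_L2[OF g]])
      also have "\<dots> \<le> nrm (kvec g)" by (rule nrm_component[OF L2_ell2[OF kvec_L2[OF g]]])
      finally have "nrm (kvec g) * nrm (kvec g) \<le> 1 * nrm (kvec g)"
        by (simp add: power2_eq_square)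
      then show ?thesis
        by (cases "nrm (kvec g) = 0") (simp_all add: less_le mult_le_cancel_right)
    qed
    have one: "Re (?\<psi> \<one>) \<le> 1"
    proof -
      have "T tvec = \<phi> (op_id ?S) tvec"
        using T(2)[OF vnaD(2)[OF P]] by (simp add: op_id_def)
      then have "?\<psi> \<one> = canonical_trace G (\<phi> (op_id ?S))" by (simp add: kvec_one canonical_trace_def)
      moreover have "Re (canonical_trace G (\<phi> (op_id ?S))) \<le> Re (canonical_trace G (op_id ?S))"
        using \<phi>(2) vnaD(2)[OF P] op_pos_id[of ?S] by (simp add: subtracial_def)
      moreover have "canonical_trace G (op_id ?S) = 1" by (rule canonical_trace_id)
      ultimately show ?thesis by simp
    qed
    have vanish: "finite {g \<in> ?S. cmod (?\<psi> g) \<ge> d}" if d: "d > 0" for d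
    proof -
      have d2: "d / 2 > 0" using d by simp
      obtain N where N: "finite N" "N \<subseteq> ell2 ?S" "\<forall>f\<in>L2. nrm f \<le> 1 \<longrightarrow> (\<exists>c\<in>N. nrm (T f - c) < d / 2)"
        using T(5)[OF d2] by (elim exE conjE)
      have fin: "finite {g. cmod (c g) \<ge> d / 2}" if "c \<in> N" for c
      proof -
        have c: "c \<in> ell2 ?S" using that N(2) by blast
        obtain A where A: "finite A" "A \<subseteq> ?S" "nrm (c - restr c A) < d / 2"
          by (rule ell2_finite_approx1[OF c d2])
        have "g \<in> A" if "cmod (c g) \<ge> d / 2" for g
        proof (rule ccontr)
          assume "g \<notin> A"
          then have "cmod (c g) = cmod ((c - restr c A) g)" by (simp add: restr_def)
          also have "\<dots> \<le> nrm (c - restr c A)"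
            by (rule nrm_component[OF ell2_minus[OF c restr_ell2(1)[OF c]]])
          finally show False using A(3) that by simp
        qed
        then show ?thesis by (intro finite_subset[OF _ A(1)]) auto
      qed
      have "{g \<in> ?S. cmod (?\<psi> g) \<ge> d} \<subseteq> (\<Union>c\<in>N. {g. cmod (c g) \<ge> d / 2})"
      proof
        fix g assume "g \<in> {g \<in> ?S. cmod (?\<psi> g) \<ge> d}"
        then have g: "g \<in> ?S" "cmod (?\<psi> g) \<ge> d" by auto
        note kz = kvec_L2[OF g(1)]
        obtain c where c: "c \<in> N" "nrm (T (kvec g) - c) < d / 2" using N(3) kz kn[OF g(1)] by blast
        obtain c' where c': "c' \<in> ell2 ?S" "c' = c" using c(1) N(2) by blast
        have Tl: "T (kvec g) \<in> ell2 ?S" by (rule T(4)[OF kz])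
        have "cmod ((T (kvec g) - c) g) < d / 2"
          using nrm_component[OF ell2_minus[OF Tl c'(1)], of g] c(2) c'(2) by simp
        moreover have "cmod (?\<psi> g) \<le> cmod ((T (kvec g) - c) g) + cmod (c g)"
          using norm_triangle_ineq[of "(T (kvec g) - c) g" "c g"] by simp
        ultimately have "cmod (c g) \<ge> d / 2" using g(2) by simp
        then show "g \<in> (\<Union>c\<in>N. {g. cmod (c g) \<ge> d / 2})" using c(1) by blast
      qed
      then show ?thesis by (rule finite_subset) (use N(1) fin in blast)
    qed
    have close: "cmod (?\<psi> g - kvec g g) < e" if gE: "g \<in> E" for g
    proof -
      have g: "g \<in> ?S" using gE E(2) by blast
      have xg: "x g \<in> P" "nrm (kvec g - x g tvec) < e / 3" using x gE by auto
      note kz = kvec_L2[OF g]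
      have d: "kvec g - x g tvec \<in> L2" by (rule L2_minus[OF kz P_delta_L2[OF xg(1)]])
      have b: "\<phi> (x g) - x g \<in> bounded_ops ?S" by (intro bounded_ops_minus P_bounded cpP xg(1))
      have "cmod ((\<phi> (x g) - x g) tvec g) \<le> nrm ((\<phi> (x g) - x g) tvec)"
        by (rule nrm_component[OF bopsD(1)[OF b]]) simp
      then have 1: "cmod ((\<phi> (x g) - x g) tvec g) < e / 3"
        using \<phi>(4) gE trace_norm2_eq[OF b] by fastforce
      have 2: "cmod (T (kvec g - x g tvec) g) < e / 3" using T(3)[OF d g] xg(2) by linarith
      have 3: "cmod ((kvec g - x g tvec) g) < e / 3"
        using nrm_component[OF L2_ell2[OF d], of g] xg(2) by linarith
      \<comment> \<open>Three errors: replacing \<open>kvec g\<close> by an element of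
        \<open>P\<close> inside \<open>T\<close>, replacing \<open>\<phi>\<close> by the identity on
        that element, and returning to \<open>kvec g\<close>.\<close>
      have "?\<psi> g - kvec g g = T (kvec g - x g tvec) g + (\<phi> (x g) - x g) tvec g - (kvec g - x g tvec) g"
        by (simp add: T(1)[OF kz P_delta_L2[OF xg(1)]] T(2)[OF xg(1)])
      then have "cmod (?\<psi> g - kvec g g) \<le> cmod (T (kvec g - x g tvec) g) + cmod ((\<phi> (x g) - x g) tvec g) + cmod ((kvec g - x g tvec) g)"
        using norm_triangle_ineq4[of "T (kvec g - x g tvec) g + (\<phi> (x g) - x g) tvec g" "(kvec g - x g tvec) g"]
          norm_triangle_ineq[of "T (kvec g - x g tvec) g" "(\<phi> (x g) - x g) tvec g"] by (simp only:)
      then show ?thesis using 1 2 3 by linarith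
    qed
    show ?thesis
      using positive_definite_multiplier[OF \<phi>(1) T(1-3)] one vanish close by (intro exI[of _ ?\<psi>] conjI allI impI ballI)
  qed
qed

end

subsection \<open>Approximate multipliers from almost invariant finite sets\<close>

lemma has_sum_nonneg_Reals:
  assumes "(f has_sum s) A" "\<And>x. x \<in> A ==> f x \<in> \<real>\<^sub>\<ge>\<^sub>0" shows "(s :: complex) \<in> \<real>\<^sub>\<ge>\<^sub>0"
proof (rule Lim_in_closed_set[OF closed_nonneg_Reals_complex])
  show "(sum f \<longlongrightarrow> s) (finite_subsets_at_top A)" using assms(1) by (simp add: has_sum_def)
  have "sum f F \<in> \<real>\<^sub>\<ge>\<^sub>0" if "finite F" "F \<subseteq> A" for F
    using that by (induction F rule: finite_induct) (auto intro!: nonneg_Reals_add_I assms(2))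
  then show "\<forall>\<^sub>F F in finite_subsets_at_top A. sum f F \<in> \<real>\<^sub>\<ge>\<^sub>0"
    by (auto intro: eventually_finite_subsets_at_top_weakI)
qed simp

lemma has_sum_finite_sum:
  fixes f :: "'i \<Rightarrow> 'b \<Rightarrow> complex"
  assumes "finite A" "\<And>i. i \<in> A ==> (f i has_sum s i) B"
  shows "((\<lambda>x. \<Sum>i\<in>A. f i x) has_sum (\<Sum>i\<in>A. s i)) B"
  using assms by (induction A rule: finite_induct) (auto intro!: has_sum_add has_sum_0)

lemma delta_apply: "delta a x = (if x = a then 1 else 0)"
  by (simp add: delta_def)

context group
begin

text \<open>The Fourier multiplier with symbol \<open>overlap F\<close>, by
  \<open>folner_map_coefficient\<close>. The double sum over \<open>F\<close> displays its finite
  rank and prepares the proof of complete positivity.\<close>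

definition folner_map :: "'a set \<Rightarrow> 'a op2 \<Rightarrow> 'a op2" where
  "folner_map F x = op_scale (1 / of_nat (card F))
     (\<Sum>p\<in>F. \<Sum>q\<in>F. op_scale (x tvec (p \<otimes> inv q)) (lreg G (p \<otimes> inv q)))"

lemma folner_map_add: "folner_map F (x + y) = folner_map F x + folner_map F y"
  by (rule ext)
    (simp add: folner_map_def op_scale_def vsc_add fun_eq_iff sum_op_apply sum_vec_apply distrib_right
      distrib_left sum.distrib)

lemma folner_map_scale: "folner_map F (op_scale c x) = op_scale c (folner_map F x)"
  by (rule ext)
    (simp add: folner_map_def op_scale_def fun_eq_iff sum_op_apply sum_vec_apply sum_distrib_left mult_ac)

lemma folner_map_vna:
  assumes P: "von_neumann_algebra (carrier G) P" and "\<And>p q. p \<in> F ==> q \<in> F ==> lreg G (p \<otimes> inv q) \<in> P"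
  shows "folner_map F x \<in> P"
  unfolding folner_map_def by (intro vnaD(5)[OF P] vna_sum[OF P] assms(2))

lemma folner_map_bounded:
  assumes "F \<subseteq> carrier G" shows "folner_map F x \<in> bounded_ops (carrier G)"
  by (rule folner_map_vna[OF von_neumann_algebra_bounded_ops], rule lreg_bounded) (use assms in auto)

text \<open>The inner product is reindexed by \<open>t = p \<otimes> r\<close>, which makes the two
  arguments symmetric in \<open>p\<close> and \<open>q\<close>.\<close>

lemma has_sum_lreg:
  assumes pq: "p \<in> carrier G" "q \<in> carrier G" and f: "f \<in> ell2 (carrier G)" "f' \<in> ell2 (carrier G)"
  shows "((\<lambda>r. f (q \<otimes> r) * cnj (f' (p \<otimes> r))) has_sum ip (lreg G (p \<otimes> inv q) f) f') (carrier G)"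
proof -
  let ?u = "lreg G (p \<otimes> inv q)"
  have u: "?u f \<in> ell2 (carrier G)" by (rule bopsD(1)[OF lreg_bounded]) (use pq f in auto)
  have "((\<lambda>t. ?u f t * cnj (f' t)) has_sum ip (?u f) f') UNIV"
    unfolding ell2_inner_def by (rule has_sum_infsum[OF ip_summable[OF u f(2)]])
  then have "((\<lambda>t. ?u f t * cnj (f' t)) has_sum ip (?u f) f') (carrier G)"
    by (rule has_sum_cong_neutral[THEN iffD1, rotated -1]) (auto simp: ell2_outside[OF f(2)])
  then have "((\<lambda>r. ?u f (p \<otimes> r) * cnj (f' (p \<otimes> r))) has_sum ip (?u f) f') (carrier G)"
    using has_sum_reindex_bij_betw[OF bij_left[OF pq(1)], of "\<lambda>t. ?u f t * cnj (f' t)"] by simp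
  moreover have "?u f (p \<otimes> r) = f (q \<otimes> r)" if r: "r \<in> carrier G" for r
  proof -
    have "inv (p \<otimes> inv q) \<otimes> (p \<otimes> r) = q \<otimes> (inv p \<otimes> (p \<otimes> r))" using pq r by (simp add: inv_mult_group m_assoc)
    also have "inv p \<otimes> (p \<otimes> r) = r" using pq r by (simp add: m_assoc[symmetric])
    finally show ?thesis using pq r f by (simp add: lreg_apply)
  qed
  ultimately show ?thesis by (simp cong: has_sum_cong)
qed

text \<open>The common factor \<open>r\<close> drops out of the matrix entries of \<open>x\<close>,
  so all translates of \<open>F\<close> see the same finite matrix.\<close>

lemma restricted_form:
  assumes x: "x \<in> convolvers G" and F: "finite F" "F \<subseteq> carrier G" and r: "r \<in> carrier G"
  shows "ip (x (restr f ((\<lambda>p. p \<otimes> r) ` F))) (restr f' ((\<lambda>p. p \<otimes> r) ` F))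
    = (\<Sum>p\<in>F. \<Sum>q\<in>F. x tvec (p \<otimes> inv q) * (f (q \<otimes> r) * cnj (f' (p \<otimes> r))))"
proof -
  let ?S = "carrier G"
  let ?v = "\<lambda>q. vsc (f (q \<otimes> r)) (x (delta (q \<otimes> r)))" and ?w = "\<lambda>p. vsc (f' (p \<otimes> r)) (delta (p \<otimes> r))"
    and ?c = "\<lambda>p q. f (q \<otimes> r) * cnj (f' (p \<otimes> r))" and ?Fr = "(\<lambda>p. p \<otimes> r) ` F"
  have xb: "x \<in> bounded_ops ?S" by (rule convolversD(1)[OF x])
  have inj: "inj_on (\<lambda>p. p \<otimes> r) F" 
  proof (rule inj_onI)
    fix p q assume "p \<in> F" "q \<in> F" "p \<otimes> r = q \<otimes> r"
    then show "p = q" using F(2) r right_cancel[of r p q] by blast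
  qed
  have restr: "restr h ?Fr = (\<Sum>p\<in>F. vsc (h (p \<otimes> r)) (delta (p \<otimes> r)))" for h
    using restr_sum[of "(\<lambda>p. p \<otimes> r) ` F" h] F(1) sum.reindex[OF inj, of "\<lambda>y. vsc (h y) (delta y)"]
    by (simp add: o_def)
  have d: "delta (p \<otimes> r) \<in> ell2 ?S" if "p \<in> F" for p using that F(2) r by auto
  have m: "p \<otimes> r \<in> ?S" if "p \<in> F" for p using that F(2) r by auto
  have "x (restr f ?Fr) = (\<Sum>q\<in>F. x (vsc (f (q \<otimes> r)) (delta (q \<otimes> r))))"
    unfolding restr by (rule bounded_ops_sum[OF xb]) (use d in auto)
  also have "\<dots> = (\<Sum>q\<in>F. ?v q)"
    by (intro sum.cong refl bopsD(3)[OF xb] d)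
  finally have xr: "x (restr f ?Fr) = (\<Sum>q\<in>F. ?v q)" .
  have xd: "x (delta (q \<otimes> r)) \<in> ell2 ?S" if "q \<in> F" for q by (rule bopsD(1)[OF xb d[OF that]])
  have "ip (x (restr f ?Fr)) (restr f' ?Fr)
      = (\<Sum>p\<in>F. ip (\<Sum>q\<in>F. ?v q) (?w p))"
    unfolding xr restr[of f'] by (rule ip_sum_right[of _ _ ?S _ ?S]) (use d xd in auto)
  also have "\<dots> = (\<Sum>p\<in>F. \<Sum>q\<in>F. x tvec (p \<otimes> inv q) * ?c p q)"
  proof (rule sum.cong[OF refl])
    fix p assume p: "p \<in> F"
    have "ip (\<Sum>q\<in>F. ?v q) (?w p)
        = (\<Sum>q\<in>F. ip (?v q) (?w p))"
      by (rule ip_sum_left[of _ _ ?S _ ?S]) (use d xd p in auto)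
    also have "\<dots> = (\<Sum>q\<in>F. x tvec (p \<otimes> inv q) * ?c p q)"
    proof (rule sum.cong[OF refl])
      fix q assume q: "q \<in> F"
      have qp: "q \<in> ?S" "p \<in> ?S" using p q F(2) by auto
      have "(p \<otimes> r) \<otimes> inv (q \<otimes> r) = p \<otimes> (r \<otimes> (inv r \<otimes> inv q))" using qp r by (simp add: inv_mult_group m_assoc)
      also have "r \<otimes> (inv r \<otimes> inv q) = inv q" using qp r by (simp add: m_assoc[symmetric])
      finally have "x (delta (q \<otimes> r)) (p \<otimes> r) = x tvec (p \<otimes> inv q)"
        using convolver_delta[OF x m[OF q] m[OF p]] by simp
      then show "ip (?v q) (?w p)
          = x tvec (p \<otimes> inv q) * ?c p q"
        by (simp add: ip_scale_left ip_scale_right mult_ac)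
    qed
    finally show "ip (\<Sum>q\<in>F. ?v q) (?w p)
        = (\<Sum>q\<in>F. x tvec (p \<otimes> inv q) * ?c p q)" .
  qed
  finally show ?thesis .
qed

lemma folner_map_inner:
  assumes F: "F \<subseteq> carrier G" and f: "f \<in> ell2 (carrier G)" "f' \<in> ell2 (carrier G)"
  shows "ip (folner_map F x f) f'
    = 1 / of_nat (card F) * (\<Sum>p\<in>F. \<Sum>q\<in>F. x tvec (p \<otimes> inv q) * ip (lreg G (p \<otimes> inv q) f) f')"
proof -
  let ?S = "carrier G" and ?t = "\<lambda>p q. vsc (x tvec (p \<otimes> inv q)) (lreg G (p \<otimes> inv q) f)"
  have t: "?t p q \<in> ell2 ?S" if "p \<in> F" "q \<in> F" for p q
    by (rule ell2_scale, rule bopsD(1)[OF lreg_bounded]) (use that F f in auto)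
  have "folner_map F x f = vsc (1 / of_nat (card F)) (\<Sum>p\<in>F. \<Sum>q\<in>F. ?t p q)"
    by (simp only: folner_map_def op_scale_def sum_op_apply)
  then have "ip (folner_map F x f) f' = 1 / of_nat (card F) * ip (\<Sum>p\<in>F. \<Sum>q\<in>F. ?t p q) f'"
    by (simp only: ip_scale_left)
  also have "ip (\<Sum>p\<in>F. \<Sum>q\<in>F. ?t p q) f' = (\<Sum>p\<in>F. ip (\<Sum>q\<in>F. ?t p q) f')"
    by (rule ip_sum_left[of _ _ ?S _ ?S]) (use t f in auto)
  also have "\<dots> = (\<Sum>p\<in>F. \<Sum>q\<in>F. ip (?t p q) f')"
    by (intro sum.cong refl ip_sum_left[of _ _ ?S _ ?S]) (use t f in auto)
  finally show ?thesis by (simp only: ip_scale_left)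
qed

text \<open>Averaging the compressions of \<open>x\<close> to the finite sets \<open>F r\<close> exhibits \<open>folner_map F\<close> as completely positive.\<close>

lemma has_sum_folner_map:
  assumes x: "x \<in> convolvers G" and F: "finite F" "F \<subseteq> carrier G" and f: "f \<in> ell2 (carrier G)" "f' \<in> ell2 (carrier G)"
  shows "((\<lambda>r. 1 / of_nat (card F) * ip (x (restr f ((\<lambda>p. p \<otimes> r) ` F))) (restr f' ((\<lambda>p. p \<otimes> r) ` F)))
    has_sum ip (folner_map F x f) f') (carrier G)"
proof -
  have "((\<lambda>r. 1 / of_nat (card F) * (\<Sum>p\<in>F. \<Sum>q\<in>F. x tvec (p \<otimes> inv q) * (f (q \<otimes> r) * cnj (f' (p \<otimes> r)))))
    has_sum ip (folner_map F x f) f') (carrier G)"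
    unfolding folner_map_inner[OF F(2) f]
    by (intro has_sum_cmult_right has_sum_finite_sum F(1) has_sum_lreg f) (use F(2) in auto)
  then show ?thesis by (simp add: restricted_form[OF x F] cong: has_sum_cong)
qed

lemma folner_map_matrix_pos:
  assumes X: "\<And>i j. i < k ==> j < k ==> X i j \<in> convolvers G" "matrix_pos (carrier G) k X"
    and F: "finite F" "F \<subseteq> carrier G"
  shows "matrix_pos (carrier G) k (\<lambda>i j. folner_map F (X i j))"
  unfolding matrix_pos_def
proof (intro allI impI)
  fix \<xi> :: "nat \<Rightarrow> 'a vec2" assume "\<forall>i<k. \<xi> i \<in> ell2 (carrier G)"
  then have \<xi>: "\<xi> i \<in> ell2 (carrier G)" if "i < k" for i using that by blast
  let ?R = "\<lambda>r i. restr (\<xi> i) ((\<lambda>p. p \<otimes> r) ` F)"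
  show "(\<Sum>i<k. \<Sum>j<k. ip (folner_map F (X i j) (\<xi> j)) (\<xi> i)) \<in> \<real>\<^sub>\<ge>\<^sub>0"
  proof (rule has_sum_nonneg_Reals)
    show "((\<lambda>r. \<Sum>i<k. \<Sum>j<k. 1 / of_nat (card F) * ip (X i j (?R r j)) (?R r i))
        has_sum (\<Sum>i<k. \<Sum>j<k. ip (folner_map F (X i j) (\<xi> j)) (\<xi> i))) (carrier G)"
      by (intro has_sum_finite_sum has_sum_folner_map X F \<xi>) auto
    fix r assume r: "r \<in> carrier G"
    have "(\<Sum>i<k. \<Sum>j<k. ip (X i j (?R r j)) (?R r i)) \<in> \<real>\<^sub>\<ge>\<^sub>0"
      using X(2)[unfolded matrix_pos_def, rule_format, of "?R r"] restr_ell2(1)[OF \<xi>] by blast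
    then have "1 / of_nat (card F) * (\<Sum>i<k. \<Sum>j<k. ip (X i j (?R r j)) (?R r i)) \<in> \<real>\<^sub>\<ge>\<^sub>0"
      by (intro nonneg_Reals_mult_I) auto
    then show "(\<Sum>i<k. \<Sum>j<k. 1 / of_nat (card F) * ip (X i j (?R r j)) (?R r i)) \<in> \<real>\<^sub>\<ge>\<^sub>0"
      by (simp only: sum_distrib_left)
  qed
qed

definition overlap :: "'a set \<Rightarrow> 'a \<Rightarrow> real" where
  "overlap F h = real (card {q \<in> F. h \<otimes> q \<in> F}) / real (card F)"

lemma overlap_bounds:
  assumes "finite F" shows "0 \<le> overlap F h" "overlap F h \<le> 1"
proof -
  have "card {q \<in> F. h \<otimes> q \<in> F} \<le> card F" using assms by (intro card_mono) auto
  then show "overlap F h \<le> 1" unfolding overlap_def by (cases "card F = 0") auto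
qed (simp add: overlap_def)

lemma folner_map_coefficient:
  assumes F: "finite F" "F \<subseteq> carrier G" and h: "h \<in> carrier G"
  shows "folner_map F x tvec h = of_real (overlap F h) * x tvec h"
proof -
  let ?S = "carrier G"
  have "folner_map F x tvec h = ip (folner_map F x tvec) (delta h)" by simp
  also have "\<dots> = 1 / of_nat (card F) * (\<Sum>p\<in>F. \<Sum>q\<in>F. x tvec (p \<otimes> inv q) * ip (lreg G (p \<otimes> inv q) tvec) (delta h))"
    by (rule folner_map_inner[OF F(2)]) (use h in auto)
  also have "(\<Sum>p\<in>F. \<Sum>q\<in>F. x tvec (p \<otimes> inv q) * ip (lreg G (p \<otimes> inv q) tvec) (delta h))
      = (\<Sum>p\<in>F. \<Sum>q\<in>F. if p = h \<otimes> q then x tvec h else 0)"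
  proof (intro sum.cong refl)
    fix p q assume "p \<in> F" "q \<in> F"
    then have pq: "p \<in> ?S" "q \<in> ?S" using F(2) by auto
    have "h = p \<otimes> inv q \<longleftrightarrow> p = h \<otimes> q" using inv_solve_right[OF h pq] by blast
    then show "x tvec (p \<otimes> inv q) * ip (lreg G (p \<otimes> inv q) tvec) (delta h) = (if p = h \<otimes> q then x tvec h else 0)"
      using pq by (auto simp: lreg_delta delta_apply)
  qed
  also have "\<dots> = (\<Sum>q\<in>F. \<Sum>p\<in>F. if p = h \<otimes> q then x tvec h else 0)" by (rule sum.swap)
  also have "\<dots> = (\<Sum>q\<in>F. if h \<otimes> q \<in> F then x tvec h else 0)" using F(1) by simp
  also have "\<dots> = of_nat (card {q \<in> F. h \<otimes> q \<in> F}) * x tvec h"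
    using F(1) by (simp add: sum.If_cases Int_def)
  finally show ?thesis by (simp add: overlap_def)
qed

end

subsection \<open>Suprema of directed sets of positive operators\<close>

lemma op_pos_cauchy_schwarz:
  assumes A: "A \<in> bounded_ops S" "op_pos S A" and f: "f \<in> ell2 S" and g: "g \<in> ell2 S"
  shows "(cmod (ip (A f) g))\<^sup>2 \<le> Re (ip (A f) f) * Re (ip (A g) g)"
proof -
  have "matrix_pos S 2 (\<lambda>_ _. A)"
    unfolding matrix_pos_def
  proof (intro allI impI)
    fix \<xi> :: "nat \<Rightarrow> 'a vec2" assume "\<forall>i<2. \<xi> i \<in> ell2 S"
    then have v: "\<xi> 0 \<in> ell2 S" "\<xi> 1 \<in> ell2 S" by auto
    note Av = bopsD(1)[OF A(1) v(1)] bopsD(1)[OF A(1) v(2)]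
    have "ip (A (\<xi> 0 + \<xi> 1)) (\<xi> 0 + \<xi> 1) \<in> \<real>\<^sub>\<ge>\<^sub>0" using A(2) v unfolding op_pos_def by blast
    then show "(\<Sum>i<2. \<Sum>j<2. ip (A (\<xi> j)) (\<xi> i)) \<in> \<real>\<^sub>\<ge>\<^sub>0"
      unfolding sum_lessThan_2 bopsD(2)[OF A(1) v] ip_add_left[OF Av ell2_add[OF v]]
        ip_add_right[OF v Av(1)] ip_add_right[OF v Av(2)]
      by (simp only: add_ac)
  qed
  from matrix_pos_2_cauchy_schwarz(1)[OF _ this f g] A(1) show ?thesis by (simp add: mult.commute)
qed

lemma op_le_iff:
  assumes "A \<in> bounded_ops S" "B \<in> bounded_ops S"
  shows "op_le S A B \<longleftrightarrow> (\<forall>f\<in>ell2 S. ip (B f) f - ip (A f) f \<in> \<real>\<^sub>\<ge>\<^sub>0)"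
proof -
  have "ip ((B - A) f) f = ip (B f) f - ip (A f) f" if "f \<in> ell2 S" for f
    using ip_diff_left[OF bopsD(1)[OF assms(2) that] bopsD(1)[OF assms(1) that] that] by simp
  then show ?thesis by (simp add: op_le_def op_pos_def)
qed

text \<open>The difference has zero quadratic form, and Cauchy-Schwarz for positive operators makes
  its off-diagonal coefficients vanish too.\<close>

lemma op_le_antisym:
  assumes A: "A \<in> bounded_ops S" and B: "B \<in> bounded_ops S" and "op_le S A B" "op_le S B A"
  shows "A = B"
proof (rule bounded_ops_eqI[OF A B])
  fix f g assume f: "f \<in> ell2 S" and g: "g \<in> ell2 S"
  have C: "B - A \<in> bounded_ops S" by (rule bounded_ops_minus[OF B A])
  have e: "ip ((B - A) h) k = ip (B h) k - ip (A h) k" if "h \<in> ell2 S" "k \<in> ell2 S" for h k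
    using ip_diff_left[OF bopsD(1)[OF B that(1)] bopsD(1)[OF A that(1)] that(2)] by simp
  have "ip (B f) f - ip (A f) f \<in> \<real>\<^sub>\<ge>\<^sub>0" "ip (A f) f - ip (B f) f \<in> \<real>\<^sub>\<ge>\<^sub>0"
    using assms(3,4) f by (simp_all add: op_le_iff[OF A B] op_le_iff[OF B A])
  then have "Re (ip ((B - A) f) f) = 0" unfolding e[OF f f] by (simp add: complex_nonneg_Reals_iff)
  then have "(cmod (ip ((B - A) f) g))\<^sup>2 \<le> 0"
    using op_pos_cauchy_schwarz[OF C _ f g] assms(3) by (simp add: op_le_def)
  then show "ip (A f) g = ip (B f) g" using e[OF f g] by simp
qed

lemma polarization:
  assumes A: "A \<in> bounded_ops S" and f: "f \<in> ell2 S" and g: "g \<in> ell2 S"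
  shows "ip (A f) g = 1 / 4 * (\<Sum>c\<in>{1, \<i>, - 1, - \<i>}. c * ip (A (f + vsc c g)) (f + vsc c g))"
proof -
  note Af = bopsD(1)[OF A f] and Ag = bopsD(1)[OF A g]
  have E: "ip (A (f + vsc c g)) (f + vsc c g) = ip (A f) f + cnj c * ip (A f) g
      + c * ip (A g) f + c * cnj c * ip (A g) g" for c
    unfolding bopsD(2)[OF A f ell2_scale[OF g]] bopsD(3)[OF A g]
      ip_add_left[OF Af ell2_scale[OF Ag] ell2_add[OF f ell2_scale[OF g]]]
      ip_add_right[OF f ell2_scale[OF g] Af] ip_add_right[OF f ell2_scale[OF g] Ag]
      ip_scale_left ip_scale_right
    by (simp add: algebra_simps)
  have four: "(\<Sum>c\<in>{1, \<i>, - 1, - \<i>}. h c) = h 1 + h \<i> + h (- 1) + h (- \<i>)" for h :: "complex \<Rightarrow> complex"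
    by (simp add: complex_eq_iff)
  show ?thesis unfolding four E by (simp add: algebra_simps)
qed

text \<open>\<open>is_op_sup\<close> is a purely order theoretic condition within \<open>P\<close>,
  so convergence of the forms has to be proved. The pointwise suprema of the forms define a bounded
  operator \<open>A\<close> that is a weak limit of elements of \<open>D\<close>, hence lies in
  \<open>P\<close>; being an upper bound below \<open>x\<close>, it equals \<open>x\<close>.\<close>

lemma op_sup_approx:
  assumes P: "von_neumann_algebra S P" and D: "D \<subseteq> P" "D \<noteq> {}" "\<And>d. d \<in> D ==> op_pos S d"
    and dir: "\<And>a b. a \<in> D ==> b \<in> D ==> \<exists>c\<in>D. op_le S a c \<and> op_le S b c"
    and x: "is_op_sup S P D x" and f: "f \<in> ell2 S" and e: "e > 0"
  obtains d where "d \<in> D" "Re (ip (x f) f) - Re (ip (d f) f) < e"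
proof -
  have Db: "d \<in> bounded_ops S" if "d \<in> D" for d using that D(1) vnaD(1)[OF P] by blast
  have xP: "x \<in> P" and xD: "\<And>d. d \<in> D ==> op_le S d x"
    and xl: "\<And>y. y \<in> P ==> (\<And>d. d \<in> D ==> op_le S d y) ==> op_le S x y"
    using x unfolding is_op_sup_def by blast+
  have xb: "x \<in> bounded_ops S" using xP vnaD(1)[OF P] by blast
  define q where "q d f = Re (ip (d f) f)" for d :: "'a op2" and f
  have qd: "ip (d f) f = of_real (q d f)" "q d f \<ge> 0" if "d \<in> D" "f \<in> ell2 S" for d f
    using D(3)[OF that(1)] that(2) by (auto simp: op_pos_def q_def complex_nonneg_Reals_iff complex_eq_iff)
  have mono: "q a f \<le> q b f" if "op_le S a b" "a \<in> bounded_ops S" "b \<in> bounded_ops S" "f \<in> ell2 S" for a b f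
    using that(1)[unfolded op_le_iff[OF that(2,3)], rule_format, OF that(4)] by (simp add: q_def complex_nonneg_Reals_iff)
  have qx: "q d f \<le> q x f" if "d \<in> D" "f \<in> ell2 S" for d f by (rule mono[OF xD[OF that(1)] Db[OF that(1)] xb that(2)])
  obtain d0 where d0: "d0 \<in> D" using D(2) by blast
  have xr: "ip (x f) f = of_real (q x f)" if "f \<in> ell2 S" for f
  proof -
    have "Im (ip (d0 f) f) = 0" using qd(1)[OF d0 that] by simp
    then have "Im (ip (x f) f) = 0"
      using xD[OF d0, unfolded op_le_iff[OF Db[OF d0] xb], rule_format, OF that] by (simp add: complex_nonneg_Reals_iff)
    then show ?thesis by (simp add: q_def complex_eq_iff)
  qed
  define m where "m f = (SUP d\<in>D. q d f)" for f
  have bdd: "bdd_above ((\<lambda>d. q d f) ` D)" if "f \<in> ell2 S" for f using qx[OF _ that] by (intro bdd_aboveI2)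
  have qm: "q d f \<le> m f" if "d \<in> D" "f \<in> ell2 S" for d f
    unfolding m_def by (rule cSUP_upper[OF that(1) bdd[OF that(2)]])
  have mx: "m f \<le> q x f" if "f \<in> ell2 S" for f unfolding m_def by (rule cSUP_least[OF D(2) qx[OF _ that]])
  \<comment> \<open>The section filter of the directed set: along it the quadratic forms increase to
    their suprema.\<close>
  define \<Phi> where "\<Phi> = (INF d\<in>D. principal {c \<in> D. op_le S d c})"
  have ev: "eventually Q \<Phi> \<longleftrightarrow> (\<exists>d\<in>D. \<forall>c\<in>D. op_le S d c \<longrightarrow> Q c)" for Q
    unfolding \<Phi>_def
  proof (subst eventually_INF_base[OF D(2)])
    fix a b assume ab: "a \<in> D" "b \<in> D"
    obtain c where c: "c \<in> D" "op_le S a c" "op_le S b c" using dir[OF ab] by blast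
    have tr: "op_le S a k" if "op_le S a c" "op_le S c k" "k \<in> D" "a \<in> D" for a k
      unfolding op_le_iff[OF Db[OF that(4)] Db[OF that(3)]]
    proof
      fix f assume f: "f \<in> ell2 S"
      have "(ip (k f) f - ip (c f) f) + (ip (c f) f - ip (a f) f) \<in> \<real>\<^sub>\<ge>\<^sub>0"
        using that(1,2) f by (intro nonneg_Reals_add_I) (simp_all add: op_le_iff Db c(1) that(3,4))
      then show "ip (k f) f - ip (a f) f \<in> \<real>\<^sub>\<ge>\<^sub>0" by simp
    qed
    show "\<exists>c\<in>D. principal {k \<in> D. op_le S c k} \<le> inf (principal {k \<in> D. op_le S a k}) (principal {k \<in> D. op_le S b k})"
      using c tr[OF c(2) _ _ ab(1)] tr[OF c(3) _ _ ab(2)] by (intro bexI[of _ c]) auto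
  qed (auto simp: eventually_principal)
  have refl: "op_le S d d" for d by (simp add: op_le_def op_pos_def)
  have \<Phi>: "\<Phi> \<noteq> bot" unfolding trivial_limit_def ev using refl by blast
  have evD: "\<forall>\<^sub>F d in \<Phi>. d \<in> D" unfolding ev using D(2) by blast
  have qlim: "((\<lambda>d. q d f) \<longlongrightarrow> m f) \<Phi>" if f: "f \<in> ell2 S" for f
  proof (rule order_tendstoI)
    fix a assume "a < m f"
    then obtain d where d: "d \<in> D" "a < q d f" unfolding m_def using less_cSUP_iff[OF D(2) bdd[OF f]] by blast
    have "a < q c f" if "c \<in> D" "op_le S d c" for c using mono[OF that(2) Db[OF d(1)] Db[OF that(1)] f] d(2) by linarith
    then show "\<forall>\<^sub>F d in \<Phi>. a < q d f" unfolding ev using d(1) by blast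
  next
    fix a assume "m f < a"
    then show "\<forall>\<^sub>F d in \<Phi>. q d f < a" using qm[OF _ f] by (intro eventually_mono[OF evD]) (meson le_less_trans)
  qed
  \<comment> \<open>Polarisation of the supremum form. Its linearity is inherited as a limit of the
    forms of the operators in \<open>D\<close>.\<close>
  define L where "L f g = 1 / 4 * (\<Sum>c\<in>{1, \<i>, - 1, - \<i>}. c * of_real (m (f + vsc c g)))" for f g
  have lim: "((\<lambda>d. ip (d f) g) \<longlongrightarrow> L f g) \<Phi>" if f: "f \<in> ell2 S" and g: "g \<in> ell2 S" for f g
  proof -
    have v: "f + vsc c g \<in> ell2 S" for c using f g by auto
    have "((\<lambda>d. 1 / 4 * (\<Sum>c\<in>{1, \<i>, - 1, - \<i>}. c * of_real (q d (f + vsc c g)))) \<longlongrightarrow> L f g) \<Phi>"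
      unfolding L_def by (intro tendsto_intros qlim v)
    moreover have "\<forall>\<^sub>F d in \<Phi>. 1 / 4 * (\<Sum>c\<in>{1, \<i>, - 1, - \<i>}. c * of_real (q d (f + vsc c g))) = ip (d f) g"
      using evD
    proof (rule eventually_mono)
      fix d assume d: "d \<in> D"
      show "1 / 4 * (\<Sum>c\<in>{1, \<i>, - 1, - \<i>}. c * of_real (q d (f + vsc c g))) = ip (d f) g"
        by (simp only: polarization[OF Db[OF d] f g] qd(1)[OF d v])
    qed
    ultimately show ?thesis by (rule Lim_transform_eventually)
  qed
  have uniq: "L f g = l" if "((\<lambda>d. ip (d f) g) \<longlongrightarrow> l) \<Phi>" "f \<in> ell2 S" "g \<in> ell2 S" for f g l
    by (rule tendsto_unique[OF \<Phi> lim[OF that(2,3)] that(1)])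
  obtain C where C: "C > 0" "\<forall>f\<in>ell2 S. nrm (x f) \<le> C * nrm f"
    using bounded_ops_bound[OF xb] by (elim exE conjE)
  have qC: "q x f \<le> C * (nrm f)\<^sup>2" if f: "f \<in> ell2 S" for f
  proof -
    have "q x f \<le> cmod (ip (x f) f)" unfolding q_def by (rule complex_Re_le_cmod)
    also have "\<dots> \<le> nrm (x f) * nrm f" by (rule ip_cauchy_schwarz[OF bopsD(1)[OF xb f] f])
    also have "\<dots> \<le> (C * nrm f) * nrm f" by (rule mult_right_mono[OF C(2)[rule_format, OF f]]) simp
    finally show ?thesis by (simp add: power2_eq_square)
  qed
  obtain A where A: "A \<in> bounded_ops S" "\<And>f g. f \<in> ell2 S ==> g \<in> ell2 S ==> ip (A f) g = L f g"
  proof (rule sesquilinear_form_operator[of S L C])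
    fix f f' g assume v: "f \<in> ell2 S" "f' \<in> ell2 S" "g \<in> ell2 S"
    have "((\<lambda>d. ip (d (f + f')) g) \<longlongrightarrow> L f g + L f' g) \<Phi>"
    proof (rule Lim_transform_eventually[OF tendsto_add[OF lim[OF v(1,3)] lim[OF v(2,3)]]], rule eventually_mono[OF evD])
      fix d assume "d \<in> D"
      note d = Db[OF this]
      show "ip (d f) g + ip (d f') g = ip (d (f + f')) g"
        unfolding bopsD(2)[OF d v(1,2)]
        by (rule ip_add_left[OF bopsD(1)[OF d v(1)] bopsD(1)[OF d v(2)] v(3), symmetric])
    qed
    then show "L (f + f') g = L f g + L f' g" by (rule uniq[OF _ ell2_add[OF v(1,2)] v(3)])
  next
    fix c f g assume v: "f \<in> ell2 S" "g \<in> ell2 S"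
    have "((\<lambda>d. ip (d (vsc c f)) g) \<longlongrightarrow> c * L f g) \<Phi>"
    proof (rule Lim_transform_eventually[OF tendsto_mult_left[OF lim[OF v]]], rule eventually_mono[OF evD])
      fix d assume "d \<in> D"
      show "c * ip (d f) g = ip (d (vsc c f)) g"
        unfolding bopsD(3)[OF Db[OF \<open>d \<in> D\<close>] v(1)] by (simp add: ip_scale_left)
    qed
    then show "L (vsc c f) g = c * L f g" by (rule uniq[OF _ ell2_scale[OF v(1)] v(2)])
  next
    fix f g g' assume v: "f \<in> ell2 S" "g \<in> ell2 S" "g' \<in> ell2 S"
    have "((\<lambda>d. ip (d f) (g + g')) \<longlongrightarrow> L f g + L f g') \<Phi>"
    proof (rule Lim_transform_eventually[OF tendsto_add[OF lim[OF v(1,2)] lim[OF v(1,3)]]], rule eventually_mono[OF evD])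
      fix d assume "d \<in> D"
      show "ip (d f) g + ip (d f) g' = ip (d f) (g + g')"
        by (rule ip_add_right[OF v(2,3) bopsD(1)[OF Db[OF \<open>d \<in> D\<close>] v(1)], symmetric])
    qed
    then show "L f (g + g') = L f g + L f g'" by (rule uniq[OF _ v(1) ell2_add[OF v(2,3)]])
  next
    fix c f g assume v: "f \<in> ell2 S" "g \<in> ell2 S"
    have "((\<lambda>d. ip (d f) (vsc c g)) \<longlongrightarrow> cnj c * L f g) \<Phi>"
      unfolding ip_scale_right by (rule tendsto_mult_left[OF lim[OF v]])
    then show "L f (vsc c g) = cnj c * L f g" by (rule uniq[OF _ v(1) ell2_scale[OF v(2)]])
  next
    fix f g assume v: "f \<in> ell2 S" "g \<in> ell2 S"
    show "cmod (L f g) \<le> C * nrm f * nrm g"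
    proof (rule tendsto_upperbound[OF tendsto_norm[OF lim[OF v]] _ \<Phi>], rule eventually_mono[OF evD])
      fix d assume d: "d \<in> D"
      have "(cmod (ip (d f) g))\<^sup>2 \<le> q d f * q d g"
        unfolding q_def by (rule op_pos_cauchy_schwarz[OF Db[OF d] D(3)[OF d] v])
      also have "\<dots> \<le> (C * (nrm f)\<^sup>2) * (C * (nrm g)\<^sup>2)"
        by (intro mult_mono order_trans[OF qx[OF d] qC] v qd(2)[OF d]) (use C(1) in auto)
      also have "\<dots> = (C * nrm f * nrm g)\<^sup>2" by (simp add: power2_eq_square mult_ac)
      finally show "cmod (ip (d f) g) \<le> C * nrm f * nrm g"
        by (rule power2_le_imp_le) (use C(1) in auto)
    qed
  next
    fix A assume "A \<in> bounded_ops S" "\<And>f g. f \<in> ell2 S ==> g \<in> ell2 S ==> ip (A f) g = L f g"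
    then show thesis by (rule that)
  qed
  have Am: "ip (A f) f = of_real (m f)" if f: "f \<in> ell2 S" for f
  proof -
    have "((\<lambda>d. ip (d f) f) \<longlongrightarrow> of_real (m f)) \<Phi>"
      by (rule Lim_transform_eventually[OF tendsto_of_real[OF qlim[OF f]]], rule eventually_mono[OF evD])
        (simp add: qd(1) f)
    then show ?thesis using uniq f A(2) by simp
  qed
  have "A \<in> P"
  proof (rule vna_sequentially_closed[OF P \<Phi> A(1)])
    \<comment> \<open>The closure lemma wants every index to give an element of \<open>P\<close>;
      the default zero is irrelevant along \<open>\<Phi>\<close>, which lives on
      \<open>D\<close>.\<close>
    show "(if d \<in> D then d else 0) \<in> P" for d using D(1) vnaD(8)[OF P] by auto
    fix f g assume v: "f \<in> ell2 S" "g \<in> ell2 S"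
    show "((\<lambda>d. ip ((if d \<in> D then d else 0) f) g) \<longlongrightarrow> ip (A f) g) \<Phi>"
      unfolding A(2)[OF v] by (rule Lim_transform_eventually[OF lim[OF v]], rule eventually_mono[OF evD]) simp
  qed
  then have "op_le S x A"
  proof (rule xl)
    fix d assume d: "d \<in> D"
    show "op_le S d A" unfolding op_le_iff[OF Db[OF d] A(1)] using qm[OF d] by (simp add: Am qd(1)[OF d] flip: of_real_diff)
  qed
  moreover have "op_le S A x"
    unfolding op_le_iff[OF A(1) xb] using mx by (simp add: Am xr flip: of_real_diff)
  ultimately have "x = A" using op_le_antisym[OF xb A(1)] by blast
  then have "m f = q x f" using Am[OF f] xr[OF f] by simp
  then have "q x f - e < m f" using e by simp
  then obtain d where "d \<in> D" "q x f - e < q d f" unfolding m_def using less_cSUP_iff[OF D(2) bdd[OF f]] by blast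
  then show ?thesis using that[of d] by (simp add: q_def algebra_simps)
qed

context group_subalgebra
begin

lemma folner_map_diff: "folner_map F (x - y) = folner_map F x - folner_map F y"
  unfolding op_minus_scale folner_map_add folner_map_scale ..

lemma folner_map_pos:
  assumes x: "x \<in> convolvers G" "op_pos (carrier G) x" and F: "finite F" "F \<subseteq> carrier G"
  shows "op_pos (carrier G) (folner_map F x)"
  unfolding op_pos_def
proof
  fix f assume f: "f \<in> ell2 (carrier G)"
  show "ip (folner_map F x f) f \<in> \<real>\<^sub>\<ge>\<^sub>0"
  proof (rule has_sum_nonneg_Reals[OF has_sum_folner_map[OF x(1) F f f]])
    fix r
    show "1 / of_nat (card F) * ip (x (restr f ((\<lambda>p. p \<otimes> r) ` F))) (restr f ((\<lambda>p. p \<otimes> r) ` F)) \<in> \<real>\<^sub>\<ge>\<^sub>0"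
      using x(2) restr_ell2(1)[OF f] by (intro nonneg_Reals_mult_I) (auto simp: op_pos_def)
  qed
qed

lemma positive_coefficient_le_trace:
  assumes y: "y \<in> convolvers G" "op_pos (carrier G) y" and h: "h \<in> carrier G"
  shows "cmod (y tvec h) \<le> Re (y tvec \<one>)"
proof -
  have "y (delta h) h = y tvec \<one>" using convolver_delta[OF y(1) h h] h by simp
  then have "(cmod (y tvec h))\<^sup>2 \<le> (Re (y tvec \<one>))\<^sup>2"
    using op_pos_cauchy_schwarz[OF convolversD(1)[OF y(1)] y(2), of "tvec" "delta h"] h by (simp add: power2_eq_square)
  moreover have "ip (y tvec) tvec \<in> \<real>\<^sub>\<ge>\<^sub>0" using y(2) unfolding op_pos_def by (rule bspec) simp
  then have "0 \<le> Re (y tvec \<one>)" by (simp add: complex_nonneg_Reals_iff)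
  ultimately show ?thesis by (rule power2_le_imp_le)
qed

text \<open>The form of \<open>folner_map F (x - d)\<close> at \<open>f\<close> is at most
  \<open>card F\<close> times the trace of \<open>x - d\<close> times the squared norm of
  \<open>f\<close>, because a positive convolver has no coefficient larger than its trace.
  Convergence of the traces therefore suffices.\<close>

lemma folner_map_normal:
  assumes F: "finite F" "F \<subseteq> carrier G" "F \<noteq> {}" and \<phi>P: "\<And>x. x \<in> P ==> folner_map F x \<in> P"
  shows "normal_map (carrier G) P (folner_map F)"
  unfolding normal_map_def
proof (intro allI impI, elim conjE)
  let ?S = "carrier G" and ?\<phi> = "folner_map F"
  fix D x assume D: "D \<subseteq> P" "D \<noteq> {}" "\<forall>d\<in>D. op_pos ?S d" "\<forall>a\<in>D. \<forall>b\<in>D. \<exists>c\<in>D. op_le ?S a c \<and> op_le ?S b c"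
    and x: "is_op_sup ?S P D x"
  have xP: "x \<in> P" and xD: "\<And>d. d \<in> D ==> op_le ?S d x" using x unfolding is_op_sup_def by blast+
  have cv: "x - d \<in> convolvers G" "op_pos ?S (x - d)" if "d \<in> D" for d
    using vnaD(7)[OF P xP] that D(1) PL xD[OF that] by (auto simp: op_le_def)
  show "is_op_sup ?S P (?\<phi> ` D) (?\<phi> x)"
    unfolding is_op_sup_def
  proof (intro conjI ballI impI)
    show "?\<phi> x \<in> P" by (rule \<phi>P[OF xP])
    show "op_le ?S d' (?\<phi> x)" if d': "d' \<in> ?\<phi> ` D" for d'
    proof -
      obtain d where "d \<in> D" "d' = ?\<phi> d" using d' by blast
      then show ?thesis using folner_map_pos[OF cv F(1,2)] by (simp add: op_le_def folner_map_diff)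
    qed
    fix y assume y: "y \<in> P" "\<forall>d'\<in>?\<phi> ` D. op_le ?S d' y"
    show "op_le ?S (?\<phi> x) y"
      unfolding op_le_iff[OF P_bounded[OF \<phi>P[OF xP]] P_bounded[OF y(1)]]
    proof
      fix f assume f: "f \<in> ell2 ?S"
      let ?l = "ip (y f) f - ip (?\<phi> x f) f"
      have "\<exists>z\<in>\<real>\<^sub>\<ge>\<^sub>0. dist z ?l < e" if e: "e > 0" for e
      proof -
        \<comment> \<open>The added one keeps \<open>N\<close> positive when \<open>f\<close> is
          zero.\<close>
        define N where "N = real (card F) * (nrm f)\<^sup>2 + 1"
        have N: "N > 0" unfolding N_def by (simp add: add_nonneg_pos)
        have e': "e / N > 0" using e N by simp
        obtain d where d: "d \<in> D" "Re (ip (x tvec) tvec) - Re (ip (d tvec) tvec) < e / N"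
        proof (rule op_sup_approx[OF P D(1,2) _ _ x _ e', of "tvec"])
          show "op_pos ?S d" if "d \<in> D" for d using that D(3) by blast
          show "\<exists>c\<in>D. op_le ?S a c \<and> op_le ?S b c" if "a \<in> D" "b \<in> D" for a b using that D(4) by blast
        qed auto
        define t where "t = Re ((x - d) tvec \<one>)"
        have t: "t < e / N" using d(2) by (simp add: t_def)
        have t0: "0 \<le> t" unfolding t_def
          by (rule order_trans[OF norm_ge_zero positive_coefficient_le_trace[OF cv[OF d(1)], of \<one>]]) simp
        have "cmod (ip (?\<phi> (x - d) f) f) \<le> real (card F) * t * (nrm f)\<^sup>2"
        proof -
          have entry: "cmod ((x - d) tvec (p \<otimes> inv q) * ip (lreg G (p \<otimes> inv q) f) f) \<le> t * (nrm f)\<^sup>2"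
            if pq: "p \<in> F" "q \<in> F" for p q
          proof -
            have h: "p \<otimes> inv q \<in> ?S" using pq F(2) by auto
            have "cmod (ip (lreg G (p \<otimes> inv q) f) f) \<le> nrm f * nrm f"
              using ip_cauchy_schwarz[OF bopsD(1)[OF lreg_bounded[OF h] f] f]
              by (simp add: lreg_norm[OF h f])
            then show ?thesis unfolding norm_mult power2_eq_square
              using positive_coefficient_le_trace[OF cv[OF d(1)] h] t0 by (intro mult_mono) (auto simp: t_def)
          qed
          have "cmod (ip (?\<phi> (x - d) f) f) = 1 / real (card F) *
              cmod (\<Sum>p\<in>F. \<Sum>q\<in>F. (x - d) tvec (p \<otimes> inv q) * ip (lreg G (p \<otimes> inv q) f) f)"
            unfolding folner_map_inner[OF F(2) f f] norm_mult by (simp add: norm_divide)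
          also have "\<dots> \<le> 1 / real (card F) * (\<Sum>p\<in>F. \<Sum>q\<in>F. t * (nrm f)\<^sup>2)"
            by (rule mult_left_mono, rule order_trans[OF norm_sum sum_mono[OF order_trans[OF norm_sum sum_mono]]])
              (use entry in auto)
          also have "\<dots> = real (card F) * t * (nrm f)\<^sup>2" using F(1,3) by simp
          finally show ?thesis .
        qed
        also have "\<dots> = t * (real (card F) * (nrm f)\<^sup>2)" by simp
        also have "\<dots> \<le> t * N" using t0 by (intro mult_left_mono) (simp_all add: N_def)
        also have "\<dots> < e" using t N by (simp add: pos_less_divide_eq)
        finally have small: "cmod (ip (?\<phi> (x - d) f) f) < e" .
        have dP: "d \<in> P" using d(1) D(1) by blast
        have "ip (?\<phi> (x - d) f) f = ip (?\<phi> x f) f - ip (?\<phi> d f) f"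
          using ip_diff_left[OF bopsD(1)[OF P_bounded[OF \<phi>P[OF xP]] f] bopsD(1)[OF P_bounded[OF \<phi>P[OF dP]] f] f]
          by (simp add: folner_map_diff)
        then have "dist (ip (y f) f - ip (?\<phi> d f) f) ?l < e"
          using small by (simp add: dist_norm)
        moreover have "ip (y f) f - ip (?\<phi> d f) f \<in> \<real>\<^sub>\<ge>\<^sub>0"
          using y(2)[rule_format, of "?\<phi> d"] d(1) f op_le_iff[OF P_bounded[OF \<phi>P[OF dP]] P_bounded[OF y(1)]] by blast
        ultimately show ?thesis by blast
      qed
      then show "?l \<in> \<real>\<^sub>\<ge>\<^sub>0" using closed_approachable[OF closed_nonneg_Reals_complex] by blast
    qed
  qed
qed

end

lemma nrm_sum:
  assumes "\<And>i. i \<in> I ==> f i \<in> ell2 S" shows "nrm (\<Sum>i\<in>I. f i) \<le> (\<Sum>i\<in>I. nrm (f i))"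
  using assms
proof (induction I rule: infinite_finite_induct)
  case (insert i I)
  have "nrm (f i + sum f I) \<le> nrm (f i) + nrm (sum f I)"
    by (rule nrm_triangle[of _ S]) (use insert.prems in auto)
  also have "\<dots> \<le> nrm (f i) + (\<Sum>i\<in>I. nrm (f i))" using insert.IH insert.prems by simp
  finally show ?case by (simp only: sum.insert[OF insert.hyps])
qed auto

text \<open>Finite nets of the unit disc give finite nets for combinations with coefficients in the
  disc; completeness of \<open>ell2 S\<close> turns total boundedness into compactness of the
  closure.\<close>

lemma compact_closure_coefficient_cube:
  assumes I: "finite I" and v: "\<And>i. i \<in> I ==> v i \<in> ell2 S" "\<And>i. i \<in> I ==> nrm (v i) \<le> 1"
    and A: "A \<subseteq> {\<Sum>i\<in>I. vsc (c i) (v i) | c. \<forall>i\<in>I. cmod (c i) \<le> 1}"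
  shows "compactin (ell2_topology S) (ell2_topology S closure_of A)"
proof -
  interpret M: Metric_space "ell2 S" "\<lambda>f g. nrm (f - g)" by (rule Metric_space_ell2)
  let ?K = "{\<Sum>i\<in>I. vsc (c i) (v i) | c. \<forall>i\<in>I. cmod (c i) \<le> 1}"
  have vec: "(\<Sum>i\<in>I. vsc (c i) (v i)) \<in> ell2 S" for c by (intro ell2_sum ell2_scale v(1))
  have "M.mtotally_bounded ?K"
    unfolding M.mtotally_bounded_def
  proof (intro allI impI)
    fix \<epsilon> :: real assume e: "\<epsilon> > 0"
    define \<delta> where "\<delta> = \<epsilon> / (real (card I) + 1)"
    have d: "\<delta> > 0" using e by (simp add: \<delta>_def)
    have "seq_compact (cball (0::complex) 1)" by (simp add: compact_imp_seq_compact)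
    from seq_compact_imp_totally_bounded[OF this, rule_format, OF d]
    obtain Z where Z: "finite Z" "Z \<subseteq> cball (0::complex) 1" "cball 0 1 \<subseteq> (\<Union>z\<in>Z. ball z \<delta>)" by blast
    let ?N = "(\<lambda>c. \<Sum>i\<in>I. vsc (c i) (v i)) ` (I \<rightarrow>\<^sub>E Z)"
    show "\<exists>N. finite N \<and> N \<subseteq> ?K \<and> ?K \<subseteq> (\<Union>x\<in>N. M.mball x \<epsilon>)"
    proof (intro exI conjI)
      show "finite ?N" using I Z(1) by (intro finite_imageI finite_PiE) auto
      show "?N \<subseteq> ?K"
      proof
        fix y assume "y \<in> ?N"
        then obtain c where c: "c \<in> I \<rightarrow>\<^sub>E Z" "y = (\<Sum>i\<in>I. vsc (c i) (v i))" by blast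
        have "cmod (c i) \<le> 1" if "i \<in> I" for i using PiE_mem[OF c(1) that] Z(2) by auto
        then show "y \<in> ?K" using c(2) by blast
      qed
      show "?K \<subseteq> (\<Union>x\<in>?N. M.mball x \<epsilon>)"
      proof
        fix y assume "y \<in> ?K"
        then obtain c where c: "\<forall>i\<in>I. cmod (c i) \<le> 1" and y: "y = (\<Sum>i\<in>I. vsc (c i) (v i))" by blast
        have "\<forall>i\<in>I. \<exists>z. z \<in> Z \<and> dist z (c i) < \<delta>"
        proof
          fix i assume "i \<in> I"
          then have "c i \<in> cball 0 1" using c by simp
          then obtain z where "z \<in> Z" "c i \<in> ball z \<delta>" using Z(3) by blast
          then show "\<exists>z. z \<in> Z \<and> dist z (c i) < \<delta>" by (intro exI[of _ z]) simp
        qed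
        from bchoice[OF this] obtain b where b: "\<forall>i\<in>I. b i \<in> Z \<and> dist (b i) (c i) < \<delta>" ..
        define b' where "b' = restrict b I"
        have b': "b' \<in> I \<rightarrow>\<^sub>E Z" using b by (simp add: b'_def)
        have "(\<Sum>i\<in>I. vsc (b' i) (v i)) - y = (\<Sum>i\<in>I. vsc (b i - c i) (v i))"
          unfolding y sum_subtractf[symmetric] by (rule sum.cong) (auto simp: b'_def fun_eq_iff algebra_simps)
        then have "nrm ((\<Sum>i\<in>I. vsc (b' i) (v i)) - y) \<le> (\<Sum>i\<in>I. nrm (vsc (b i - c i) (v i)))"
          using nrm_sum[of I "\<lambda>i. vsc (b i - c i) (v i)" S] v(1) by (simp add: ell2_scale)
        also have "\<dots> \<le> (\<Sum>i\<in>I. \<delta>)"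
        proof (rule sum_mono)
          fix i assume i: "i \<in> I"
          have "cmod (b i - c i) * nrm (v i) \<le> \<delta> * 1"
            using b i v(2)[OF i] d by (intro mult_mono) (auto simp: dist_norm less_imp_le)
          then show "nrm (vsc (b i - c i) (v i)) \<le> \<delta>" by (simp add: nrm_scale)
        qed
        also have "\<dots> < \<epsilon>" using e by (simp add: \<delta>_def pos_divide_less_eq)
        finally have "y \<in> M.mball (\<Sum>i\<in>I. vsc (b' i) (v i)) \<epsilon>"
          using vec by (simp add: M.in_mball y)
        then show "y \<in> (\<Union>x\<in>?N. M.mball x \<epsilon>)" using b' by blast
      qed
    qed
  qed
  then have tb: "M.mtotally_bounded A" by (rule M.mtotally_bounded_subset[OF _ A])
  have "M.mcomplete"
    unfolding M.mcomplete_def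
  proof (intro allI impI)
    fix \<sigma> assume "M.MCauchy \<sigma>"
    note c = this[unfolded M.MCauchy_def]
    have s: "\<sigma> n \<in> ell2 S" for n using conjunct1[OF c] by (rule subsetD) simp
    have s': "\<exists>N. \<forall>m\<ge>N. \<forall>n\<ge>N. nrm (\<sigma> m - \<sigma> n) < e" if e: "e > 0" for e
    proof -
      from conjunct2[OF c, rule_format, OF e]
      obtain N where "\<forall>n n'. N \<le> n \<longrightarrow> N \<le> n' \<longrightarrow> nrm (\<sigma> n - \<sigma> n') < e" ..
      then show ?thesis by (intro exI[of _ N]) simp
    qed
    obtain l where l: "l \<in> ell2 S" "(\<lambda>n. nrm (\<sigma> n - l)) \<longlonglongrightarrow> 0" by (rule ell2_complete[OF s s'])
    have "\<exists>N. \<forall>n\<ge>N. \<sigma> n \<in> ell2 S \<and> nrm (\<sigma> n - l) < e" if "e > 0" for e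
      using order_tendstoD(2)[OF l(2) that] s by (auto simp: eventually_sequentially)
    then show "\<exists>x. limitin M.mtopology \<sigma> x sequentially"
      unfolding M.limit_metric_sequentially using l(1) by blast
  qed
  from M.mtotally_bounded_eq_compact_closure_of[OF this, of A] tb
  show ?thesis unfolding ell2_topology_def by simp
qed

text \<open>Under a common norm bound, density reduces weak convergence to matrix entries, first in
  one argument and then in the other.\<close>

lemma wot_tendsto_deltas:
  assumes B: "\<And>n. B n \<in> bounded_ops S" and A: "A \<in> bounded_ops S"
    and bound: "\<And>n f g. f \<in> ell2 S ==> g \<in> ell2 S ==> cmod (ip (B n f) g) \<le> C * nrm f * nrm g"
      "\<And>f g. f \<in> ell2 S ==> g \<in> ell2 S ==> cmod (ip (A f) g) \<le> C * nrm f * nrm g"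
    and lim: "\<And>s t. s \<in> S ==> t \<in> S ==> (\<lambda>n. B n (delta s) t) \<longlonglongrightarrow> A (delta s) t"
    and f: "f \<in> ell2 S" and g: "g \<in> ell2 S"
  shows "(\<lambda>n::nat. ip (B n f) g) \<longlonglongrightarrow> ip (A f) g"
proof -
  define D where "D n = B n - A" for n
  have D: "D n \<in> bounded_ops S" for n unfolding D_def by (rule bounded_ops_minus[OF B A])
  note De = bopsD(1)[OF D]
  have Di: "ip (D n f) g = ip (B n f) g - ip (A f) g" if "f \<in> ell2 S" "g \<in> ell2 S" for n f g
    using ip_diff_left[OF bopsD(1)[OF B that(1)] bopsD(1)[OF A that(1)] that(2)] by (simp add: D_def)
  have Db: "cmod (ip (D n f) g) \<le> 2 * C * nrm f * nrm g" if "f \<in> ell2 S" "g \<in> ell2 S" for n f g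
    using norm_triangle_ineq4[of "ip (B n f) g" "ip (A f) g"] bound(1)[OF that, of n] bound(2)[OF that]
    unfolding Di[OF that] by linarith
  have 1: "(\<lambda>n. ip (D n f) (delta t)) \<longlonglongrightarrow> 0" if t: "t \<in> S" for t
  proof (rule functional_tendsto_0[where L = "\<lambda>n f. ip (D n f) (delta t)", OF _ _ _ _ f])
    show "(\<lambda>n. ip (D n (delta s)) (delta t)) \<longlonglongrightarrow> 0" if "s \<in> S" for s
      using tendsto_diff[OF lim[OF that t] tendsto_const[of "A (delta s) t"]] by (simp add: D_def)
    show "cmod (ip (D n h) (delta t)) \<le> 2 * C * nrm h" if "h \<in> ell2 S" for n h
      using Db[OF that delta_in_ell2[OF t], of n] by simp
  qed (simp_all add: bopsD(2,3)[OF D])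
  have "(\<lambda>n. cnj (ip (D n f) g)) \<longlonglongrightarrow> 0"
  proof (rule functional_tendsto_0[where L = "\<lambda>n g. cnj (ip (D n f) g)", OF _ _ _ _ g])
    show "cnj (ip (D n f) (h + k)) = cnj (ip (D n f) h) + cnj (ip (D n f) k)"
      if "h \<in> ell2 S" "k \<in> ell2 S" for n h k
      by (simp add: ip_add_right[OF that De[OF f]])
    show "(\<lambda>n. cnj (ip (D n f) (delta t))) \<longlonglongrightarrow> 0" if "t \<in> S" for t
      using tendsto_cnj[OF 1[OF that]] by simp
    show "cmod (cnj (ip (D n f) h)) \<le> 2 * C * nrm f * nrm h" if "h \<in> ell2 S" for n h
      using Db[OF f that] by simp
  qed (simp add: ip_scale_right)
  then have "(\<lambda>n. ip (B n f) g - ip (A f) g) \<longlonglongrightarrow> 0"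
    using tendsto_cnj by (fastforce simp: Di[OF f g])
  then show ?thesis by (rule LIM_zero_cancel)
qed

context group
begin

text \<open>The projection \<open>E\<close> onto \<open>ell2 H\<close> commutes with the generators,
  hence with the whole algebra. Since it fixes \<open>tvec\<close>, it fixes
  \<open>x tvec\<close>.\<close>

lemma subgroup_vna_support:
  assumes H: "subgroup H G" and x: "x \<in> subgroup_vna G H" and g: "g \<in> carrier G" "g \<notin> H"
  shows "x tvec g = 0"
proof -
  let ?S = "carrier G"
  define E :: "'a op2" where "E f = (if f \<in> ell2 ?S then restr f H else 0)" for f
  have HS: "H \<subseteq> ?S" by (rule subgroup.subset[OF H])
  have Eb: "E \<in> bounded_ops ?S"
    by (rule bounded_opsI[where C = 1])
      (auto simp: E_def restr_ell2 ell2_add ell2_scale, auto simp: restr_def fun_eq_iff)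
  have Eadj: "adj ?S E = E"
  proof (rule adj_unique[OF Eb])
    fix f g assume "f \<in> ell2 ?S" "g \<in> ell2 ?S"
    then show "ip (E f) g = ip f (E g)"
      unfolding ell2_inner_def by (intro infsum_cong) (simp add: E_def restr_def)
  qed
  have Q: "von_neumann_algebra ?S (commutant ?S {E})"
    by (rule von_neumann_algebra_commutant) (auto simp: Eb Eadj)
  have Ed: "E (delta a) = (if a \<in> H then delta a else 0)" if "a \<in> ?S" for a
    using that by (auto simp: E_def restr_def delta_apply fun_eq_iff)
  have "lreg G h \<in> commutant ?S {E}" if h: "h \<in> H" for h
  proof -
    have hS: "h \<in> ?S" using h HS by blast
    note L = lreg_bounded[OF hS]
    have "lreg G h \<circ> E = E \<circ> lreg G h"
    proof (rule bounded_ops_eq_on_delta[OF bounded_ops_comp[OF L Eb] bounded_ops_comp[OF Eb L]])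
      fix a assume a: "a \<in> ?S"
      have "h \<otimes> a \<in> H \<longleftrightarrow> a \<in> H"
        using subgroup.m_closed[OF H h] subgroup.m_closed[OF H subgroup.m_inv_closed[OF H h], of "h \<otimes> a"] hS a
        by (auto simp: m_assoc[symmetric])
      then show "(lreg G h \<circ> E) (delta a) = (E \<circ> lreg G h) (delta a)"
        using hS a by (simp add: Ed lreg_delta bopsD(5)[OF L])
    qed
    then show ?thesis using L by (simp add: commutant_def fun_eq_iff)
  qed
  then have "subgroup_vna G H \<subseteq> commutant ?S {E}" unfolding subgroup_vna_def by (intro vn_generated_minimal[OF Q]) blast
  then have x': "x \<in> bounded_ops ?S" "x (E tvec) = E (x tvec)"
    using x unfolding commutant_def by auto
  have "x tvec = E (x tvec)" using x'(2) Ed[of \<one>] subgroup.one_closed[OF H] by simp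
  then have "x tvec g = E (x tvec) g" by (rule fun_cong)
  also have "\<dots> = 0" using g bopsD(1)[OF x'(1), of "tvec"] by (simp add: E_def restr_def)
  finally show ?thesis .
qed

lemma op_scale_inner: "ip (op_scale c A f) g = c * ip (A f) g"
  by (simp add: op_scale_def ip_scale_left)

text \<open>The 2 by 2 matrix with diagonal entries \<open>C\<close> and off-diagonal entry
  \<open>x\<close> is positive. \<open>folner_map F\<close> preserves its positivity and fixes its
  diagonal, and Cauchy-Schwarz gives the same bound for the image of \<open>x\<close>.\<close>

lemma folner_map_norm_bound:
  assumes x: "x \<in> convolvers G" and C: "C > 0" "\<And>f. f \<in> ell2 (carrier G) ==> nrm (x f) \<le> C * nrm f"
    and F: "finite F" "F \<subseteq> carrier G" "F \<noteq> {}" and f: "f \<in> ell2 (carrier G)" and g: "g \<in> ell2 (carrier G)"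
  shows "cmod (ip (folner_map F x f) g) \<le> C * nrm f * nrm g"
proof -
  let ?S = "carrier G"
  have xb: "x \<in> bounded_ops ?S" by (rule convolversD(1)[OF x])
  define M where "M i j = (if i = 0 then (if j = 0 then op_scale (of_real C) (op_id ?S) else x)
      else (if j = 0 then adj ?S x else op_scale (of_real C) (op_id ?S)))" for i j :: nat
  note vc = von_neumann_algebra_convolvers
  have Mc: "M i j \<in> convolvers G" for i j
    using x vnaD(6)[OF vc x] vnaD(5)[OF vc vnaD(2)[OF vc]] by (simp add: M_def)
  have Mpos: "matrix_pos ?S 2 M"
    unfolding matrix_pos_def
  proof (intro allI impI)
    fix \<xi> :: "nat \<Rightarrow> 'a vec2" assume "\<forall>i<2. \<xi> i \<in> ell2 ?S"
    then have v: "\<xi> 0 \<in> ell2 ?S" "\<xi> 1 \<in> ell2 ?S" by auto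
    define z where "z = ip (x (\<xi> 1)) (\<xi> 0)"
    have "ip (adj ?S x (\<xi> 0)) (\<xi> 1) = cnj z"
      unfolding adj_inner(2)[OF xb v] z_def by (rule ip_commute)
    then have "(\<Sum>i<2. \<Sum>j<2. ip (M i j (\<xi> j)) (\<xi> i))
       = of_real (C * (nrm (\<xi> 0))\<^sup>2) + z + (cnj z + of_real (C * (nrm (\<xi> 1))\<^sup>2))"
      using v by (simp add: sum_lessThan_2 M_def op_scale_def op_id_def ip_scale_left ip_self z_def)
    also have "\<dots> = of_real (C * (nrm (\<xi> 0))\<^sup>2 + 2 * Re z + C * (nrm (\<xi> 1))\<^sup>2)"
      by (simp add: complex_eq_iff)
    finally have sum: "(\<Sum>i<2. \<Sum>j<2. ip (M i j (\<xi> j)) (\<xi> i))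
       = of_real (C * (nrm (\<xi> 0))\<^sup>2 + 2 * Re z + C * (nrm (\<xi> 1))\<^sup>2)" .
    have "\<bar>Re z\<bar> \<le> cmod z" by (rule abs_Re_le_cmod)
    also have "\<dots> \<le> nrm (x (\<xi> 1)) * nrm (\<xi> 0)"
      unfolding z_def by (rule ip_cauchy_schwarz[OF bopsD(1)[OF xb v(2)] v(1)])
    also have "\<dots> \<le> (C * nrm (\<xi> 1)) * nrm (\<xi> 0)" by (rule mult_right_mono[OF C(2)[OF v(2)]]) simp
    finally have "2 * Re z \<ge> - (C * (2 * nrm (\<xi> 0) * nrm (\<xi> 1)))" by (simp add: mult_ac)
    moreover have "0 \<le> C * (nrm (\<xi> 0) - nrm (\<xi> 1))\<^sup>2" using C(1) by simp
    ultimately have "0 \<le> C * (nrm (\<xi> 0))\<^sup>2 + 2 * Re z + C * (nrm (\<xi> 1))\<^sup>2"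
      unfolding power2_diff by (simp add: algebra_simps)
    then show "(\<Sum>i<2. \<Sum>j<2. ip (M i j (\<xi> j)) (\<xi> i)) \<in> \<real>\<^sub>\<ge>\<^sub>0" unfolding sum nonneg_Reals_of_real_iff .
  qed
  let ?\<phi> = "folner_map F"
  have \<phi>b: "?\<phi> y \<in> bounded_ops ?S" for y by (rule folner_map_bounded[OF F(2)])
  have pos: "matrix_pos ?S 2 (\<lambda>i j. ?\<phi> (M i j))" by (rule folner_map_matrix_pos[OF Mc Mpos F(1,2)])
  have id: "ip (?\<phi> (op_id ?S) k) k = of_real ((nrm k)\<^sup>2)" if k: "k \<in> ell2 ?S" for k
  proof -
    have "(\<Sum>p\<in>F. \<Sum>q\<in>F. op_id ?S tvec (p \<otimes> inv q) * ip (lreg G (p \<otimes> inv q) k) k)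
        = (\<Sum>p\<in>F. \<Sum>q\<in>F. if q = p then ip k k else 0)"
    proof (intro sum.cong refl)
      fix p q assume "p \<in> F" "q \<in> F"
      then have pq: "p \<in> ?S" "q \<in> ?S" using F(2) by auto
      have "p \<otimes> inv q = \<one> \<longleftrightarrow> q = p" using pq inv_solve_right[of \<one> p q] by auto
      then show "op_id ?S tvec (p \<otimes> inv q) * ip (lreg G (p \<otimes> inv q) k) k = (if q = p then ip k k else 0)"
        using pq k by (auto simp: op_id_def delta_apply lreg_one)
    qed
    also have "\<dots> = of_nat (card F) * ip k k" using F(1) by simp
    finally show ?thesis unfolding folner_map_inner[OF F(2) k k] using F(1,3) by (simp add: ip_self)
  qed
  have C_id: "ip (?\<phi> (op_scale (of_real C) (op_id ?S)) k) k = of_real (C * (nrm k)\<^sup>2)" if "k \<in> ell2 ?S" for k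
    by (simp add: folner_map_scale op_scale_inner id[OF that])
  have "(cmod (ip (?\<phi> x f) g))\<^sup>2 \<le> (C * (nrm g)\<^sup>2) * (C * (nrm f)\<^sup>2)"
    using matrix_pos_2_cauchy_schwarz(1)[OF \<phi>b pos f g] unfolding M_def by (simp add: C_id f g del: of_real_mult)
  also have "\<dots> = (C * nrm f * nrm g)\<^sup>2" by (simp add: power2_eq_square mult_ac)
  finally show ?thesis by (rule power2_le_imp_le) (use C(1) in auto)
qed

end

context group_subalgebra
begin

text \<open>Finite rank: only the coefficients at quotients \<open>p \<otimes> inv q\<close> are
  used, and the corresponding vectors lie in \<open>L2\<close> because their unitaries are in
  \<open>P\<close>.\<close>

lemma folner_map_L2_compact:
  assumes F: "finite F" "F \<noteq> {}" "F \<subseteq> carrier G" and L: "\<And>p q. p \<in> F ==> q \<in> F ==> lreg G (p \<otimes> inv q) \<in> P"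
  shows "L2_compact G P (folner_map F)"
proof -
  let ?S = "carrier G"
  define T :: "'a op2" where "T f = (\<Sum>i\<in>F \<times> F. vsc (f (fst i \<otimes> inv (snd i)) / of_nat (card F)) (delta (fst i \<otimes> inv (snd i))))" for f
  have h: "fst i \<otimes> inv (snd i) \<in> ?S" if "i \<in> F \<times> F" for i
  proof -
    have "fst i \<in> ?S" "snd i \<in> ?S" using that F(3) by auto
    then show ?thesis by simp
  qed
  have dL: "delta (fst i \<otimes> inv (snd i)) \<in> L2" if i: "i \<in> F \<times> F" for i
  proof -
    have "lreg G (fst i \<otimes> inv (snd i)) \<in> P" using L i by auto
    from P_delta_L2[OF this] show ?thesis using h[OF i] by (simp add: lreg_delta)
  qed
  note sub = closed_subspaceD[OF closed_subspace_L2]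
  have sumL: "(\<Sum>i\<in>I. v i) \<in> L2" if "finite I" "\<And>i. i \<in> I ==> v i \<in> L2" for I :: "('a \<times> 'a) set" and v
    using that
  proof (induction I rule: finite_induct)
    case empty
    show ?case unfolding sum.empty by (rule sub(2))
  next
    case (insert i I)
    have "v i + sum v I \<in> L2" by (rule sub(3)) (use insert in auto)
    then show ?case by (simp only: sum.insert[OF insert.hyps])
  qed
  have fin: "finite (F \<times> F)" using F(1) by simp
  have lin: "linear_map_on L2 T"
    unfolding linear_map_on_def
  proof (intro conjI ballI allI)
    show "T f \<in> L2" for f unfolding T_def by (rule sumL[OF fin]) (intro sub(4) dL)
    show "T (f + g) = T f + T g" for f g
      unfolding T_def sum.distrib[symmetric] by (rule sum.cong) (auto simp: fun_eq_iff add_divide_distrib distrib_right)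
    show "T (vsc c f) = vsc c (T f)" for c f
      by (rule ext) (simp add: T_def sum_vec_apply sum_distrib_left mult.assoc)
  qed
  have "compactin (ell2_topology ?S) (ell2_topology ?S closure_of (T ` {f \<in> L2. nrm f \<le> 1}))"
  proof (rule compact_closure_coefficient_cube[OF fin])
    show "delta (fst i \<otimes> inv (snd i)) \<in> ell2 ?S" if "i \<in> F \<times> F" for i using h[OF that] by simp
    show "T ` {f \<in> L2. nrm f \<le> 1} \<subseteq> {\<Sum>i\<in>F \<times> F. vsc (c i) (delta (fst i \<otimes> inv (snd i))) | c. \<forall>i\<in>F \<times> F. cmod (c i) \<le> 1}"
    proof
      fix y assume "y \<in> T ` {f \<in> L2. nrm f \<le> 1}"
      then obtain f where f: "f \<in> L2" "nrm f \<le> 1" and y: "y = T f" by blast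
      have c1: "real (card F) \<ge> 1" using F(1,2) by (simp add: Suc_le_eq card_gt_0_iff)
      have "cmod (f (fst i \<otimes> inv (snd i)) / of_nat (card F)) \<le> 1" for i
      proof -
        have "cmod (f (fst i \<otimes> inv (snd i))) \<le> 1" using nrm_component[OF L2_ell2[OF f(1)]] f(2) by (rule order_trans)
        then show ?thesis using c1 by (simp add: norm_divide divide_le_eq)
      qed
      then show "y \<in> {\<Sum>i\<in>F \<times> F. vsc (c i) (delta (fst i \<otimes> inv (snd i))) | c. \<forall>i\<in>F \<times> F. cmod (c i) \<le> 1}"
        unfolding y T_def mem_Collect_eq
        by (intro exI[of _ "\<lambda>i. f (fst i \<otimes> inv (snd i)) / of_nat (card F)"] conjI ballI refl)
    qed
  qed simp
  moreover have "T (x tvec) = folner_map F x tvec" if "x \<in> P" for x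
  proof
    fix y
    have "T (x tvec) y = (\<Sum>p\<in>F. \<Sum>q\<in>F. x tvec (p \<otimes> inv q) / of_nat (card F) * delta (p \<otimes> inv q) y)"
      unfolding T_def sum_vec_apply by (simp add: sum.cartesian_product case_prod_beta)
    also have "\<dots> = folner_map F x tvec y"
      unfolding folner_map_def op_scale_def sum_op_apply sum_vec_apply vsc_apply sum_distrib_left
    proof (intro sum.cong refl)
      fix p q assume "p \<in> F" "q \<in> F"
      then have "p \<otimes> inv q \<in> ?S" using F(3) by auto
      then show "x tvec (p \<otimes> inv q) / of_nat (card F) * delta (p \<otimes> inv q) y
          = 1 / of_nat (card F) * (x tvec (p \<otimes> inv q) * lreg G (p \<otimes> inv q) tvec y)"
        by (simp add: lreg_delta)
    qed
    finally show "T (x tvec) y = folner_map F x tvec y" .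
  qed
  ultimately show ?thesis unfolding L2_compact_def compact_operator_on_def using lin by blast
qed

text \<open>The overlap at the neutral element is one, so the trace is even preserved.\<close>

lemma folner_map_subtracial:
  assumes F: "finite F" "F \<noteq> {}" "F \<subseteq> carrier G"
  shows "subtracial G P (folner_map F)"
proof -
  have "{q \<in> F. \<one> \<otimes> q \<in> F} = F" using F(3) by auto
  then have "overlap F \<one> = 1" using F(1,2) by (simp add: overlap_def)
  then show ?thesis using folner_map_coefficient[OF F(1,3), of \<one>] by (simp add: subtracial_def canonical_trace_def)
qed

text \<open>Multipliers between zero and one do not enlarge the tail of \<open>x tvec\<close>, so
  convergence is checked on finitely many coefficients. Asking for \<open>lim\<close> only at
  nonzero coefficients admits elements supported on a proper subgroup.\<close>

lemma folner_map_tendsto: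
  assumes F: "\<And>n::nat. finite (F n)" "\<And>n. F n \<subseteq> carrier G"
    and lim: "\<And>h. h \<in> carrier G ==> x tvec h \<noteq> 0 ==> (\<lambda>n. overlap (F n) h) \<longlonglongrightarrow> 1"
    and x: "x \<in> P"
  shows "(\<lambda>n. trace_norm2 G (folner_map (F n) x - x)) \<longlonglongrightarrow> 0"
proof (rule LIMSEQ_I)
  fix e :: real assume e: "e > 0"
  let ?S = "carrier G" and ?f = "x tvec"
  have f: "?f \<in> ell2 ?S" by (rule P_delta[OF x])
  have b: "folner_map (F n) x - x \<in> bounded_ops ?S" for n
    by (intro bounded_ops_minus folner_map_bounded F P_bounded x)
  have e2: "e / 2 > 0" using e by simp
  obtain A where A: "finite A" "A \<subseteq> ?S" "nrm (?f - restr ?f A) < e / 2" by (rule ell2_finite_approx1[OF f e2])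
  have "(\<lambda>n. \<Sum>h\<in>A. (1 - overlap (F n) h) * cmod (?f h)) \<longlonglongrightarrow> (\<Sum>h\<in>A. 0)"
  proof (rule tendsto_sum)
    fix h assume "h \<in> A"
    show "(\<lambda>n. (1 - overlap (F n) h) * cmod (?f h)) \<longlonglongrightarrow> 0"
    proof (cases "?f h = 0")
      case False
      have "(\<lambda>n. (1 - overlap (F n) h) * cmod (?f h)) \<longlonglongrightarrow> (1 - 1) * cmod (?f h)"
        by (intro tendsto_intros lim) (use A(2) \<open>h \<in> A\<close> False in auto)
      then show ?thesis by simp
    qed simp
  qed
  then have "(\<lambda>n. \<Sum>h\<in>A. (1 - overlap (F n) h) * cmod (?f h)) \<longlonglongrightarrow> 0" by simp
  from order_tendstoD(2)[OF this e2] obtain n0 where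
    n0: "\<And>n. n \<ge> n0 ==> (\<Sum>h\<in>A. (1 - overlap (F n) h) * cmod (?f h)) < e / 2"
    unfolding eventually_sequentially by blast
  show "\<exists>no. \<forall>n\<ge>no. norm (trace_norm2 G (folner_map (F n) x - x) - 0) < e"
  proof (intro exI allI impI)
    fix n assume n: "n \<ge> n0"
    define d where "d = (folner_map (F n) x - x) tvec"
    have d: "d \<in> ell2 ?S" unfolding d_def by (rule bopsD(1)[OF b]) simp
    have dh: "d h = of_real (overlap (F n) h - 1) * ?f h" if "h \<in> ?S" for h
      by (simp add: d_def folner_map_coefficient[OF F that] algebra_simps)
    have ab: "cmod (of_real (overlap (F n) h - 1)) = 1 - overlap (F n) h" for h
      unfolding norm_of_real using overlap_bounds[OF F(1), of n h] by linarith
    have "nrm (restr d A) \<le> (\<Sum>h\<in>A. nrm (vsc (d h) (delta h)))"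
      unfolding restr_sum[OF A(1)] by (rule nrm_sum[of _ _ ?S]) (use A(2) in auto)
    also have "\<dots> = (\<Sum>h\<in>A. (1 - overlap (F n) h) * cmod (?f h))"
    proof (rule sum.cong[OF refl])
      fix h assume "h \<in> A"
      then have "h \<in> ?S" using A(2) by blast
      then show "nrm (vsc (d h) (delta h)) = (1 - overlap (F n) h) * cmod (?f h)"
        by (simp only: nrm_scale nrm_delta dh norm_mult ab mult_1_right)
    qed
    finally have 1: "nrm (restr d A) < e / 2" using n0[OF n] by linarith
    have 2: "nrm (d - restr d A) \<le> nrm (?f - restr ?f A)"
    proof (rule ell2_bounded_finite_sums(2)[of ?S])
      show "(d - restr d A) x = 0" if "x \<notin> ?S" for x
        using ell2_outside[OF d that] by (simp add: restr_def)
      fix U assume U: "finite U" "U \<subseteq> ?S"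
      have "(\<Sum>h\<in>U. (cmod ((d - restr d A) h))\<^sup>2) \<le> (\<Sum>h\<in>U. (cmod ((?f - restr ?f A) h))\<^sup>2)"
      proof (intro sum_mono power_mono)
        fix h assume "h \<in> U"
        then have h: "h \<in> ?S" using U(2) by blast
        have "cmod (d h) \<le> 1 * cmod (?f h)" unfolding dh[OF h] norm_mult ab
          by (rule mult_right_mono) (use overlap_bounds[OF F(1), of n h] in auto)
        then show "cmod ((d - restr d A) h) \<le> cmod ((?f - restr ?f A) h)" by (simp add: restr_def)
      qed simp
      also have "\<dots> \<le> (nrm (?f - restr ?f A))\<^sup>2"
        by (rule finite_sum_le_nrm[OF ell2_minus[OF f restr_ell2(1)[OF f]] U(1)])
      finally show "(\<Sum>h\<in>U. (cmod ((d - restr d A) h))\<^sup>2) \<le> (nrm (?f - restr ?f A))\<^sup>2" .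
    qed simp
    have "d = (d - restr d A) + restr d A" by simp
    then have "nrm d \<le> nrm (d - restr d A) + nrm (restr d A)"
      using nrm_triangle[OF ell2_minus[OF d restr_ell2(1)[OF d, of A]] restr_ell2(1)[OF d, of A]] by simp
    then have "nrm d < e" using 1 2 A(3) by linarith
    then show "norm (trace_norm2 G (folner_map (F n) x - x) - 0) < e" by (simp add: trace_norm2_eq[OF b] d_def)
  qed
qed

end

text \<open>Amenability in the form of a Folner sequence inside \<open>H\<close>.\<close>

locale amenable_subgroup = group G for G (structure) +
  fixes H :: "'a set" and F :: "nat \<Rightarrow> 'a set"
  assumes H: "subgroup H G"
    and F: "finite (F n)" "F n \<subseteq> H" "F n \<noteq> {}"
    and overlap_tendsto: "h \<in> H ==> (\<lambda>n. overlap (F n) h) \<longlonglongrightarrow> 1"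
begin

lemma H_subset: "H \<subseteq> carrier G" by (rule subgroup.subset[OF H])

lemma F_subset: "F n \<subseteq> carrier G" using F(2) H_subset by blast

sublocale group_subalgebra G "subgroup_vna G H"
  by unfold_locales (rule von_neumann_algebra_subgroup_vna[OF H_subset], rule subgroup_vna_convolvers[OF H_subset])

lemma lreg_quotient: "p \<in> F n ==> q \<in> F n ==> lreg G (p \<otimes> inv q) \<in> subgroup_vna G H"
proof -
  assume "p \<in> F n" "q \<in> F n"
  then have "p \<otimes> inv q \<in> H" using F(2) subgroup.m_closed[OF H] subgroup.m_inv_closed[OF H] by blast
  then show ?thesis unfolding subgroup_vna_def using vn_generated_superset by blast
qed

lemma folner_map_subgroup_vna: "folner_map (F n) x \<in> subgroup_vna G H"
  by (rule folner_map_vna[OF P lreg_quotient])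

text \<open>The Folner averages of \<open>x\<close> are finite combinations of unitaries from
  \<open>H\<close>, are uniformly bounded, and converge to \<open>x\<close> entry by entry, hence
  weakly. Off \<open>H\<close> there is nothing to converge since the coefficients vanish.\<close>

theorem subgroup_vna_supportI:
  assumes x: "x \<in> convolvers G" "\<And>g. g \<in> carrier G ==> g \<notin> H ==> x tvec g = 0"
  shows "x \<in> subgroup_vna G H"
proof -
  let ?S = "carrier G"
  have xb: "x \<in> bounded_ops ?S" by (rule convolversD(1)[OF x(1)])
  obtain C where C: "C > 0" "\<forall>f\<in>ell2 ?S. nrm (x f) \<le> C * nrm f"
    using bounded_ops_bound[OF xb] by (elim exE conjE)
  show ?thesis
  proof (rule vna_sequentially_closed[OF P sequentially_bot xb folner_map_subgroup_vna])
    fix f g assume f: "f \<in> ell2 ?S" and g: "g \<in> ell2 ?S"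
    show "(\<lambda>n. ip (folner_map (F n) x f) g) \<longlonglongrightarrow> ip (x f) g"
    proof (rule wot_tendsto_deltas[OF folner_map_bounded[OF F_subset] xb _ _ _ f g])
      fix n h k assume hk: "h \<in> ell2 ?S" "k \<in> ell2 ?S"
      show "cmod (ip (folner_map (F n) x h) k) \<le> C * nrm h * nrm k"
        by (rule folner_map_norm_bound[OF x(1) C(1) _ F(1) F_subset F(3) hk]) (use C(2) in blast)
    next
      fix h k assume hk: "h \<in> ell2 ?S" "k \<in> ell2 ?S"
      have "cmod (ip (x h) k) \<le> nrm (x h) * nrm k"
        by (rule ip_cauchy_schwarz[OF bopsD(1)[OF xb hk(1)] hk(2)])
      also have "\<dots> \<le> (C * nrm h) * nrm k" by (rule mult_right_mono) (use C(2) hk in auto)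
      finally show "cmod (ip (x h) k) \<le> C * nrm h * nrm k" .
    next
      fix s t assume st: "s \<in> ?S" "t \<in> ?S"
      have h: "t \<otimes> inv s \<in> ?S" using st by simp
      have cv: "folner_map (F n) x \<in> convolvers G" for n
        using folner_map_subgroup_vna PL by blast
      have "folner_map (F n) x (delta s) t = of_real (overlap (F n) (t \<otimes> inv s)) * x tvec (t \<otimes> inv s)" for n
        using convolver_delta[OF cv st] folner_map_coefficient[OF F(1) F_subset h] by simp
      moreover have "x (delta s) t = x tvec (t \<otimes> inv s)" by (rule convolver_delta[OF x(1) st])
      moreover have "(\<lambda>n. of_real (overlap (F n) (t \<otimes> inv s)) * x tvec (t \<otimes> inv s)) \<longlonglongrightarrow> x tvec (t \<otimes> inv s)"
      proof (cases "t \<otimes> inv s \<in> H")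
        case True
        have "(\<lambda>n. of_real (overlap (F n) (t \<otimes> inv s)) * x tvec (t \<otimes> inv s)) \<longlonglongrightarrow> of_real 1 * x tvec (t \<otimes> inv s)"
          by (intro tendsto_intros overlap_tendsto True)
        then show ?thesis by simp
      next
        case False
        then show ?thesis using x(2)[OF h] by simp
      qed
      ultimately show "(\<lambda>n. folner_map (F n) x (delta s) t) \<longlonglongrightarrow> x (delta s) t" by (simp only:)
    qed
  qed
qed

text \<open>Support in \<open>H\<close> characterises the algebra among the convolvers, and
  conjugation by \<open>g\<close> permutes coefficients along an automorphism that preserves
  \<open>H\<close>. Applying it with \<open>inv g\<close> gives surjectivity.\<close>

theorem invariant_subgroup_vna:
  assumes conj: "\<And>g h. g \<in> carrier G ==> h \<in> H ==> g \<otimes> h \<otimes> inv g \<in> H"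
  shows "invariant_subalgebra G (subgroup_vna G H)"
  unfolding invariant_subalgebra_def
proof (intro conjI ballI)
  show "von_neumann_algebra (carrier G) (subgroup_vna G H)" by (rule P)
  show "subgroup_vna G H \<subseteq> group_vna G" by (rule subgroup_vna_mono[OF H_subset order_refl])
  let ?Ad = "\<lambda>g x. lreg G g \<circ> x \<circ> adj (carrier G) (lreg G g)"
  have Ad: "?Ad g x \<in> subgroup_vna G H" if g: "g \<in> carrier G" and x: "x \<in> subgroup_vna G H" for g x
  proof (rule subgroup_vna_supportI)
    have xc: "x \<in> convolvers G" using x PL by blast
    note vc = von_neumann_algebra_convolvers
    show "?Ad g x \<in> convolvers G"
      by (intro vnaD(4,6)[OF vc] lreg_convolver g xc)
    fix k assume k: "k \<in> carrier G" "k \<notin> H"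
    have e: "inv g \<otimes> k \<otimes> g \<in> carrier G" using g k by simp
    have "g \<otimes> (inv g \<otimes> k \<otimes> g) \<otimes> inv g = g \<otimes> (inv g \<otimes> (k \<otimes> (g \<otimes> inv g)))"
      using g k(1) by (simp only: m_assoc m_closed inv_closed)
    also have "\<dots> = k" using g k(1) by (simp add: m_assoc[symmetric])
    finally have "inv g \<otimes> k \<otimes> g \<notin> H" using conj[OF g, of "inv g \<otimes> k \<otimes> g"] k(2) by auto
    then have "x tvec (inv g \<otimes> k \<otimes> g) = 0" by (rule subgroup_vna_support[OF H x e])
    then show "?Ad g x tvec k = 0"
      using g k bopsD(1)[OF convolversD(1)[OF xc], of "delta (inv g)"] convolver_delta[OF xc, of "inv g" "inv g \<otimes> k"]
      by (simp add: lreg_adj lreg_delta lreg_apply)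
  qed
  fix g assume g: "g \<in> carrier G"
  show "?Ad g ` subgroup_vna G H = subgroup_vna G H"
  proof (intro equalityI subsetI)
    fix x assume x: "x \<in> subgroup_vna G H"
    have "?Ad g (?Ad (inv g) x) = (lreg G g \<circ> lreg G (inv g)) \<circ> x \<circ> (lreg G g \<circ> lreg G (inv g))"
      using g by (simp add: lreg_adj o_assoc)
    also have "\<dots> = x" using g P_bounded[OF x] by (simp add: lreg_mult lreg_one)
    finally have "x = ?Ad g (?Ad (inv g) x)" ..
    moreover have "?Ad (inv g) x \<in> subgroup_vna G H" by (rule Ad[OF inv_closed[OF g] x])
    ultimately show "x \<in> ?Ad g ` subgroup_vna G H" by (rule image_eqI)
  qed (use Ad[OF g] in auto)
qed

text \<open>The net in the definition is the sequence of Folner multipliers, pushed forward to a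
  filter on maps.\<close>

theorem haagerup_subgroup_vna: "haagerup G (subgroup_vna G H)"
proof -
  let ?S = "carrier G" and ?P = "subgroup_vna G H"
  have cp: "completely_positive ?S ?P (folner_map (F n))" for n
    unfolding completely_positive_def
  proof (intro conjI ballI allI impI)
    fix k X assume X: "(\<forall>i<k. \<forall>j<k. X i j \<in> ?P) \<and> matrix_pos ?S k X"
    show "matrix_pos ?S k (\<lambda>i j. folner_map (F n) (X i j))"
      by (rule folner_map_matrix_pos) (use X PL F(1) F_subset in auto)
  qed (rule folner_map_subgroup_vna folner_map_add folner_map_scale)+
  define \<F> where "\<F> = filtermap (\<lambda>n. folner_map (F n)) sequentially"
  have "\<F> \<noteq> bot" unfolding \<F>_def by (simp add: filtermap_bot_iff)
  moreover have "\<forall>\<^sub>F \<phi> in \<F>. completely_positive ?S ?P \<phi> \<and> normal_map ?S ?P \<phi> \<and> subtracial G ?P \<phi> \<and> L2_compact G ?P \<phi>"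
    unfolding \<F>_def eventually_filtermap
    by (intro always_eventually allI conjI cp folner_map_normal folner_map_subtracial folner_map_L2_compact
        F(1,3) F_subset folner_map_subgroup_vna lreg_quotient)
  moreover have "((\<lambda>\<phi>. trace_norm2 G (\<phi> x - x)) \<longlongrightarrow> 0) \<F>" if x: "x \<in> ?P" for x
    unfolding \<F>_def filterlim_filtermap
    by (rule folner_map_tendsto[OF F(1) F_subset overlap_tendsto x]) (use subgroup_vna_support[OF H x] in blast)
  ultimately show ?thesis unfolding haagerup_def by blast
qed

end

subsection \<open>The group \<open>\<int>\<^sup>n \<rtimes> SL\<^sub>n(\<int>)\<close>\<close>

lemma int_matrix_neg_mult: "(A :: int ^ 'n ^ 'n) ** (- B) = - (A ** B)" "(- A) ** B = - (A ** B)"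
  by (simp_all add: vec_eq_iff matrix_matrix_mult_def sum_negf)

lemma det_neg_mat_1: "det (- mat 1 :: int ^ 'n ^ 'n) = (- 1) ^ CARD('n)"
proof -
  have "det (- mat 1 :: int ^ 'n ^ 'n) = (\<Prod>i\<in>UNIV. (- mat 1 :: int ^ 'n ^ 'n) $ i $ i)"
    by (rule det_diagonal) (simp add: mat_def)
  then show ?thesis by (simp add: mat_def)
qed

text \<open>Symmetric about the origin, unlike \<open>box\<close>, so that minus the identity
  preserves it.\<close>

definition int_box :: "nat \<Rightarrow> (int ^ 'n) set" where
  "int_box N = {v. \<forall>i. \<bar>v $ i\<bar> \<le> int N}"

lemma int_box: "finite (int_box N :: (int ^ 'n) set)" "card (int_box N :: (int ^ 'n) set) = (2 * N + 1) ^ CARD('n)"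
proof -
  have bij: "bij_betw vec_lambda (PiE UNIV (\<lambda>_. {- int N..int N})) (int_box N :: (int ^ 'n) set)"
  proof (rule bij_betwI[where g = vec_nth])
    show "vec_lambda \<in> (PiE UNIV (\<lambda>_. {- int N..int N})) \<rightarrow> (int_box N :: (int ^ 'n) set)"
    proof
      fix f :: "'n \<Rightarrow> int" assume "f \<in> PiE UNIV (\<lambda>_. {- int N..int N})"
      then have "f i \<in> {- int N..int N}" for i by (rule PiE_mem) simp
      then show "vec_lambda f \<in> int_box N" by (simp add: int_box_def abs_le_iff minus_le_iff)
    qed
    show "vec_nth \<in> (int_box N :: (int ^ 'n) set) \<rightarrow> PiE UNIV (\<lambda>_. {- int N..int N})"
      by (auto simp: int_box_def abs_le_iff minus_le_iff)
  qed (simp_all add: vec_lambda_inverse)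
  show "finite (int_box N :: (int ^ 'n) set)"
    using bij_betw_finite[OF bij] by (simp add: finite_PiE)
  have "card {- int N..int N} = 2 * N + 1" by simp
  then show "card (int_box N :: (int ^ 'n) set) = (2 * N + 1) ^ CARD('n)"
    using bij_betw_same_card[OF bij] by (simp add: card_PiE)
qed

text \<open>Treats both parities together: the two admissible sets are the identity alone and the
  pair of signs, and the determinant clause admits the latter only in even dimension.\<close>

definition scalar_units :: "(int ^ 'n ^ 'n) set \<Rightarrow> bool" where
  "scalar_units U \<longleftrightarrow> mat 1 \<in> U \<and> U \<subseteq> {mat 1, - mat 1} \<and> (\<forall>u\<in>U. det u = 1)"

context
  fixes U :: "(int ^ 'n ^ 'n) set"
  assumes U: "scalar_units U"
begin

abbreviation (input) HU :: "((int ^ 'n) \<times> (int ^ 'n ^ 'n)) set" where "HU \<equiv> UNIV \<times> U"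

abbreviation (input) BU :: "nat \<Rightarrow> ((int ^ 'n) \<times> (int ^ 'n ^ 'n)) set" where "BU N \<equiv> int_box N \<times> U"

lemma unit_cases: "u \<in> U ==> u = mat 1 \<or> u = - mat 1" and unit_det: "u \<in> U ==> det u = 1"
  and unit_one: "mat 1 \<in> U"
  using U by (auto simp: scalar_units_def)

lemma unit_mult: "u \<in> U ==> u' \<in> U ==> u ** u' \<in> U"
  using unit_cases[of u] unit_cases[of u'] unit_one by (auto simp: int_matrix_neg_mult)

lemma unit_commute: "u \<in> U ==> A ** u = u ** A"
  using unit_cases[of u] by (auto simp: int_matrix_neg_mult)

lemma unit_square: "u \<in> U ==> u ** u = mat 1"
  using unit_cases[of u] by (auto simp: int_matrix_neg_mult)

lemma finite_units: "finite U"
  using U by (auto simp: scalar_units_def intro: finite_subset)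

lemma units_subset: "HU \<subseteq> carrier Gn"
  using unit_det by auto

lemma subgroup_units: "subgroup (HU) (Gn :: ((int ^ 'n) \<times> (int ^ 'n ^ 'n)) monoid)"
proof -
  interpret group "Gn :: ((int ^ 'n) \<times> (int ^ 'n ^ 'n)) monoid" by (rule group_Gn)
  show ?thesis
  proof (rule subgroupI[OF units_subset])
    show "HU \<noteq> {}" using unit_one by blast
    fix a assume a: "a \<in> HU"
    obtain v u where vu: "a = (v, u)" "u \<in> U" using a by blast
    have "inv\<^bsub>Gn\<^esub> (v, u) = (- (u *v v), u)"
    proof (rule inv_equality)
      show "(- (u *v v), u) \<otimes>\<^bsub>Gn\<^esub> (v, u) = \<one>\<^bsub>Gn\<^esub>" using unit_square[OF vu(2)] by simp
    qed (use vu(2) unit_det in auto)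
    then show "inv\<^bsub>Gn\<^esub> a \<in> HU" using vu by simp
    fix b assume b: "b \<in> HU"
    then show "a \<otimes>\<^bsub>Gn\<^esub> b \<in> HU" using a unit_mult by auto
  qed
qed

lemma conj_units:
  assumes g: "g \<in> carrier Gn" and h: "h \<in> HU"
  shows "g \<otimes>\<^bsub>Gn\<^esub> h \<otimes>\<^bsub>Gn\<^esub> inv\<^bsub>Gn\<^esub> g \<in> HU"
proof -
  interpret group "Gn :: ((int ^ 'n) \<times> (int ^ 'n ^ 'n)) monoid" by (rule group_Gn)
  obtain v A where gA: "g = (v, A)" by (cases g)
  obtain w u where hu: "h = (w, u)" "u \<in> U" using h by blast
  obtain v' A' where i: "inv\<^bsub>Gn\<^esub> (v, A) = (v', A')" by (cases "inv\<^bsub>Gn\<^esub> (v, A)")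
  have "(v, A) \<otimes>\<^bsub>Gn\<^esub> inv\<^bsub>Gn\<^esub> (v, A) = \<one>\<^bsub>Gn\<^esub>" using r_inv[OF g] unfolding gA .
  then have "A ** A' = mat 1" unfolding i by simp
  then have "A ** u ** A' = u" unfolding unit_commute[OF hu(2)] by (simp add: matrix_mul_assoc[symmetric])
  then show ?thesis unfolding gA hu(1) i using hu(2) by simp
qed

text \<open>An element acts on the box by a sign and a shift, so the box shrunk by the size
  \<open>R\<close> of the shift stays inside; the volume ratio tends to one.\<close>

lemma overlap_box:
  assumes h: "h \<in> HU"
  shows "(\<lambda>N. group.overlap Gn (BU N) h) \<longlonglongrightarrow> 1"
proof -
  interpret group "Gn :: ((int ^ 'n) \<times> (int ^ 'n ^ 'n)) monoid" by (rule group_Gn)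
  obtain w u where hu: "h = (w, u)" "u \<in> U" using h by blast
  define R where "R = nat (\<Sum>i\<in>UNIV. \<bar>w $ i\<bar>)"
  have R: "\<bar>w $ i\<bar> \<le> int R" for i
    unfolding R_def using member_le_sum[of i UNIV "\<lambda>i. \<bar>w $ i\<bar>"] by (simp add: sum_nonneg)
  have Uv: "\<bar>(u *v v) $ i\<bar> = \<bar>v $ i\<bar>" for v i
    using unit_cases[OF hu(2)] by (auto simp: matrix_vector_mult_def mat_def if_distrib if_distribR sum_negf cong: if_cong)
  have lower: "(real (2 * (N - R) + 1) / real (2 * N + 1)) ^ CARD('n) \<le> overlap (BU N) h" if N: "N \<ge> R" for N
  proof -
    have "BU (N - R) \<subseteq> {q \<in> BU N. h \<otimes>\<^bsub>Gn\<^esub> q \<in> BU N}"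
    proof
      fix q assume "q \<in> BU (N - R)"
      then obtain v u' where q: "q = (v, u')" "v \<in> int_box (N - R)" "u' \<in> U" by blast
      have v: "\<bar>v $ i\<bar> \<le> int N - int R" for i using q(2) N by (simp add: int_box_def of_nat_diff)
      have "v \<in> int_box N" unfolding int_box_def
      proof (intro CollectI allI)
        fix i show "\<bar>v $ i\<bar> \<le> int N" using v[of i] by linarith
      qed
      moreover have "w + u *v v \<in> int_box N" unfolding int_box_def
      proof (intro CollectI allI)
        fix i
        have "\<bar>(w + u *v v) $ i\<bar> \<le> \<bar>w $ i\<bar> + \<bar>(u *v v) $ i\<bar>" by simp
        then show "\<bar>(w + u *v v) $ i\<bar> \<le> int N" using v[of i] R[of i] Uv[of v i] by linarith
      qed
      ultimately show "q \<in> {q \<in> BU N. h \<otimes>\<^bsub>Gn\<^esub> q \<in> BU N}"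
        using q hu unit_mult by simp
    qed
    then have "card (BU (N - R) :: ((int ^ 'n) \<times> (int ^ 'n ^ 'n)) set) \<le> card {q \<in> BU N. h \<otimes>\<^bsub>Gn\<^esub> q \<in> BU N}"
      by (rule card_mono[rotated]) (rule finite_subset[of _ "BU N"], use int_box(1) finite_units in auto)
    then have "real (card (int_box (N - R) :: (int ^ 'n) set) * card U) \<le> real (card {q \<in> BU N. h \<otimes>\<^bsub>Gn\<^esub> q \<in> BU N})"
      unfolding card_cartesian_product of_nat_le_iff .
    then have "real (card (int_box (N - R) :: (int ^ 'n) set) * card U) / real (card (int_box N :: (int ^ 'n) set) * card U)
        \<le> overlap (BU N) h"
      unfolding overlap_def card_cartesian_product by (rule divide_right_mono) simp
    moreover have "card U > 0" using finite_units unit_one card_gt_0_iff by blast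
    ultimately show ?thesis by (simp add: int_box(2) power_divide)
  qed
  have "(\<lambda>N. real (2 * (N - R) + 1) / real (2 * N + 1)) \<longlonglongrightarrow> 1"
  proof (rule Lim_transform_eventually)
    show "(\<lambda>N. 1 - 2 * real R / (2 * real N + 1)) \<longlonglongrightarrow> 1" by real_asymp
    show "\<forall>\<^sub>F N in sequentially. 1 - 2 * real R / (2 * real N + 1) = real (2 * (N - R) + 1) / real (2 * N + 1)"
      by (rule eventually_sequentiallyI[of R]) (simp add: of_nat_diff field_simps)
  qed
  then have "(\<lambda>N. (real (2 * (N - R) + 1) / real (2 * N + 1)) ^ CARD('n)) \<longlonglongrightarrow> 1 ^ CARD('n)"
    by (intro tendsto_power)
  then have lim: "(\<lambda>N. (real (2 * (N - R) + 1) / real (2 * N + 1)) ^ CARD('n)) \<longlonglongrightarrow> 1" by simp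
  show ?thesis
  proof (rule tendsto_sandwich[OF _ _ lim tendsto_const])
    show "\<forall>\<^sub>F N in sequentially. (real (2 * (N - R) + 1) / real (2 * N + 1)) ^ CARD('n) \<le> overlap (BU N) h"
      by (rule eventually_sequentiallyI[OF lower])
    show "\<forall>\<^sub>F N in sequentially. overlap (BU N) h \<le> 1"
      by (rule always_eventually) (simp add: overlap_bounds(2) int_box(1) finite_units)
  qed
qed

lemma amenable_units: "amenable_subgroup Gn HU BU"
proof -
  have "(0, mat 1) \<in> BU n" for n using unit_one by (simp add: int_box_def)
  then show ?thesis
    by (intro amenable_subgroup.intro amenable_subgroup_axioms.intro group_Gn subgroup_units overlap_box)
      (auto simp: int_box(1) finite_units)
qed

text \<open>By \<open>all\<close>, a group element outside the subgroup has a matrix different from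
  plus and minus the identity. There the diagonal kernel of \<open>Q\<close> vanishes by
  \<open>Gn_character_vanishes\<close>, so elements of \<open>Q\<close> have no coefficient, and
  \<open>subgroup_vna_supportI\<close> applies.\<close>

lemma haagerup_invariant_subset:
  assumes all: "\<And>u. det u = 1 ==> u = mat 1 \<or> u = - mat 1 ==> u \<in> U"
    and Q: "invariant_subalgebra Gn Q" "haagerup Gn Q"
  shows "Q \<subseteq> subgroup_vna Gn (HU)"
proof
  let ?G = "Gn :: ((int ^ 'n) \<times> (int ^ 'n ^ 'n)) monoid"
  interpret group ?G by (rule group_Gn)
  have Qv: "von_neumann_algebra (carrier ?G) Q" and QL: "Q \<subseteq> group_vna ?G"
    and Qi: "\<And>g. g \<in> carrier ?G ==> (\<lambda>x. lreg ?G g \<circ> x \<circ> adj (carrier ?G) (lreg ?G g)) ` Q = Q"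
    using Q(1) by (auto simp: invariant_subalgebra_def)
  interpret Q: group_subalgebra ?G Q
    by unfold_locales (use Qv QL subgroup_vna_convolvers[of "carrier ?G"] in auto)
  have conj: "lreg ?G g \<circ> x \<circ> adj (carrier ?G) (lreg ?G g) \<in> Q" if "g \<in> carrier ?G" "x \<in> Q" for g x
    using Qi[OF that(1)] that(2) by blast
  have zero: "Q.kvec (w, A) (w, A) = 0" if A: "det A = 1" "A \<noteq> mat 1" "A \<noteq> - mat 1" for w A
  proof (rule Gn_character_vanishes[of "\<lambda>g. Q.kvec g g", OF _ _ A])
    show "Q.kvec (g \<otimes>\<^bsub>?G\<^esub> x \<otimes>\<^bsub>?G\<^esub> inv\<^bsub>?G\<^esub> g) (g \<otimes>\<^bsub>?G\<^esub> x \<otimes>\<^bsub>?G\<^esub> inv\<^bsub>?G\<^esub> g) = Q.kvec x x"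
      if "g \<in> carrier ?G" "x \<in> carrier ?G" for g x
      by (rule Q.kvec_conj[OF conj conj that]) (use that in auto)
    fix E :: "((int ^ 'n) \<times> (int ^ 'n ^ 'n)) set" and e :: real
    assume E: "finite E" "E \<subseteq> carrier ?G" "e > 0"
    obtain \<psi> where \<psi>: "posdef ?G \<psi>" "Re (\<psi> \<one>\<^bsub>?G\<^esub>) \<le> 1" "\<forall>e>0. finite {g \<in> carrier ?G. cmod (\<psi> g) \<ge> e}"
      "\<forall>g\<in>E. cmod (\<psi> g - Q.kvec g g) < e"
      using Q.haagerup_characters[OF Q(2) E] by blast
    have "finite {v. cmod (\<psi> (v, mat 1)) \<ge> d}" if "d > 0" for d
    proof (rule finite_subset)
      show "{v. cmod (\<psi> (v, mat 1)) \<ge> d} \<subseteq> fst ` {g \<in> carrier ?G. cmod (\<psi> g) \<ge> d}"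
      proof
        fix v assume "v \<in> {v. cmod (\<psi> (v, mat 1)) \<ge> d}"
        then have "(v, mat 1) \<in> {g \<in> carrier ?G. cmod (\<psi> g) \<ge> d}" by simp
        then show "v \<in> fst ` {g \<in> carrier ?G. cmod (\<psi> g) \<ge> d}" by (rule image_eqI[rotated]) simp
      qed
      show "finite (fst ` {g \<in> carrier ?G. cmod (\<psi> g) \<ge> d})" using \<psi>(3) that by blast
    qed
    then show "\<exists>\<psi>. posdef ?G \<psi> \<and> Re (\<psi> (0, mat 1)) \<le> 1 \<and> (\<forall>e>0. finite {v. cmod (\<psi> (v, mat 1)) \<ge> e}) \<and>
        (\<forall>g\<in>E. cmod (\<psi> g - Q.kvec g g) < e)"
      using \<psi>(1,2,4) by (intro exI[of _ \<psi>]) simp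
  qed
  fix x assume x: "x \<in> Q"
  show "x \<in> subgroup_vna ?G (HU)"
  proof (rule amenable_subgroup.subgroup_vna_supportI[OF amenable_units])
    show "x \<in> convolvers ?G" using x Q.PL by blast
    fix g assume g: "g \<in> carrier ?G" "g \<notin> HU"
    obtain w A where wA: "g = (w, A)" by (cases g)
    have "Q.kvec g g = 0" unfolding wA by (rule zero) (use g all wA in auto)
    then show "x (delta \<one>\<^bsub>?G\<^esub>) g = 0" by (rule Q.L2_vanishing[OF Q.P_delta_L2[OF x] g(1)])
  qed
qed

text \<open>The algebra is the largest member of the class, since every invariant Haagerup
  subalgebra lies in it; this gives maximality and uniqueness at once.\<close>

lemma unique_maximal_units:
  assumes "\<And>u. det u = 1 ==> u = mat 1 \<or> u = - mat 1 ==> u \<in> U"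
  shows "unique_maximal_haagerup_invariant Gn (subgroup_vna Gn (HU))"
proof -
  let ?P = "subgroup_vna Gn (HU)"
  have inv: "invariant_subalgebra Gn ?P"
    by (rule amenable_subgroup.invariant_subgroup_vna[OF amenable_units conj_units])
  note sub = haagerup_invariant_subset[OF assms]
  show ?thesis
    unfolding unique_maximal_haagerup_invariant_def maximal_haagerup_invariant_def
    using inv amenable_subgroup.haagerup_subgroup_vna[OF amenable_units] sub by blast
qed

end

theorem corollary1p2:
  assumes "CARD('n::finite) \<ge> 2"
  shows "(even CARD('n) \<longrightarrow>
            unique_maximal_haagerup_invariant (Gn :: ((int ^ 'n) \<times> (int ^ 'n ^ 'n)) monoid)
              (subgroup_vna Gn (UNIV \<times> {mat 1, - mat 1}))) \<and>
         (odd CARD('n) \<longrightarrow>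
            unique_maximal_haagerup_invariant (Gn :: ((int ^ 'n) \<times> (int ^ 'n ^ 'n)) monoid)
              (subgroup_vna Gn (UNIV \<times> {mat 1})))"
proof (intro conjI impI)
  assume "even CARD('n)"
  then have "scalar_units {mat 1, - mat 1 :: int ^ 'n ^ 'n}" by (simp add: scalar_units_def det_neg_mat_1)
  then show "unique_maximal_haagerup_invariant (Gn :: ((int ^ 'n) \<times> (int ^ 'n ^ 'n)) monoid)
              (subgroup_vna Gn (UNIV \<times> {mat 1, - mat 1}))"
    by (rule unique_maximal_units) blast
next
  assume odd: "odd CARD('n)"
  have "scalar_units {mat 1 :: int ^ 'n ^ 'n}" by (simp add: scalar_units_def)
  then show "unique_maximal_haagerup_invariant (Gn :: ((int ^ 'n) \<times> (int ^ 'n ^ 'n)) monoid)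
              (subgroup_vna Gn (UNIV \<times> {mat 1}))"
    \<comment> \<open>In odd dimension minus the identity has determinant minus one and is not in
      the group.\<close>
    by (rule unique_maximal_units) (use odd in \<open>auto simp: det_neg_mat_1\<close>)
qed

end
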